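(* Let $\mathcal{F}^{X}$ and $\mathcal{F}^{Y}$ be two topologically equivalent holomorphic foliations at $(\mathbb{C}^{n},0)$ generated by the holomorphic vector fields $X$ and $Y$, respectively. If $\mathrm{Spect}(DX(0))\neq\{0\}$, then $\mathrm{Spect}(DY(0))\neq\{0\}$.
   Context: Vector fields $X=\sum_i f_i\,\partial/\partial z_i$ are germs of holomorphic vector fields at $0\in\mathbb{C}^n$ with $\gcd(f_1,\dots,f_n)=1$ and an isolated singularity at $0$; $\mathcal{F}^X$ is the foliation by integral curves of $X$. $\mathcal{F}^X$ and $\mathcal{F}^Y$ are topologically equivalent if there is a germ of homeomorphism $\varphi\colon(\mathbb{C}^n,0)\to(\mathbb{C}^n,0)$ sending each integral curve of $X$ onto an integral curve of $Y$. $\mathrm{Spect}(DX(0))$ denotes the set of eigenvalues of the linear part $DX(0)$. *)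

theory Defs
  imports "HOL-Analysis.Analysis"
begin

definition hol_fun :: "(complex^'n) set \<Rightarrow> (complex^'n \<Rightarrow> complex) \<Rightarrow> bool" where
  "hol_fun S f \<longleftrightarrow> open S \<and>
     (\<forall>z\<in>S. \<exists>L. (f has_derivative L) (at z) \<and> (\<forall>c v. L (c *s v) = c * L v))"

definition hol_vf :: "(complex^'n) set \<Rightarrow> (complex^'n \<Rightarrow> complex^'n) \<Rightarrow> bool" where
  "hol_vf S X \<longleftrightarrow> (\<forall>i. hol_fun S (\<lambda>z. X z $ i))"

text \<open>Germ of holomorphic vector field at 0, holomorphic on ball 0 r, with an isolated
singularity at 0 and gcd(f_1,...,f_n) = 1 in the ring of germs (no common divisor
vanishing at 0, i.e. no common non-unit divisor).\<close>
definition vf_germ :: "(complex^'n \<Rightarrow> complex^'n) \<Rightarrow> real \<Rightarrow> bool" where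
  "vf_germ X r \<longleftrightarrow> r > 0 \<and> hol_vf (ball 0 r) X \<and> X 0 = 0 \<and>
     (\<forall>z\<in>ball 0 r. z \<noteq> 0 \<longrightarrow> X z \<noteq> 0) \<and>
     \<not> (\<exists>h g \<epsilon>. \<epsilon> > 0 \<and> hol_fun (ball 0 \<epsilon>) h \<and> h 0 = 0 \<and>
          (\<forall>i. hol_fun (ball 0 \<epsilon>) (g i)) \<and>
          (\<forall>i. \<forall>z\<in>ball 0 \<epsilon>. X z $ i = h z * g i z))"

definition on_integral_curve ::
  "(complex^'n \<Rightarrow> complex^'n) \<Rightarrow> (complex^'n) set \<Rightarrow> complex^'n \<Rightarrow> complex^'n \<Rightarrow> bool" where
  "on_integral_curve X U x y \<longleftrightarrow>
     (\<exists>(D::complex set) \<gamma>. open D \<and> connected D \<and>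
        (\<forall>t\<in>D. \<gamma> t \<in> U \<and> X (\<gamma> t) \<noteq> 0 \<and>
                 (\<gamma> has_derivative (\<lambda>h. h *s X (\<gamma> t))) (at t)) \<and>
        x \<in> \<gamma> ` D \<and> y \<in> \<gamma> ` D)"

definition leaf :: "(complex^'n \<Rightarrow> complex^'n) \<Rightarrow> (complex^'n) set \<Rightarrow> complex^'n \<Rightarrow> (complex^'n) set" where
  "leaf X U x = {y. (on_integral_curve X U)\<^sup>*\<^sup>* x y}"

definition top_equiv ::
  "(complex^'n \<Rightarrow> complex^'n) \<Rightarrow> (complex^'n) set \<Rightarrow> (complex^'n \<Rightarrow> complex^'n) \<Rightarrow> (complex^'n) set \<Rightarrow> bool" where
  "top_equiv X S Y T \<longleftrightarrow>
     (\<exists>U V \<phi> \<psi>. open U \<and> open V \<and> 0 \<in> U \<and> 0 \<in> V \<and> U \<subseteq> S \<and> V \<subseteq> T \<and>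
        homeomorphism U V \<phi> \<psi> \<and> \<phi> 0 = 0 \<and>
        (\<forall>x\<in>U. X x \<noteq> 0 \<longrightarrow> \<phi> ` leaf X U x = leaf Y V (\<phi> x)))"

definition Spect :: "(complex^'n \<Rightarrow> complex^'n) \<Rightarrow> complex set" where
  "Spect X = {c. \<exists>v. v \<noteq> 0 \<and> frechet_derivative X (at 0) v = c *s v}"

end

(* Suppose DX(0) has a nonzero eigenvalue but DY(0) is nilpotent.  Choosing an eigenvalue alpha of
   DX(0) of nearly maximal modulus, no multiple j alpha with j >= 2 is an eigenvalue, so X has a
   smooth separatrix Gamma with X(Gamma z) = alpha z Gamma'(z).  Its image kappa = phi o Gamma lies
   on leaves of Y.  In terms of the flow times of Y along kappa (a topological time change, locally
   injective and of constant local degree epsilon /= 0), kappa becomes an analytic curve G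
   after a homeomorphic reparametrization s of the disc.  Comparing the orders of vanishing,
   nilpotency of DY(0) makes the order k of some coordinate of Y along G different from the order m
   of the same coordinate of G.

   On the other hand X moves Gamma z to Gamma (a z) with a < 1 in a complex time h that is constant,
   and the induced time tau(x, h) of Y is a nonvanishing function on a punctured neighbourhood of the
   origin, which is simply connected because n >= 2.  Hence z |-> tau(Gamma z, h) has winding number
   0 on a small circle.  The winding number of a coordinate of kappa(a z) - kappa(z) is then
   k epsilon when computed from the flow of Y, and m epsilon when computed from G, so k = m. *)
theory Submission
  imports Defs "HOL-Complex_Analysis.Complex_Analysis"
begin

unbundle no Formal_Power_Series.fps_syntax

section \<open>Integral curves of holomorphic vector fields\<close>

text \<open>The obstacle is that \<open>\<phi>\<close> is only continuous: it transports neither the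
  linear part of \<open>X\<close> nor the parametrization of a separatrix. It respects leaves and
  winding numbers, so each order of vanishing has to be read off as an index of one and the same
  continuous displacement. A leaf may accumulate on itself, so nearness in space does not give
  nearness in the leaf. A leaf meets a transversal only countably often, hence a small connected
  piece of it lies in one plaque; this makes the induced time well defined and continuous. The
  analytic parametrization is built by hand: the times of \<open>Y\<close> make the punctured disc a
  Riemann surface on which the coordinates of the image curve are holomorphic. One of them has a
  zero of finite multiplicity N at the puncture, and its N-th root is the new parameter. On the
  curve alone the induced time might wind, which is why it is constructed on a whole shell of C^n.
  The sign of \<epsilon> stays unknown, since \<open>\<phi>\<close> may reverse orientation along
  the curve; it cancels in the final equation.\<close>

lemma norm_cscale: "norm (c *s v) = norm c * norm (v :: complex^'n)"
  by (simp add: norm_vec_def norm_mult L2_set_right_distrib)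

lemma bounded_bilinear_cscale: "bounded_bilinear ((*s) :: complex \<Rightarrow> complex^'n \<Rightarrow> complex^'n)"
proof (rule bounded_bilinear.intro)
  show "\<exists>K. \<forall>a b. norm (a *s b :: complex^'n) \<le> norm a * norm b * K"
    by (intro exI[of _ 1]) (simp add: norm_cscale)
qed (simp_all add: vec_eq_iff algebra_simps)

lemmas continuous_on_cscale [continuous_intros] =
  bounded_bilinear.continuous_on[OF bounded_bilinear_cscale]
lemmas tendsto_cscale [tendsto_intros] =
  bounded_bilinear.tendsto[OF bounded_bilinear_cscale]

lemma bounded_linear_cscale: "bounded_linear (\<lambda>h. h *s (w :: complex^'n))"
  using bounded_bilinear.bounded_linear_left[OF bounded_bilinear_cscale] .

text \<open>\<open>has_vector_derivative\<close> is real and \<open>has_field_derivative\<close>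
  needs scalar values, so the complex velocity of a curve in C^n is encoded as a Frechet derivative
  that multiplies a fixed vector.\<close>

abbreviation has_vderiv :: "(complex \<Rightarrow> complex^'n) \<Rightarrow> complex^'n \<Rightarrow> complex \<Rightarrow> bool" where
  "has_vderiv \<gamma> w t \<equiv> (\<gamma> has_derivative (\<lambda>h. h *s w)) (at t)"

lemma vec_eq_sum_axis: "(x :: complex^'n) = (\<Sum>i\<in>UNIV. (x $ i) *s axis i 1)"
  by (simp add: vec_eq_iff axis_def if_distrib cong: if_cong)

lemma has_derivative_vec_componentwise:
  fixes f :: "'a::real_normed_vector \<Rightarrow> complex^'n"
  assumes "\<And>i. ((\<lambda>x. f x $ i) has_derivative (\<lambda>h. L h $ i)) F"
  shows "(f has_derivative L) F"
proof -
  have "((\<lambda>x. \<Sum>i\<in>UNIV. (f x $ i) *s axis i 1) has_derivative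
        (\<lambda>h. \<Sum>i\<in>UNIV. (L h $ i) *s (axis i 1 :: complex^'n))) F"
    by (intro has_derivative_sum bounded_linear.has_derivative[OF bounded_linear_cscale] assms)
  then show ?thesis by (simp flip: vec_eq_sum_axis)
qed

lemma has_derivative_vec_nth:
  "(f has_derivative L) F \<Longrightarrow> ((\<lambda>x. f x $ i) has_derivative (\<lambda>h. L h $ i)) F"
  by (rule bounded_linear.has_derivative[OF bounded_linear_vec_nth])

lemma has_vderiv_iff:
  "has_vderiv \<gamma> w t \<longleftrightarrow> (\<forall>i. ((\<lambda>t. \<gamma> t $ i) has_field_derivative w $ i) (at t))"
proof
  assume "has_vderiv \<gamma> w t"
  from has_derivative_vec_nth[OF this]
  show "\<forall>i. ((\<lambda>t. \<gamma> t $ i) has_field_derivative w $ i) (at t)"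
    by (simp add: has_field_derivative_def mult.commute[of _ "w $ _"])
next
  assume "\<forall>i. ((\<lambda>t. \<gamma> t $ i) has_field_derivative w $ i) (at t)"
  then show "has_vderiv \<gamma> w t"
    by (intro has_derivative_vec_componentwise)
       (simp add: has_field_derivative_def mult.commute[of _ "w $ _"])
qed

lemma has_vderiv_imp_continuous: "has_vderiv \<gamma> w t \<Longrightarrow> isCont \<gamma> t"
  by (rule has_derivative_continuous)

lemma has_vderiv_norm_bound:
  assumes "convex S" "\<And>t. t \<in> S \<Longrightarrow> has_vderiv \<gamma> (w t) t" "\<And>t. t \<in> S \<Longrightarrow> norm (w t) \<le> B"
    and "a \<in> S" "b \<in> S"
  shows "norm (\<gamma> a - \<gamma> b) \<le> B * norm (a - b)"
proof (rule differentiable_bound[OF assms(1)])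
  fix t assume "t \<in> S"
  then show "(\<gamma> has_derivative (\<lambda>h. h *s w t)) (at t within S)"
    using assms(2) has_derivative_at_withinI by blast
  show "onorm (\<lambda>h. h *s w t) \<le> B"
  proof (rule onorm_le)
    fix h :: complex
    show "norm (h *s w t) \<le> B * norm h"
      using mult_right_mono[OF assms(3)[OF \<open>t \<in> S\<close>], of "norm h"] by (simp add: norm_cscale mult.commute)
  qed
qed (use assms in auto)

lemma hol_vf_open: "hol_vf S X \<Longrightarrow> open S"
  by (auto simp: hol_vf_def hol_fun_def)

lemma hol_vf_has_derivative:
  assumes "hol_vf S X" "z \<in> S"
  obtains L where "(X has_derivative L) (at z)" "\<And>c v. L (c *s v) = c *s L v"
proof -
  have "\<forall>i. \<exists>L. ((\<lambda>z. X z $ i) has_derivative L) (at z) \<and> (\<forall>c v. L (c *s v) = c * L v)"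
    using assms by (auto simp: hol_vf_def hol_fun_def)
  then obtain L where L: "\<And>i. ((\<lambda>z. X z $ i) has_derivative L i) (at z)"
      "\<And>i c v. L i (c *s v) = c * L i v" by metis
  show ?thesis
  proof
    show "(X has_derivative (\<lambda>v. \<chi> i. L i v)) (at z)"
      by (rule has_derivative_vec_componentwise) (simp add: L)
    show "(\<chi> i. L i (c *s v)) = c *s (\<chi> i. L i v)" for c v
      by (simp add: vec_eq_iff L)
  qed
qed

lemma hol_vf_continuous_on: "hol_vf S X \<Longrightarrow> continuous_on S X"
  by (metis hol_vf_has_derivative has_derivative_continuous continuous_at_imp_continuous_on)

text \<open>The real chain rule gives the derivative \<open>L (h *s w)\<close>; complex linearity of
  \<open>L\<close> turns it into \<open>h * L w\<close>, which is a complex derivative.\<close>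

lemma hol_fun_curve:
  assumes "hol_fun S f" "has_vderiv \<gamma> w t" "\<gamma> t \<in> S"
  shows "(\<lambda>t. f (\<gamma> t)) field_differentiable (at t)"
proof -
  obtain L where L: "(f has_derivative L) (at (\<gamma> t))" "\<And>c v. L (c *s v) = c * L v"
    using assms by (auto simp: hol_fun_def)
  have "((\<lambda>t. f (\<gamma> t)) has_derivative (\<lambda>h. L (h *s w))) (at t)"
    using diff_chain_at[OF assms(2) L(1)] by (simp add: o_def)
  then have "((\<lambda>t. f (\<gamma> t)) has_field_derivative L w) (at t)"
    by (simp add: has_field_derivative_def L mult.commute[of _ "L w"])
  then show ?thesis by (auto simp: field_differentiable_def)
qed

text \<open>Keeps iterations among holomorphic functions: the right-hand side of the equation along
  a differentiable curve is holomorphic again and so has primitives on discs.\<close>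

lemma hol_vf_curve:
  assumes "hol_vf S X" "open D" "\<And>t. t \<in> D \<Longrightarrow> \<exists>w. has_vderiv \<gamma> w t" "\<And>t. t \<in> D \<Longrightarrow> \<gamma> t \<in> S"
  shows "(\<lambda>t. X (\<gamma> t) $ i) holomorphic_on D"
proof -
  have "(\<lambda>t. X (\<gamma> t) $ i) field_differentiable (at t)" if t: "t \<in> D" for t
  proof -
    obtain w where "has_vderiv \<gamma> w t" using assms(3)[OF t] by blast
    moreover have "hol_fun S (\<lambda>z. X z $ i)" using assms by (simp add: hol_vf_def)
    ultimately show ?thesis using hol_fun_curve assms(4)[OF t] by blast
  qed
  then show ?thesis using assms(2) by (simp add: holomorphic_on_open field_differentiable_def)
qed

section \<open>Cauchy estimates and uniform Lipschitz constants\<close>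

lemma hol_fun_derivative_bound:
  assumes f: "hol_fun S f" and S: "cball y \<rho> \<subseteq> S" "\<rho> > 0"
    and M: "\<And>x. x \<in> cball y \<rho> \<Longrightarrow> norm (f x) \<le> M"
    and L: "(f has_derivative L) (at y)" "\<And>c v. L (c *s v) = c * L v"
  shows "norm (L v) \<le> M / \<rho> * norm v"
proof (cases "v = 0")
  case True
  have "L 0 = 0" using L(2)[of 0 0] by simp
  then show ?thesis using True by simp
next
  case False
  \<comment> \<open>Cauchy's inequality is applied on the complex line through \<open>y\<close> in
    direction \<open>v\<close>; the disc of this radius in the line is mapped into
    \<open>cball y \<rho>\<close>.\<close>
  define r where "r = \<rho> / norm v"
  have r: "r > 0" using False S by (simp add: r_def)
  define g where "g = (\<lambda>\<zeta>. y + \<zeta> *s v)"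
  have gd: "has_vderiv g v \<zeta>" for \<zeta>
    unfolding g_def by (auto intro!: derivative_eq_intros bounded_linear.has_derivative[OF bounded_linear_cscale])
  have gin: "g \<zeta> \<in> cball y \<rho>" if "norm \<zeta> \<le> r" for \<zeta>
    using that False by (simp add: g_def dist_norm norm_cscale r_def field_simps)
  have diff: "(\<lambda>\<zeta>. f (g \<zeta>)) field_differentiable (at \<zeta>)" if "norm \<zeta> \<le> r" for \<zeta>
    using hol_fun_curve[OF f gd] gin[OF that] S(1) by blast
  have hol: "(\<lambda>\<zeta>. f (g \<zeta>)) holomorphic_on cball 0 r"
    unfolding holomorphic_on_def
  proof
    fix \<zeta> :: complex assume "\<zeta> \<in> cball 0 r"
    then show "(\<lambda>\<zeta>. f (g \<zeta>)) field_differentiable (at \<zeta> within cball 0 r)"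
      using field_differentiable_at_within[OF diff[of \<zeta>]] by simp
  qed
  have "((\<lambda>t. f (g t)) has_derivative (\<lambda>h. L (h *s v))) (at 0)"
    using diff_chain_at[OF gd[of 0], of f L] L(1) by (simp add: o_def g_def)
  then have der: "deriv (\<lambda>\<zeta>. f (g \<zeta>)) 0 = L v"
    by (intro DERIV_imp_deriv) (simp add: has_field_derivative_def L(2) mult.commute[of _ "L v"])
  have "norm ((deriv ^^ 1) (\<lambda>\<zeta>. f (g \<zeta>)) 0) \<le> fact 1 * M / r ^ 1"
  proof (rule Cauchy_inequality)
    show "(\<lambda>\<zeta>. f (g \<zeta>)) holomorphic_on ball 0 r"
      using hol holomorphic_on_subset ball_subset_cball by blast
    show "continuous_on (cball 0 r) (\<lambda>\<zeta>. f (g \<zeta>))"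
      using hol holomorphic_on_imp_continuous_on by blast
    show "norm (f (g x)) \<le> M" if "norm (0 - x) = r" for x
      using M[OF gin[of x]] that by simp
  qed (use r in auto)
  then show ?thesis using der by (simp add: r_def)
qed

text \<open>\<open>hol_vf\<close> asks for complex differentiability at each point and says nothing
  about continuity of the derivative. The bound on the derivative comes from Cauchy's inequality on
  balls of radius \<open>\<rho>\<close> inside the doubled ball; the factor \<open>CARD('n)\<close>
  arises from estimating the Euclidean norm by the sum over the coordinates.\<close>

lemma hol_vf_lipschitz:
  fixes X :: "complex^'n \<Rightarrow> complex^'n"
  assumes X: "hol_vf S X" and S: "cball x (2*\<rho>) \<subseteq> S" "\<rho> > 0"
    and M: "\<And>y. y \<in> cball x (2*\<rho>) \<Longrightarrow> norm (X y) \<le> M"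
    and y: "y \<in> cball x \<rho>" "y' \<in> cball x \<rho>"
  shows "norm (X y - X y') \<le> real (CARD('n)) * M / \<rho> * norm (y - y')"
proof (rule differentiable_bound[of "cball x \<rho>" X "\<lambda>z. frechet_derivative X (at z)"])
  fix z assume z: "z \<in> cball x \<rho>"
  have sub: "cball z \<rho> \<subseteq> cball x (2*\<rho>)"
  proof
    fix w assume "w \<in> cball z \<rho>"
    then show "w \<in> cball x (2*\<rho>)"
      using z dist_triangle[of x w z] by simp
  qed
  have "z \<in> S" using sub S by (meson centre_in_cball less_imp_le subsetD)
  then obtain L where L: "(X has_derivative L) (at z)" "\<And>c v. L (c *s v) = c *s L v"
    using hol_vf_has_derivative[OF X] by blast
  have fr: "frechet_derivative X (at z) = L"
    using L(1) frechet_derivative_at by metis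
  show "(X has_derivative frechet_derivative X (at z)) (at z within cball x \<rho>)"
    using L(1) fr has_derivative_at_withinI by blast
  show "onorm (frechet_derivative X (at z)) \<le> real (CARD('n)) * M / \<rho>"
    unfolding fr
  proof (rule onorm_le)
    fix v
    have "norm (L v $ i) \<le> M / \<rho> * norm v" for i
    proof (rule hol_fun_derivative_bound[of S "\<lambda>z. X z $ i" z \<rho> M "\<lambda>v. L v $ i"])
      show "hol_fun S (\<lambda>z. X z $ i)" using X by (simp add: hol_vf_def)
      show "cball z \<rho> \<subseteq> S" using sub S by blast
      show "norm (X x $ i) \<le> M" if "x \<in> cball z \<rho>" for x
        using M[of x] that sub Finite_Cartesian_Product.norm_nth_le order_trans by blast
    qed (use S has_derivative_vec_nth[OF L(1)] L(2) in auto)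
    then have "(\<Sum>i\<in>UNIV. norm (L v $ i)) \<le> (\<Sum>i\<in>(UNIV::'n set). M / \<rho> * norm v)"
      by (intro sum_mono) auto
    then show "norm (L v) \<le> real (CARD('n)) * M / \<rho> * norm v"
      unfolding norm_vec_def
      using L2_set_le_sum[of UNIV "\<lambda>i. norm (L v $ i)"] by (simp add: norm_vec_def)
  qed
qed (use y in auto)

text \<open>A closed thickening of \<open>K\<close> is still compact, so one bound of
  \<open>X\<close> on it serves every centre in \<open>K\<close>. The radius returned is half the
  thickness, since the Lipschitz estimate wants a bound on the doubled ball.\<close>

lemma hol_vf_local_bounds:
  fixes X :: "complex^'n \<Rightarrow> complex^'n"
  assumes X: "hol_vf S X" and K: "compact K" "K \<subseteq> W" and W: "open W" "W \<subseteq> S"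
  obtains \<rho> M \<Lambda> where "\<rho> > 0" "M > 0" "\<Lambda> > 0"
    "\<And>x. x \<in> K \<Longrightarrow> cball x \<rho> \<subseteq> W"
    "\<And>x y. x \<in> K \<Longrightarrow> y \<in> cball x \<rho> \<Longrightarrow> norm (X y) \<le> M"
    "\<And>x y y'. x \<in> K \<Longrightarrow> y \<in> cball x \<rho> \<Longrightarrow> y' \<in> cball x \<rho> \<Longrightarrow> norm (X y - X y') \<le> \<Lambda> * norm (y - y')"
proof -
  obtain e where e: "e > 0" "\<And>x. x \<in> K \<Longrightarrow> cball x e \<subseteq> W"
  proof (rule compact_subset_open_imp_cball_epsilon_subset[OF K(1) W(1) K(2)])
    fix e assume e: "e > 0" "(\<Union>x\<in>K. cball x e) \<subseteq> W"
    show thesis by (rule that[of e]) (use e in auto)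
  qed
  define K' where "K' = {x + y | x y. x \<in> K \<and> y \<in> cball 0 e}"
  have "compact K'" unfolding K'_def by (intro compact_sums K compact_cball)
  have K': "x \<in> K \<Longrightarrow> cball x e \<subseteq> K'" for x
  proof
    fix w assume "x \<in> K" "w \<in> cball x e"
    then show "w \<in> K'" unfolding K'_def
      by (intro CollectI exI[of _ x] exI[of _ "w - x"]) (auto simp: dist_norm norm_minus_commute)
  qed
  have "K' \<subseteq> W"
  proof
    fix w assume "w \<in> K'"
    then obtain x y where "w = x + y" "x \<in> K" "y \<in> cball 0 e" by (auto simp: K'_def)
    then have "w \<in> cball x e" by (simp add: dist_norm)
    then show "w \<in> W" using e \<open>x \<in> K\<close> by blast
  qed
  have "compact (X ` K')"
    using hol_vf_continuous_on[OF X] \<open>compact K'\<close> \<open>K' \<subseteq> W\<close> W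
    by (meson compact_continuous_image continuous_on_subset)
  then obtain B where B: "B > 0" "\<And>y. y \<in> K' \<Longrightarrow> norm (X y) \<le> B"
    using compact_imp_bounded bounded_pos by (metis imageI)
  show ?thesis
  proof (rule that[of "e/2" B "real (CARD('n)) * B / (e/2)"])
    fix x y y' assume *: "x \<in> K" "y \<in> cball x (e/2)" "y' \<in> cball x (e/2)"
    show "norm (X y - X y') \<le> real (CARD('n)) * B / (e/2) * norm (y - y')"
      by (rule hol_vf_lipschitz[OF X, of x "e/2" B y y'])
         (use * e K' B W \<open>K' \<subseteq> W\<close> in \<open>auto simp: subset_iff\<close>)
  qed (use e B K' in \<open>auto simp: subset_iff\<close>)
qed

section \<open>Picard iteration in complex time\<close>

lemma geometric_Cauchy_limit:
  fixes a :: "nat \<Rightarrow> 'a::banach"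
  assumes "\<And>n. norm (a (Suc n) - a n) \<le> C * q ^ n" "0 \<le> q" "q < 1"
  obtains l where "\<And>n. norm (a n - l) \<le> C * q ^ n / (1 - q)"
proof -
  define d where "d = (\<lambda>n. a (Suc n) - a n)"
  have sg: "summable (\<lambda>n. C * q ^ n)"
    using assms by (intro summable_mult summable_geometric) auto
  have sn: "summable (\<lambda>n. norm (d n))"
    by (rule summable_comparison_test'[OF sg, of 0]) (use assms(1) in \<open>auto simp: d_def\<close>)
  define l where "l = a 0 + suminf d"
  have part: "a n = a 0 + sum d {..<n}" for n
    by (simp add: d_def sum_lessThan_telescope)
  have "norm (a n - l) \<le> C * q ^ n / (1 - q)" for n
  proof -
    have sd: "summable d" using sn summable_norm_cancel by blast
    have "l - a n = (\<Sum>k. d (k + n))"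
      using suminf_minus_initial_segment[OF sd, of n] part[of n] by (simp add: l_def)
    moreover have "norm (\<Sum>k. d (k + n)) \<le> (\<Sum>k. norm (d (k + n)))"
      using summable_ignore_initial_segment[OF sn] by (intro summable_norm)
    moreover have "(\<Sum>k. norm (d (k + n))) \<le> (\<Sum>k. C * q ^ (k + n))"
      by (intro suminf_le) (use assms(1) summable_ignore_initial_segment[OF sn] summable_ignore_initial_segment[OF sg] in \<open>auto simp: d_def\<close>)
    moreover have "(\<Sum>k. C * q ^ (k + n)) = C * q ^ n / (1 - q)"
    proof -
      have "(\<Sum>k. C * q ^ (k + n)) = (\<Sum>k. (C * q ^ n) * q ^ k)"
        by (simp add: power_add ac_simps)
      also have "\<dots> = (C * q ^ n) * (\<Sum>k. q ^ k)"
        using assms by (intro suminf_mult summable_geometric) auto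
      also have "\<dots> = C * q ^ n / (1 - q)" using assms by (simp add: suminf_geometric)
      finally show ?thesis .
    qed
    ultimately show ?thesis by (metis norm_minus_commute order_trans)
  qed
  then show ?thesis using that by blast
qed

text \<open>Primitives taken coordinate by coordinate and normalized at \<open>a\<close>; they take
  the place of the integral in the iterations for the flow and for the separatrix.\<close>

lemma vderiv_primitive:
  fixes f :: "complex \<Rightarrow> complex^'n"
  assumes "convex D" "open D" "\<And>i. (\<lambda>t. f t $ i) holomorphic_on D" "a \<in> D"
  obtains g where "g a = b" "\<And>t. t \<in> D \<Longrightarrow> has_vderiv g (f t) t"
proof -
  have "\<forall>i. \<exists>g. \<forall>t\<in>D. (g has_field_derivative f t $ i) (at t)"
  proof
    fix i
    obtain g where "\<And>x. x \<in> D \<Longrightarrow> (g has_field_derivative f x $ i) (at x within D)"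
      using holomorphic_convex_primitive'[OF assms(1,2), of "\<lambda>t. f t $ i"] assms(3) by blast
    then show "\<exists>g. \<forall>t\<in>D. (g has_field_derivative f t $ i) (at t)"
      using assms(2) by (metis at_within_open)
  qed
  then obtain g where g: "\<And>i t. t \<in> D \<Longrightarrow> (g i has_field_derivative f t $ i) (at t)" by metis
  show ?thesis
  proof (rule that[of "\<lambda>t. \<chi> i. g i t - g i a + b $ i"])
    show "(\<chi> i. g i a - g i a + b $ i) = b" by (simp add: vec_eq_iff)
    show "has_vderiv (\<lambda>t. \<chi> i. g i t - g i a + b $ i) (f t) t" if "t \<in> D" for t
      unfolding has_vderiv_iff using g[OF that] by (auto intro!: derivative_eq_intros)
  qed
qed

text \<open>Picard iteration with holomorphic primitives on the disc of times. The bound on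
  \<open>\<eta> * M\<close> keeps the iterates in the ball, the bound on
  \<open>\<eta> * \<Lambda>\<close> halves the distance between successive ones.\<close>

lemma ode_exists:
  fixes X :: "complex^'n \<Rightarrow> complex^'n"
  assumes X: "hol_vf S X" and S: "cball x \<rho> \<subseteq> S"
    and M: "\<And>y. y \<in> cball x \<rho> \<Longrightarrow> norm (X y) \<le> M"
    and Lip: "\<And>y y'. y \<in> cball x \<rho> \<Longrightarrow> y' \<in> cball x \<rho> \<Longrightarrow> norm (X y - X y') \<le> \<Lambda> * norm (y - y')"
    and \<eta>: "\<eta> > 0" "\<eta> * M \<le> \<rho>" "\<eta> * \<Lambda> \<le> 1/2" "\<rho> > 0" "\<Lambda> > 0"
  obtains \<gamma> where "\<gamma> 0 = x" "\<And>t. t \<in> ball 0 \<eta> \<Longrightarrow> \<gamma> t \<in> cball x \<rho>"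
    "\<And>t. t \<in> ball 0 \<eta> \<Longrightarrow> has_vderiv \<gamma> (X (\<gamma> t)) t"
proof -
  \<comment> \<open>Primitives are only known to exist, so the iterates are selected by dependent
    choice. \<open>Q\<close> records that an iterate is complex differentiable, without which the
    next right-hand side would not be holomorphic.\<close>
  define Q where "Q = (\<lambda>n::nat. \<lambda>\<gamma>. \<gamma> 0 = x \<and> (\<forall>t\<in>ball 0 \<eta>. \<gamma> t \<in> cball x \<rho> \<and> (\<exists>w. has_vderiv \<gamma> w t)))"
  define R where "R = (\<lambda>n::nat. \<lambda>\<gamma> \<gamma>'. \<forall>t\<in>ball 0 \<eta>. has_vderiv \<gamma>' (X (\<gamma> t)) t)"
  have "\<exists>f. \<forall>n. Q n (f n) \<and> R n (f n) (f (Suc n))"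
  proof (rule dependent_nat_choice)
    have "has_vderiv (\<lambda>_. x) 0 t" for t
      by (rule has_derivative_eq_rhs[OF has_derivative_const]) auto
    then show "\<exists>\<gamma>. Q 0 \<gamma>"
      unfolding Q_def using \<eta> by (intro exI[of _ "\<lambda>_. x"] conjI ballI exI[of _ 0]) auto
  next
    fix \<gamma> n assume Q: "Q n \<gamma>"
    have "(\<lambda>t. X (\<gamma> t) $ i) holomorphic_on ball 0 \<eta>" for i
      using Q S by (intro hol_vf_curve[OF X]) (auto simp: Q_def)
    then obtain g where g: "g 0 = x" "\<And>t. t \<in> ball 0 \<eta> \<Longrightarrow> has_vderiv g (X (\<gamma> t)) t"
      using vderiv_primitive[of "ball 0 \<eta>" "\<lambda>t. X (\<gamma> t)" 0 x] \<eta> by auto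
    have "g t \<in> cball x \<rho>" if t: "t \<in> ball 0 \<eta>" for t
    proof -
      have "norm (g t - g 0) \<le> M * norm (t - 0)"
        by (rule has_vderiv_norm_bound[of "ball 0 \<eta>" g "\<lambda>t. X (\<gamma> t)"])
           (use g M Q t \<eta> in \<open>auto simp: Q_def\<close>)
      also have "\<dots> \<le> M * \<eta>"
      proof -
        have "0 \<le> M" using M[of x] \<eta> norm_ge_zero[of "X x"] by (simp del: norm_ge_zero)
        then show ?thesis using t by (intro mult_left_mono) auto
      qed
      finally show ?thesis using g(1) \<eta> by (simp add: dist_norm norm_minus_commute mult.commute)
    qed
    then have "Q (Suc n) g" "R n \<gamma> g" using g unfolding Q_def R_def by fast+
    then show "\<exists>\<gamma>'. Q (Suc n) \<gamma>' \<and> R n \<gamma> \<gamma>'" by blast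
  qed
  then obtain f where "\<forall>n. Q n (f n) \<and> R n (f n) (f (Suc n))" ..
  then have QR: "Q n (f n)" "R n (f n) (f (Suc n))" for n by simp_all
  have f: "\<And>n. f n 0 = x" "\<And>n t. t \<in> ball 0 \<eta> \<Longrightarrow> f n t \<in> cball x \<rho>"
     "\<And>n t. t \<in> ball 0 \<eta> \<Longrightarrow> has_vderiv (f (Suc n)) (X (f n t)) t"
    "\<And>n t. t \<in> ball 0 \<eta> \<Longrightarrow> \<exists>w. has_vderiv (f n) w t"
    using QR by (auto simp: Q_def R_def)
  have step: "norm (f (Suc n) t - f n t) \<le> 2 * \<rho> * (1/2)^n" if "t \<in> ball 0 \<eta>" for n t
    using that
  proof (induction n arbitrary: t)
    case 0
    have "norm (f (Suc 0) t - f 0 t) \<le> norm (f (Suc 0) t - x) + norm (f 0 t - x)"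
      using norm_triangle_ineq4[of "f (Suc 0) t - x" "f 0 t - x"] by simp
    then show ?case using f(2)[OF 0, of 0] f(2)[OF 0, of "Suc 0"]
      by (simp add: dist_norm norm_minus_commute)
  next
    case (Suc n)
    have "norm ((f (Suc (Suc n)) t - f (Suc n) t) - (f (Suc (Suc n)) 0 - f (Suc n) 0))
          \<le> (\<Lambda> * (2 * \<rho> * (1/2)^n)) * norm (t - 0)"
    proof (rule has_vderiv_norm_bound[of "ball 0 \<eta>" "\<lambda>t. f (Suc (Suc n)) t - f (Suc n) t" "\<lambda>t. X (f (Suc n) t) - X (f n t)"])
      fix s :: complex assume s: "s \<in> ball 0 \<eta>"
      show "has_vderiv (\<lambda>t. f (Suc (Suc n)) t - f (Suc n) t) (X (f (Suc n) s) - X (f n s)) s"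
        using f(3)[OF s, of "Suc n"] f(3)[OF s, of n]
        by (auto intro!: derivative_eq_intros simp: vec_eq_iff algebra_simps)
      have "norm (X (f (Suc n) s) - X (f n s)) \<le> \<Lambda> * norm (f (Suc n) s - f n s)"
        by (rule Lip) (use f(2) s in auto)
      also have "\<dots> \<le> \<Lambda> * (2 * \<rho> * (1/2)^n)"
        using Suc.IH[OF s] \<eta> by (intro mult_left_mono) auto
      finally show "norm (X (f (Suc n) s) - X (f n s)) \<le> \<Lambda> * (2 * \<rho> * (1/2)^n)" .
    qed (use Suc.prems \<eta> in auto)
    also have "\<dots> \<le> (\<Lambda> * (2 * \<rho> * (1/2)^n)) * \<eta>"
      using Suc.prems \<eta> by (intro mult_left_mono) auto
    also have "\<dots> = (\<eta> * \<Lambda>) * (2 * \<rho> * (1/2)^n)" by simp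
    also have "\<dots> \<le> 1/2 * (2 * \<rho> * (1/2)^n)"
      using \<eta> by (intro mult_right_mono) auto
    finally show ?case by (simp add: f(1))
  qed
  have "\<forall>t\<in>ball 0 \<eta>. \<exists>l. \<forall>n. norm (f n t - l) \<le> 4 * \<rho> * (1/2)^n"
  proof
    fix t :: complex assume "t \<in> ball 0 \<eta>"
    then obtain l where "\<And>n. norm (f n t - l) \<le> 2 * \<rho> * (1/2)^n / (1 - 1/2)"
      using geometric_Cauchy_limit[of "\<lambda>n. f n t" "2 * \<rho>" "1/2" thesis] step by auto
    then show "\<exists>l. \<forall>n. norm (f n t - l) \<le> 4 * \<rho> * (1/2)^n" by (intro exI[of _ l]) (simp add: mult.assoc)
  qed
  from bchoice[OF this] obtain g
    where "\<forall>t\<in>ball 0 \<eta>. \<forall>n. norm (f n t - g t) \<le> 4 * \<rho> * (1/2)^n" ..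
  then have g: "norm (f n t - g t) \<le> 4 * \<rho> * (1/2)^n" if "t \<in> ball 0 \<eta>" for n t
    using that by blast
  have small: "\<forall>\<^sub>F n in sequentially. 4 * \<rho> * (1/2)^n < e" if "e > 0" for e
  proof -
    have "(\<lambda>n. 4 * \<rho> * (1/2::real)^n) \<longlonglongrightarrow> 4 * \<rho> * 0"
      by (intro tendsto_intros LIMSEQ_power_zero) auto
    then show ?thesis using order_tendstoD(2)[of _ 0 _ e] that by simp
  qed
  have lim: "(\<lambda>n. f n t) \<longlonglongrightarrow> g t" if "t \<in> ball 0 \<eta>" for t
  proof (rule tendstoI)
    fix e :: real assume "e > 0"
    show "\<forall>\<^sub>F n in sequentially. dist (f n t) (g t) < e"
      using small[OF \<open>e > 0\<close>] by eventually_elim (simp add: dist_norm le_less_trans[OF g[OF that]])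
  qed
  have gin: "g t \<in> cball x \<rho>" if "t \<in> ball 0 \<eta>" for t
    by (rule closed_sequentially[OF closed_cball _ lim[OF that]]) (use f(2)[OF that] in blast)
  \<comment> \<open>Only the shifted iterates have a derivative expressed through \<open>X\<close>,
    hence the sequence \<open>f (Suc n)\<close>. The geometric rate and the Lipschitz bound make
    these derivatives converge uniformly, so the limit is differentiable and solves the
    equation.\<close>
  have "\<exists>g0. \<forall>t\<in>ball 0 \<eta>. (\<lambda>n. f (Suc n) t) \<longlonglongrightarrow> g0 t \<and> (g0 has_derivative (\<lambda>h. h *s X (g t))) (at t within ball 0 \<eta>)"
  proof (rule has_derivative_sequence[where f' = "\<lambda>n t h. h *s X (f n t)" and ?x0.0 = 0])
    show "(f (Suc n) has_derivative (\<lambda>h. h *s X (f n t))) (at t within ball 0 \<eta>)" if "t \<in> ball 0 \<eta>" for n t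
      using f(3)[OF that] has_derivative_at_withinI by blast
    show "\<forall>\<^sub>F n in sequentially. \<forall>t\<in>ball 0 \<eta>. \<forall>h. norm (h *s X (f n t) - h *s X (g t)) \<le> e * norm h"
      if "e > 0" for e
    proof -
      have "e / \<Lambda> > 0" using that \<eta> by simp
      from small[OF this] show ?thesis
      proof eventually_elim
        case (elim n)
        show ?case
        proof clarify
          fix t h assume t: "t \<in> ball (0::complex) \<eta>"
          have "norm (X (f n t) - X (g t)) \<le> \<Lambda> * norm (f n t - g t)"
            by (rule Lip) (use f(2) gin t in auto)
          also have "\<dots> \<le> \<Lambda> * (e / \<Lambda>)"
            using g[OF t, of n] elim \<eta> by (intro mult_left_mono) auto
          finally have le: "norm (X (f n t) - X (g t)) \<le> e" using \<eta> by simp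
          have eq: "h *s X (f n t) - h *s X (g t) = h *s (X (f n t) - X (g t))"
            by (simp add: vec_eq_iff algebra_simps)
          show "norm (h *s X (f n t) - h *s X (g t)) \<le> e * norm h"
            unfolding eq norm_cscale mult.commute[of e]
            by (rule mult_left_mono) (use le in auto)
        qed
      qed
    qed
    show "(\<lambda>n. f (Suc n) 0) \<longlonglongrightarrow> x" by (simp add: f(1))
    show "(0::complex) \<in> ball 0 \<eta>" using \<eta> by simp
    show "convex (ball (0::complex) \<eta>)" by simp
  qed
  then obtain g0 where "\<forall>t\<in>ball 0 \<eta>. (\<lambda>n. f (Suc n) t) \<longlonglongrightarrow> g0 t \<and> (g0 has_derivative (\<lambda>h. h *s X (g t))) (at t within ball 0 \<eta>)"
    ..
  then have g0: "(\<lambda>n. f (Suc n) t) \<longlonglongrightarrow> g0 t" "(g0 has_derivative (\<lambda>h. h *s X (g t))) (at t within ball 0 \<eta>)"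
    if "t \<in> ball 0 \<eta>" for t using that by simp_all
  have eq: "g0 t = g t" if "t \<in> ball 0 \<eta>" for t
    using g0(1)[OF that] LIMSEQ_Suc[OF lim[OF that]] LIMSEQ_unique by blast
  show ?thesis
  proof (rule that[of g0])
    show "g0 0 = x" using g0(1)[of 0] \<eta> by (simp add: f(1) LIMSEQ_const_iff)
    show "g0 t \<in> cball x \<rho>" if "t \<in> ball 0 \<eta>" for t using eq gin that by metis
    show "has_vderiv g0 (X (g0 t)) t" if "t \<in> ball 0 \<eta>" for t
      using g0(2)[OF that] unfolding at_within_open[OF that open_ball] eq[OF that] .
  qed
qed

section \<open>The local flow\<close>

definition integral_curve ::
  "(complex^'n \<Rightarrow> complex^'n) \<Rightarrow> (complex^'n) set \<Rightarrow> complex set \<Rightarrow> (complex \<Rightarrow> complex^'n) \<Rightarrow> bool" where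
  "integral_curve X W D \<gamma> \<longleftrightarrow> open D \<and> connected D \<and> (\<forall>t\<in>D. \<gamma> t \<in> W \<and> has_vderiv \<gamma> (X (\<gamma> t)) t)"

lemma norm_cscale_diff [simp]: "norm (a *s v - b *s v) = norm (a - b) * norm (v :: complex^'n)"
  by (metis norm_cscale vector_sub_rdistrib)

lemma integral_curve_mono: "integral_curve X W D \<gamma> \<Longrightarrow> W \<subseteq> S \<Longrightarrow> integral_curve X S D \<gamma>"
  by (auto simp: integral_curve_def)

lemma integral_curve_subset:
  "integral_curve X W D \<gamma> \<Longrightarrow> open D' \<Longrightarrow> connected D' \<Longrightarrow> D' \<subseteq> D \<Longrightarrow> integral_curve X W D' \<gamma>"
  by (auto simp: integral_curve_def)

lemma integral_curve_continuous_on: "integral_curve X W D \<gamma> \<Longrightarrow> continuous_on D \<gamma>"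
  by (auto simp: integral_curve_def intro!: continuous_at_imp_continuous_on has_vderiv_imp_continuous)

lemma has_vderiv_shift: "has_vderiv \<gamma> w (a + t) \<Longrightarrow> has_vderiv (\<lambda>s. \<gamma> (a + s)) w t"
  unfolding has_vderiv_iff by (simp add: DERIV_shift add.commute[of a])

lemma integral_curve_shift:
  assumes "integral_curve X W D \<gamma>" "ball a \<eta> \<subseteq> D"
  shows "integral_curve X W (ball 0 \<eta>) (\<lambda>t. \<gamma> (a + t))"
proof -
  have "a + t \<in> D" if "t \<in> ball 0 \<eta>" for t
    using assms(2) that by (auto simp: dist_norm)
  then show ?thesis
    using assms(1) unfolding integral_curve_def by (auto intro!: has_vderiv_shift)
qed

text \<open>A Gronwall estimate by iteration. With \<open>\<eta> * \<Lambda> \<le> 1/2\<close>, a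
  bound 2d + e for the distance of the curves improves by integration to d + (2d + e)/2 = 2d + e/2,
  so that 2d remains in the limit.\<close>

lemma ode_dist:
  fixes X :: "complex^'n \<Rightarrow> complex^'n"
  assumes c1: "\<And>t. t \<in> ball 0 \<eta> \<Longrightarrow> \<gamma>1 t \<in> cball x \<rho>" "\<And>t. t \<in> ball 0 \<eta> \<Longrightarrow> has_vderiv \<gamma>1 (X (\<gamma>1 t)) t"
    and c2: "\<And>t. t \<in> ball 0 \<eta> \<Longrightarrow> \<gamma>2 t \<in> cball x \<rho>" "\<And>t. t \<in> ball 0 \<eta> \<Longrightarrow> has_vderiv \<gamma>2 (X (\<gamma>2 t)) t"
    and Lip: "\<And>y y'. y \<in> cball x \<rho> \<Longrightarrow> y' \<in> cball x \<rho> \<Longrightarrow> norm (X y - X y') \<le> \<Lambda> * norm (y - y')"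
    and \<eta>: "\<eta> * \<Lambda> \<le> 1/2" "\<Lambda> > 0" "\<eta> > 0" and t: "t \<in> ball 0 \<eta>"
  shows "norm (\<gamma>1 t - \<gamma>2 t) \<le> 2 * norm (\<gamma>1 0 - \<gamma>2 0)"
proof -
  define d where "d = norm (\<gamma>1 0 - \<gamma>2 0)"
  have it: "norm (\<gamma>1 t - \<gamma>2 t) \<le> 2 * d + 2 * \<rho> * (1/2)^n" if "t \<in> ball 0 \<eta>" for n t
    using that
  proof (induction n arbitrary: t)
    case 0
    have "norm (\<gamma>1 t - \<gamma>2 t) \<le> 2 * \<rho>"
      using c1(1)[OF 0] c2(1)[OF 0] norm_triangle_ineq4[of "\<gamma>1 t - x" "\<gamma>2 t - x"]
      by (simp add: dist_norm norm_minus_commute)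
    moreover have "0 \<le> d" by (simp add: d_def)
    ultimately show ?case by simp
  next
    case (Suc n)
    have B: "norm (X (\<gamma>1 s) - X (\<gamma>2 s)) \<le> \<Lambda> * (2 * d + 2 * \<rho> * (1/2)^n)" if "s \<in> ball 0 \<eta>" for s
    proof -
      have "norm (X (\<gamma>1 s) - X (\<gamma>2 s)) \<le> \<Lambda> * norm (\<gamma>1 s - \<gamma>2 s)"
        by (rule Lip) (use c1 c2 that in auto)
      also have "\<dots> \<le> \<Lambda> * (2 * d + 2 * \<rho> * (1/2)^n)"
        using Suc.IH[OF that] \<eta> by (intro mult_left_mono) auto
      finally show ?thesis .
    qed
    have "norm ((\<gamma>1 t - \<gamma>2 t) - (\<gamma>1 0 - \<gamma>2 0)) \<le> (\<Lambda> * (2 * d + 2 * \<rho> * (1/2)^n)) * norm (t - 0)"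
    proof (rule has_vderiv_norm_bound[of "ball 0 \<eta>" "\<lambda>s. \<gamma>1 s - \<gamma>2 s" "\<lambda>s. X (\<gamma>1 s) - X (\<gamma>2 s)"])
      fix s :: complex assume s: "s \<in> ball 0 \<eta>"
      show "has_vderiv (\<lambda>s. \<gamma>1 s - \<gamma>2 s) (X (\<gamma>1 s) - X (\<gamma>2 s)) s"
        using has_derivative_diff[OF c1(2)[OF s] c2(2)[OF s]] by simp
    qed (use B Suc.prems \<eta> in auto)
    also have "\<dots> \<le> (\<Lambda> * (2 * d + 2 * \<rho> * (1/2)^n)) * \<eta>"
    proof (rule mult_left_mono)
      show "norm (t - 0) \<le> \<eta>" using Suc.prems by simp
      show "0 \<le> \<Lambda> * (2 * d + 2 * \<rho> * (1/2)^n)"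
        using order_trans[OF norm_ge_zero B[OF Suc.prems]] .
    qed
    also have "\<dots> = (\<eta> * \<Lambda>) * (2 * d + 2 * \<rho> * (1/2)^n)" by simp
    also have "\<dots> \<le> 1/2 * (2 * d + 2 * \<rho> * (1/2)^n)"
      using order_trans[OF norm_ge_zero Suc.IH[OF Suc.prems]] \<eta> by (intro mult_right_mono) auto
    finally have "norm ((\<gamma>1 t - \<gamma>2 t) - (\<gamma>1 0 - \<gamma>2 0)) \<le> d + \<rho> * (1/2)^n" by simp
    then show ?case
      using norm_triangle_ineq[of "(\<gamma>1 t - \<gamma>2 t) - (\<gamma>1 0 - \<gamma>2 0)" "\<gamma>1 0 - \<gamma>2 0"]
      unfolding d_def by simp
  qed
  have "(\<lambda>n. 2 * d + 2 * \<rho> * (1/2::real)^n) \<longlonglongrightarrow> 2 * d + 2 * \<rho> * 0"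
    by (intro tendsto_intros LIMSEQ_power_zero) auto
  then have "norm (\<gamma>1 t - \<gamma>2 t) \<le> 2 * d + 2 * \<rho> * 0"
    by (rule LIMSEQ_le_const) (use it[OF t] in auto)
  then show ?thesis by (simp add: d_def)
qed

text \<open>Connectedness of the time domain: agreement at one time spreads to a neighbourhood, as
  the case of initial distance 0 in \<open>ode_dist\<close>, and disagreement is open by
  continuity.\<close>

lemma ode_unique:
  assumes X: "hol_vf S X" and c: "integral_curve X S D \<gamma>1" "integral_curve X S D \<gamma>2"
    and a: "a \<in> D" "\<gamma>1 a = \<gamma>2 a" and b: "b \<in> D"
  shows "\<gamma>1 b = \<gamma>2 b"
proof (rule connected_induction_simple[of D a b "\<lambda>t. \<gamma>1 t = \<gamma>2 t"])
  fix d assume d: "d \<in> D"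
  have oD: "open D" using c by (simp add: integral_curve_def)
  have cont: "isCont \<gamma>1 d" "isCont \<gamma>2 d"
    using c d unfolding integral_curve_def by (blast intro: has_vderiv_imp_continuous)+
  show "\<exists>T. openin (top_of_set D) T \<and> d \<in> T \<and> (\<forall>x\<in>T. \<forall>y\<in>T. \<gamma>1 x = \<gamma>2 x \<longrightarrow> \<gamma>1 y = \<gamma>2 y)"
  proof (cases "\<gamma>1 d = \<gamma>2 d")
    case False
    have "open {t \<in> D. \<gamma>1 t - \<gamma>2 t \<in> -{0}}"
      using continuous_open_preimage[of D "\<lambda>t. \<gamma>1 t - \<gamma>2 t" "-{0}"] oD
        integral_curve_continuous_on[OF c(1)] integral_curve_continuous_on[OF c(2)]
      by (auto intro!: continuous_intros simp: vimage_def Int_def conj_commute)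
    then show ?thesis
      by (intro exI[of _ "{t \<in> D. \<gamma>1 t - \<gamma>2 t \<in> -{0}}"])
         (use d False oD in \<open>auto simp: openin_open_eq\<close>)
  next
    case True
    have "\<gamma>1 d \<in> S" using c d by (simp add: integral_curve_def)
    then have "{\<gamma>1 d} \<subseteq> S" by simp
    then obtain \<rho> M \<Lambda> where "\<rho> > 0" "M > 0" "\<Lambda> > 0"
      "\<And>x. x \<in> {\<gamma>1 d} \<Longrightarrow> cball x \<rho> \<subseteq> S"
      "\<And>x y. x \<in> {\<gamma>1 d} \<Longrightarrow> y \<in> cball x \<rho> \<Longrightarrow> norm (X y) \<le> M"
      and lip: "\<And>x y y'. x \<in> {\<gamma>1 d} \<Longrightarrow> y \<in> cball x \<rho> \<Longrightarrow> y' \<in> cball x \<rho> \<Longrightarrow> norm (X y - X y') \<le> \<Lambda> * norm (y - y')"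
      by (rule hol_vf_local_bounds[OF X compact_sing _ hol_vf_open[OF X] order_refl]) (rule that; assumption)
    note b = \<open>\<rho> > 0\<close> \<open>\<Lambda> > 0\<close> lip[OF singletonI]
    have "\<forall>\<^sub>F t in nhds d. t \<in> D \<and> dist (\<gamma>1 t) (\<gamma>1 d) < \<rho>/4 \<and> dist (\<gamma>2 t) (\<gamma>2 d) < \<rho>/4"
      using cont oD d b(1)
      by (intro eventually_conj eventually_nhds_in_open tendstoD) (auto simp: isCont_def tendsto_at_iff_tendsto_nhds)
    then obtain e where e: "e > 0" "\<And>t. dist t d < e \<Longrightarrow> t \<in> D \<and> dist (\<gamma>1 t) (\<gamma>1 d) < \<rho>/4 \<and> dist (\<gamma>2 t) (\<gamma>2 d) < \<rho>/4"
      unfolding eventually_nhds_metric by blast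
    \<comment> \<open>Two times in the ball of radius \<open>\<eta>/2\<close> are less than
      \<open>\<eta>\<close> apart, so moving the origin of time to one of them covers the other. The
      shifted disc stays within 3/2 \<open>\<eta>\<close> of \<open>d\<close>, hence within
      \<open>e\<close>.\<close>
    define \<eta> where "\<eta> = min (e/2) (1/(2*\<Lambda>))"
    have \<eta>: "\<eta> > 0" "\<eta> * \<Lambda> \<le> 1/2" "\<eta> \<le> e/2" using e b
      by (auto simp: \<eta>_def min_def field_simps)
    have same: "\<gamma>1 y = \<gamma>2 y" if "x \<in> ball d (\<eta>/2)" "y \<in> ball d (\<eta>/2)" "\<gamma>1 x = \<gamma>2 x" for x y
    proof -
      have bs: "dist s d < e" if "s \<in> ball x \<eta>" for s
      proof -
        have "dist s d \<le> dist s x + dist x d" by (rule dist_triangle)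
        also have "\<dots> < \<eta> + \<eta>/2" using that \<open>x \<in> ball d (\<eta>/2)\<close> by (simp add: dist_commute)
        finally show ?thesis using \<eta> by simp
      qed
      have ic: "integral_curve X S (ball 0 \<eta>) (\<lambda>s. \<gamma>1 (x + s))" "integral_curve X S (ball 0 \<eta>) (\<lambda>s. \<gamma>2 (x + s))"
        using bs e(2) by (auto intro!: integral_curve_shift c)
      have inb: "\<gamma>1 (x + s) \<in> cball (\<gamma>1 d) \<rho>" "\<gamma>2 (x + s) \<in> cball (\<gamma>1 d) \<rho>" if "s \<in> ball 0 \<eta>" for s
        using e(2)[OF bs[of "x + s"]] that True b(1) by (auto simp: dist_norm norm_minus_commute)
      have "norm (\<gamma>1 (x + (y - x)) - \<gamma>2 (x + (y - x))) \<le> 2 * norm (\<gamma>1 (x + 0) - \<gamma>2 (x + 0))"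
      proof (rule ode_dist[where \<eta> = \<eta> and \<rho> = \<rho> and x = "\<gamma>1 d" and X = X and \<Lambda> = \<Lambda>])
        have "dist y x < \<eta>" using that dist_triangle[of y x d] by (simp add: dist_commute)
        then show "y - x \<in> ball 0 \<eta>" by (simp add: dist_norm norm_minus_commute)
      qed (use ic inb b \<eta> in \<open>auto simp: integral_curve_def\<close>)
      then show ?thesis using that by simp
    qed
    show ?thesis
    proof (intro exI[of _ "D \<inter> ball d (\<eta>/2)"] conjI ballI impI)
      show "openin (top_of_set D) (D \<inter> ball d (\<eta>/2))" by (rule openin_open_Int[OF open_ball])
      show "d \<in> D \<inter> ball d (\<eta>/2)" using d \<eta> by simp
    qed (use same in blast)
  qed
qed (use c a b in \<open>auto simp: integral_curve_def\<close>)

definition flow ::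
  "(complex^'n \<Rightarrow> complex^'n) \<Rightarrow> (complex^'n) set \<Rightarrow> complex \<Rightarrow> complex^'n \<Rightarrow> complex^'n" where
  "flow X S t x = (THE y. \<exists>\<eta> \<gamma>. norm t < \<eta> \<and> integral_curve X S (ball 0 \<eta>) \<gamma> \<and> \<gamma> 0 = x \<and> \<gamma> t = y)"

lemma flow_eq:
  assumes X: "hol_vf S X" and c: "integral_curve X S (ball 0 \<eta>) \<gamma>" "norm t < \<eta>" "\<gamma> 0 = x"
  shows "flow X S t x = \<gamma> t"
  unfolding flow_def
proof (rule the_equality)
  fix y assume "\<exists>\<eta> \<gamma>. norm t < \<eta> \<and> integral_curve X S (ball 0 \<eta>) \<gamma> \<and> \<gamma> 0 = x \<and> \<gamma> t = y"
  then obtain \<eta>' \<gamma>' where *: "norm t < \<eta>'" "integral_curve X S (ball 0 \<eta>') \<gamma>'" "\<gamma>' 0 = x" "\<gamma>' t = y"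
    by blast
  have "\<gamma>' t = \<gamma> t"
  proof (rule ode_unique[OF X, of "ball 0 (min \<eta> \<eta>')" \<gamma>' \<gamma> 0 t])
    show "integral_curve X S (ball 0 (min \<eta> \<eta>')) \<gamma>'" by (rule integral_curve_subset[OF *(2)]) auto
    show "integral_curve X S (ball 0 (min \<eta> \<eta>')) \<gamma>" by (rule integral_curve_subset[OF c(1)]) auto
    show "0 \<in> ball 0 (min \<eta> \<eta>')" using *(1) c(2) le_less_trans[OF norm_ge_zero] by auto
  qed (use * c in auto)
  then show "y = \<gamma> t" using * by simp
qed (use c in blast)

text \<open>The form in which flows are composed: an integral curve may be restarted at any of its
  points, as long as a whole disc of times about that point is available.\<close>

lemma flow_along:
  assumes X: "hol_vf S X" and c: "integral_curve X S D \<gamma>" "ball a \<eta> \<subseteq> D" "norm t < \<eta>"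
  shows "flow X S t (\<gamma> a) = \<gamma> (a + t)"
  using flow_eq[OF X integral_curve_shift[OF c(1,2)] c(3)] by simp

text \<open>The quantitative facts about short times, with constants uniform over \<open>K\<close>.
  The estimate with \<open>\<delta>\<close> compares the flow at two times with straight motion
  along \<open>X x\<close>; injectivity in time and the expansion of displacements both come from
  it. The last estimate is Lipschitz dependence on the starting point.\<close>

lemma local_flow:
  fixes X :: "complex^'n \<Rightarrow> complex^'n"
  assumes X: "hol_vf S X" and K: "compact K" "K \<subseteq> W" and W: "open W" "W \<subseteq> S"
  obtains \<eta> C where "\<eta> > 0" "C > 0"
    "\<And>x. x \<in> K \<Longrightarrow> integral_curve X W (ball 0 \<eta>) (\<lambda>t. flow X S t x)"
    "\<And>x. x \<in> K \<Longrightarrow> flow X S 0 x = x"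
    "\<And>x t. x \<in> K \<Longrightarrow> norm t < \<eta> \<Longrightarrow> norm (flow X S t x - x) \<le> C * norm t"
    "\<And>x t t' \<delta>. x \<in> K \<Longrightarrow> norm t \<le> \<delta> \<Longrightarrow> norm t' \<le> \<delta> \<Longrightarrow> \<delta> < \<eta> \<Longrightarrow>
       norm (flow X S t x - flow X S t' x - (t - t') *s X x) \<le> C * \<delta> * norm (t - t')"
    "\<And>x x' t. x \<in> K \<Longrightarrow> x' \<in> K \<Longrightarrow> norm (x - x') < \<eta> \<Longrightarrow> norm t < \<eta> \<Longrightarrow>
       norm (flow X S t x - flow X S t x') \<le> 2 * norm (x - x')"
proof -
  obtain \<rho> M \<Lambda> where b: "\<rho> > 0" "M > 0" "\<Lambda> > 0"
    "\<And>x. x \<in> K \<Longrightarrow> cball x \<rho> \<subseteq> W"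
    "\<And>x y. x \<in> K \<Longrightarrow> y \<in> cball x \<rho> \<Longrightarrow> norm (X y) \<le> M"
    "\<And>x y y'. x \<in> K \<Longrightarrow> y \<in> cball x \<rho> \<Longrightarrow> y' \<in> cball x \<rho> \<Longrightarrow> norm (X y - X y') \<le> \<Lambda> * norm (y - y')"
    using hol_vf_local_bounds[OF X K W] by blast
  \<comment> \<open>Orbits from \<open>K\<close> are confined to radius \<open>\<rho>/2\<close>, so
    that an orbit starting within \<open>\<eta> \<le> \<rho>/2\<close> of \<open>x\<close> still
    stays in \<open>cball x \<rho>\<close>, where the Lipschitz constant is valid.\<close>
  define \<eta> where "\<eta> = min (\<rho>/2) (min (\<rho>/(2*M)) (1/(2*\<Lambda>)))"
  have "\<eta> > 0" "\<eta> \<le> \<rho>/2" "\<eta> \<le> \<rho>/(2*M)" "\<eta> \<le> 1/(2*\<Lambda>)" using b by (auto simp: \<eta>_def)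
  then have \<eta>: "\<eta> > 0" "\<eta> \<le> \<rho>/2" "\<eta> * M \<le> \<rho>/2" "\<eta> * \<Lambda> \<le> 1/2"
    using b by (auto simp: field_simps)
  have fl: "flow X S 0 x = x \<and> (\<forall>t\<in>ball 0 \<eta>. flow X S t x \<in> cball x (\<rho>/2) \<and> has_vderiv (\<lambda>t. flow X S t x) (X (flow X S t x)) t)"
    if x: "x \<in> K" for x
  proof -
    have sub: "cball x (\<rho>/2) \<subseteq> cball x \<rho>" using b by auto
    obtain \<gamma> where g: "\<gamma> 0 = x" "\<And>t. t \<in> ball 0 \<eta> \<Longrightarrow> \<gamma> t \<in> cball x (\<rho>/2)"
      "\<And>t. t \<in> ball 0 \<eta> \<Longrightarrow> has_vderiv \<gamma> (X (\<gamma> t)) t"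
    proof (rule ode_exists[OF X, of x "\<rho>/2" M \<Lambda> \<eta>])
      show "cball x (\<rho>/2) \<subseteq> S" using b(4)[OF x] sub W(2) by blast
    qed (use \<eta> b sub x in auto)
    have ic: "integral_curve X S (ball 0 \<eta>) \<gamma>"
      using g b(4)[OF x] sub W(2) unfolding integral_curve_def by (simp add: subset_iff)
    have eq: "flow X S t x = \<gamma> t" if "t \<in> ball 0 \<eta>" for t
      using flow_eq[OF X ic _ g(1)] that by simp
    have "has_vderiv (\<lambda>t. flow X S t x) (X (\<gamma> t)) t" if "t \<in> ball 0 \<eta>" for t
      by (rule has_derivative_transform_within_open[OF g(3)[OF that] open_ball that]) (simp add: eq)
    then show ?thesis using eq g \<eta> by simp
  qed
  have fb: "norm (flow X S t x - x) \<le> M * norm t" if "x \<in> K" "norm t < \<eta>" for x t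
  proof -
    have "norm (flow X S t x - flow X S 0 x) \<le> M * norm (t - 0)"
    proof (rule has_vderiv_norm_bound[of "ball 0 \<eta>" _ "\<lambda>t. X (flow X S t x)"])
      fix s :: complex assume s: "s \<in> ball 0 \<eta>"
      have "flow X S s x \<in> cball x (\<rho>/2)" using fl[OF that(1)] s by blast
      then have "flow X S s x \<in> cball x \<rho>" using b(1) by simp
      then show "norm (X (flow X S s x)) \<le> M" by (rule b(5)[OF that(1)])
    qed (use fl[OF that(1)] that \<eta> in auto)
    then show ?thesis using fl[OF that(1)] by simp
  qed
  show ?thesis
  proof (rule that[of \<eta> "M + \<Lambda> * M"])
    show "integral_curve X W (ball 0 \<eta>) (\<lambda>t. flow X S t x)" if x: "x \<in> K" for x
      unfolding integral_curve_def
    proof (intro conjI ballI)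
      fix t :: complex assume t: "t \<in> ball 0 \<eta>"
      have "flow X S t x \<in> cball x \<rho>" using fl[OF x] t b(1) by fastforce
      then show "flow X S t x \<in> W" using b(4)[OF x] by blast
      show "has_vderiv (\<lambda>t. flow X S t x) (X (flow X S t x)) t" using fl[OF x] t by blast
    qed auto
    show "norm (flow X S t x - x) \<le> (M + \<Lambda> * M) * norm t" if "x \<in> K" "norm t < \<eta>" for x t
    proof -
      have "M * norm t \<le> (M + \<Lambda> * M) * norm t" using b by (intro mult_right_mono) auto
      then show ?thesis using fb[OF that] by linarith
    qed
    show "norm (flow X S t x - flow X S t' x - (t - t') *s X x) \<le> (M + \<Lambda> * M) * \<delta> * norm (t - t')"
      if x: "x \<in> K" and "norm t \<le> \<delta>" "norm t' \<le> \<delta>" "\<delta> < \<eta>" for x t t' \<delta>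
    proof -
      have "norm ((flow X S t x - t *s X x) - (flow X S t' x - t' *s X x)) \<le> (\<Lambda> * (M * \<delta>)) * norm (t - t')"
      proof (rule has_vderiv_norm_bound[of "cball 0 \<delta>" "\<lambda>s. flow X S s x - s *s X x" "\<lambda>s. X (flow X S s x) - X x"])
        fix s :: complex assume s: "s \<in> cball 0 \<delta>"
        then have s': "s \<in> ball 0 \<eta>" using that by auto
        have d: "has_vderiv (\<lambda>t. flow X S t x) (X (flow X S s x)) s" using fl[OF x] s' by blast
        show "has_vderiv (\<lambda>s. flow X S s x - s *s X x) (X (flow X S s x) - X x) s"
          using has_derivative_diff[OF d bounded_linear_imp_has_derivative[OF bounded_linear_cscale[of "X x"]]]
          by simp
        have "norm (X (flow X S s x) - X x) \<le> \<Lambda> * norm (flow X S s x - x)"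
          by (rule b(6)[OF x]) (use fl[OF x] s' b(1) in \<open>force+\<close>)
        also have "\<dots> \<le> \<Lambda> * (M * norm s)" using fb[OF x] s' b by (intro mult_left_mono) auto
        also have "\<dots> \<le> \<Lambda> * (M * \<delta>)" using s b by (intro mult_left_mono) auto
        finally show "norm (X (flow X S s x) - X x) \<le> \<Lambda> * (M * \<delta>)" .
      qed (use that in auto)
      also have "\<dots> \<le> ((M + \<Lambda> * M) * \<delta>) * norm (t - t')"
      proof (rule mult_right_mono)
        have "0 \<le> \<delta>" using that norm_ge_zero order_trans by blast
        then show "\<Lambda> * (M * \<delta>) \<le> (M + \<Lambda> * M) * \<delta>" using b by (simp add: algebra_simps)
      qed simp
      finally show ?thesis by (simp add: vector_sub_rdistrib algebra_simps)
    qed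
    show "norm (flow X S t x - flow X S t x') \<le> 2 * norm (x - x')"
      if x: "x \<in> K" "x' \<in> K" and d: "norm (x - x') < \<eta>" and t: "norm t < \<eta>" for x x' t
    proof -
      have in2: "flow X S s x' \<in> cball x \<rho>" if "s \<in> ball 0 \<eta>" for s
      proof -
        have "dist x (flow X S s x') \<le> dist x x' + dist x' (flow X S s x')" by (rule dist_triangle)
        also have "\<dots> \<le> \<rho>/2 + \<rho>/2"
          using d \<eta>(2) fl[OF x(2)] that by (intro add_mono) (auto simp: dist_norm)
        finally show ?thesis by simp
      qed
      have in1: "flow X S s x \<in> cball x \<rho>" if "s \<in> ball 0 \<eta>" for s
        using fl[OF x(1)] that b(1) by fastforce
      have "norm (flow X S t x - flow X S t x') \<le> 2 * norm (flow X S 0 x - flow X S 0 x')"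
        by (rule ode_dist[where \<eta> = \<eta> and \<rho> = \<rho> and x = x and X = X and \<Lambda> = \<Lambda>])
           (use in1 in2 b(3) b(6)[OF x(1)] fl[OF x(1)] fl[OF x(2)] \<eta> t in auto)
      then show ?thesis using fl x by simp
    qed
    show "flow X S 0 x = x" if "x \<in> K" for x using fl[OF that] by blast
  qed (use \<eta> b in \<open>auto intro: add_pos_pos\<close>)
qed

lemma flow_zero: "hol_vf S X \<Longrightarrow> x \<in> S \<Longrightarrow> flow X S 0 x = x"
  by (rule local_flow[of S X "{x}" S]) (auto dest: hol_vf_open)

text \<open>Continuity in the time for a fixed start, together with a Lipschitz bound in the start
  that is uniform in the time, gives joint continuity.\<close>

lemma flow_continuous_on:
  fixes X :: "complex^'n \<Rightarrow> complex^'n"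
  assumes X: "hol_vf S X" and K: "compact K" "K \<subseteq> W" and W: "open W" "W \<subseteq> S"
  obtains \<eta> where "\<eta> > 0" "continuous_on (ball 0 \<eta> \<times> K) (\<lambda>(t, x). flow X S t x)"
proof -
  obtain \<eta> C :: real where \<eta>: "\<eta> > 0" "C > 0" and ic: "\<And>x. x \<in> K \<Longrightarrow> integral_curve X W (ball 0 \<eta>) (\<lambda>t. flow X S t x)"
    and lip: "\<And>x x' t. x \<in> K \<Longrightarrow> x' \<in> K \<Longrightarrow> norm (x - x') < \<eta> \<Longrightarrow> norm t < \<eta> \<Longrightarrow>
       norm (flow X S t x - flow X S t x') \<le> 2 * norm (x - x')"
    by (rule local_flow[OF X K W]) (rule that; assumption)
  have "continuous_on (ball 0 \<eta> \<times> K) (\<lambda>(t, x). flow X S t x)"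
    unfolding continuous_on_iff
  proof (intro ballI allI impI)
    fix p :: "complex \<times> (complex, 'n) vec" and e :: real assume p0: "p \<in> ball 0 \<eta> \<times> K" and e: "e > 0"
    obtain t x where p: "p = (t, x)" by force
    have t: "t \<in> ball 0 \<eta>" and x: "x \<in> K" using p0 p by auto
    have "isCont (\<lambda>t. flow X S t x) t"
      using ic[OF x] t unfolding integral_curve_def by (blast intro: has_vderiv_imp_continuous)
    then obtain d where d: "d > 0" "\<And>s. dist s t < d \<Longrightarrow> dist (flow X S s x) (flow X S t x) < e/2"
      unfolding continuous_at_eps_delta using e half_gt_zero by blast
    show "\<exists>d>0. \<forall>p'\<in>ball 0 \<eta> \<times> K. dist p' p < d \<longrightarrow>
            dist (case p' of (t, x) \<Rightarrow> flow X S t x) (case p of (t, x) \<Rightarrow> flow X S t x) < e"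
    proof (intro exI[of _ "min d (min (e/4) \<eta>)"] conjI ballI impI)
      fix p' assume pp: "p' \<in> ball 0 \<eta> \<times> K" "dist p' p < min d (min (e/4) \<eta>)"
      obtain s y where p': "p' = (s, y)" by force
      have "dist s t \<le> dist p' p" "dist y x \<le> dist p' p"
        using dist_fst_le[of p' p] dist_snd_le[of p' p] by (auto simp: p' p)
      then have st: "dist s t < d" and yx: "dist y x < e/4" "dist y x < \<eta>" using pp by auto
      have "norm (flow X S s y - flow X S s x) \<le> 2 * norm (y - x)"
        by (rule lip) (use pp p' x yx in \<open>auto simp: dist_norm\<close>)
      then have "dist (flow X S s y) (flow X S s x) < e/2" using yx by (simp add: dist_norm)
      then have "dist (flow X S s y) (flow X S t x) < e"
        using d(2)[OF st] dist_triangle[of "flow X S s y" "flow X S t x" "flow X S s x"] by simp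
      then show "dist (case p' of (t, x) \<Rightarrow> flow X S t x) (case p of (t, x) \<Rightarrow> flow X S t x) < e"
        by (simp add: p' p)
    qed (use d e \<eta> in auto)
  qed
  then show thesis using that \<eta> by blast
qed

text \<open>If two times lead to the same point, the first-order estimate bounds the speed at
  \<open>x\<close> by \<open>C * \<delta>\<close>; \<open>\<delta>\<close> is chosen to push this
  below the minimal speed on \<open>K\<close>.\<close>

lemma flow_inj:
  fixes X :: "complex^'n \<Rightarrow> complex^'n"
  assumes X: "hol_vf S X" and K: "compact K" "K \<subseteq> S" and nz: "\<And>x. x \<in> K \<Longrightarrow> X x \<noteq> 0"
  obtains \<eta> where "\<eta> > 0" "\<And>x. x \<in> K \<Longrightarrow> inj_on (\<lambda>t. flow X S t x) (ball 0 \<eta>)"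
proof -
  obtain \<eta> C :: real where \<eta>: "\<eta> > 0" "C > 0" and aff: "\<And>x t t' \<delta>. x \<in> K \<Longrightarrow> norm t \<le> \<delta> \<Longrightarrow> norm t' \<le> \<delta> \<Longrightarrow> \<delta> < \<eta> \<Longrightarrow>
       norm (flow X S t x - flow X S t' x - (t - t') *s X x) \<le> C * \<delta> * norm (t - t')"
    by (rule local_flow[OF X K hol_vf_open[OF X] order_refl]) (rule that; assumption)
  have "continuous_on K X" using hol_vf_continuous_on[OF X] K continuous_on_subset by blast
  then have "compact (X ` K)" using K compact_continuous_image by blast
  moreover have "0 \<notin> X ` K" using nz by auto
  ultimately have "\<exists>m>0. \<forall>x\<in>K. m \<le> norm (X x)"
    using separate_point_closed[of "X ` K" 0] compact_imp_closed[of "X ` K"] by (simp add: dist_norm)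
  then obtain m where m: "m > 0" "\<And>x. x \<in> K \<Longrightarrow> m \<le> norm (X x)" by blast
  define \<delta> where "\<delta> = min (\<eta>/2) (m/(2*C))"
  have \<delta>: "\<delta> > 0" "\<delta> < \<eta>" "C * \<delta> < m"
  proof -
    show "\<delta> > 0" "\<delta> < \<eta>" using \<eta> m by (auto simp: \<delta>_def)
    have "C * \<delta> \<le> C * (m/(2*C))" using \<eta> by (intro mult_left_mono) (auto simp: \<delta>_def)
    also have "\<dots> < m" using \<eta> m by simp
    finally show "C * \<delta> < m" .
  qed
  show thesis
  proof (rule that[OF \<delta>(1)])
    fix x assume x: "x \<in> K"
    show "inj_on (\<lambda>t. flow X S t x) (ball 0 \<delta>)"
    proof (rule inj_onI, rule ccontr)
      fix t t' assume t: "t \<in> ball (0::complex) \<delta>" "t' \<in> ball (0::complex) \<delta>" "flow X S t x = flow X S t' x" "t \<noteq> t'"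
      have "norm (t - t') * norm (X x) \<le> C * \<delta> * norm (t - t')"
        using aff[OF x, of t \<delta> t'] t \<delta> norm_minus_commute[of t' t] by simp
      then have "norm (t - t') * norm (X x) \<le> norm (t - t') * (C * \<delta>)"
        by (simp add: mult.commute)
      then have "norm (X x) \<le> C * \<delta>" using t(4) by simp
      then show False using m(2)[OF x] \<delta> by simp
    qed
  qed
qed

section \<open>Time changes induced by leaf-preserving homeomorphisms\<close>

text \<open>The property that arbitrarily short times lead into \<open>E\<close> passes along
  integral curves. A time \<open>t\<close> into \<open>E\<close> at \<open>\<gamma> d1\<close> is
  followed by some \<open>q\<close> of the dense set \<open>Q\<close> close to
  \<open>d2 - d1 - t\<close>: the point reached lies in \<open>E\<close> by stability, and seen from
  \<open>\<gamma> d2\<close> it is only the short time \<open>t2\<close> away.\<close>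

lemma flow_dense_orbit_step:
  fixes Y :: "complex^'n \<Rightarrow> complex^'n"
  assumes Y: "hol_vf S Y" and V: "V \<subseteq> S"
    and Q: "\<And>U::complex set. open U \<Longrightarrow> U \<noteq> {} \<Longrightarrow> \<exists>q\<in>Q. q \<in> U"
    and E: "\<And>q y. q \<in> Q \<Longrightarrow> y \<in> E \<Longrightarrow> flow Y S q y \<in> E"
    and oic: "on_integral_curve Y V y y1"
    and P: "\<And>\<delta>. \<delta> > 0 \<Longrightarrow> \<exists>t. norm t < \<delta> \<and> flow Y S t y \<in> E"
    and \<delta>: "\<delta> > 0"
  shows "\<exists>t. norm t < \<delta> \<and> flow Y S t y1 \<in> E"
proof -
  define P' where "P' = (\<lambda>y. \<forall>\<delta>>0. \<exists>t. norm t < \<delta> \<and> flow Y S t y \<in> E)"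
  obtain D \<gamma> a b where D: "open D" "connected D"
    and g: "\<And>t. t \<in> D \<Longrightarrow> \<gamma> t \<in> V \<and> has_vderiv \<gamma> (Y (\<gamma> t)) t"
    and ab: "a \<in> D" "b \<in> D" "y = \<gamma> a" "y1 = \<gamma> b"
    using oic unfolding on_integral_curve_def by blast
  have ic: "integral_curve Y S D \<gamma>" using D g V by (auto simp: integral_curve_def)
  have "P' (\<gamma> b)"
  proof (rule connected_induction_simple[OF D(2) ab(1,2), of "\<lambda>d. P' (\<gamma> d)"])
    show "P' (\<gamma> a)" using P ab(3) by (simp add: P'_def)
  next
    fix d assume d: "d \<in> D"
    then obtain r where r: "r > 0" "ball d r \<subseteq> D" using D(1) open_contains_ball by blast
    \<comment> \<open>All times below stay under \<open>4 * \<rho>\<close>, and a disc of that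
      radius about any centre within \<open>2 * \<rho>\<close> of \<open>d\<close> lies in
      \<open>D\<close>.\<close>
    define \<rho> where "\<rho> = r / 8"
    have \<rho>: "\<rho> > 0" "r = 8 * \<rho>" using r by (auto simp: \<rho>_def)
    have sub: "ball c (4 * \<rho>) \<subseteq> D" if "dist c d < 2 * \<rho>" for c
    proof
      fix z assume "z \<in> ball c (4*\<rho>)"
      then have "dist d z < r" using dist_triangle[of d z c] that \<rho> by (simp add: dist_commute)
      then show "z \<in> D" using r by auto
    qed
    have key: "P' (\<gamma> d2)" if d12: "d1 \<in> ball d \<rho>" "d2 \<in> ball d \<rho>" and p1: "P' (\<gamma> d1)" for d1 d2
      unfolding P'_def
    proof (intro allI impI)
      fix e :: real assume e: "e > 0"
      define e' where "e' = min e \<rho>"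
      have e': "e' > 0" "e' \<le> e" "e' \<le> \<rho>" using e \<rho> by (auto simp: e'_def)
      obtain t where t: "norm t < e'" "flow Y S t (\<gamma> d1) \<in> E" using p1 e' unfolding P'_def by blast
      have dd: "dist d1 d < \<rho>" "dist d2 d < \<rho>" using d12 by (auto simp: dist_commute)
      have f1: "flow Y S t (\<gamma> d1) = \<gamma> (d1 + t)"
        by (rule flow_along[OF Y ic sub[of d1]]) (use dd t e' \<rho> in auto)
      obtain q where q: "q \<in> Q" "q \<in> ball (d2 - d1 - t) e'"
        using Q[of "ball (d2 - d1 - t) e'"] e' by auto
      have dt: "dist (d1 + t) d < 2 * \<rho>"
        using norm_triangle_ineq[of "d1 - d" t] dd t e' by (simp add: dist_norm algebra_simps)
      define t2 where "t2 = d1 + t + q - d2"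
      have t2: "norm t2 < e'"
      proof -
        have "t2 = q - (d2 - d1 - t)" by (simp add: t2_def)
        then show ?thesis using q(2) by (simp add: dist_norm norm_minus_commute)
      qed
      have "norm q < 4 * \<rho>"
      proof -
        have "q = t2 + (d2 - d) - (d1 - d) - t" by (simp add: t2_def)
        then have "norm q \<le> norm t2 + norm (d2 - d) + norm (d1 - d) + norm t"
          using norm_triangle_ineq4[of "t2 + (d2 - d) - (d1 - d)" t] norm_triangle_ineq4[of "t2 + (d2 - d)" "d1 - d"]
            norm_triangle_ineq[of t2 "d2 - d"] by simp
        then show ?thesis using t2 dd t e' by (simp add: dist_norm)
      qed
      then have f2: "flow Y S q (\<gamma> (d1 + t)) = \<gamma> (d1 + t + q)"
        by (intro flow_along[OF Y ic sub[OF dt]]) auto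
      have "flow Y S t2 (\<gamma> d2) = \<gamma> (d2 + t2)"
        by (rule flow_along[OF Y ic sub[of d2]]) (use dd t2 e' \<rho> in auto)
      also have "\<dots> = \<gamma> (d1 + t + q)" by (simp add: t2_def algebra_simps)
      finally have "flow Y S t2 (\<gamma> d2) \<in> E" using E[OF q(1) t(2)] f1 f2 by simp
      then show "\<exists>t. norm t < e \<and> flow Y S t (\<gamma> d2) \<in> E" using t2 e' by (intro exI[of _ t2]) auto
    qed
    show "\<exists>T. openin (top_of_set D) T \<and> d \<in> T \<and> (\<forall>x\<in>T. \<forall>y\<in>T. P' (\<gamma> x) \<longrightarrow> P' (\<gamma> y))"
    proof (intro exI[of _ "D \<inter> ball d \<rho>"] conjI ballI impI)
      show "openin (top_of_set D) (D \<inter> ball d \<rho>)" by (rule openin_open_Int[OF open_ball])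
      show "d \<in> D \<inter> ball d \<rho>" using d \<rho> by simp
    qed (use key in blast)
  qed
  then show ?thesis using \<delta> ab(4) unfolding P'_def by blast
qed

text \<open>A leaf is countable up to short times: \<open>E\<close> collects the points reached from
  \<open>y0\<close> by finite words of flow times from a countable dense set. Words that leave the
  domain of the flow contribute unspecified points, which affects neither countability nor stability
  under \<open>Q\<close>.\<close>

lemma leaf_dense_orbit:
  fixes Y :: "complex^'n \<Rightarrow> complex^'n"
  assumes Y: "hol_vf S Y" and V: "V \<subseteq> S" and y0: "y0 \<in> S"
  obtains E where "countable E" "y0 \<in> E" "\<And>y \<delta>. y \<in> leaf Y V y0 \<Longrightarrow> \<delta> > 0 \<Longrightarrow> \<exists>t. norm t < \<delta> \<and> flow Y S t y \<in> E"
proof -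
  obtain Q :: "complex set" where Q: "countable Q" "\<And>U. open U \<Longrightarrow> U \<noteq> {} \<Longrightarrow> \<exists>q\<in>Q. q \<in> U"
    using countable_dense_exists[where 'a = complex] by blast
  define E where "E = (\<lambda>qs. foldr (flow Y S) qs y0) ` lists Q"
  have E: "flow Y S q y \<in> E" if "q \<in> Q" "y \<in> E" for q y
  proof -
    obtain qs where "qs \<in> lists Q" "y = foldr (flow Y S) qs y0" using \<open>y \<in> E\<close> by (auto simp: E_def)
    then show ?thesis unfolding E_def using that(1) by (intro image_eqI[of _ _ "q # qs"]) auto
  qed
  have "y0 \<in> E" unfolding E_def by (intro image_eqI[of _ _ "[]"]) auto
  have "\<forall>\<delta>>0. \<exists>t. norm t < \<delta> \<and> flow Y S t y \<in> E" if "y \<in> leaf Y V y0" for y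
  proof -
    have "(on_integral_curve Y V)\<^sup>*\<^sup>* y0 y" using that by (simp add: leaf_def)
    then show ?thesis
    proof (induction rule: rtranclp_induct)
      case base
      then show ?case using flow_zero[OF Y y0] \<open>y0 \<in> E\<close> by (auto intro!: exI[of _ 0])
    next
      case (step y z)
      show ?case
        using flow_dense_orbit_step[OF Y V Q(2) E step(2)] step(3) by blast
    qed
  qed
  moreover have "countable E" unfolding E_def using Q(1) by auto
  ultimately show ?thesis using that \<open>y0 \<in> E\<close> by blast
qed

text \<open>The transverse coordinate \<open>c\<close> (flow until the \<open>i\<close>-th coordinate returns to that of \<open>y0\<close>) takes
  only countably many values on a leaf, hence it is constant on connected pieces of a leaf.\<close>

lemma plaque:
  fixes Y :: "complex^'n \<Rightarrow> complex^'n"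
  assumes Y: "hol_vf S Y" and V: "open V" "V \<subseteq> S" and y0: "y0 \<in> V" "Y y0 \<noteq> 0" and \<eta>': "\<eta>' > 0"
  obtains \<rho> where "\<rho> > 0"
    "\<And>C y y'. connected C \<Longrightarrow> y \<in> C \<Longrightarrow> C \<subseteq> ball y0 \<rho> \<Longrightarrow> C \<subseteq> leaf Y V y \<Longrightarrow> y' \<in> C \<Longrightarrow>
       \<exists>t. norm t < \<eta>' \<and> y' = flow Y S t y"
proof -
  \<comment> \<open>The hyperplane on which the \<open>i\<close>-th coordinate equals that of
    \<open>y0\<close> is transverse to \<open>Y\<close> near \<open>y0\<close> and serves as the
    local transversal.\<close>
  obtain i where i: "Y y0 $ i \<noteq> 0" using y0(2) by (auto simp: vec_eq_iff)
  define b where "b = Y y0 $ i"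
  have b: "norm b > 0" using i by (simp add: b_def)
  have "isCont (\<lambda>y. Y y $ i) y0"
    using hol_vf_continuous_on[OF Y] y0(1) V hol_vf_open[OF Y]
    by (intro continuous_intros) (auto simp: continuous_on_eq_continuous_at)
  then obtain d1 where d1: "d1 > 0" "\<And>y. dist y y0 < d1 \<Longrightarrow> dist (Y y $ i) b < norm b / 4"
    unfolding continuous_at_eps_delta b_def using b b_def
    by (meson divide_pos_pos zero_less_numeral)
  obtain d2 where d2: "d2 > 0" "cball y0 d2 \<subseteq> V" using V(1) y0(1) open_contains_cball by blast
  define K where "K = cball y0 (min (d1/2) d2)"
  have K: "compact K" "K \<subseteq> V" using d2 by (auto simp: K_def)
  have Kb: "norm (Y y $ i - b) \<le> norm b / 4" if "y \<in> K" for y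
    using d1(2)[of y] that d1(1) by (auto simp: K_def dist_norm norm_minus_commute)
  obtain \<eta> C where \<eta>: "\<eta> > 0" "C > 0" 
    and ic: "\<And>x. x \<in> K \<Longrightarrow> integral_curve Y V (ball 0 \<eta>) (\<lambda>t. flow Y S t x)"
    and f0: "\<And>x. x \<in> K \<Longrightarrow> flow Y S 0 x = x"
    and fb: "\<And>x t. x \<in> K \<Longrightarrow> norm t < \<eta> \<Longrightarrow> norm (flow Y S t x - x) \<le> C * norm t"
    and aff: "\<And>x t t' \<delta>. x \<in> K \<Longrightarrow> norm t \<le> \<delta> \<Longrightarrow> norm t' \<le> \<delta> \<Longrightarrow> \<delta> < \<eta> \<Longrightarrow>
       norm (flow Y S t x - flow Y S t' x - (t - t') *s Y x) \<le> C * \<delta> * norm (t - t')"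
    and lip: "\<And>x x' t. x \<in> K \<Longrightarrow> x' \<in> K \<Longrightarrow> norm (x - x') < \<eta> \<Longrightarrow> norm t < \<eta> \<Longrightarrow>
       norm (flow Y S t x - flow Y S t x') \<le> 2 * norm (x - x')"
    by (rule local_flow[OF Y K V]) (rule that; assumption)
  define \<delta> where "\<delta> = min (\<eta>/4) (min (\<eta>'/4) (norm b/(4*C)))"
  have "\<delta> > 0" "\<delta> \<le> \<eta>/4" "\<delta> \<le> \<eta>'/4" "\<delta> \<le> norm b/(4*C)" using \<eta> \<eta>' b by (auto simp: \<delta>_def)
  then have \<delta>: "\<delta> > 0" "\<delta> \<le> \<eta>/4" "\<delta> \<le> \<eta>'/4" "C * \<delta> \<le> norm b / 4"
    using \<eta> by (auto simp: field_simps)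
  \<comment> \<open>The bound \<open>\<delta> * norm b / 8\<close> makes the first step
    \<open>g y 0\<close> of the iteration at most \<open>\<delta>/8\<close>, which confines its
    fixed point to \<open>\<delta>/4\<close>.\<close>
  define \<rho> where "\<rho> = min (min (d1/2) d2) (min (\<eta>/4) (\<delta> * norm b / 8))"
  have \<rho>: "\<rho> > 0" "\<rho> \<le> \<eta>/4" "\<rho> \<le> \<delta> * norm b / 8" "ball y0 \<rho> \<subseteq> K"
    using d1 d2 \<eta> \<delta> b by (auto simp: \<rho>_def K_def)
  \<comment> \<open>A Newton step with the derivative frozen at \<open>b\<close>; its fixed point is
    the short time at which the orbit of \<open>y\<close> meets the transversal. The contraction
    factor 1/2 consists of 1/4 from the variation of the \<open>i\<close>-th component of
    \<open>Y\<close> and 1/4 from the nonlinearity of the flow.\<close>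
  define g where "g = (\<lambda>y T. T - (flow Y S T y $ i - y0 $ i) / b)"
  have g_lip: "norm (g y T - g y T') \<le> 1/2 * norm (T - T')"
    if y: "y \<in> K" and T: "norm T \<le> \<delta>" "norm T' \<le> \<delta>" for y T T'
  proof -
    define w where "w = flow Y S T y - flow Y S T' y - (T - T') *s Y y"
    have w: "norm (w $ i) \<le> norm b / 4 * norm (T - T')"
    proof -
      have "norm (w $ i) \<le> norm w" by (rule Finite_Cartesian_Product.norm_nth_le)
      also have "\<dots> \<le> C * \<delta> * norm (T - T')" unfolding w_def using aff[OF y T] \<delta> \<eta> by simp
      also have "\<dots> \<le> norm b / 4 * norm (T - T')" using \<delta>(4) by (intro mult_right_mono) auto
      finally show ?thesis .
    qed
    have "g y T - g y T' = - ((T - T') * (Y y $ i - b) + w $ i) / b"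
      using b by (simp add: g_def w_def field_simps)
    then have "norm (g y T - g y T') = norm ((T - T') * (Y y $ i - b) + w $ i) / norm b"
      by (simp add: norm_divide norm_minus_commute flip: norm_minus_cancel[of "(T - T') * (Y y $ i - b) + w $ i"])
    also have "\<dots> \<le> (norm (T - T') * (norm b / 4) + norm b / 4 * norm (T - T')) / norm b"
    proof (intro divide_right_mono order_trans[OF norm_triangle_ineq] add_mono w)
      show "norm ((T - T') * (Y y $ i - b)) \<le> norm (T - T') * (norm b / 4)"
        unfolding norm_mult using Kb[OF y] by (intro mult_left_mono) auto
    qed auto
    also have "\<dots> = 1/2 * norm (T - T')" using b by (simp add: field_simps)
    finally show ?thesis .
  qed
  have g0: "norm (g y 0) \<le> \<delta>/8" if "y \<in> ball y0 \<rho>" for y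
  proof -
    have "norm (g y 0) = norm ((y - y0) $ i) / norm b"
      using f0[of y] that \<rho>(4) by (auto simp: g_def norm_divide norm_minus_commute)
    also have "\<dots> \<le> norm (y - y0) / norm b"
      by (intro divide_right_mono Finite_Cartesian_Product.norm_nth_le) auto
    also have "\<dots> \<le> \<rho> / norm b"
      using that by (intro divide_right_mono) (auto simp: dist_norm norm_minus_commute)
    also have "\<dots> \<le> \<delta>/8" using \<rho>(3) b by (simp add: field_simps)
    finally show ?thesis .
  qed
  have ex1: "\<exists>!T. T \<in> cball 0 \<delta> \<and> g y T = T" if y: "y \<in> ball y0 \<rho>" for y
  proof (rule Banach_fix[of "cball 0 \<delta>" "1/2"])
    have yK: "y \<in> K" using y \<rho>(4) by blast
    show "g y ` cball 0 \<delta> \<subseteq> cball 0 \<delta>"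
    proof clarify
      fix T :: complex assume T: "T \<in> cball 0 \<delta>"
      have "norm (g y T) \<le> norm (g y T - g y 0) + norm (g y 0)"
        using norm_triangle_ineq[of "g y T - g y 0" "g y 0"] by simp
      also have "\<dots> \<le> 1/2 * norm (T - 0) + \<delta>/8"
        using g_lip[OF yK, of T 0] g0[OF y] T \<delta>(1) by (intro add_mono) auto
      also have "\<dots> \<le> \<delta>" using T \<delta>(1) by simp
      finally show "g y T \<in> cball 0 \<delta>" by simp
    qed
    show "dist (g y T) (g y T') \<le> 1/2 * dist T T'" if "T \<in> cball 0 \<delta>" "T' \<in> cball 0 \<delta>" for T T'
      using g_lip[OF yK, of T T'] that by (simp add: dist_norm)
  qed (use \<delta> in \<open>auto simp: complete_eq_closed\<close>)
  define \<tau> where "\<tau> = (\<lambda>y. THE T. T \<in> cball 0 \<delta> \<and> g y T = T)"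
  have \<tau>: "norm (\<tau> y) \<le> \<delta>" "g y (\<tau> y) = \<tau> y" if "y \<in> ball y0 \<rho>" for y
    using theI'[OF ex1[OF that]] by (auto simp: \<tau>_def)
  have \<tau>_unique: "\<tau> y = T" if "y \<in> ball y0 \<rho>" "norm T \<le> \<delta>" "flow Y S T y $ i = y0 $ i" for y T
    using ex1[OF that(1)] \<tau>[OF that(1)] that(2,3) by (auto simp: g_def)
  have \<tau>_i: "flow Y S (\<tau> y) y $ i = y0 $ i" if "y \<in> ball y0 \<rho>" for y
    using \<tau>(2)[OF that] b by (auto simp: g_def)
  have \<tau>_small: "norm (\<tau> y) \<le> \<delta>/4" if y: "y \<in> ball y0 \<rho>" for y
  proof -
    have "norm (\<tau> y) \<le> norm (g y (\<tau> y) - g y 0) + norm (g y 0)"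
      using norm_triangle_ineq[of "g y (\<tau> y) - g y 0" "g y 0"] \<tau>(2)[OF y] by simp
    also have "\<dots> \<le> 1/2 * norm (\<tau> y - 0) + \<delta>/8"
      using g_lip[of y "\<tau> y" 0] g0[OF y] \<tau>(1)[OF y] y \<rho>(4) \<delta>(1) by (intro add_mono) auto
    finally show ?thesis by simp
  qed
  have \<tau>_lip: "dist (\<tau> y) (\<tau> y') \<le> 4 / norm b * dist y y'"
    if y: "y \<in> ball y0 \<rho>" "y' \<in> ball y0 \<rho>" for y y'
  proof -
    have K2: "y \<in> K" "y' \<in> K" using y \<rho>(4) by auto
    have yy: "norm (y - y') < \<eta>"
      using y dist_triangle[of y y' y0] \<rho>(2) \<eta>(1) by (auto simp: dist_norm norm_minus_commute)
    have t': "norm (\<tau> y') < \<eta>" using \<tau>(1)[OF y(2)] \<delta> \<eta> by simp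
    have "norm (g y (\<tau> y') - g y' (\<tau> y')) = norm ((flow Y S (\<tau> y') y - flow Y S (\<tau> y') y') $ i) / norm b"
      by (simp add: g_def norm_divide norm_minus_commute flip: diff_divide_distrib)
    also have "\<dots> \<le> (2 * norm (y - y')) / norm b"
      by (intro divide_right_mono order_trans[OF Finite_Cartesian_Product.norm_nth_le] lip K2 yy t') auto
    finally have 1: "norm (g y (\<tau> y') - g y' (\<tau> y')) \<le> 2 * norm (y - y') / norm b" .
    have "norm (\<tau> y - \<tau> y') \<le> norm (g y (\<tau> y) - g y (\<tau> y')) + norm (g y (\<tau> y') - g y' (\<tau> y'))"
      using norm_triangle_ineq[of "g y (\<tau> y) - g y (\<tau> y')" "g y (\<tau> y') - g y' (\<tau> y')"] \<tau>(2) y by simp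
    also have "\<dots> \<le> 1/2 * norm (\<tau> y - \<tau> y') + 2 * norm (y - y') / norm b"
      using g_lip[OF K2(1) \<tau>(1)[OF y(1)] \<tau>(1)[OF y(2)]] 1 by (intro add_mono)
    finally show ?thesis by (simp add: dist_norm)
  qed
  have \<tau>_cont: "continuous_on (ball y0 \<rho>) \<tau>"
    by (rule lipschitz_on_continuous_on[OF lipschitz_onI[of _ _ "4 / norm b"]]) (use \<tau>_lip in auto)
  define c where "c = (\<lambda>y. flow Y S (\<tau> y) y)"
  have c_cont: "continuous_on (ball y0 \<rho>) c"
  proof (rule continuous_onI)
    fix y and e :: real assume y: "y \<in> ball y0 \<rho>" and e: "e > 0"
    define L where "L = C * \<delta> * (4 / norm b) + (4 / norm b) * norm (Y y) + 2"
    have L: "L > 0" unfolding L_def using \<eta> \<delta> b by (intro add_nonneg_pos add_nonneg_nonneg) auto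
    have cl: "dist (c y') (c y) \<le> L * dist y' y" if y': "y' \<in> ball y0 \<rho>" for y'
    proof -
      have K2: "y \<in> K" "y' \<in> K" using y y' \<rho>(4) by auto
      have yy: "norm (y' - y) < \<eta>"
        using y y' dist_triangle[of y y' y0] \<rho>(2) \<eta>(1) by (auto simp: dist_norm norm_minus_commute)
      have t': "norm (\<tau> y') < \<eta>" using \<tau>(1)[OF y'] \<delta> \<eta> by simp
      have tt: "norm (\<tau> y' - \<tau> y) \<le> 4 / norm b * norm (y' - y)"
        using \<tau>_lip[OF y' y] by (simp add: dist_norm)
      have A: "norm (flow Y S (\<tau> y') y' - flow Y S (\<tau> y') y) \<le> 2 * norm (y' - y)"
        by (rule lip[OF K2(2,1) yy t'])
      have "norm (flow Y S (\<tau> y') y - flow Y S (\<tau> y) y - (\<tau> y' - \<tau> y) *s Y y) \<le> C * \<delta> * norm (\<tau> y' - \<tau> y)"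
        by (rule aff[OF K2(1) \<tau>(1)[OF y'] \<tau>(1)[OF y]]) (use \<delta> \<eta> in auto)
      then have "norm (flow Y S (\<tau> y') y - flow Y S (\<tau> y) y) \<le> C * \<delta> * norm (\<tau> y' - \<tau> y) + norm (\<tau> y' - \<tau> y) * norm (Y y)"
        using norm_triangle_ineq[of "flow Y S (\<tau> y') y - flow Y S (\<tau> y) y - (\<tau> y' - \<tau> y) *s Y y" "(\<tau> y' - \<tau> y) *s Y y"]
        unfolding norm_cscale by simp
      also have "\<dots> = norm (\<tau> y' - \<tau> y) * (C * \<delta> + norm (Y y))" by (simp add: algebra_simps)
      also have "\<dots> \<le> (4 / norm b * norm (y' - y)) * (C * \<delta> + norm (Y y))"
        using tt \<eta> \<delta> by (intro mult_right_mono) auto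
      finally have B: "norm (flow Y S (\<tau> y') y - flow Y S (\<tau> y) y) \<le> (4 / norm b * norm (y' - y)) * (C * \<delta> + norm (Y y))" .
      have "norm (c y' - c y) \<le> 2 * norm (y' - y) + (4 / norm b * norm (y' - y)) * (C * \<delta> + norm (Y y))"
        using norm_triangle_ineq[of "flow Y S (\<tau> y') y' - flow Y S (\<tau> y') y" "flow Y S (\<tau> y') y - flow Y S (\<tau> y) y"] A B
        by (simp add: c_def)
      also have "\<dots> = L * norm (y' - y)" by (simp add: L_def algebra_simps add_divide_distrib)
      finally show ?thesis by (simp add: dist_norm)
    qed
    show "\<exists>d>0. \<forall>y'\<in>ball y0 \<rho>. dist y' y < d \<longrightarrow> dist (c y') (c y) \<le> e"
    proof (intro exI[of _ "e / L"] conjI ballI impI)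
      fix y' assume *: "y' \<in> ball y0 \<rho>" "dist y' y < e / L"
      have "L * dist y' y \<le> L * (e / L)" using * L by (intro mult_left_mono) auto
      then show "dist (c y') (c y) \<le> e" using cl[OF *(1)] L by simp
    qed (use L e in simp)
  qed
  have grp: "flow Y S s (flow Y S t y) = flow Y S (t + s) y" if "y \<in> K" "norm t + norm s < \<eta>" for s t y
  proof (rule flow_along[OF Y integral_curve_mono[OF ic[OF that(1)] V(2)]])
    show "ball t (\<eta> - norm t) \<subseteq> ball 0 \<eta>"
    proof
      fix z assume "z \<in> ball t (\<eta> - norm t)"
      then show "z \<in> ball 0 \<eta>" using norm_triangle_ineq[of "z - t" t] by (simp add: dist_norm norm_minus_commute)
    qed
  qed (use that in auto)
  \<comment> \<open>Sliding \<open>y\<close> along its orbit by \<open>s\<close> lowers the hitting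
    time by \<open>s\<close>. The new time is still of norm at most \<open>\<delta>\<close>, as
    \<open>\<tau> y\<close> is at most \<open>\<delta>/4\<close> and \<open>s\<close> below
    \<open>\<delta>/2\<close>, so uniqueness of the fixed point identifies it.\<close>
  have c_flow: "c (flow Y S s y) = c y" if y: "y \<in> ball y0 \<rho>" "flow Y S s y \<in> ball y0 \<rho>" and s: "norm s < \<delta>/2" for s y
  proof -
    have yK: "y \<in> K" using y \<rho>(4) by blast
    have n: "norm (\<tau> y - s) \<le> norm (\<tau> y) + norm s" by (rule norm_triangle_ineq4)
    have eq: "flow Y S (\<tau> y - s) (flow Y S s y) = flow Y S (\<tau> y) y"
      using grp[OF yK, of s "\<tau> y - s"] n s \<tau>_small[OF y(1)] \<delta> \<eta> by simp
    have "\<tau> (flow Y S s y) = \<tau> y - s"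
      by (rule \<tau>_unique[OF y(2)]) (use n s \<tau>_small[OF y(1)] \<delta>(1) \<tau>_i[OF y(1)] eq in auto)
    then show ?thesis by (simp add: c_def eq)
  qed
  show ?thesis
  proof (rule that[OF \<rho>(1)])
    fix Cs y y' assume Cs: "connected Cs" "y \<in> Cs" "Cs \<subseteq> ball y0 \<rho>" "Cs \<subseteq> leaf Y V y" "y' \<in> Cs"
    have yb: "y \<in> ball y0 \<rho>" "y' \<in> ball y0 \<rho>" using Cs by auto
    then have yK: "y \<in> K" "y' \<in> K" using \<rho>(4) by auto
    then have "y \<in> S" using K V by blast
    then obtain E where E: "countable E" "\<And>z \<delta>. z \<in> leaf Y V y \<Longrightarrow> \<delta> > 0 \<Longrightarrow> \<exists>t. norm t < \<delta> \<and> flow Y S t z \<in> E"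
      using leaf_dense_orbit[OF Y V(2)] by metis
    \<comment> \<open>A sufficiently short time carries \<open>z\<close> into \<open>E\<close>
      without leaving the ball, and \<open>c\<close> does not change along the way.\<close>
    have "c z \<in> c ` E" if z: "z \<in> Cs" for z
    proof -
      have zb: "z \<in> ball y0 \<rho>" using z Cs by blast
      then have zK: "z \<in> K" using \<rho>(4) by blast
      define r where "r = \<rho> - dist y0 z"
      have r: "r > 0" using zb by (simp add: r_def)
      define e where "e = min (\<delta>/2) (r / C)"
      have e: "e > 0" using r \<eta> \<delta> by (simp add: e_def)
      obtain t where t: "norm t < e" "flow Y S t z \<in> E" using E(2)[OF _ e] z Cs by blast
      have "norm (flow Y S t z - z) \<le> C * norm t" using fb[OF zK] t \<delta> \<eta> by (simp add: e_def)
      also have "\<dots> < C * (r / C)" using t \<eta> by (intro mult_strict_left_mono) (auto simp: e_def)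
      finally have "dist z (flow Y S t z) < r" using \<eta> by (simp add: dist_norm norm_minus_commute)
      then have "flow Y S t z \<in> ball y0 \<rho>" using dist_triangle[of y0 "flow Y S t z" z] by (simp add: r_def)
      then have "c (flow Y S t z) = c z" using c_flow[OF zb] t by (simp add: e_def)
      then show ?thesis using t(2) by (metis imageI)
    qed
    then have "countable (c ` Cs)" using E(1) by (metis countable_image countable_subset image_subsetI)
    moreover have "connected (c ` Cs)"
      using Cs(1,3) c_cont by (metis connected_continuous_image continuous_on_subset)
    \<comment> \<open>A connected set with two distinct points is uncountable, whereas
      \<open>c\<close> takes countably many values on \<open>Cs\<close>.\<close>
    ultimately have "c y' = c y" using connected_uncountable[of "c ` Cs" "c y'" "c y"] Cs by blast
    then have eq: "flow Y S (\<tau> y') y' = flow Y S (\<tau> y) y" by (simp add: c_def)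
    have sm: "norm (\<tau> y) \<le> \<delta>/4" "norm (\<tau> y') \<le> \<delta>/4" using \<tau>_small yb by auto
    \<comment> \<open>Both points have the same foot on the transversal, so \<open>y'\<close> is
      reached from \<open>y\<close> by flowing to the foot and back out, in time
      \<open>\<tau> y - \<tau> y'\<close>.\<close>
    have "y' = flow Y S (- \<tau> y') (flow Y S (\<tau> y') y')"
      using grp[OF yK(2), of "\<tau> y'" "- \<tau> y'"] f0[OF yK(2)] sm \<delta> \<eta> by simp
    also have "\<dots> = flow Y S (\<tau> y - \<tau> y') y"
      using grp[OF yK(1), of "\<tau> y" "- \<tau> y'"] sm \<delta> \<eta> by (simp add: eq)
    finally have "y' = flow Y S (\<tau> y - \<tau> y') y" .
    moreover have "norm (\<tau> y - \<tau> y') < \<eta>'"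
      using norm_triangle_ineq4[of "\<tau> y" "\<tau> y'"] sm \<delta> by simp
    ultimately show "\<exists>t. norm t < \<eta>' \<and> y' = flow Y S t y" by blast
  qed
qed

section \<open>The induced change of time\<close>

text \<open>The image under \<open>\<phi>\<close> of a small disc of X-times is connected, small and
  contained in one leaf, hence by \<open>plaque\<close> in one short orbit of \<open>Y\<close>.
  Injectivity of the flow of \<open>Y\<close> for short times makes the Y-time unique; it inherits
  injectivity from \<open>\<phi>\<close> and the flow of \<open>X\<close>, and it is continuous
  because its graph is closed and its values lie in a compact disc.\<close>

lemma time_change:
  fixes X Y :: "complex^'n \<Rightarrow> complex^'n"
  assumes X: "hol_vf S X" and Y: "hol_vf T Y" and U: "open U" "U \<subseteq> S" and V: "open V" "V \<subseteq> T"
    and hom: "homeomorphism U V \<phi> \<psi>"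
    and leaf: "\<And>x. x \<in> U \<Longrightarrow> X x \<noteq> 0 \<Longrightarrow> \<phi> ` leaf X U x \<subseteq> leaf Y V (\<phi> x)"
    and K: "compact K" "K \<subseteq> U" and nzX: "\<And>x. x \<in> K \<Longrightarrow> X x \<noteq> 0" and nzY: "\<And>x. x \<in> K \<Longrightarrow> Y (\<phi> x) \<noteq> 0"
    and \<eta>': "\<eta>' > 0"
  obtains \<eta> \<tau> where "\<eta> > 0"
    "\<And>x h. x \<in> K \<Longrightarrow> norm h \<le> \<eta> \<Longrightarrow>
       flow X S h x \<in> U \<and> norm (\<tau> x h) < \<eta>' \<and> \<phi> (flow X S h x) = flow Y T (\<tau> x h) (\<phi> x)"
    "\<And>x. x \<in> K \<Longrightarrow> inj_on (\<tau> x) (cball 0 \<eta>)" "\<And>x. x \<in> K \<Longrightarrow> \<tau> x 0 = 0"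
    "continuous_on (K \<times> cball 0 \<eta>) (\<lambda>(x, h). \<tau> x h)"
proof -
  have cphi: "continuous_on U \<phi>" and injphi: "inj_on \<phi> U" and imphi: "\<phi> ` U = V"
    using hom unfolding homeomorphism_def by (auto intro: inj_on_inverseI)
  define K2 where "K2 = \<phi> ` K"
  have K2: "compact K2" "K2 \<subseteq> V" "K2 \<subseteq> T"
    using K cphi imphi V unfolding K2_def
    by (blast intro: compact_continuous_image continuous_on_subset)+
  have nz2: "Y y \<noteq> 0" if "y \<in> K2" for y using nzY that by (auto simp: K2_def)
  obtain e1 where e1: "e1 > 0" "\<And>y. y \<in> K2 \<Longrightarrow> inj_on (\<lambda>t. flow Y T t y) (ball 0 e1)"
    by (rule flow_inj[OF Y K2(1,3)], erule nz2, rule that, assumption, assumption)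
  obtain e2 where e2: "e2 > 0" "continuous_on (ball 0 e2 \<times> K2) (\<lambda>(t, y). flow Y T t y)"
    by (rule flow_continuous_on[OF Y K2(1,3) hol_vf_open[OF Y] order_refl]) (rule that; assumption)
  define e where "e = min \<eta>' (min e1 e2) / 2"
  have e: "e > 0" "e < \<eta>'" "e < e1" "e < e2" using \<eta>' e1 e2 by (auto simp: e_def)
  have "\<forall>y0\<in>K2. \<exists>\<rho>>0. \<forall>C y y'. connected C \<longrightarrow> y \<in> C \<longrightarrow> C \<subseteq> ball y0 \<rho> \<longrightarrow> C \<subseteq> leaf Y V y \<longrightarrow> y' \<in> C \<longrightarrow>
       (\<exists>t. norm t < e \<and> y' = flow Y T t y)"
  proof
    fix y0 assume "y0 \<in> K2"
    then have "y0 \<in> V" "Y y0 \<noteq> 0" using K2 nz2 by auto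
    from plaque[OF Y V this e(1)] show "\<exists>\<rho>>0. \<forall>C y y'. connected C \<longrightarrow> y \<in> C \<longrightarrow> C \<subseteq> ball y0 \<rho> \<longrightarrow> C \<subseteq> leaf Y V y \<longrightarrow> y' \<in> C \<longrightarrow>
       (\<exists>t. norm t < e \<and> y' = flow Y T t y)" by metis
  qed
  from bchoice[OF this] obtain \<rho> where \<rho>: "\<And>y0. y0 \<in> K2 \<Longrightarrow> \<rho> y0 > 0"
    "\<And>y0 C y y'. y0 \<in> K2 \<Longrightarrow> connected C \<Longrightarrow> y \<in> C \<Longrightarrow> C \<subseteq> ball y0 (\<rho> y0) \<Longrightarrow> C \<subseteq> leaf Y V y \<Longrightarrow> y' \<in> C \<Longrightarrow>
       \<exists>t. norm t < e \<and> y' = flow Y T t y" by metis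
  \<comment> \<open>A Lebesgue number: each ball of radius \<open>r\<close> about a point of
    \<open>K2\<close> lies in one of the balls provided by \<open>plaque\<close>, so one range of
    X-times works for all of \<open>K\<close>.\<close>
  obtain r where r: "r > 0" "\<And>y. y \<in> K2 \<Longrightarrow> \<exists>G \<in> (\<lambda>y0. ball y0 (\<rho> y0)) ` K2. ball y r \<subseteq> G"
  proof (rule Heine_Borel_lemma[OF K2(1), of "(\<lambda>y0. ball y0 (\<rho> y0)) ` K2"])
    show "K2 \<subseteq> \<Union> ((\<lambda>y0. ball y0 (\<rho> y0)) ` K2)" using \<rho>(1) by force
  qed auto
  \<comment> \<open>On \<open>W\<close> the field \<open>X\<close> has no zeros, as
    \<open>on_integral_curve\<close> demands; an orbit confined to \<open>W\<close> is therefore a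
    piece of a leaf of \<open>X\<close> in \<open>U\<close>.\<close>
  define W where "W = U \<inter> {x \<in> S. X x \<in> -{0}}"
  have "open {x \<in> S. X x \<in> -{0}}"
    using continuous_open_preimage[OF hol_vf_continuous_on[OF X] hol_vf_open[OF X], of "-{0}"]
    by (simp add: vimage_def Int_def open_Compl)
  then have "open W" unfolding W_def using U(1) by (rule open_Int[rotated])
  moreover have "W \<subseteq> S" "K \<subseteq> W" "W \<subseteq> U" using U K nzX by (auto simp: W_def)
  ultimately have W: "open W" "W \<subseteq> S" "K \<subseteq> W" "W \<subseteq> U" by simp_all
  obtain d1 C :: real where d1: "d1 > 0" "C > 0"
    and ic: "\<And>x. x \<in> K \<Longrightarrow> integral_curve X W (ball 0 d1) (\<lambda>t. flow X S t x)"
    and f0: "\<And>x. x \<in> K \<Longrightarrow> flow X S 0 x = x"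
    by (rule local_flow[OF X K(1) W(3,1,2)]) (rule that; assumption)
  obtain d2 where d2: "d2 > 0" "\<And>x. x \<in> K \<Longrightarrow> inj_on (\<lambda>t. flow X S t x) (ball 0 d2)"
    by (rule flow_inj[OF X K(1) order_trans[OF W(3,2)]], erule nzX, rule that, assumption, assumption)
  obtain d3 where d3: "d3 > 0" "continuous_on (ball 0 d3 \<times> K) (\<lambda>(t, x). flow X S t x)"
    by (rule flow_continuous_on[OF X K(1) W(3,1,2)]) (rule that; assumption)
  define d where "d = min d1 (min d2 d3) / 2"
  have d: "d > 0" "d < d1" "d < d2" "d < d3" using d1 d2 d3 by (auto simp: d_def)
  have inU: "flow X S h x \<in> U" if "x \<in> K" "norm h < d1" for x h
    using ic[OF that(1)] that(2) W(4) unfolding integral_curve_def by auto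
  have cont0: "continuous_on (K \<times> cball 0 d) (\<lambda>p. flow X S (snd p) (fst p))"
  proof -
    have "continuous_on (K \<times> cball 0 d) (\<lambda>p. (\<lambda>(t, x). flow X S t x) (snd p, fst p))"
      by (rule continuous_on_compose2[OF d3(2)]) (use d in \<open>auto intro!: continuous_intros\<close>)
    then show ?thesis by simp
  qed
  have cont: "continuous_on (K \<times> cball 0 d) (\<lambda>p. \<phi> (flow X S (snd p) (fst p)))"
    by (rule continuous_on_compose2[OF cphi cont0]) (use inU d in auto)
  then have "uniformly_continuous_on (K \<times> cball 0 d) (\<lambda>p. \<phi> (flow X S (snd p) (fst p)))"
    using K by (intro compact_uniformly_continuous compact_Times) auto
  then obtain d4 where d4: "d4 > 0"
    "\<And>p p'. p \<in> K \<times> cball 0 d \<Longrightarrow> p' \<in> K \<times> cball 0 d \<Longrightarrow> dist p' p < d4 \<Longrightarrow>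
      dist (\<phi> (flow X S (snd p') (fst p'))) (\<phi> (flow X S (snd p) (fst p))) < r"
    unfolding uniformly_continuous_on_def using r(1) by meson
  define \<eta>1 where "\<eta>1 = min d d4"
  have \<eta>1: "\<eta>1 > 0" "\<eta>1 \<le> d" "\<eta>1 \<le> d4" using d d4 by (auto simp: \<eta>1_def)
  have close: "dist (\<phi> (flow X S h x)) (\<phi> x) < r" if "x \<in> K" "norm h < \<eta>1" for x h
    using d4(2)[of "(x, 0)" "(x, h)"] that \<eta>1 d f0[OF that(1)] by (simp add: dist_Pair_Pair)
  have ex: "\<exists>t. norm t < e \<and> \<phi> (flow X S h x) = flow Y T t (\<phi> x)" if x: "x \<in> K" and h: "norm h < \<eta>1" for x h
  proof -
    define Cs where "Cs = (\<lambda>h. \<phi> (flow X S h x)) ` ball 0 \<eta>1"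
    have icx: "integral_curve X W (ball 0 \<eta>1) (\<lambda>t. flow X S t x)"
      by (rule integral_curve_subset[OF ic[OF x]]) (use \<eta>1 d in auto)
    have "connected Cs" unfolding Cs_def
    proof (rule connected_continuous_image)
      show "continuous_on (ball 0 \<eta>1) (\<lambda>h. \<phi> (flow X S h x))"
        by (rule continuous_on_compose2[OF cphi integral_curve_continuous_on[OF icx]])
           (use inU[OF x] \<eta>1 d in auto)
    qed simp
    moreover have x0: "\<phi> x \<in> Cs" unfolding Cs_def using f0[OF x] \<eta>1 by (intro image_eqI[of _ _ 0]) auto
    moreover obtain y0 where y0: "y0 \<in> K2" "ball (\<phi> x) r \<subseteq> ball y0 (\<rho> y0)"
      using r(2)[of "\<phi> x"] x by (auto simp: K2_def)
    moreover have "Cs \<subseteq> ball (\<phi> x) r" using close[OF x] by (auto simp: Cs_def dist_commute)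
    moreover have "Cs \<subseteq> leaf Y V (\<phi> x)"
    proof -
      have "flow X S h' x \<in> leaf X U x" if "h' \<in> ball 0 \<eta>1" for h'
      proof -
        have "on_integral_curve X U x (flow X S h' x)"
          unfolding on_integral_curve_def
        proof (intro exI[of _ "ball 0 \<eta>1"] exI[of _ "\<lambda>t. flow X S t x"] conjI ballI)
          show "flow X S t x \<in> U" "X (flow X S t x) \<noteq> 0" "has_vderiv (\<lambda>t. flow X S t x) (X (flow X S t x)) t"
            if "t \<in> ball 0 \<eta>1" for t
            using icx that unfolding integral_curve_def W_def by auto
          show "x \<in> (\<lambda>t. flow X S t x) ` ball 0 \<eta>1"
            using f0[OF x] \<eta>1 by (intro image_eqI[of _ _ 0]) auto
        qed (use that in auto)
        then show ?thesis by (auto simp: leaf_def)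
      qed
      then have "Cs \<subseteq> \<phi> ` leaf X U x" by (auto simp: Cs_def)
      then show ?thesis using leaf[of x] K nzX x by blast
    qed
    moreover have "\<phi> (flow X S h x) \<in> Cs" using h by (auto simp: Cs_def)
    ultimately show ?thesis using \<rho>(2)[of y0 Cs "\<phi> x" "\<phi> (flow X S h x)"] by blast
  qed
  \<comment> \<open>Uniqueness is claimed up to \<open>e1\<close>, where the flow of
    \<open>Y\<close> is injective, while the times found stay below \<open>e < e1\<close>. The gap
    leaves the closed disc of radius \<open>e\<close> as a compact range for the closed-graph
    argument.\<close>
  define \<tau> where "\<tau> = (\<lambda>x h. THE t. norm t < e1 \<and> \<phi> (flow X S h x) = flow Y T t (\<phi> x))"
  have \<tau>_eq: "\<tau> x h = t" if "x \<in> K" "norm t < e1" "\<phi> (flow X S h x) = flow Y T t (\<phi> x)" for x h t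
    unfolding \<tau>_def
  proof (rule the_equality)
    fix s assume "norm s < e1 \<and> \<phi> (flow X S h x) = flow Y T s (\<phi> x)"
    then show "s = t" using that inj_onD[OF e1(2)[of "\<phi> x"], of s t] by (auto simp: K2_def)
  qed (use that in auto)
  have \<tau>: "norm (\<tau> x h) < e" "\<phi> (flow X S h x) = flow Y T (\<tau> x h) (\<phi> x)" if "x \<in> K" "norm h < \<eta>1" for x h
  proof -
    obtain t where t: "norm t < e" "\<phi> (flow X S h x) = flow Y T t (\<phi> x)" using ex[OF \<open>x \<in> K\<close> \<open>norm h < \<eta>1\<close>] by blast
    then have "\<tau> x h = t" using \<tau>_eq[OF \<open>x \<in> K\<close>] e by simp
    then show "norm (\<tau> x h) < e" "\<phi> (flow X S h x) = flow Y T (\<tau> x h) (\<phi> x)" using t by simp_all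
  qed
  show ?thesis
  proof (rule that[of "\<eta>1/2" \<tau>])
    fix x assume x: "x \<in> K"
    show "flow X S h x \<in> U \<and> norm (\<tau> x h) < \<eta>' \<and> \<phi> (flow X S h x) = flow Y T (\<tau> x h) (\<phi> x)" if "norm h \<le> \<eta>1/2" for h
      using \<tau>[OF x, of h] inU[OF x, of h] that e d \<eta>1 by auto
    show "\<tau> x 0 = 0"
      using \<tau>_eq[OF x, of 0 0] e1 f0[OF x] flow_zero[OF Y, of "\<phi> x"] K2(3) x by (auto simp: K2_def)
    show "inj_on (\<tau> x) (cball 0 (\<eta>1/2))"
    proof (rule inj_onI)
      fix h h' assume h: "h \<in> cball 0 (\<eta>1/2)" "h' \<in> cball 0 (\<eta>1/2)" "\<tau> x h = \<tau> x h'"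
      then have n: "norm h < \<eta>1" "norm h' < \<eta>1" using \<eta>1 by auto
      then have "\<phi> (flow X S h x) = \<phi> (flow X S h' x)" using \<tau>(2)[OF x] h(3) by simp
      then have "flow X S h x = flow X S h' x"
        using inj_onD[OF injphi] inU[OF x] n \<eta>1 d by simp
      then show "h = h'" using inj_onD[OF d2(2)[OF x], of h h'] n \<eta>1 d by simp
    qed
  next
    define P where "P = K \<times> cball (0::complex) (\<eta>1/2)"
    have Psub: "P \<subseteq> K \<times> cball 0 d" using \<eta>1 by (auto simp: P_def)
    have comP: "compact P" unfolding P_def using K by (intro compact_Times) auto
    \<comment> \<open>The graph is the zero set of a continuous function on the compact set
      \<open>Q\<close>: any time of norm at most \<open>e\<close> that satisfies the equation must
      be the value of \<open>\<tau>\<close>.\<close>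
    have "closed ((\<lambda>p. Pair p (\<tau> (fst p) (snd p))) ` P)"
    proof -
      define Q where "Q = P \<times> cball (0::complex) e"
      have comQ: "compact Q" unfolding Q_def using comP by (intro compact_Times) auto
      have eq: "(\<lambda>p. Pair p (\<tau> (fst p) (snd p))) ` P =
          {q \<in> Q. \<phi> (flow X S (snd (fst q)) (fst (fst q))) - flow Y T (snd q) (\<phi> (fst (fst q))) = 0}"
        (is "?L = ?R")
      proof
        show "?L \<subseteq> ?R"
          using \<tau> \<eta>1 by (fastforce simp: Q_def P_def less_imp_le)
        show "?R \<subseteq> ?L"
        proof
          fix q assume q: "q \<in> ?R"
          obtain x h t where qe: "q = ((x, h), t)" by (metis surj_pair)
          have "x \<in> K" "norm t < e1" "\<phi> (flow X S h x) = flow Y T t (\<phi> x)"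
            using q e by (auto simp: Q_def P_def qe)
          then have "\<tau> x h = t" by (rule \<tau>_eq)
          then show "q \<in> ?L" using q by (auto simp: Q_def qe image_iff)
        qed
      qed
      have cQ: "continuous_on Q (\<lambda>q. \<phi> (flow X S (snd (fst q)) (fst (fst q))) - flow Y T (snd q) (\<phi> (fst (fst q))))"
      proof (rule continuous_on_diff)
        show "continuous_on Q (\<lambda>q. \<phi> (flow X S (snd (fst q)) (fst (fst q))))"
          by (rule continuous_on_compose2[OF cont]) (use Psub in \<open>auto simp: Q_def intro!: continuous_intros\<close>)
        have "continuous_on Q (\<lambda>q. (\<lambda>(t, y). flow Y T t y) (snd q, \<phi> (fst (fst q))))"
        proof (rule continuous_on_compose2[OF e2(2)])
          have "continuous_on Q (\<lambda>q. \<phi> (fst (fst q)))"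
            by (rule continuous_on_compose2[OF cphi]) (use K in \<open>auto simp: Q_def P_def intro!: continuous_intros\<close>)
          then show "continuous_on Q (\<lambda>q. (snd q, \<phi> (fst (fst q))))"
            by (auto intro!: continuous_intros)
        qed (use e in \<open>auto simp: Q_def P_def K2_def\<close>)
        then show "continuous_on Q (\<lambda>q. flow Y T (snd q) (\<phi> (fst (fst q))))" by simp
      qed
      show ?thesis
        unfolding eq by (rule continuous_closed_preimage_constant[OF cQ compact_imp_closed[OF comQ]])
    qed
    then have "continuous_on P (\<lambda>p. \<tau> (fst p) (snd p))"
    proof (rule continuous_from_closed_graph[of "cball 0 e", rotated 2])
      show "(\<lambda>p. \<tau> (fst p) (snd p)) \<in> P \<rightarrow> cball 0 e"
        using \<tau>(1) \<eta>1 by (fastforce simp: P_def less_imp_le)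
    qed auto
    then show "continuous_on (K \<times> cball 0 (\<eta>1/2)) (\<lambda>(x, h). \<tau> x h)"
      by (simp add: P_def case_prod_beta)
  qed (use \<eta>1 in auto)
qed

section \<open>Indices of functions on circles\<close>

text \<open>The loop \<open>g\<close> over the circle is in general merely continuous, so the index
  is not a contour integral and is computed by continuous logarithms and homotopies.\<close>

definition ind :: "(complex \<Rightarrow> complex) \<Rightarrow> complex \<Rightarrow> real \<Rightarrow> complex" where
  "ind g a r = winding_number (\<lambda>t. g (circlepath a r t)) 0"

lemma circlepath_in_sphere: "0 \<le> r \<Longrightarrow> circlepath a r t \<in> sphere a r"
  by (simp add: circlepath dist_norm norm_mult)

lemma ind_path:
  assumes "continuous_on (sphere a r) g" "r > 0" "\<And>z. z \<in> sphere a r \<Longrightarrow> g z \<noteq> 0"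
  shows "path (\<lambda>t. g (circlepath a r t))" "0 \<notin> path_image (\<lambda>t. g (circlepath a r t))"
    "pathfinish (\<lambda>t. g (circlepath a r t)) = pathstart (\<lambda>t. g (circlepath a r t))"
proof -
  have "continuous_on {0..1} (circlepath a r)" using path_circlepath[of a r] by (simp add: path_def)
  then show "path (\<lambda>t. g (circlepath a r t))"
    unfolding path_def using assms circlepath_in_sphere[of r a]
    by (intro continuous_on_compose2[OF assms(1)]) auto
  show "0 \<notin> path_image (\<lambda>t. g (circlepath a r t))"
    using assms circlepath_in_sphere[of r a] by (force simp: path_image_def)
  show "pathfinish (\<lambda>t. g (circlepath a r t)) = pathstart (\<lambda>t. g (circlepath a r t))"
    using pathfinish_circlepath[of a r] pathstart_circlepath[of a r] by (simp add: pathfinish_def pathstart_def)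
qed

text \<open>The working description of the index: the increment of a continuous logarithm along the
  circle, divided by 2 pi i. With its converse \<open>ind_eqI\<close> it reduces products to
  sums.\<close>

lemma ind_log:
  assumes "continuous_on (sphere a r) g" "r > 0" "\<And>z. z \<in> sphere a r \<Longrightarrow> g z \<noteq> 0"
  obtains q where "path q" "pathfinish q - pathstart q = 2 * of_real pi * \<i> * ind g a r"
    "\<And>t. t \<in> {0..1} \<Longrightarrow> g (circlepath a r t) = exp (q t)"
  using winding_number_as_continuous_log[OF ind_path(1,2)[OF assms]] unfolding ind_def
  by (metis add_0)

lemma ind_eqI:
  assumes "path q" "\<And>t. t \<in> {0..1} \<Longrightarrow> g (circlepath a r t) = exp (q t)"
  shows "ind g a r = (pathfinish q - pathstart q) / (2 * of_real pi * \<i>)"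
proof -
  have "ind g a r = winding_number (exp \<circ> q) 0"
    unfolding ind_def by (rule winding_number_cong) (use assms(2) in auto)
  then show ?thesis using winding_number_compose_exp[OF assms(1)] by simp
qed

lemma ind_mult:
  assumes g: "continuous_on (sphere a r) g" "\<And>z. z \<in> sphere a r \<Longrightarrow> g z \<noteq> 0"
    and h: "continuous_on (sphere a r) h" "\<And>z. z \<in> sphere a r \<Longrightarrow> h z \<noteq> 0" and r: "r > 0"
  shows "ind (\<lambda>z. g z * h z) a r = ind g a r + ind h a r"
proof -
  obtain p where p: "path p" "pathfinish p - pathstart p = 2 * of_real pi * \<i> * ind g a r"
    "\<And>t. t \<in> {0..1} \<Longrightarrow> g (circlepath a r t) = exp (p t)" using ind_log[OF g(1) r g(2)] by blast
  obtain q where q: "path q" "pathfinish q - pathstart q = 2 * of_real pi * \<i> * ind h a r"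
    "\<And>t. t \<in> {0..1} \<Longrightarrow> h (circlepath a r t) = exp (q t)" using ind_log[OF h(1) r h(2)] by blast
  have "ind (\<lambda>z. g z * h z) a r = (pathfinish (\<lambda>t. p t + q t) - pathstart (\<lambda>t. p t + q t)) / (2 * of_real pi * \<i>)"
    using p q by (intro ind_eqI) (auto simp: path_def exp_add intro!: continuous_intros)
  also have "\<dots> = ((pathfinish p - pathstart p) + (pathfinish q - pathstart q)) / (2 * of_real pi * \<i>)"
    by (simp add: pathfinish_def pathstart_def)
  also have "\<dots> = ind g a r + ind h a r" by (simp add: p(2) q(2) add_divide_distrib)
  finally show ?thesis .
qed

lemma ind_cong: "(\<And>z. z \<in> sphere a r \<Longrightarrow> g z = h z) \<Longrightarrow> r > 0 \<Longrightarrow> ind g a r = ind h a r"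
  unfolding ind_def by (rule winding_number_cong) (use circlepath_in_sphere[of r a] in auto)

lemma ind_exp:
  assumes "continuous_on (sphere a r) L" "r > 0" "\<And>z. z \<in> sphere a r \<Longrightarrow> g z = exp (L z)"
  shows "ind g a r = 0"
proof -
  have "continuous_on {0..1} (circlepath a r)" using path_circlepath[of a r] by (simp add: path_def)
  then have "path (\<lambda>t. L (circlepath a r t))"
    unfolding path_def using assms circlepath_in_sphere[of r a]
    by (intro continuous_on_compose2[OF assms(1)]) auto
  from ind_eqI[OF this, of g a r]
  have "ind g a r = (L (circlepath a r 1) - L (circlepath a r 0)) / (2 * of_real pi * \<i>)"
    using assms circlepath_in_sphere[of r a] by (simp add: pathfinish_def pathstart_def)
  moreover have "circlepath a r 1 = circlepath a r 0"
    using pathfinish_circlepath[of a r] pathstart_circlepath[of a r] by (simp add: pathfinish_def pathstart_def)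
  ultimately show ?thesis by simp
qed

lemma ind_const: "c \<noteq> 0 \<Longrightarrow> r > 0 \<Longrightarrow> ind (\<lambda>_. c) a r = 0"
  by (rule ind_exp[where L = "\<lambda>_. Ln c"]) auto

lemma ind_nonzero_cball:
  assumes "continuous_on (cball a r) g" "r > 0" "\<And>z. z \<in> cball a r \<Longrightarrow> g z \<noteq> 0"
  shows "ind g a r = 0"
proof -
  obtain L where L: "continuous_on (cball a r) L" "\<And>z. z \<in> cball a r \<Longrightarrow> g z = exp (L z)"
    using continuous_logarithm_on_cball[OF assms(1,3)] by blast
  show ?thesis
    by (rule ind_exp[OF continuous_on_subset[OF L(1)]]) (use L assms in auto)
qed

lemma ind_inverse:
  assumes g: "continuous_on (sphere a r) g" "\<And>z. z \<in> sphere a r \<Longrightarrow> g z \<noteq> 0" and r: "r > 0"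
  shows "ind (\<lambda>z. inverse (g z)) a r = - ind g a r"
proof -
  have "ind (\<lambda>z. g z * inverse (g z)) a r = ind g a r + ind (\<lambda>z. inverse (g z)) a r"
    by (rule ind_mult) (use assms in \<open>auto intro!: continuous_intros\<close>)
  moreover have "ind (\<lambda>z. g z * inverse (g z)) a r = ind (\<lambda>_. 1) a r"
    by (rule ind_cong) (use assms in auto)
  ultimately show ?thesis using ind_const[OF _ r, of 1 a] by (simp add: add_eq_0_iff)
qed

lemma ind_power:
  assumes g: "continuous_on (sphere a r) g" "\<And>z. z \<in> sphere a r \<Longrightarrow> g z \<noteq> 0" and r: "r > 0"
  shows "ind (\<lambda>z. g z ^ n) a r = of_nat n * ind g a r"
proof (induction n)
  case 0
  then show ?case using ind_const[OF _ r, of 1 a] by simp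
next
  case (Suc n)
  have "ind (\<lambda>z. g z * g z ^ n) a r = ind g a r + ind (\<lambda>z. g z ^ n) a r"
    by (rule ind_mult) (use assms in \<open>auto intro!: continuous_intros\<close>)
  then show ?case using Suc by (simp add: algebra_simps)
qed

lemma ind_power_int:
  assumes g: "continuous_on (sphere a r) g" "\<And>z. z \<in> sphere a r \<Longrightarrow> g z \<noteq> 0" and r: "r > 0"
  shows "ind (\<lambda>z. g z powi n) a r = of_int n * ind g a r"
proof (cases "n \<ge> 0")
  case True
  then show ?thesis using ind_power[OF assms, of "nat n"] by (simp add: power_int_def)
next
  case False
  have "ind (\<lambda>z. inverse (g z) ^ nat (-n)) a r = of_nat (nat (-n)) * ind (\<lambda>z. inverse (g z)) a r"
    by (rule ind_power) (use assms in \<open>auto intro!: continuous_intros\<close>)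
  then show ?thesis using False ind_inverse[OF assms] by (simp add: power_int_def)
qed

lemma ind_integer:
  assumes "continuous_on (sphere a r) g" "r > 0" "\<And>z. z \<in> sphere a r \<Longrightarrow> g z \<noteq> 0"
  obtains n where "ind g a r = of_int n"
  using integer_winding_number[OF ind_path(1,3,2)[OF assms]] unfolding ind_def Ints_def by blast

lemma ind_homotopy:
  assumes H: "continuous_on ({0..1} \<times> sphere a r) (\<lambda>(s, z). H s z)" and r: "r > 0"
    and nz: "\<And>s z. s \<in> {0..1::real} \<Longrightarrow> z \<in> sphere a r \<Longrightarrow> H s z \<noteq> 0"
  shows "ind (H 0) a r = ind (H 1) a r"
proof -
  have c: "continuous_on {0..1} (circlepath a r)" using path_circlepath[of a r] by (simp add: path_def)
  have "homotopic_loops (-{0}) (\<lambda>t. H 0 (circlepath a r t)) (\<lambda>t. H 1 (circlepath a r t))"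
    unfolding homotopic_loops
  proof (intro exI[of _ "\<lambda>(s, t). H s (circlepath a r t)"] conjI ballI)
    have "continuous_on ({0..1::real} \<times> {0..1::real}) (\<lambda>p. (\<lambda>(s, z). H s z) (fst p, circlepath a r (snd p)))"
      by (rule continuous_on_compose2[OF H])
         (use r circlepath_in_sphere[of r a] in \<open>auto intro!: continuous_intros continuous_on_compose2[OF c]\<close>)
    then show "continuous_on ({0..1} \<times> {0..1}) (\<lambda>(s, t). H s (circlepath a r t))"
      by (simp add: case_prod_beta)
    show "(\<lambda>(s, t). H s (circlepath a r t)) \<in> {0..1} \<times> {0..1} \<rightarrow> - {0}"
      using nz r circlepath_in_sphere[of r a] by auto
    fix s :: real assume "s \<in> {0..1}"
    have "circlepath a r 1 = circlepath a r 0"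
      using pathfinish_circlepath[of a r] pathstart_circlepath[of a r] by (simp add: pathfinish_def pathstart_def)
    then show "pathfinish ((\<lambda>(s, t). H s (circlepath a r t)) \<circ> Pair s) = pathstart ((\<lambda>(s, t). H s (circlepath a r t)) \<circ> Pair s)"
      by (simp add: pathfinish_def pathstart_def)
  qed auto
  then show ?thesis unfolding ind_def by (rule winding_number_homotopic_loops)
qed

text \<open>Rouche's argument: the segment from \<open>h z\<close> to \<open>g z\<close> avoids 0,
  so moving along it is a homotopy of loops in the punctured plane.\<close>

lemma ind_close:
  assumes g: "continuous_on (sphere a r) g" and h: "continuous_on (sphere a r) h" and r: "r > 0"
    and lt: "\<And>z. z \<in> sphere a r \<Longrightarrow> norm (g z - h z) < norm (h z)"
  shows "ind g a r = ind h a r"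
proof -
  have nz: "h z + of_real s * (g z - h z) \<noteq> 0" if "s \<in> {0..1}" "z \<in> sphere a r" for s z
  proof
    assume "h z + of_real s * (g z - h z) = 0"
    then have "h z = - (of_real s * (g z - h z))" by (simp add: add_eq_0_iff)
    then have "norm (h z) = norm (- (of_real s * (g z - h z)))" by (rule arg_cong)
    then have "norm (h z) = \<bar>s\<bar> * norm (g z - h z)" by (simp only: norm_minus_cancel norm_mult norm_of_real)
    also have "\<dots> \<le> 1 * norm (g z - h z)" using that by (intro mult_right_mono) auto
    finally show False using lt[OF that(2)] by simp
  qed
  have "ind (\<lambda>z. h z + of_real 0 * (g z - h z)) a r = ind (\<lambda>z. h z + of_real 1 * (g z - h z)) a r"
  proof (rule ind_homotopy[where H = "\<lambda>s z. h z + of_real s * (g z - h z)", OF _ r])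
    have 1: "continuous_on ({0..1::real} \<times> sphere a r) (\<lambda>p. g (snd p))"
      by (rule continuous_on_compose2[OF g]) (auto intro!: continuous_intros)
    have 2: "continuous_on ({0..1::real} \<times> sphere a r) (\<lambda>p. h (snd p))"
      by (rule continuous_on_compose2[OF h]) (auto intro!: continuous_intros)
    show "continuous_on ({0..1} \<times> sphere a r) (\<lambda>(s, z). h z + of_real s * (g z - h z))"
      unfolding case_prod_beta by (intro continuous_intros 1 2)
  qed (use nz in auto)
  then show ?thesis by simp
qed

lemma ind_rescale: "r > 0 \<Longrightarrow> ind g a r' = ind (\<lambda>z. g (a + of_real (r' / r) * (z - a))) a r"
  unfolding ind_def by (rule winding_number_cong) (simp add: circlepath)

lemma ind_annulus:
  assumes g: "continuous_on (cball a r2 - ball a r1) g" and r: "0 < r1" "r1 \<le> r2"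
    and nz: "\<And>z. z \<in> cball a r2 - ball a r1 \<Longrightarrow> g z \<noteq> 0"
  shows "ind g a r1 = ind g a r2"
proof -
  \<comment> \<open>The stretching factor that takes the circle of radius \<open>r1\<close> to a
    radius moving linearly from \<open>r1\<close> to \<open>r2\<close>.\<close>
  define \<rho> where "\<rho> = (\<lambda>s::real. ((1 - s) * r1 + s * r2) / r1)"
  define H where "H = (\<lambda>s z. g (a + of_real (\<rho> s) * (z - a)))"
  have inn: "a + of_real (\<rho> s) * (z - a) \<in> cball a r2 - ball a r1" if "s \<in> {0..1}" "z \<in> sphere a r1" for s z
  proof -
    have "(1 - s) * r1 + s * r2 = r1 + s * (r2 - r1)" by (simp add: algebra_simps)
    moreover have "0 \<le> s * (r2 - r1)" "s * (r2 - r1) \<le> 1 * (r2 - r1)"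
      using that(1) r(2) by (simp_all only: mult_right_mono diff_ge_0_iff_ge atLeastAtMost_iff mult_nonneg_nonneg)
    ultimately have b: "r1 \<le> (1 - s) * r1 + s * r2" "(1 - s) * r1 + s * r2 \<le> r2" by auto
    have "norm (z - a) = r1" using that by (simp add: dist_norm norm_minus_commute)
    then have "norm (of_real (\<rho> s) * (z - a)) = \<bar>\<rho> s\<bar> * r1" by (simp only: norm_mult norm_of_real)
    also have "\<dots> = (1 - s) * r1 + s * r2" using r b by (simp add: \<rho>_def)
    finally have "norm (of_real (\<rho> s) * (z - a)) = (1 - s) * r1 + s * r2" .
    then show ?thesis using b by (simp add: dist_norm)
  qed
  have "ind (H 0) a r1 = ind (H 1) a r1"
  proof (rule ind_homotopy[OF _ r(1)])
    have "continuous_on ({0..1::real} \<times> sphere a r1) (\<lambda>p. g (a + of_real (\<rho> (fst p)) * (snd p - a)))"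
      by (rule continuous_on_compose2[OF g])
         (use inn r in \<open>auto simp: \<rho>_def intro!: continuous_intros\<close>)
    then show "continuous_on ({0..1} \<times> sphere a r1) (\<lambda>(s, z). H s z)" by (simp add: H_def case_prod_beta)
  qed (use inn nz in \<open>auto simp: H_def\<close>)
  moreover have "H 0 = g" "ind (H 1) a r1 = ind g a r2"
    using r ind_rescale[OF r(1), of g a r2] by (auto simp: H_def \<rho>_def)
  ultimately show ?thesis by simp
qed

lemma ind_diff_centre: "r > 0 \<Longrightarrow> e \<in> ball a r \<Longrightarrow> ind (\<lambda>z. z - e) a r = 1"
proof -
  assume r: "r > 0" and e: "e \<in> ball a r"
  have "ind (\<lambda>z. z - e) a r = ind (\<lambda>z. z - a) a r"
    by (rule ind_close) (use r e in \<open>auto simp: dist_norm norm_minus_commute intro!: continuous_intros\<close>)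
  also have "\<dots> = winding_number (circlepath 0 r) 0"
    unfolding ind_def by (rule winding_number_cong) (simp add: circlepath)
  also have "\<dots> = 1" using winding_number_circlepath_centre[OF r] .
  finally show ?thesis .
qed

text \<open>Converse to \<open>ind_nonzero_cball\<close>: a loop of winding number 0 is
  null-homotopic in the punctured plane, and a null-homotopic map of the circle extends over the
  disc. It serves to erase points of local index 0.\<close>

lemma ind_zero_extension:
  assumes g: "continuous_on (sphere a r) g" "\<And>z. z \<in> sphere a r \<Longrightarrow> g z \<noteq> 0" and r: "r > 0"
    and i: "ind g a r = 0"
  obtains G where "continuous_on (cball a r) G" "\<And>z. z \<in> cball a r \<Longrightarrow> G z \<noteq> 0" "\<And>z. z \<in> sphere a r \<Longrightarrow> G z = g z"
proof -
  obtain c where hl: "homotopic_loops (-{0}) (\<lambda>t. g (circlepath a r t)) (\<lambda>t. c)"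
    using winding_number_homotopic_loops_null_eq[OF ind_path(1,2)[OF g(1) r g(2)]] i unfolding ind_def by blast
  have eq: "circlepath a r (Arg2pi z / (2 * pi)) = a + of_real r * z" if "z \<in> sphere 0 1" for z
  proof -
    have "z = of_real (norm z) * exp (\<i> * of_real (Arg2pi z))" using Arg2pi[of z] unfolding is_Arg_def by blast
    then have "z = exp (\<i> * of_real (Arg2pi z))" using that by simp
    then show ?thesis by (simp add: circlepath mult.commute)
  qed
  have "homotopic_with_canon (\<lambda>h. True) (sphere 0 1) (-{0}) (\<lambda>z. g (a + of_real r * z)) (\<lambda>z. c)"
    by (rule homotopic_with_eq[OF homotopic_loops_imp_homotopic_circlemaps[OF hl]]) (auto simp: eq)
  then have "\<exists>c. homotopic_with_canon (\<lambda>h. True) (sphere 0 1) (-{0}) (\<lambda>z. g (a + of_real r * z)) (\<lambda>z. c)" by blast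
  then obtain G where G: "continuous_on (cball 0 1) G" "G ` cball 0 1 \<subseteq> -{0}"
    "\<And>z. z \<in> sphere 0 1 \<Longrightarrow> G z = g (a + of_real r * z)"
    unfolding nullhomotopic_from_sphere_extension by blast
  have im: "(z - a) / of_real r \<in> cball 0 1" if "z \<in> cball a r" for z
    using that r by (simp add: norm_divide dist_norm norm_minus_commute)
  show ?thesis
  proof (rule that[of "\<lambda>z. G ((z - a) / of_real r)"])
    show "continuous_on (cball a r) (\<lambda>z. G ((z - a) / of_real r))"
      by (rule continuous_on_compose2[OF G(1)]) (use im r in \<open>auto intro!: continuous_intros\<close>)
    show "G ((z - a) / of_real r) \<noteq> 0" if "z \<in> cball a r" for z using im[OF that] G(2) by blast
    show "G ((z - a) / of_real r) = g z" if "z \<in> sphere a r" for z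
      using that r G(3)[of "(z - a) / of_real r"] by (simp add: norm_divide dist_norm norm_minus_commute)
  qed
qed

section \<open>Local indices and an argument principle for continuous functions\<close>

text \<open>Nothing is asked of \<open>g\<close> at \<open>e\<close> itself. The same index on all
  small circles is part of the notion, so the radius can be shrunk freely and \<open>k\<close> is
  unique.\<close>

definition lind :: "(complex \<Rightarrow> complex) \<Rightarrow> complex \<Rightarrow> int \<Rightarrow> bool" where
  "lind g e k \<longleftrightarrow> (\<exists>\<rho>>0. continuous_on (cball e \<rho> - {e}) g \<and> (\<forall>z\<in>cball e \<rho> - {e}. g z \<noteq> 0) \<and>
     (\<forall>r. 0 < r \<and> r \<le> \<rho> \<longrightarrow> ind g e r = of_int k))"

lemma lindI:
  assumes "\<rho> > 0" "continuous_on (cball e \<rho> - {e}) g" "\<And>z. z \<in> cball e \<rho> - {e} \<Longrightarrow> g z \<noteq> 0" "ind g e \<rho> = of_int k"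
  shows "lind g e k"
  unfolding lind_def
proof (intro exI[of _ \<rho>] conjI allI impI ballI)
  fix r assume r: "0 < r \<and> r \<le> \<rho>"
  have "ind g e r = ind g e \<rho>"
  proof (rule ind_annulus[OF continuous_on_subset[OF assms(2)]])
    show "g z \<noteq> 0" if "z \<in> cball e \<rho> - ball e r" for z
      using assms(3)[of z] that r by (cases "z = e") auto
  qed (use r in auto)
  then show "ind g e r = of_int k" using assms(4) by simp
qed (use assms in auto)

lemma lind_ex:
  assumes "\<rho> > 0" "continuous_on (cball e \<rho> - {e}) g" "\<And>z. z \<in> cball e \<rho> - {e} \<Longrightarrow> g z \<noteq> 0"
  obtains k where "lind g e k" "ind g e \<rho> = of_int k"
proof -
  obtain k where "ind g e \<rho> = of_int k"
  proof (rule ind_integer[of e \<rho> g])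
    show "continuous_on (sphere e \<rho>) g" by (rule continuous_on_subset[OF assms(2)]) (use assms(1) in auto)
  qed (use assms in auto)
  then show ?thesis using that lindI[OF assms] by blast
qed

lemma lind_small:
  assumes "lind g e k" "\<delta> > 0"
  obtains \<rho> where "\<rho> > 0" "\<rho> < \<delta>" "continuous_on (cball e \<rho> - {e}) g" "\<And>z. z \<in> cball e \<rho> - {e} \<Longrightarrow> g z \<noteq> 0"
    "ind g e \<rho> = of_int k"
proof -
  obtain \<rho> where r: "\<rho> > 0" "continuous_on (cball e \<rho> - {e}) g" "\<And>z. z \<in> cball e \<rho> - {e} \<Longrightarrow> g z \<noteq> 0"
    "\<And>r. 0 < r \<Longrightarrow> r \<le> \<rho> \<Longrightarrow> ind g e r = of_int k" using assms(1) unfolding lind_def by blast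
  define m where "m = min \<rho> (\<delta>/2)"
  have m: "m > 0" "m \<le> \<rho>" "m < \<delta>" using r(1) assms(2) by (auto simp: m_def)
  show ?thesis
    by (rule that[OF m(1,3) continuous_on_subset[OF r(2)]]) (use m r(3,4) in auto)
qed

lemma lind_unique:
  assumes "lind g e k" "lind g e k'"
  shows "k = k'"
proof -
  obtain \<rho> where r: "\<rho> > 0" "\<And>r. 0 < r \<Longrightarrow> r \<le> \<rho> \<Longrightarrow> ind g e r = of_int k" using assms(1) unfolding lind_def by blast
  obtain \<rho>' where r': "\<rho>' > 0" "\<rho>' < \<rho>" "ind g e \<rho>' = of_int k'" by (rule lind_small[OF assms(2) r(1)])
  show ?thesis using r(2)[of \<rho>'] r' by simp
qed

lemma lind_cong:
  assumes "lind g e k" "\<delta> > 0" "\<And>z. z \<in> ball e \<delta> - {e} \<Longrightarrow> g z = h z"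
  shows "lind h e k"
proof -
  obtain \<rho> where r: "\<rho> > 0" "\<rho> < \<delta>" "continuous_on (cball e \<rho> - {e}) g" "\<And>z. z \<in> cball e \<rho> - {e} \<Longrightarrow> g z \<noteq> 0"
    "ind g e \<rho> = of_int k" by (rule lind_small[OF assms(1,2)]) (rule that; assumption)
  have eq: "g z = h z" if "z \<in> cball e \<rho> - {e}" for z using that r(2) assms(3)[of z] by auto
  show ?thesis
  proof (rule lindI[OF r(1)])
    show "continuous_on (cball e \<rho> - {e}) h" using r(3) by (rule continuous_on_eq) (simp add: eq)
    show "h z \<noteq> 0" if "z \<in> cball e \<rho> - {e}" for z using r(4)[OF that] eq[OF that] by simp
    have "ind g e \<rho> = ind h e \<rho>" by (rule ind_cong) (use eq r(1) in auto)
    then show "ind h e \<rho> = of_int k" using r(5) by simp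
  qed
qed

lemma lind_mult_nonzero:
  assumes "lind g e k" "\<delta> > 0" "continuous_on (cball e \<delta>) h" "\<And>z. z \<in> cball e \<delta> \<Longrightarrow> h z \<noteq> 0"
  shows "lind (\<lambda>z. g z * h z) e k"
proof -
  obtain \<rho> where r: "\<rho> > 0" "\<rho> < \<delta>" "continuous_on (cball e \<rho> - {e}) g" "\<And>z. z \<in> cball e \<rho> - {e} \<Longrightarrow> g z \<noteq> 0"
    "ind g e \<rho> = of_int k" by (rule lind_small[OF assms(1,2)]) (rule that; assumption)
  have hc: "continuous_on (cball e \<rho>) h" by (rule continuous_on_subset[OF assms(3)]) (use r in auto)
  show ?thesis
  proof (rule lindI[OF r(1)])
    show "continuous_on (cball e \<rho> - {e}) (\<lambda>z. g z * h z)"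
      by (intro continuous_on_mult r(3) continuous_on_subset[OF hc]) auto
    show "g z * h z \<noteq> 0" if "z \<in> cball e \<rho> - {e}" for z using r(2) r(4)[OF that] assms(4)[of z] that by auto
    have "ind (\<lambda>z. g z * h z) e \<rho> = ind g e \<rho> + ind h e \<rho>"
      by (rule ind_mult)
         (use r assms(4) in \<open>auto intro: continuous_on_subset[OF r(3)] continuous_on_subset[OF hc]\<close>)
    moreover have "ind h e \<rho> = 0" by (rule ind_nonzero_cball[OF hc r(1)]) (use r assms(4) in auto)
    ultimately show "ind (\<lambda>z. g z * h z) e \<rho> = of_int k" using r(5) by simp
  qed
qed

lemma lind_power:
  assumes "lind g e k"
  shows "lind (\<lambda>z. g z ^ m) e (int m * k)"
proof -
  obtain \<rho> where r: "\<rho> > 0" "\<rho> < 1" "continuous_on (cball e \<rho> - {e}) g" "\<And>z. z \<in> cball e \<rho> - {e} \<Longrightarrow> g z \<noteq> 0"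
    "ind g e \<rho> = of_int k" by (rule lind_small[OF assms zero_less_one]) (rule that; assumption)
  show ?thesis
  proof (rule lindI[OF r(1)])
    show "continuous_on (cball e \<rho> - {e}) (\<lambda>z. g z ^ m)" by (intro continuous_intros r)
    have "ind (\<lambda>z. g z ^ m) e \<rho> = of_nat m * ind g e \<rho>"
      by (rule ind_power) (use r in \<open>auto intro: continuous_on_subset[OF r(3)]\<close>)
    then show "ind (\<lambda>z. g z ^ m) e \<rho> = of_int (int m * k)" using r(5) by simp
  qed (use r(4) in auto)
qed

text \<open>Induction on the exceptional points. Multiplying by a power of \<open>z - e\<close>
  brings the local index at \<open>e\<close> to 0, after which the function can be redefined near
  \<open>e\<close> without zeros; on the large circle only the index of the power has been
  added.\<close>

lemma ind_additive:
  assumes "finite E" "E \<subseteq> ball a r" "continuous_on (cball a r - E) g" "\<And>z. z \<in> cball a r - E \<Longrightarrow> g z \<noteq> 0"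
    "\<And>e. e \<in> E \<Longrightarrow> lind g e (k e)" "r > 0"
  shows "ind g a r = of_int (\<Sum>e\<in>E. k e)"
  using assms
proof (induction E arbitrary: g rule: finite_induct)
  case empty
  then show ?case using ind_nonzero_cball[of a r g] by simp
next
  case (insert e E)
  have "open (ball a r - E)" using insert(1) by (simp add: open_Diff finite_imp_closed)
  moreover have "e \<in> ball a r - E" using insert by auto
  ultimately obtain \<delta> where \<delta>: "\<delta> > 0" "cball e \<delta> \<subseteq> ball a r - E"
    using open_contains_cball by blast
  obtain \<rho> where r: "\<rho> > 0" "\<rho> < \<delta>" "continuous_on (cball e \<rho> - {e}) g" "\<And>z. z \<in> cball e \<rho> - {e} \<Longrightarrow> g z \<noteq> 0"
    "ind g e \<rho> = of_int (k e)" by (rule lind_small[OF insert(7)[OF insertI1] \<delta>(1)]) (rule that; assumption)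
  have "cball e \<rho> \<subseteq> cball e \<delta>" using r(2) by auto
  then have sub: "cball e \<rho> \<subseteq> ball a r - E" using \<delta>(2) by blast
  \<comment> \<open>An integer power, because local indices may be negative: charts of the curve may
    reverse orientation.\<close>
  define p where "p = (\<lambda>z. (z - e) powi (- k e))"
  define G where "G = (\<lambda>z. g z * p z)"
  have pc: "continuous_on (A - {e}) p" for A
    unfolding p_def power_int_def by (cases "- k e \<ge> 0") (auto intro!: continuous_intros)
  have pnz: "p z \<noteq> 0" if "z \<noteq> e" for z using that by (simp add: p_def)
  have p_ind: "ind p b t = of_int (- k e)" if "t > 0" "e \<in> ball b t" for b t
  proof -
    have "ind p b t = of_int (- k e) * ind (\<lambda>z. z - e) b t"
      unfolding p_def by (rule ind_power_int) (use that in \<open>auto intro!: continuous_intros\<close>)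
    then show ?thesis using ind_diff_centre[OF that] by simp
  qed
  have Gc: "continuous_on (cball a r - insert e E) G" unfolding G_def
    by (intro continuous_on_mult insert(5) continuous_on_subset[OF pc[of UNIV]]) auto
  have Gnz: "G z \<noteq> 0" if "z \<in> cball a r - insert e E" for z
    using insert(6)[OF that] pnz[of z] that by (auto simp: G_def)
  have "ind G e \<rho> = ind g e \<rho> + ind p e \<rho>" unfolding G_def
    by (rule ind_mult) (use r pnz in \<open>auto intro: continuous_on_subset[OF r(3)] continuous_on_subset[OF pc[of UNIV]]\<close>)
  then have G0: "ind G e \<rho> = 0" using r(1,5) p_ind[of \<rho> e] by simp
  have spe: "sphere e \<rho> \<subseteq> cball a r - insert e E" using sub r(1) by auto
  obtain F where F: "continuous_on (cball e \<rho>) F" "\<And>z. z \<in> cball e \<rho> \<Longrightarrow> F z \<noteq> 0" "\<And>z. z \<in> sphere e \<rho> \<Longrightarrow> F z = G z"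
  proof (rule ind_zero_extension[OF continuous_on_subset[OF Gc spe] _ r(1) G0])
    show "G z \<noteq> 0" if "z \<in> sphere e \<rho>" for z using Gnz[of z] spe that by blast
  qed (rule that; assumption)
  \<comment> \<open>The zero-free extension inside the small disc and the corrected function
    outside; they agree on the circle, so the glued function is continuous and \<open>e\<close> is
    no longer exceptional.\<close>
  define g' where "g' = (\<lambda>z. if z \<in> cball e \<rho> then F z else G z)"
  have g'c: "continuous_on (cball a r - E) g'"
  proof -
    define A where "A = (cball a r - E) - ball e \<rho>"
    have un: "cball e \<rho> \<union> A = cball a r - E" using sub by (auto simp: A_def)
    have "continuous_on (cball e \<rho> \<union> A) (\<lambda>z. if z \<in> cball e \<rho> then F z else G z)"
    proof (rule continuous_on_cases_local)
      show "closedin (top_of_set (cball e \<rho> \<union> A)) (cball e \<rho>)" by (simp add: closed_subset)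
      have "A = (cball e \<rho> \<union> A) \<inter> - ball e \<rho>"
        unfolding un by (auto simp: A_def)
      then show "closedin (top_of_set (cball e \<rho> \<union> A)) A"
        by (metis closedin_closed_Int open_ball closed_Compl)
      show "continuous_on A G" by (rule continuous_on_subset[OF Gc]) (use r(1) in \<open>auto simp: A_def\<close>)
      show "F x = G x" if "x \<in> cball e \<rho> \<and> x \<notin> cball e \<rho> \<or> x \<in> A \<and> x \<in> cball e \<rho>" for x
        using that F(3)[of x] by (auto simp: A_def)
    qed (rule F(1))
    then show ?thesis unfolding un g'_def .
  qed
  have "ind g' a r = of_int (\<Sum>e\<in>E. k e)"
  proof (rule insert(3))
    show "E \<subseteq> ball a r" using insert(4) by blast
    show "g' z \<noteq> 0" if "z \<in> cball a r - E" for z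
      using F(2)[of z] Gnz[of z] that r(1) by (cases "z = e") (auto simp: g'_def)
    show "lind g' e' (k e')" if e': "e' \<in> E" for e'
    proof -
      have "open (- cball e \<rho>)" by (simp add: open_Compl)
      moreover have "e' \<in> - cball e \<rho>" using sub e' by auto
      ultimately obtain d where d: "d > 0" "cball e' d \<subseteq> - cball e \<rho>" using open_contains_cball by blast
      have "lind G e' (k e')" unfolding G_def
      proof (rule lind_mult_nonzero[OF insert(7) d(1)])
        have "e \<notin> cball e' d" using d(2) r(1) by auto
        then show "p z \<noteq> 0" if "z \<in> cball e' d" for z using pnz[of z] that by blast
        show "continuous_on (cball e' d) p"
          by (rule continuous_on_subset[OF pc[of UNIV]]) (use \<open>e \<notin> cball e' d\<close> in auto)
      qed (use e' in auto)
      moreover have "G z = g' z" if "z \<in> ball e' d - {e'}" for z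
      proof -
        have "z \<in> cball e' d" using that by simp
        then have "z \<notin> cball e \<rho>" using d(2) by blast
        then show ?thesis by (simp add: g'_def)
      qed
      ultimately show ?thesis by (rule lind_cong[OF _ d(1)])
    qed
  qed (use g'c insert(8) in auto)
  moreover have "ind g' a r = ind G a r"
  proof (rule ind_cong)
    show "g' z = G z" if "z \<in> sphere a r" for z using that sub by (auto simp: g'_def)
  qed (rule insert(8))
  moreover have "ind G a r = ind g a r + ind p a r"
  proof -
    have s: "sphere a r \<subseteq> cball a r - insert e E" using insert(4) by auto
    show ?thesis unfolding G_def
    proof (rule ind_mult[OF continuous_on_subset[OF insert(5) s] _ continuous_on_subset[OF pc[of UNIV]]])
      fix z assume z: "z \<in> sphere a r"
      show "g z \<noteq> 0" using z s insert(6)[of z] by blast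
      show "p z \<noteq> 0" using z s by (intro pnz) blast
    qed (use s insert(8) in auto)
  qed
  moreover have "ind p a r = of_int (- k e)" using p_ind[of r a] insert(4,8) by auto
  ultimately have "ind g a r = of_int (\<Sum>e\<in>E. k e) + of_int (k e)"
    by (simp add: algebra_simps)
  then show ?case using insert(1,2) by simp
qed

section \<open>Uniformization of the punctured disc\<close>

lemma continuous_on_cball_isCont:
  fixes f :: "complex \<Rightarrow> 'b::topological_space"
  shows "continuous_on (cball a d) f \<Longrightarrow> d > 0 \<Longrightarrow> isCont f a"
  using continuous_on_interior[of "cball a d" f a] by simp

text \<open>A local homeomorphism of the plane winds around its zero. Otherwise its restriction to
  the circle would extend over the disc without zeros; transported by the inverse of
  \<open>F\<close> and normalized, this would extend the map x / |x| from the image of the circle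
  over the bounded component of the complement containing 0, contrary to Borsuk's theorem.\<close>

lemma lind_inj:
  assumes \<delta>: "\<delta> > 0" and F: "continuous_on (cball z0 \<delta>) F" "inj_on F (cball z0 \<delta>)" "F z0 = 0"
  obtains k where "lind F z0 k" "k \<noteq> 0"
proof -
  have nz: "F z \<noteq> 0" if "z \<in> cball z0 \<delta> - {z0}" for z
    using inj_onD[OF F(2), of z z0] F(3) that \<delta> by auto
  obtain k where k: "lind F z0 k" "ind F z0 \<delta> = of_int k"
    by (rule lind_ex[OF \<delta> continuous_on_subset[OF F(1)] nz]) auto
  have "k \<noteq> 0"
  proof
    assume "k = 0"
    then have i0: "ind F z0 \<delta> = 0" using k by simp
    have sub: "sphere z0 \<delta> \<subseteq> cball z0 \<delta>" by auto
    obtain G where G: "continuous_on (cball z0 \<delta>) G" "\<And>z. z \<in> cball z0 \<delta> \<Longrightarrow> G z \<noteq> 0"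
      "\<And>z. z \<in> sphere z0 \<delta> \<Longrightarrow> G z = F z"
    proof (rule ind_zero_extension[OF continuous_on_subset[OF F(1) sub] _ \<delta> i0])
      show "F z \<noteq> 0" if "z \<in> sphere z0 \<delta>" for z using nz[of z] that \<delta> by auto
    qed (rule that; assumption)
    define S where "S = F ` sphere z0 \<delta>"
    define C where "C = F ` ball z0 \<delta>"
    have SC: "S \<union> C = F ` cball z0 \<delta>" unfolding S_def C_def by (auto simp: image_Un[symmetric])
    have comS: "compact S" unfolding S_def
      by (rule compact_continuous_image[OF continuous_on_subset[OF F(1) sub]]) simp
    have com: "compact (F ` cball z0 \<delta>)" by (rule compact_continuous_image[OF F(1)]) simp
    have disj: "C \<inter> S = {}"
      unfolding S_def C_def using inj_onD[OF F(2)] by fastforce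
    have opC: "open C" unfolding C_def
      by (rule invariance_of_domain[OF continuous_on_subset[OF F(1)] _ inj_on_subset[OF F(2)]]) auto
    have conC: "connected C" unfolding C_def
      by (rule connected_continuous_image[OF continuous_on_subset[OF F(1)]]) auto
    have 0: "0 \<in> C" unfolding C_def using F(3) \<delta> by (metis centre_in_ball imageI)
    have boc: "bounded C" unfolding C_def
      by (rule bounded_subset[OF compact_imp_bounded[OF com]]) auto
    \<comment> \<open>\<open>C\<close> is open by invariance of domain, and relatively closed off
      the curve \<open>S\<close> because \<open>S \<union> C\<close> is compact; hence it is a whole
      component of the complement.\<close>
    have comp: "C \<in> components (- S)"
      unfolding in_components_maximal
    proof (intro conjI allI impI)
      show "C \<noteq> {}" using 0 by blast
      show "C \<subseteq> - S" using disj by blast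
      fix D assume D: "D \<noteq> {} \<and> C \<subseteq> D \<and> D \<subseteq> - S \<and> connected D"
      have "openin (top_of_set D) (D \<inter> C)" by (rule openin_open_Int[OF opC])
      moreover have "D \<inter> C = D \<inter> (F ` cball z0 \<delta>)" using D SC by blast
      then have "closedin (top_of_set D) (D \<inter> C)"
        using closedin_closed_Int[OF compact_imp_closed[OF com]] by metis
      ultimately have "D \<inter> C = {} \<or> D \<inter> C = D" using D connected_clopen[of D] by blast
      then show "D = C" using D 0 by blast
    qed (rule conC)
    obtain Fi where Fi: "homeomorphism (cball z0 \<delta>) (F ` cball z0 \<delta>) F Fi"
      using homeomorphism_compact[OF _ F(1) refl F(2)] by auto
    define g where "g = (\<lambda>x. inverse (norm (G (Fi x))) *\<^sub>R G (Fi x))"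
    have Fic: "continuous_on (S \<union> C) Fi" "Fi ` (S \<union> C) \<subseteq> cball z0 \<delta>"
      using Fi unfolding SC homeomorphism_def by auto
    have GF: "continuous_on (S \<union> C) (\<lambda>x. G (Fi x))"
      by (rule continuous_on_compose2[OF G(1) Fic(1) Fic(2)])
    have Gnz: "G (Fi x) \<noteq> 0" if "x \<in> S \<union> C" for x using G(2) Fic(2) that by blast
    have "continuous_on (S \<union> C) g" unfolding g_def
      by (intro continuous_intros GF) (use Gnz in auto)
    moreover have "g \<in> (S \<union> C) \<rightarrow> sphere 0 1" using Gnz by (auto simp: g_def)
    moreover have "g x = inverse (norm (x - 0)) *\<^sub>R (x - 0)" if "x \<in> S" for x
    proof -
      obtain z where z: "z \<in> sphere z0 \<delta>" "x = F z" using \<open>x \<in> S\<close> unfolding S_def by blast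
      have "Fi x = z" using Fi z by (auto simp: homeomorphism_def)
      then show ?thesis using G(3)[OF z(1)] z by (simp add: g_def)
    qed
    ultimately show False using non_extensible_Borsuk_map[OF comS comp boc 0] by blast
  qed
  then show ?thesis using that k by blast
qed

text \<open>Near 0 the function \<open>h\<close> is a power w^m times a factor without zeros. The
  power multiplies the index of \<open>F\<close> by \<open>m\<close>, the other factor contributes
  nothing.\<close>

lemma lind_compose:
  assumes F: "lind F z0 k" "\<delta> > 0" "continuous_on (cball z0 \<delta>) F" "F z0 = 0"
    and h: "h holomorphic_on ball 0 \<eta>" "\<eta> > 0" "h 0 = 0" "\<not> h constant_on ball 0 \<eta>"
  obtains m where "m > 0" "lind (\<lambda>z. h (F z)) z0 (int m * k)"
proof -
  obtain g r n where g: "0 < n" "0 < r" "ball (0::complex) r \<subseteq> ball 0 \<eta>" "g holomorphic_on ball 0 r"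
     "\<And>w. w \<in> ball 0 r \<Longrightarrow> h w = (w - 0) ^ n * g w" "\<And>w. w \<in> ball 0 r \<Longrightarrow> g w \<noteq> 0"
  proof (rule holomorphic_factor_zero_nonconstant[OF h(1) open_ball connected_ball _ h(3,4)])
    show "0 \<in> ball 0 \<eta>" using h(2) by simp
  qed (rule that; assumption)
  have "isCont F z0"
    using F(2,3) continuous_on_cball_isCont by blast
  then have "\<exists>d>0. \<forall>z. dist z z0 < d \<longrightarrow> dist (F z) (F z0) < r"
    using g(2) unfolding continuous_at_eps_delta by blast
  then obtain d where d: "d > 0" "\<And>z. dist z z0 < d \<Longrightarrow> dist (F z) 0 < r" using F(4) by auto
  define e where "e = min \<delta> (d/2)"
  have e: "e > 0" "e \<le> \<delta>" "e < d" using F(2) d by (auto simp: e_def)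
  have inb: "F z \<in> ball 0 r" if "z \<in> cball z0 e" for z
    using d(2)[of z] that e by (auto simp: dist_commute)
  have "lind (\<lambda>z. F z ^ n * g (F z)) z0 (int n * k)"
  proof (rule lind_mult_nonzero[OF lind_power[OF F(1)] e(1)])
    show "continuous_on (cball z0 e) (\<lambda>z. g (F z))"
      by (rule continuous_on_compose2[OF holomorphic_on_imp_continuous_on[OF g(4)] continuous_on_subset[OF F(3)]])
         (use e inb in auto)
  qed (use g(6) inb in auto)
  then have "lind (\<lambda>z. h (F z)) z0 (int n * k)"
    by (rule lind_cong[OF _ e(1)]) (use g(5) inb in auto)
  then show ?thesis using that g(1) by blast
qed

text \<open>\<open>F z0\<close> is a continuous local coordinate at \<open>z0\<close> of a Riemann surface structure on the punctured
  disc, of constant local orientation \<open>\<epsilon>\<close>; \<open>chol\<close> says that a function is holomorphic for it.\<close>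

definition chol :: "real \<Rightarrow> (complex \<Rightarrow> complex \<Rightarrow> complex) \<Rightarrow> (complex \<Rightarrow> complex) \<Rightarrow> bool" where
  "chol R F v \<longleftrightarrow> (\<forall>z0\<in>ball 0 R - {0}. \<exists>\<eta>>0. \<exists>h. h holomorphic_on ball 0 \<eta> \<and> (\<forall>\<^sub>F z in nhds z0. v z = h (F z0 z)))"

text \<open>Every point has its own chart centred there, and holomorphy is always tested in the
  chart of the point at hand. The essential assumption is one \<epsilon> for all points:
  multiplicities in a fibre then all count with the same sign, so that an index bounds a number of
  solutions.\<close>

locale curve_charts =
  fixes R :: real and F :: "complex \<Rightarrow> complex \<Rightarrow> complex" and \<epsilon> :: int
  assumes R: "R > 0" and eps: "\<epsilon> \<noteq> 0"
    and F0: "z0 \<in> ball 0 R - {0} \<Longrightarrow> F z0 z0 = 0"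
    and Flind: "z0 \<in> ball 0 R - {0} \<Longrightarrow> lind (F z0) z0 \<epsilon>"
    and Floc: "z0 \<in> ball 0 R - {0} \<Longrightarrow> \<exists>\<delta>>0. continuous_on (cball z0 \<delta>) (F z0) \<and> inj_on (F z0) (cball z0 \<delta>)"
begin

lemma restrict: "0 < r \<Longrightarrow> r \<le> R \<Longrightarrow> curve_charts r F \<epsilon>"
  by unfold_locales (use eps F0 Flind Floc in auto)

text \<open>One radius on which the chart is injective and continuous and the local expression of
  \<open>v\<close> is valid.\<close>

lemma chart_ball:
  assumes v: "chol R F v" and z0: "z0 \<in> ball 0 R - {0}"
  obtains \<eta> h \<delta> where "\<eta> > 0" "h holomorphic_on ball 0 \<eta>" "\<delta> > 0" "cball z0 \<delta> \<subseteq> ball 0 R - {0}"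
    "continuous_on (cball z0 \<delta>) (F z0)" "inj_on (F z0) (cball z0 \<delta>)"
    "\<And>z. z \<in> cball z0 \<delta> \<Longrightarrow> F z0 z \<in> ball 0 \<eta>" "\<And>z. z \<in> cball z0 \<delta> \<Longrightarrow> v z = h (F z0 z)"
proof -
  obtain \<eta> h where h: "\<eta> > 0" "h holomorphic_on ball 0 \<eta>" "\<forall>\<^sub>F z in nhds z0. v z = h (F z0 z)"
    using v z0 unfolding chol_def by blast
  obtain d0 where d0: "d0 > 0" "continuous_on (cball z0 d0) (F z0)" "inj_on (F z0) (cball z0 d0)"
    using Floc[OF z0] by blast
  obtain d1 where d1: "d1 > 0" "\<And>z. dist z z0 < d1 \<Longrightarrow> v z = h (F z0 z)"
    using h(3) unfolding eventually_nhds_metric by blast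
  have "isCont (F z0) z0"
    using d0(1,2) continuous_on_cball_isCont by blast
  then have "\<exists>d>0. \<forall>z. dist z z0 < d \<longrightarrow> dist (F z0 z) (F z0 z0) < \<eta>"
    using h(1) unfolding continuous_at_eps_delta by blast
  then obtain d2 where d2: "d2 > 0" "\<And>z. dist z z0 < d2 \<Longrightarrow> dist (F z0 z) 0 < \<eta>" using F0[OF z0] by auto
  have "open (ball 0 R - {0::complex})" by (simp add: open_Diff)
  then obtain d3 where d3: "d3 > 0" "cball z0 d3 \<subseteq> ball 0 R - {0}" using z0 open_contains_cball by blast
  define \<delta> where "\<delta> = min (min d0 (d1/2)) (min (d2/2) d3)"
  have \<delta>: "\<delta> > 0" "\<delta> \<le> d0" "\<delta> < d1" "\<delta> < d2" "\<delta> \<le> d3" using d0 d1 d2 d3 by (auto simp: \<delta>_def)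
  show ?thesis
  proof (rule that[OF h(1,2) \<delta>(1)])
    show "cball z0 \<delta> \<subseteq> ball 0 R - {0}" using subset_cball[OF \<delta>(5), of z0] d3(2) by blast
    show "continuous_on (cball z0 \<delta>) (F z0)" by (rule continuous_on_subset[OF d0(2)]) (use \<delta> in auto)
    show "inj_on (F z0) (cball z0 \<delta>)" by (rule inj_on_subset[OF d0(3)]) (use \<delta> in auto)
    fix z assume "z \<in> cball z0 \<delta>"
    then have "dist z z0 < d1" "dist z z0 < d2" using \<delta> by (auto simp: dist_commute)
    then show "F z0 z \<in> ball 0 \<eta>" "v z = h (F z0 z)" using d1(2) d2(2) by auto
  qed
qed

lemma chol_continuous:
  assumes v: "chol R F v"
  shows "continuous_on (ball 0 R - {0}) v"
proof -
  have "isCont v z0" if z0: "z0 \<in> ball 0 R - {0}" for z0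
  proof -
    obtain \<eta> h \<delta> where c: "\<eta> > 0" "h holomorphic_on ball 0 \<eta>" "\<delta> > 0" "cball z0 \<delta> \<subseteq> ball 0 R - {0}"
      "continuous_on (cball z0 \<delta>) (F z0)" "inj_on (F z0) (cball z0 \<delta>)"
      "\<And>z. z \<in> cball z0 \<delta> \<Longrightarrow> F z0 z \<in> ball 0 \<eta>" "\<And>z. z \<in> cball z0 \<delta> \<Longrightarrow> v z = h (F z0 z)"
      by (rule chart_ball[OF v z0]) (rule that; assumption)
    have "continuous_on (cball z0 \<delta>) (\<lambda>z. h (F z0 z))"
      by (rule continuous_on_compose2[OF holomorphic_on_imp_continuous_on[OF c(2)] c(5)]) (use c(7) in auto)
    then have "continuous_on (cball z0 \<delta>) v" by (rule continuous_on_eq) (simp add: c(8))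
    then show ?thesis using c(3) continuous_on_cball_isCont by blast
  qed
  then show ?thesis by (simp add: continuous_at_imp_continuous_on)
qed

text \<open>The identity theorem, chart by chart: the chart image of a small disc is open by
  invariance of domain, so \<open>v\<close> constant on that disc makes the holomorphic
  \<open>h\<close> constant on its whole ball. The punctured disc is connected.\<close>

lemma locally_const_propagates:
  assumes v: "chol R F v" and z: "z1 \<in> ball 0 R - {0}" "z2 \<in> ball 0 R - {0}"
    and c: "\<forall>\<^sub>F x in nhds z1. v x = c"
  shows "\<forall>\<^sub>F x in nhds z2. v x = c"
proof (rule connected_induction_simple[OF _ z, of "\<lambda>z. \<forall>\<^sub>F x in nhds z. v x = c"])
  show "connected (ball 0 R - {0::complex})"
    by (intro connected_punctured_ball) auto
next
  fix z0 :: complex assume z0: "z0 \<in> ball 0 R - {0}"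
  obtain \<eta> h \<delta> where ch: "\<eta> > 0" "h holomorphic_on ball 0 \<eta>" "\<delta> > 0" "cball z0 \<delta> \<subseteq> ball 0 R - {0}"
    "continuous_on (cball z0 \<delta>) (F z0)" "inj_on (F z0) (cball z0 \<delta>)"
    "\<And>z. z \<in> cball z0 \<delta> \<Longrightarrow> F z0 z \<in> ball 0 \<eta>" "\<And>z. z \<in> cball z0 \<delta> \<Longrightarrow> v z = h (F z0 z)"
    by (rule chart_ball[OF v z0]) (rule that; assumption)
  have key: "\<forall>\<^sub>F w in nhds y. v w = c"
    if x: "x \<in> ball z0 \<delta>" and y: "y \<in> ball z0 \<delta>" and Px: "\<forall>\<^sub>F w in nhds x. v w = c" for x y
  proof -
    have "\<forall>\<^sub>F w in nhds x. v w = c \<and> w \<in> ball z0 \<delta>"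
      using Px x by (intro eventually_conj eventually_nhds_in_open) auto
    then obtain e where e: "e > 0" "\<And>w. w \<in> ball x e \<Longrightarrow> v w = c \<and> w \<in> ball z0 \<delta>"
      unfolding eventually_nhds_metric by (auto simp: dist_commute)
    have sub: "ball x e \<subseteq> cball z0 \<delta>"
    proof
      fix w assume "w \<in> ball x e"
      from e(2)[OF this] show "w \<in> cball z0 \<delta>" by simp
    qed
    have "open (F z0 ` ball x e)"
      by (rule invariance_of_domain[OF continuous_on_subset[OF ch(5) sub] _ inj_on_subset[OF ch(6) sub]]) simp
    then have hc: "h T = c" if "T \<in> ball 0 \<eta>" for T
    proof (rule analytic_continuation_open[where f = h and g = "\<lambda>_. c" and s' = "ball 0 \<eta>"])
      show "F z0 ` ball x e \<noteq> {}" using e(1) by auto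
      show "F z0 ` ball x e \<subseteq> ball 0 \<eta>" using ch(7) sub by blast
      show "h z = c" if "z \<in> F z0 ` ball x e" for z
        using that e(2) ch(8) sub by (metis imageE subsetD)
    qed (use ch that in auto)
    have "\<forall>\<^sub>F w in nhds y. w \<in> ball z0 \<delta>" using y by (intro eventually_nhds_in_open) auto
    then show ?thesis by eventually_elim (use hc ch(7,8) in auto)
  qed
  show "\<exists>T. openin (top_of_set (ball 0 R - {0})) T \<and> z0 \<in> T \<and>
      (\<forall>x\<in>T. \<forall>y\<in>T. (\<forall>\<^sub>F x in nhds x. v x = c) \<longrightarrow> (\<forall>\<^sub>F x in nhds y. v x = c))"
  proof (intro exI[of _ "(ball 0 R - {0}) \<inter> ball z0 \<delta>"] conjI ballI impI)
    show "openin (top_of_set (ball 0 R - {0})) ((ball 0 R - {0}) \<inter> ball z0 \<delta>)"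
      by (rule openin_open_Int[OF open_ball])
    show "z0 \<in> (ball 0 R - {0}) \<inter> ball z0 \<delta>" using z0 ch(3) by simp
  qed (use key in blast)
qed (use c in auto)

text \<open>Read in the chart at \<open>z0\<close>, \<open>v - c\<close> is a nonconstant
  holomorphic function vanishing at 0. Its order is \<open>m\<close>, and the chart contributes
  \<epsilon>.\<close>

lemma fibre_lind:
  assumes v: "chol R F v" and nc: "\<And>c. \<not> (\<forall>\<^sub>F x in nhds z0. v x = c)" and z0: "z0 \<in> ball 0 R - {0}" "v z0 = c"
  obtains m where "m > 0" "lind (\<lambda>z. v z - c) z0 (int m * \<epsilon>)"
proof -
  obtain \<eta> h \<delta> where ch: "\<eta> > 0" "h holomorphic_on ball 0 \<eta>" "\<delta> > 0" "cball z0 \<delta> \<subseteq> ball 0 R - {0}"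
    "continuous_on (cball z0 \<delta>) (F z0)" "inj_on (F z0) (cball z0 \<delta>)"
    "\<And>z. z \<in> cball z0 \<delta> \<Longrightarrow> F z0 z \<in> ball 0 \<eta>" "\<And>z. z \<in> cball z0 \<delta> \<Longrightarrow> v z = h (F z0 z)"
    by (rule chart_ball[OF v z0(1)]) (rule that; assumption)
  have "\<not> (\<lambda>T. h T - c) constant_on ball 0 \<eta>"
  proof
    assume "(\<lambda>T. h T - c) constant_on ball 0 \<eta>"
    then obtain k where k: "\<And>T. T \<in> ball 0 \<eta> \<Longrightarrow> h T - c = k" unfolding constant_on_def by blast
    have "\<forall>\<^sub>F w in nhds z0. w \<in> ball z0 \<delta>" using ch(3) by (intro eventually_nhds_in_open) auto
    then have "\<forall>\<^sub>F w in nhds z0. v w = k + c"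
    proof eventually_elim
      case (elim w)
      then have "w \<in> cball z0 \<delta>" by simp
      then have "h (F z0 w) - c = k" "v w = h (F z0 w)" using k ch(7,8) by auto
      then show ?case by (simp add: algebra_simps)
    qed
    then show False using nc by blast
  qed
  moreover have "h 0 - c = 0" using ch(8)[of z0] ch(3) F0[OF z0(1)] z0(2) by simp
  ultimately obtain m where m: "m > 0" "lind (\<lambda>z. h (F z0 z) - c) z0 (int m * \<epsilon>)"
  proof (rule_tac lind_compose[OF Flind[OF z0(1)] ch(3,5) F0[OF z0(1)], of "\<lambda>T. h T - c" \<eta>])
    show "(\<lambda>T. h T - c) holomorphic_on ball 0 \<eta>" using ch(2) by (intro holomorphic_intros)
  qed (use ch(1) in auto)
  have "lind (\<lambda>z. v z - c) z0 (int m * \<epsilon>)"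
    by (rule lind_cong[OF m(2) ch(3)]) (use ch(8) in auto)
  then show ?thesis using that m(1) by blast
qed

text \<open>An accumulation point of the fibre in \<open>A\<close> would belong to the fibre by
  continuity; but there \<open>v - c\<close> has a local index, hence no further zeros
  nearby.\<close>

lemma fibre_finite:
  assumes v: "chol R F v" and nc: "\<And>z c. z \<in> ball 0 R - {0} \<Longrightarrow> \<not> (\<forall>\<^sub>F x in nhds z. v x = c)"
    and A: "compact A" "A \<subseteq> ball 0 R - {0}"
  shows "finite {z \<in> A. v z = c}"
proof (rule ccontr)
  assume "infinite {z \<in> A. v z = c}"
  then obtain z0 where z0: "z0 \<in> A" "z0 islimpt {z \<in> A. v z = c}"
    using A(1) unfolding compact_eq_Bolzano_Weierstrass by (metis (mono_tags, lifting) mem_Collect_eq subsetI)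
  have "closed {z \<in> A. v z = c}"
    by (rule continuous_closed_preimage_constant[OF continuous_on_subset[OF chol_continuous[OF v] A(2)] compact_imp_closed[OF A(1)]])
  then have "v z0 = c" using z0(2) closed_limpt by blast
  then obtain m where m: "lind (\<lambda>z. v z - c) z0 (int m * \<epsilon>)"
    using fibre_lind[OF v nc] z0(1) A(2) by blast
  obtain \<rho> where r: "\<rho> > 0" "\<And>z. z \<in> cball z0 \<rho> - {z0} \<Longrightarrow> v z - c \<noteq> 0"
    by (rule lind_small[OF m zero_less_one]) (rule that; assumption)
  obtain z where "z \<in> {z \<in> A. v z = c}" "z \<noteq> z0" "dist z z0 < \<rho>"
    using z0(2) r(1) unfolding islimpt_approachable by blast
  then show False using r(2)[of z] by (auto simp: dist_commute)
qed

text \<open>\<open>n\<close> is the number of solutions with multiplicity. The condition at 0 keeps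
  solutions away from the centre, which has no chart; the last clause yields a solution once
  \<open>n > 0\<close>.\<close>

lemma fibre_count:
  assumes v: "chol R F v" and nc: "\<And>z c. z \<in> ball 0 R - {0} \<Longrightarrow> \<not> (\<forall>\<^sub>F x in nhds z. v x = c)"
    and cont: "continuous_on (ball 0 R) v" and r: "0 < r" "r < R" and c: "v 0 \<noteq> c" "\<And>z. z \<in> sphere 0 r \<Longrightarrow> v z \<noteq> c"
  obtains n where "ind (\<lambda>z. v z - c) 0 r = of_int (int n * \<epsilon>)" "finite {z \<in> ball 0 r. v z = c}"
    "card {z \<in> ball 0 r. v z = c} \<le> n" "{z \<in> ball 0 r. v z = c} = {} \<Longrightarrow> n = 0"
proof -
  define Z where "Z = {z \<in> cball 0 r. v z = c}"
  have sub: "cball 0 r \<subseteq> ball (0::complex) R" using r by auto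
  have "closed Z" unfolding Z_def
    by (rule continuous_closed_preimage_constant[OF continuous_on_subset[OF cont sub] closed_cball])
  moreover have "bounded Z" by (rule bounded_subset[OF bounded_cball, of _ 0 r]) (auto simp: Z_def)
  ultimately have "compact Z" by (simp add: compact_eq_bounded_closed)
  moreover have Zs: "Z \<subseteq> ball 0 R - {0}" using sub c(1) by (auto simp: Z_def)
  ultimately have "finite {z \<in> Z. v z = c}"
  proof (rule_tac fibre_finite[OF v])
    show "\<not> (\<forall>\<^sub>F x in nhds z. v x = c)" if "z \<in> ball 0 R - {0}" for z c by (rule nc[OF that])
  qed auto
  then have fin: "finite Z" by (simp add: Z_def)
  have Zeq: "{z \<in> ball 0 r. v z = c} = Z" using c(2) by (force simp: Z_def)
  have "\<forall>z\<in>Z. \<exists>m>0. lind (\<lambda>x. v x - c) z (int m * \<epsilon>)"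
  proof
    fix z assume z: "z \<in> Z"
    then have "z \<in> ball 0 R - {0}" "v z = c" using Zs by (auto simp: Z_def)
    then show "\<exists>m>0. lind (\<lambda>x. v x - c) z (int m * \<epsilon>)" using fibre_lind[OF v nc, of z c] by blast
  qed
  from bchoice[OF this] obtain m where m: "\<And>z. z \<in> Z \<Longrightarrow> m z > 0" "\<And>z. z \<in> Z \<Longrightarrow> lind (\<lambda>x. v x - c) z (int (m z) * \<epsilon>)"
    by blast
  have "ind (\<lambda>z. v z - c) 0 r = of_int (\<Sum>z\<in>Z. int (m z) * \<epsilon>)"
  proof (rule ind_additive[OF fin])
    show "Z \<subseteq> ball 0 r" using Zeq by blast
    show "continuous_on (cball 0 r - Z) (\<lambda>z. v z - c)"
      by (intro continuous_intros continuous_on_subset[OF cont]) (use sub in auto)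
    show "v z - c \<noteq> 0" if "z \<in> cball 0 r - Z" for z using that by (auto simp: Z_def)
  qed (use m r in auto)
  also have "(\<Sum>z\<in>Z. int (m z) * \<epsilon>) = int (\<Sum>z\<in>Z. m z) * \<epsilon>" by (simp add: sum_distrib_right)
  finally have "ind (\<lambda>z. v z - c) 0 r = of_int (int (\<Sum>z\<in>Z. m z) * \<epsilon>)" .
  moreover have "card Z \<le> (\<Sum>z\<in>Z. m z)"
    using sum_mono[of Z "\<lambda>_. 1" m] m(1) by (simp add: Suc_leI)
  ultimately show ?thesis
    by (intro that[of "\<Sum>z\<in>Z. m z"]) (simp_all only: Zeq fin sum.empty)
qed

end

section \<open>The centre of the disc: isolated zero, root and uniformizing coordinate\<close>

lemma compact_norm_lower_bound:
  fixes f :: "'a::topological_space \<Rightarrow> 'b::real_normed_vector"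
  assumes "compact K" "continuous_on K f" "\<And>z. z \<in> K \<Longrightarrow> f z \<noteq> 0"
  obtains m where "m > 0" "\<And>z. z \<in> K \<Longrightarrow> m \<le> norm (f z)"
proof (cases "K = {}")
  case True
  then show ?thesis using that[of 1] by simp
next
  case False
  obtain x where x: "x \<in> K" "\<And>y. y \<in> K \<Longrightarrow> norm (f x) \<le> norm (f y)"
    using continuous_attains_inf[OF assms(1) False continuous_on_norm[OF assms(2)]] by blast
  then show ?thesis using that[of "norm (f x)"] assms(3)[of x] by simp
qed

text \<open>The common reason why increments of logarithms and quotients of roots are
  constant.\<close>

lemma continuous_countable_range_constant:
  fixes f :: "'a::topological_space \<Rightarrow> 'b::metric_space"
  assumes "connected S" "continuous_on S f" "countable B" "f ` S \<subseteq> B" "x \<in> S" "y \<in> S"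
  shows "f x = f y"
proof (rule ccontr)
  assume "f x \<noteq> f y"
  then have "uncountable (f ` S)"
    using connected_uncountable[OF connected_continuous_image[OF assms(2,1)], of "f x" "f y"] assms(5,6) by blast
  then show False using countable_subset[OF assms(4,3)] by blast
qed

lemma finite_separated:
  fixes S :: "'a::metric_space set"
  assumes "finite S"
  obtains d where "d > 0" "\<And>x y. x \<in> S \<Longrightarrow> y \<in> S \<Longrightarrow> x \<noteq> y \<Longrightarrow> d \<le> dist x y"
proof -
  define D where "D = insert 1 ((\<lambda>p. dist (fst p) (snd p)) ` {p \<in> S \<times> S. fst p \<noteq> snd p})"
  have fin: "finite D" using assms by (simp add: D_def)
  show ?thesis
  proof (rule that[of "Min D"])
    have "Min D \<in> D" using fin by (intro Min_in) (auto simp: D_def)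
    then show "Min D > 0" by (auto simp: D_def)
    fix x y assume "x \<in> S" "y \<in> S" "x \<noteq> y"
    then have "dist x y \<in> D" unfolding D_def by (intro insertI2 image_eqI[of _ _ "(x, y)"]) auto
    then show "Min D \<le> dist x y" using fin by (intro Min_le)
  qed
qed

context curve_charts begin

text \<open>Since the centre has no chart, zeros might accumulate there. But the index on one circle
  is \<open>N0\<close> times \<epsilon>; each zero in the punctured disc persists as a nearby
  solution of u = c for small nonzero c, solutions near different zeros are different, and there are
  at most \<open>N0\<close> of them.\<close>

lemma isolated_zero:
  assumes v: "chol R F u" and nc: "\<And>z c. z \<in> ball 0 R - {0} \<Longrightarrow> \<not> (\<forall>\<^sub>F x in nhds z. u x = c)"
    and cont: "continuous_on (ball 0 R) u" and u0: "u 0 = 0"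
  obtains r1 N where "0 < r1" "r1 < R" "\<And>z. z \<in> cball 0 r1 - {0} \<Longrightarrow> u z \<noteq> 0" "N > 0"
    "ind u 0 r1 = of_int (int N * \<epsilon>)"
proof -
  \<comment> \<open>A constant smaller than \<open>u\<close> on the circle leaves the index
    unchanged, and it moves the solutions off the centre, so that \<open>fibre_count\<close> becomes
    applicable.\<close>
  have shift: "\<exists>n. ind u 0 r = of_int (int n * \<epsilon>) \<and> finite {z \<in> ball 0 r. u z = c} \<and>
      card {z \<in> ball 0 r. u z = c} \<le> n \<and> ({z \<in> ball 0 r. u z = c} = {} \<longrightarrow> n = 0)"
    if r: "0 < r" "r < R" and m: "\<And>z. z \<in> sphere 0 r \<Longrightarrow> m \<le> norm (u z)" and c: "c \<noteq> 0" "norm c < m" for r m c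
  proof -
    have uc: "u z \<noteq> c" if "z \<in> sphere 0 r" for z using m[OF that] c(2) by auto
    have "u 0 \<noteq> c" using c(1) u0 by simp
    obtain n where n: "ind (\<lambda>z. u z - c) 0 r = of_int (int n * \<epsilon>)" "finite {z \<in> ball 0 r. u z = c}"
      "card {z \<in> ball 0 r. u z = c} \<le> n" "{z \<in> ball 0 r. u z = c} = {} \<Longrightarrow> n = 0"
      by (rule fibre_count[OF v nc cont r \<open>u 0 \<noteq> c\<close> uc]) (assumption | rule that; assumption)+
    have cs: "continuous_on (sphere 0 r) u" by (rule continuous_on_subset[OF cont]) (use r in auto)
    have "ind (\<lambda>z. u z - c) 0 r = ind u 0 r"
    proof (rule ind_close[OF _ cs r(1)])
      show "norm (u z - c - u z) < norm (u z)" if "z \<in> sphere 0 r" for z using m[OF that] c(2) by simp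
    qed (intro continuous_intros cs)
    then have "ind u 0 r = of_int (int n * \<epsilon>)" using n(1) by simp
    then show ?thesis using n(2,3,4) by blast
  qed
  \<comment> \<open>Only finitely many zeros lie in this annulus, so some radius between R/4 and R/2
    is not the modulus of any of them.\<close>
  define A where "A = cball 0 (R/2) - ball (0::complex) (R/4)"
  have A: "compact A" "A \<subseteq> ball 0 R - {0}" using R by (auto simp: A_def intro: compact_diff)
  have finA: "finite {z \<in> A. u z = 0}" by (rule fibre_finite[OF v _ A]) (rule nc)
  have "infinite ({R/4<..<R/2} - norm ` {z \<in> A. u z = 0})"
    using finA R by (intro Diff_infinite_finite) (auto simp: infinite_Ioo)
  then have "{R/4<..<R/2} - norm ` {z \<in> A. u z = 0} \<noteq> {}" by (rule infinite_imp_nonempty)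
  then obtain r where rr: "r \<in> {R/4<..<R/2}" "r \<notin> norm ` {z \<in> A. u z = 0}" by blast
  have r: "0 < r" "r < R" using rr(1) R by auto
  have nzr: "u z \<noteq> 0" if "z \<in> sphere 0 r" for z
  proof
    assume "u z = 0"
    then have "z \<in> {z \<in> A. u z = 0}" using that rr(1) by (auto simp: A_def)
    then show False using rr(2) that by force
  qed
  have sph: "continuous_on (sphere 0 t) u" if "t < R" for t
    by (rule continuous_on_subset[OF cont]) (use that in auto)
  obtain m0 where m0: "m0 > 0" "\<And>z. z \<in> sphere 0 r \<Longrightarrow> m0 \<le> norm (u z)"
    by (rule compact_norm_lower_bound[OF compact_sphere sph[OF r(2)]], erule nzr, rule that, assumption, assumption)
  obtain N0 where N0: "ind u 0 r = of_int (int N0 * \<epsilon>)"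
    using shift[OF r m0(2), of "of_real (m0/2)"] m0(1) by auto
  define Z where "Z = {z \<in> ball 0 r - {0}. u z = 0}"
  have bd: "card S \<le> N0" if S: "S \<subseteq> Z" "finite S" for S
  proof -
    obtain d where d: "d > 0" "\<And>x y. x \<in> S \<Longrightarrow> y \<in> S \<Longrightarrow> x \<noteq> y \<Longrightarrow> d \<le> dist x y"
      using finite_separated[OF S(2)] by blast
    \<comment> \<open>\<open>p\<close> pairs a radius with a lower bound of \<open>u\<close> on the
      circle of that radius. Radii below d/2 make the closed discs around different zeros
      disjoint.\<close>
    have "\<forall>z\<in>S. \<exists>p. fst p > 0 \<and> fst p < d/2 \<and> fst p < r - norm z \<and> snd p > 0 \<and>
        (\<forall>w\<in>sphere z (fst p). snd p \<le> norm (u w)) \<and> ind u z (fst p) \<noteq> 0"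
    proof
      fix z assume z: "z \<in> S"
      then have zr: "norm z < r" "z \<noteq> 0" "u z = 0" using S(1) by (auto simp: Z_def)
      then have zR: "z \<in> ball 0 R - {0}" using r by auto
      obtain m where m: "m > 0" "lind (\<lambda>x. u x - 0) z (int m * \<epsilon>)" using fibre_lind[OF v nc[OF zR] zR zr(3)] by blast
      have "min (d/2) (r - norm z) > 0" using d zr by simp
      then obtain \<rho> where p: "\<rho> > 0" "\<rho> < min (d/2) (r - norm z)" "continuous_on (cball z \<rho> - {z}) (\<lambda>x. u x - 0)"
        "\<And>x. x \<in> cball z \<rho> - {z} \<Longrightarrow> u x - 0 \<noteq> 0" "ind (\<lambda>x. u x - 0) z \<rho> = of_int (int m * \<epsilon>)"
        by (rule lind_small[OF m(2)]) (rule that; assumption)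
      have sub: "sphere z \<rho> \<subseteq> cball z \<rho> - {z}" using p(1) by auto
      obtain \<mu> where mu: "\<mu> > 0" "\<And>w. w \<in> sphere z \<rho> \<Longrightarrow> \<mu> \<le> norm (u w - 0)"
      proof (rule compact_norm_lower_bound[OF compact_sphere continuous_on_subset[OF p(3) sub]])
        show "u w - 0 \<noteq> 0" if "w \<in> sphere z \<rho>" for w using p(4) sub that by blast
      qed (rule that; assumption)
      show "\<exists>p. fst p > 0 \<and> fst p < d/2 \<and> fst p < r - norm z \<and> snd p > 0 \<and>
        (\<forall>w\<in>sphere z (fst p). snd p \<le> norm (u w)) \<and> ind u z (fst p) \<noteq> 0"
        by (rule exI[of _ "(\<rho>, \<mu>)"]) (use p(1,2,5) mu m(1) eps in auto)
    qed
    from bchoice[OF this] obtain p where p: "\<And>z. z \<in> S \<Longrightarrow> fst (p z) > 0" "\<And>z. z \<in> S \<Longrightarrow> fst (p z) < d/2"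
       "\<And>z. z \<in> S \<Longrightarrow> fst (p z) < r - norm z" "\<And>z. z \<in> S \<Longrightarrow> snd (p z) > 0"
       "\<And>z w. z \<in> S \<Longrightarrow> w \<in> sphere z (fst (p z)) \<Longrightarrow> snd (p z) \<le> norm (u w)"
       "\<And>z. z \<in> S \<Longrightarrow> ind u z (fst (p z)) \<noteq> 0" by blast
    define M where "M = insert m0 ((\<lambda>z. snd (p z)) ` S)"
    define \<mu> where "\<mu> = Min M / 2"
    have finM: "finite M" "M \<noteq> {}" using S(2) by (auto simp: M_def)
    have "Min M > 0" using finM p(4) m0(1) by (auto simp: M_def)
    then have mu0: "\<mu> > 0" "\<mu> < Min M" by (auto simp: \<mu>_def)
    have "Min M \<le> m0" by (rule Min_le[OF finM(1)]) (simp add: M_def)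
    moreover have "Min M \<le> snd (p z)" if "z \<in> S" for z
      by (rule Min_le[OF finM(1)]) (use that in \<open>simp add: M_def\<close>)
    ultimately have mu: "\<mu> > 0" "\<mu> < m0" "\<And>z. z \<in> S \<Longrightarrow> \<mu> < snd (p z)"
      using mu0 by fastforce+
    define c where "c = complex_of_real \<mu>"
    have c: "c \<noteq> 0" "norm c = \<mu>" using mu by (auto simp: c_def)
    obtain n where n: "ind u 0 r = of_int (int n * \<epsilon>)" "finite {z \<in> ball 0 r. u z = c}"
      "card {z \<in> ball 0 r. u z = c} \<le> n" using shift[OF r m0(2) c(1)] c mu by auto
    have "n = N0" using n(1) N0 eps by (metis mult_cancel_right of_int_eq_iff of_nat_eq_iff)
    \<comment> \<open>If the value \<open>c\<close> were omitted on the disc, \<open>u - c\<close>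
      would have index 0 on its boundary; but that index equals the one of \<open>u\<close>, which
      is not 0.\<close>
    have "\<forall>z\<in>S. \<exists>w. w \<in> cball z (fst (p z)) \<and> u w = c"
    proof (rule ballI, rule ccontr)
      fix z assume z: "z \<in> S" and no: "\<nexists>w. w \<in> cball z (fst (p z)) \<and> u w = c"
      have cb: "cball z (fst (p z)) \<subseteq> ball 0 R"
      proof
        fix w assume "w \<in> cball z (fst (p z))"
        then have "norm w \<le> norm z + fst (p z)" using norm_triangle_ineq[of z "w - z"]
          by (simp add: dist_norm norm_minus_commute)
        then show "w \<in> ball 0 R" using p(3)[OF z] r by simp
      qed
      have cz: "continuous_on (cball z (fst (p z))) u" by (rule continuous_on_subset[OF cont cb])
      have "ind (\<lambda>w. u w - c) z (fst (p z)) = 0"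
        by (rule ind_nonzero_cball) (use no p(1)[OF z] cz in \<open>auto intro!: continuous_intros\<close>)
      moreover have "ind (\<lambda>w. u w - c) z (fst (p z)) = ind u z (fst (p z))"
      proof (rule ind_close)
        show "continuous_on (sphere z (fst (p z))) u" by (rule continuous_on_subset[OF cz]) auto
        then show "continuous_on (sphere z (fst (p z))) (\<lambda>w. u w - c)" by (intro continuous_intros)
        show "norm (u w - c - u w) < norm (u w)" if "w \<in> sphere z (fst (p z))" for w
          using p(5)[OF z that] mu(3)[OF z] c(2) by simp
      qed (rule p(1)[OF z])
      ultimately show False using p(6)[OF z] by simp
    qed
    from bchoice[OF this] obtain w where w: "\<And>z. z \<in> S \<Longrightarrow> w z \<in> cball z (fst (p z))" "\<And>z. z \<in> S \<Longrightarrow> u (w z) = c" by blast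
    have inj: "inj_on w S"
    proof (rule inj_onI, rule ccontr)
      fix x y assume xy: "x \<in> S" "y \<in> S" "w x = w y" "x \<noteq> y"
      have "dist x y \<le> dist x (w x) + dist y (w y)" using xy(3) dist_triangle2[of x y "w x"] by simp
      also have "\<dots> < d" using w(1)[OF xy(1)] w(1)[OF xy(2)] p(2)[OF xy(1)] p(2)[OF xy(2)] by simp
      finally show False using d(2)[OF xy(1,2,4)] by simp
    qed
    have "w ` S \<subseteq> {z \<in> ball 0 r. u z = c}"
    proof clarify
      fix z assume z: "z \<in> S"
      have "norm (w z) \<le> norm z + norm (w z - z)" using norm_triangle_ineq[of z "w z - z"] by simp
      also have "\<dots> < r" using w(1)[OF z] p(3)[OF z] by (simp add: dist_norm norm_minus_commute)
      finally show "w z \<in> ball 0 r \<and> u (w z) = c" using w(2)[OF z] by simp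
    qed
    then have "card (w ` S) \<le> n" using card_mono[OF n(2)] n(3) le_trans by blast
    then show ?thesis using card_image[OF inj] \<open>n = N0\<close> by simp
  qed
  have finZ: "finite Z" using finite_if_finite_subsets_card_bdd[of Z N0] bd by blast
  define M where "M = insert r (norm ` Z)"
  have finM: "finite M" "M \<noteq> {}" using finZ by (auto simp: M_def)
  define r1 where "r1 = Min M / 2"
  have "Min M > 0" using finM r by (auto simp: M_def Z_def)
  moreover have "Min M \<le> r" "\<And>z. z \<in> Z \<Longrightarrow> Min M \<le> norm z" using finM by (auto simp: M_def)
  ultimately have r1: "r1 > 0" "r1 < r" "\<And>z. z \<in> Z \<Longrightarrow> r1 < norm z"
    unfolding r1_def by fastforce+
  have nz1: "u z \<noteq> 0" if "z \<in> cball 0 r1 - {0}" for z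
    using r1(2) r1(3)[of z] that by (auto simp: Z_def)
  have r1R: "r1 < R" using r1 r by simp
  obtain m1 where m1: "m1 > 0" "\<And>z. z \<in> sphere 0 r1 \<Longrightarrow> m1 \<le> norm (u z)"
  proof (rule compact_norm_lower_bound[OF compact_sphere sph[OF r1R]])
    show "u z \<noteq> 0" if "z \<in> sphere 0 r1" for z using nz1[of z] that r1 by auto
  qed (rule that; assumption)
  have "isCont u 0"
    using cont R by (simp add: continuous_on_eq_continuous_at)
  then obtain d where d: "d > 0" "\<And>z. dist z 0 < d \<Longrightarrow> dist (u z) (u 0) < m1"
    unfolding continuous_at_eps_delta using m1(1) by blast
  \<comment> \<open>A point so near to 0 that its value is nonzero yet below \<open>m1\<close>; the
    equation with this right-hand side has the solution \<open>z1\<close>, which forces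
    \<open>n > 0\<close>.\<close>
  define z1 where "z1 = complex_of_real (min d r1 / 2)"
  have nz: "norm z1 = min d r1 / 2" using d r1 by (simp add: z1_def)
  then have z1: "norm z1 < d" "norm z1 < r1" "z1 \<noteq> 0" using d r1 by auto
  then have c1: "u z1 \<noteq> 0" "norm (u z1) < m1" using nz1[of z1] d(2)[of z1] u0 by auto
  obtain n where n: "ind u 0 r1 = of_int (int n * \<epsilon>)" "{z \<in> ball 0 r1. u z = u z1} = {} \<longrightarrow> n = 0"
     "finite {z \<in> ball 0 r1. u z = u z1}" "card {z \<in> ball 0 r1. u z = u z1} \<le> n"
    using shift[OF r1(1) r1R m1(2) c1] by blast
  have "z1 \<in> {z \<in> ball 0 r1. u z = u z1}" using z1 by simp
  then have "n > 0" using n(3,4) by (metis card_gt_0_iff empty_iff gr0I le_zero_eq)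
  then show ?thesis using that[OF r1(1) r1R nz1 _ n(1)] by blast
qed

end

text \<open>Pulled back by exp to a half-plane, \<open>u\<close> has a logarithm \<open>l\<close>.
  One turn around the centre adds 2 pi i N k to it, so \<open>exp (l t / of_nat N)\<close> is
  unchanged and descends to the punctured disc.\<close>

lemma continuous_root_punctured_disc:
  fixes k :: int
  assumes r: "r > 0" and u: "continuous_on (cball 0 r) u" "\<And>z. z \<in> cball 0 r - {0} \<Longrightarrow> u z \<noteq> 0" "u 0 = 0"
    and N: "N > 0" "ind u 0 r = of_int (int N * k)"
  obtains s where "continuous_on (ball 0 r) s" "s 0 = 0" "\<And>z. z \<in> ball 0 r \<Longrightarrow> s z ^ N = u z"
    "\<And>t. 0 < t \<Longrightarrow> t < r \<Longrightarrow> ind s 0 t = of_int k"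
proof -
  define P where "P = {t::complex. Re t \<le> ln r}"
  have expP: "exp t \<in> cball 0 r - {0}" if "t \<in> P" for t
  proof -
    have "exp (Re t) \<le> exp (ln r)" using that by (simp add: P_def)
    then show ?thesis using r by simp
  qed
  have conv: "convex P" unfolding P_def by (rule convex_halfspace_Re_le)
  have "continuous_on P (\<lambda>t. u (exp t))"
    by (rule continuous_on_compose2[OF u(1)]) (use expP in \<open>auto intro!: continuous_intros\<close>)
  moreover have "u (exp t) \<noteq> 0" if "t \<in> P" for t using u(2) expP that by blast
  ultimately obtain l where l: "continuous_on P l" "\<And>t. t \<in> P \<Longrightarrow> u (exp t) = exp (l t)"
    using continuous_logarithm_on_contractible[of P "\<lambda>t. u (exp t)"] convex_imp_contractible[OF conv] by metis
  define p where "p = 2 * of_real pi * \<i>"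
  have ep: "exp (t + of_int j * p) = exp t" for t and j :: int
    unfolding p_def by (subst exp_eq) (rule exI[of _ j], simp add: algebra_simps)
  have Pp: "t + of_int j * p \<in> P \<longleftrightarrow> t \<in> P" for t and j :: int by (simp add: P_def p_def)
  \<comment> \<open>The increment under \<open>p\<close> is continuous with values in the multiples
    of 2 pi i, hence constant; on the boundary line of \<open>P\<close> it is the increment around
    the circle of radius \<open>r\<close>, given by the index of \<open>u\<close>.\<close>
  have D: "l (t + p) - l t = of_int (int N * k) * p" if t: "t \<in> P" for t
  proof -
    define D where "D = (\<lambda>t. l (t + p) - l t)"
    have Pp1: "t + p \<in> P" if "t \<in> P" for t using Pp[of t 1] that by simp
    have "continuous_on P (\<lambda>t. l (t + p))"
      by (rule continuous_on_compose2[OF l(1)]) (use Pp1 in \<open>auto intro!: continuous_intros\<close>)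
    then have cD: "continuous_on P D" unfolding D_def using l(1) by (rule continuous_on_diff)
    have "D ` P \<subseteq> range (\<lambda>j::int. 0 + of_real (of_int (2 * j) * pi) * \<i>)"
    proof clarify
      fix t assume t: "t \<in> P"
      have "exp (l (t + p)) = exp (l t)" using l(2)[OF t] l(2)[OF Pp1[OF t]] ep[of t 1] by simp
      then have "exp (D t) = exp 0" by (simp add: D_def exp_diff)
      then obtain j :: int where "D t = 0 + of_real (of_int (2 * j) * pi) * \<i>" unfolding exp_eq by blast
      then show "D t \<in> range (\<lambda>j::int. 0 + of_real (of_int (2 * j) * pi) * \<i>)" by blast
    qed
    moreover have lnP: "of_real (ln r) \<in> P" by (simp add: P_def)
    ultimately have "D t = D (of_real (ln r))"
      by (intro continuous_countable_range_constant[OF convex_connected[OF conv] cD _ _ t]) auto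
    also have "D (of_real (ln r)) = p * ind u 0 r"
    proof -
      define q where "q = (\<lambda>x::real. l (of_real (ln r) + of_real x * p))"
      have qP: "of_real (ln r) + of_real x * p \<in> P" for x by (simp add: P_def p_def)
      have "path q" unfolding path_def q_def
        by (rule continuous_on_compose2[OF l(1)]) (use qP in \<open>auto intro!: continuous_intros\<close>)
      moreover have "u (circlepath 0 r x) = exp (q x)" for x
      proof -
        have "exp (of_real (ln r) + of_real x * p) = circlepath 0 r x"
          using r by (simp add: exp_add circlepath p_def exp_of_real mult_ac)
        then show ?thesis using l(2)[OF qP[of x]] by (simp add: q_def)
      qed
      ultimately have "ind u 0 r = (pathfinish q - pathstart q) / (2 * of_real pi * \<i>)" by (intro ind_eqI)
      then show ?thesis by (simp add: D_def q_def pathfinish_def pathstart_def p_def)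
    qed
    finally show ?thesis by (simp add: D_def N(2))
  qed
  have Dn: "l (t + of_nat j * p) = l t + of_nat j * (of_int (int N * k) * p)" if t: "t \<in> P" for t j
  proof (induction j)
    case (Suc j)
    have "t + of_nat j * p \<in> P" using Pp[of t "int j"] t by simp
    from D[OF this] Suc show ?case by (simp add: algebra_simps)
  qed simp
  have Dj: "l (t + of_int j * p) = l t + of_int j * (of_int (int N * k) * p)" if t: "t \<in> P" for t and j :: int
  proof (cases "j \<ge> 0")
    case True
    then show ?thesis using Dn[OF t, of "nat j"] by simp
  next
    case False
    have "l ((t + of_int j * p) + of_nat (nat (-j)) * p) = l (t + of_int j * p) + of_nat (nat (-j)) * (of_int (int N * k) * p)"
      by (rule Dn) (simp add: Pp t)
    then show ?thesis using False by (simp add: algebra_simps)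
  qed
  \<comment> \<open>Defined through the principal logarithm and yet continuous across its cut, since
    by \<open>s_exp\<close> any other logarithm of the point gives the same value.\<close>
  define s where "s = (\<lambda>z. if z = 0 then 0 else exp (l (Ln z) / of_nat N))"
  have s_exp: "s (exp t) = exp (l t / of_nat N)" if t: "t \<in> P" for t
  proof -
    have "exp (Ln (exp t)) = exp t" by simp
    then obtain j :: int where "Ln (exp t) = t + of_real (of_int (2 * j) * pi) * \<i>" unfolding exp_eq by blast
    then have j: "Ln (exp t) = t + of_int j * p" by (simp add: p_def algebra_simps)
    have "l (Ln (exp t)) / of_nat N = l t / of_nat N + of_int (j * k) * p"
      unfolding j Dj[OF t] using N(1) by (simp add: add_divide_distrib)
    then show ?thesis by (simp only: s_def exp_not_eq_zero if_False ep)
  qed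
  have sN: "s z ^ N = u z" if "z \<in> cball 0 r" for z
  proof (cases "z = 0")
    case True
    then show ?thesis using u(3) N(1) by (simp add: s_def)
  next
    case False
    have "Re (Ln z) \<le> ln r" using False that r by simp
    then have "Ln z \<in> P" by (simp add: P_def)
    then have "u (exp (Ln z)) = exp (l (Ln z))" by (rule l(2))
    then show ?thesis using False N(1) by (simp add: s_def flip: exp_of_nat_mult)
  qed
  have cont: "isCont s z0" if z0: "z0 \<in> ball 0 r" for z0
  proof (cases "z0 = 0")
    case True
    have "isCont u 0" using u(1) r continuous_on_cball_isCont by blast
    \<comment> \<open>At the centre no logarithm is available; there continuity follows from the
      modulus of \<open>s\<close> being the real N-th root of that of \<open>u\<close>.\<close>
    then have "((\<lambda>z. root N (norm (u z))) \<longlongrightarrow> root N (norm (u 0))) (at 0)"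
      by (intro tendsto_intros) (auto simp: isCont_def)
    then have lim: "((\<lambda>z. root N (norm (u z))) \<longlongrightarrow> 0) (at 0)" using u(3) by simp
    have "\<forall>\<^sub>F z in at 0. z \<in> cball 0 r"
      using r by (intro eventually_at_in_open'[THEN eventually_mono, of "ball 0 r"]) auto
    then have "\<forall>\<^sub>F z in at 0. root N (norm (u z)) = norm (s z)"
    proof eventually_elim
      case (elim z)
      have "norm (u z) = norm (s z) ^ N" using sN[OF elim] by (simp flip: norm_power)
      then show ?case using N(1) by (simp add: real_root_power_cancel)
    qed
    from lim this have "((\<lambda>z. norm (s z)) \<longlongrightarrow> 0) (at 0)" by (rule Lim_transform_eventually)
    then have "(s \<longlongrightarrow> 0) (at 0)" by (rule tendsto_norm_zero_cancel)
    moreover have "s 0 = 0" by (simp add: s_def)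
    ultimately show ?thesis using True by (simp add: isCont_def)
  next
    case False
    \<comment> \<open>For \<open>z\<close> within \<open>norm z0\<close> of \<open>z0\<close> the
      quotient \<open>z / z0\<close> has positive real part, so \<open>f\<close> is a continuous
      logarithm on \<open>B\<close> wherever \<open>z0\<close> lies relative to the cut.\<close>
    define B where "B = ball 0 r \<inter> ball z0 (norm z0)"
    define f where "f = (\<lambda>z. Ln z0 + Ln (z / z0))"
    have Bnz: "z / z0 \<notin> \<real>\<^sub>\<le>\<^sub>0 \<and> z \<noteq> 0" if "z \<in> B" for z
    proof -
      have "norm (z / z0 - 1) < 1"
      proof -
        have "z / z0 - 1 = (z - z0) / z0" using False by (simp add: diff_divide_distrib)
        then show ?thesis using that False by (simp add: B_def norm_divide dist_norm norm_minus_commute)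
      qed
      then have "Re (z / z0) > 0" using abs_Re_le_cmod[of "z / z0 - 1"] by simp
      then show ?thesis by (auto simp: complex_nonpos_Reals_iff)
    qed
    have ef: "exp (f z) = z" if "z \<in> B" for z using Bnz[OF that] False by (simp add: f_def exp_add)
    have fP: "f z \<in> P" if "z \<in> B" for z
    proof -
      have "exp (Re (f z)) = norm z" using ef[OF that] norm_exp_eq_Re[of "f z"] by simp
      also have "\<dots> < r" using that by (simp add: B_def)
      finally have "Re (f z) < ln r" using r by (metis exp_less_cancel_iff exp_ln)
      then show ?thesis by (simp add: P_def)
    qed
    have "continuous_on B (\<lambda>z. exp (l (f z) / of_nat N))"
    proof (intro continuous_intros continuous_on_compose2[OF l(1)])
      show "continuous_on B f" unfolding f_def using Bnz False by (auto intro!: continuous_intros)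
    qed (use fP N(1) in auto)
    then have "continuous_on B s"
      by (rule continuous_on_eq) (metis s_exp fP ef)
    moreover have "open B" "z0 \<in> B" using z0 False by (auto simp: B_def)
    ultimately show ?thesis by (simp add: continuous_on_eq_continuous_at)
  qed
  show ?thesis
  proof (rule that[of s])
    show cs: "continuous_on (ball 0 r) s" using cont by (simp add: continuous_at_imp_continuous_on)
    show "ind s 0 t = of_int k" if t: "0 < t" "t < r" for t
    proof -
      have ts: "sphere 0 t \<subseteq> ball 0 r" using t by auto
      have snz: "s z \<noteq> 0" if "z \<in> sphere 0 t" for z using that t by (auto simp: s_def)
      have "of_nat N * ind s 0 t = ind (\<lambda>z. s z ^ N) 0 t"
        using ind_power[OF continuous_on_subset[OF cs ts] snz t(1), of N] by simp
      also have "\<dots> = ind u 0 t" by (rule ind_cong) (use sN t in auto)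
      also have "\<dots> = ind u 0 r"
      proof (rule ind_annulus)
        show "continuous_on (cball 0 r - ball 0 t) u" by (rule continuous_on_subset[OF u(1)]) auto
        show "u z \<noteq> 0" if "z \<in> cball 0 r - ball 0 t" for z using u(2)[of z] that t by (cases "z = 0") auto
      qed (use t in auto)
      finally show ?thesis using N by simp
    qed
  qed (use sN in \<open>auto simp: s_def\<close>)
qed

text \<open>In a chart \<open>u\<close> has no zeros and therefore a holomorphic N-th root
  \<open>e\<close>. The quotient of \<open>s\<close> by it is continuous with values among the N-th
  roots of unity, so \<open>s\<close> is a constant multiple of \<open>e\<close>.\<close>

lemma chol_root:
  assumes c: "curve_charts R F \<epsilon>" and u: "chol R F u" "\<And>z. z \<in> ball 0 R - {0} \<Longrightarrow> u z \<noteq> 0"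
    and s: "continuous_on (ball 0 R - {0}) s" "\<And>z. z \<in> ball 0 R - {0} \<Longrightarrow> s z ^ N = u z" "N > 0"
  shows "chol R F s"
  unfolding chol_def
proof
  fix z0 assume z0: "z0 \<in> ball 0 R - {0::complex}"
  interpret curve_charts R F \<epsilon> by (rule c)
  obtain \<eta> h \<delta> where ch: "\<eta> > 0" "h holomorphic_on ball 0 \<eta>" "\<delta> > 0" "cball z0 \<delta> \<subseteq> ball 0 R - {0}"
    "continuous_on (cball z0 \<delta>) (F z0)" "inj_on (F z0) (cball z0 \<delta>)"
    "\<And>z. z \<in> cball z0 \<delta> \<Longrightarrow> F z0 z \<in> ball 0 \<eta>" "\<And>z. z \<in> cball z0 \<delta> \<Longrightarrow> u z = h (F z0 z)"
    by (rule chart_ball[OF u(1) z0]) (rule that; assumption)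
  have h0: "h 0 \<noteq> 0" using ch(8)[of z0] ch(3) F0[OF z0] u(2)[OF z0] by simp
  have "isCont h 0" using holomorphic_on_imp_continuous_on[OF ch(2)] ch(1)
    by (simp add: continuous_on_eq_continuous_at)
  then obtain d where d: "d > 0" "\<And>w. dist w 0 < d \<Longrightarrow> dist (h w) (h 0) < norm (h 0)"
    unfolding continuous_at_eps_delta using h0 by (metis zero_less_norm_iff)
  define \<eta>1 where "\<eta>1 = min d \<eta>"
  have \<eta>1: "\<eta>1 > 0" "\<eta>1 \<le> d" "\<eta>1 \<le> \<eta>" using d ch by (auto simp: \<eta>1_def)
  have hnz: "h w \<noteq> 0" if "w \<in> ball 0 \<eta>1" for w using d(2)[of w] that \<eta>1 by (auto simp: dist_norm)
  have hh: "h holomorphic_on ball 0 \<eta>1" by (rule holomorphic_on_subset[OF ch(2)]) (use \<eta>1 in auto)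
  obtain g where g: "g holomorphic_on ball 0 \<eta>1" "\<And>w. w \<in> ball 0 \<eta>1 \<Longrightarrow> h w = exp (g w)"
    using contractible_imp_holomorphic_log[OF hh convex_imp_contractible[OF convex_ball] hnz] by blast
  define e where "e = (\<lambda>w. exp (g w / of_nat N))"
  have e: "e holomorphic_on ball 0 \<eta>1" "\<And>w. e w \<noteq> 0" "\<And>w. w \<in> ball 0 \<eta>1 \<Longrightarrow> e w ^ N = h w"
    unfolding e_def using g s(3) by (auto intro!: holomorphic_intros simp flip: exp_of_nat_mult)
  have "isCont (F z0) z0" using ch(3,5) continuous_on_cball_isCont by blast
  then obtain d2 where d2: "d2 > 0" "\<And>z. dist z z0 < d2 \<Longrightarrow> dist (F z0 z) (F z0 z0) < \<eta>1"
    unfolding continuous_at_eps_delta using \<eta>1(1) by blast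
  define \<delta>1 where "\<delta>1 = min \<delta> d2"
  have \<delta>1: "\<delta>1 > 0" "\<delta>1 \<le> \<delta>" "\<delta>1 \<le> d2" using ch d2 by (auto simp: \<delta>1_def)
  have inb: "F z0 z \<in> ball 0 \<eta>1" "z \<in> cball z0 \<delta>" "z \<in> ball 0 R - {0}" if "z \<in> ball z0 \<delta>1" for z
  proof -
    show "F z0 z \<in> ball 0 \<eta>1" using d2(2)[of z] that \<delta>1 F0[OF z0] by (simp add: dist_commute)
    show "z \<in> cball z0 \<delta>" using that \<delta>1 by simp
    then show "z \<in> ball 0 R - {0}" using ch(4) by blast
  qed
  define q where "q = (\<lambda>z. s z / e (F z0 z))"
  have qc: "continuous_on (ball z0 \<delta>1) q" unfolding q_def
  proof (intro continuous_on_divide ballI e(2))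
    show "continuous_on (ball z0 \<delta>1) s" by (rule continuous_on_subset[OF s(1)]) (use inb in blast)
    show "continuous_on (ball z0 \<delta>1) (\<lambda>z. e (F z0 z))"
      by (rule continuous_on_compose2[OF holomorphic_on_imp_continuous_on[OF e(1)] continuous_on_subset[OF ch(5)]])
         (use inb in blast)+
  qed
  have "q ` ball z0 \<delta>1 \<subseteq> {w. w ^ N = 1}"
  proof clarify
    fix z assume z: "z \<in> ball z0 \<delta>1"
    have "q z ^ N = u z / h (F z0 z)"
      using s(2)[OF inb(3)[OF z]] e(3)[OF inb(1)[OF z]] by (simp add: q_def power_divide)
    then show "q z ^ N = 1" using ch(8)[OF inb(2)[OF z]] u(2)[OF inb(3)[OF z]] by simp
  qed
  moreover have "finite {w::complex. w ^ N = 1}"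
    using card_complex_roots_unity[of N] s(3) by (intro card_ge_0_finite) simp
  ultimately have qconst: "q z = q z0" if "z \<in> ball z0 \<delta>1" for z
    using continuous_countable_range_constant[OF connected_ball qc _ _ that, of _ z0] \<delta>1(1) countable_finite
    by (metis centre_in_ball)
  show "\<exists>\<eta>>0. \<exists>h. h holomorphic_on ball 0 \<eta> \<and> (\<forall>\<^sub>F z in nhds z0. s z = h (F z0 z))"
  proof (intro exI[of _ \<eta>1] exI[of _ "\<lambda>w. q z0 * e w"] conjI)
    have "\<forall>\<^sub>F z in nhds z0. z \<in> ball z0 \<delta>1" using \<delta>1 by (intro eventually_nhds_in_open) auto
    then show "\<forall>\<^sub>F z in nhds z0. s z = q z0 * e (F z0 z)"
    proof eventually_elim
      case (elim z)
      then show ?case using qconst[OF elim] e(2)[of "F z0 z"] by (simp add: q_def field_simps)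
    qed
  qed (use \<eta>1 e in \<open>auto intro!: holomorphic_intros\<close>)
qed

text \<open>\<open>u\<close> has index N \<epsilon> around the centre, so its N-th root
  \<open>s\<close> has index \<epsilon>, and by counting fibres \<open>s\<close> takes each small
  value exactly once. Invariance of domain then makes it a homeomorphism onto a disc.\<close>

lemma uniformization:
  assumes c: "curve_charts R F \<epsilon>" and u: "chol R F u" "continuous_on (ball 0 R) u" "u 0 = 0"
    and z1: "z1 \<in> ball 0 R" "u z1 \<noteq> 0"
  obtains A \<mu> s \<sigma> r0 where "open A" "0 \<in> A" "A \<subseteq> ball 0 R" "\<mu> > 0" "homeomorphism A (ball 0 \<mu>) s \<sigma>" "s 0 = 0"
    "\<And>z0. z0 \<in> A - {0} \<Longrightarrow> \<exists>\<eta>>0. \<exists>h. h holomorphic_on ball 0 \<eta> \<and> (\<forall>\<^sub>F z in nhds z0. s z = h (F z0 z))"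
    "r0 > 0" "\<And>r. 0 < r \<Longrightarrow> r \<le> r0 \<Longrightarrow> cball 0 r \<subseteq> A \<and> ind s 0 r = of_int \<epsilon>"
proof -
  interpret curve_charts R F \<epsilon> by (rule c)
  \<comment> \<open>Constancy near one point spreads over the punctured disc, and continuity at the
    centre forces the constant to be 0, against \<open>u z1 \<noteq> 0\<close>.\<close>
  have nc: "\<not> (\<forall>\<^sub>F x in nhds z. u x = k)" if z: "z \<in> ball 0 R - {0}" for z k
  proof
    assume k: "\<forall>\<^sub>F x in nhds z. u x = k"
    have all: "u w = k" if "w \<in> ball 0 R - {0}" for w
      using locally_const_propagates[OF u(1) z that k] eventually_nhds_x_imp_x by blast
    have "isCont u 0" using u(2) R by (simp add: continuous_on_eq_continuous_at)
    then have "(u \<longlongrightarrow> 0) (at 0)" using u(3) by (simp add: isCont_def)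
    moreover have "\<forall>\<^sub>F w in at 0. u w = k"
      using eventually_at_ball'[OF R, of 0 UNIV] by eventually_elim (use all in auto)
    then have "(u \<longlongrightarrow> k) (at 0)" using tendsto_eventually by blast
    ultimately have "k = 0" using tendsto_unique[OF at_neq_bot] by blast
    moreover have "z1 \<noteq> 0" using z1(2) u(3) by auto
    ultimately show False using all[of z1] z1 by simp
  qed
  obtain r1 N where r1: "0 < r1" "r1 < R" "\<And>z. z \<in> cball 0 r1 - {0} \<Longrightarrow> u z \<noteq> 0" "N > 0"
    "ind u 0 r1 = of_int (int N * \<epsilon>)"
    by (rule isolated_zero[OF u(1) nc u(2,3)]) (assumption | rule that; assumption)+
  have sub: "cball 0 r1 \<subseteq> ball (0::complex) R" using r1 by auto
  obtain s where s: "continuous_on (ball 0 r1) s" "s 0 = 0" "\<And>z. z \<in> ball 0 r1 \<Longrightarrow> s z ^ N = u z"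
    "\<And>t. 0 < t \<Longrightarrow> t < r1 \<Longrightarrow> ind s 0 t = of_int \<epsilon>"
    by (rule continuous_root_punctured_disc[OF r1(1) continuous_on_subset[OF u(2) sub] r1(3) u(3) r1(4,5)])
       (assumption | rule that; assumption)+
  interpret C: curve_charts r1 F \<epsilon> using restrict r1 by simp
  have u1: "chol r1 F u" using u(1) r1(2) unfolding chol_def by auto
  have cs: "chol r1 F s"
    by (rule chol_root[OF C.curve_charts_axioms u1 _ continuous_on_subset[OF s(1)] _ r1(4)])
       (use r1(3) s(3) in auto)
  have ncs: "\<not> (\<forall>\<^sub>F x in nhds z. s x = k)" if z: "z \<in> ball 0 r1 - {0}" for z k
  proof
    assume "\<forall>\<^sub>F x in nhds z. s x = k"
    moreover have "\<forall>\<^sub>F x in nhds z. x \<in> ball 0 r1" using z by (intro eventually_nhds_in_open) auto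
    ultimately have "\<forall>\<^sub>F x in nhds z. u x = k ^ N" by eventually_elim (use s(3) in auto)
    then show False using nc[of z "k ^ N"] z r1(2) by auto
  qed
  define r2 where "r2 = r1 / 2"
  have r2: "0 < r2" "r2 < r1" using r1 by (auto simp: r2_def)
  have snz: "s z \<noteq> 0" if "z \<in> ball 0 r1 - {0}" for z
    using s(3)[of z] r1(3)[of z] r1(4) that by (auto simp: power_0_left)
  have sph: "continuous_on (sphere 0 r2) s" by (rule continuous_on_subset[OF s(1)]) (use r2 in auto)
  obtain \<mu> where mu: "\<mu> > 0" "\<And>z. z \<in> sphere 0 r2 \<Longrightarrow> \<mu> \<le> norm (s z)"
  proof (rule compact_norm_lower_bound[OF compact_sphere sph])
    show "s z \<noteq> 0" if "z \<in> sphere 0 r2" for z using snz[of z] that r2 by auto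
  qed (rule that; assumption)
  have uniq: "\<exists>z. {z \<in> ball 0 r2. s z = c} = {z}" if c: "norm c < \<mu>" for c
  proof (cases "c = 0")
    case True
    have "z = 0" if "z \<in> ball 0 r2" "s z = c" for z
      using snz[of z] that r2 True by (cases "z = 0") auto
    then have "{z \<in> ball 0 r2. s z = c} = {0}" using True s(2) r2 by auto
    then show ?thesis by blast
  next
    case False
    have sc: "s z \<noteq> c" if "z \<in> sphere 0 r2" for z using mu(2)[OF that] c by auto
    have "s 0 \<noteq> c" using False s(2) by simp
    obtain n where n: "ind (\<lambda>z. s z - c) 0 r2 = of_int (int n * \<epsilon>)" "finite {z \<in> ball 0 r2. s z = c}"
      "card {z \<in> ball 0 r2. s z = c} \<le> n" "{z \<in> ball 0 r2. s z = c} = {} \<Longrightarrow> n = 0"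
      by (rule C.fibre_count[OF cs ncs s(1) r2 \<open>s 0 \<noteq> c\<close> sc]) (assumption | rule that; assumption)+
    have "ind (\<lambda>z. s z - c) 0 r2 = ind s 0 r2"
    proof (rule ind_close[OF _ sph r2(1)])
      show "norm (s z - c - s z) < norm (s z)" if "z \<in> sphere 0 r2" for z using mu(2)[OF that] c by simp
    qed (intro continuous_intros sph)
    \<comment> \<open>The index on the left counts the fibre over \<open>c\<close>, the one on the
      right is that of \<open>s\<close>: the multiplicities add up to 1.\<close>
    then have "of_int (int n * \<epsilon>) = complex_of_int \<epsilon>" using n(1) s(4)[OF r2] by simp
    then have "n = 1" using eps by (simp flip: of_int_mult)
    then have "card {z \<in> ball 0 r2. s z = c} = 1" using n(2,3,4) by (metis card_0_eq le_antisym less_one linorder_not_le zero_neq_one)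
    then show ?thesis by (rule card_1_singletonE) blast
  qed
  define A where "A = {z \<in> ball 0 r2. s z \<in> ball 0 \<mu>}"
  have sub2: "ball 0 r2 \<subseteq> ball (0::complex) r1" using r2 by auto
  have Asub: "A \<subseteq> ball 0 r2" by (auto simp: A_def)
  have oA: "open A"
    using continuous_open_preimage[OF continuous_on_subset[OF s(1) sub2] open_ball open_ball, of 0 \<mu>]
    by (simp add: A_def vimage_def Int_def)
  have cA: "continuous_on A s" by (rule continuous_on_subset[OF s(1)]) (use Asub sub2 in blast)
  have inj: "inj_on s A"
  proof (rule inj_onI)
    fix x y assume xy: "x \<in> A" "y \<in> A" "s x = s y"
    then obtain z where z: "{z \<in> ball 0 r2. s z = s x} = {z}" using uniq[of "s x"] by (auto simp: A_def)
    have "x \<in> {z}" "y \<in> {z}" unfolding z[symmetric] using xy by (auto simp: A_def)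
    then show "x = y" by simp
  qed
  have im: "s ` A = ball 0 \<mu>"
  proof
    show "ball 0 \<mu> \<subseteq> s ` A"
    proof
      fix c :: complex assume c: "c \<in> ball 0 \<mu>"
      then obtain z where z: "{z \<in> ball 0 r2. s z = c} = {z}" using uniq[of c] by auto
      have "z \<in> {z \<in> ball 0 r2. s z = c}" unfolding z by simp
      then show "c \<in> s ` A" using c by (auto simp: A_def)
    qed
  qed (auto simp: A_def)
  obtain \<sigma> where hom: "homeomorphism A (s ` A) s \<sigma>"
    using invariance_of_domain_homeomorphism[OF oA cA _ inj] by blast
  have A0: "0 \<in> A" using s(2) mu(1) r2 by (simp add: A_def)
  obtain r0 where r0: "r0 > 0" "cball 0 r0 \<subseteq> A" using oA A0 open_contains_cball by blast
  have "r0 < r1"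
  proof -
    have "complex_of_real r0 \<in> cball 0 r0" using r0(1) by simp
    then have "complex_of_real r0 \<in> ball 0 r1" using r0(2) Asub sub2 by blast
    then show ?thesis using r0(1) by simp
  qed
  show ?thesis
  proof (rule that[OF oA A0 _ mu(1) hom[unfolded im] s(2) _ r0(1)])
    show "A \<subseteq> ball 0 R" using Asub sub2 sub by force
    show "\<exists>\<eta>>0. \<exists>h. h holomorphic_on ball 0 \<eta> \<and> (\<forall>\<^sub>F z in nhds z0. s z = h (F z0 z))" if "z0 \<in> A - {0}" for z0
      using cs that Asub sub2 unfolding chol_def by blast
    show "cball 0 r \<subseteq> A \<and> ind s 0 r = of_int \<epsilon>" if "0 < r" "r \<le> r0" for r
      using that s(4)[of r] \<open>r0 < r1\<close> r0(2) subset_cball[OF that(2), of 0] by auto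
  qed
qed

section \<open>Smooth separatrices\<close>

text \<open>Ensures that a spectrum is nonempty. The entire function det (A - z) equals z^n det (A/z
  - 1), whose last factor tends to a number of modulus 1; it thus tends to infinity, and by
  Liouville it has a zero.\<close>

lemma complex_linear_eigenvalue:
  fixes A :: "complex^'n \<Rightarrow> complex^'n"
  assumes A: "Vector_Spaces.linear (*s) (*s) A"
  obtains c v where "v \<noteq> 0" "A v = c *s v"
proof -
  define a where "a = (\<lambda>i j. matrix A $ i $ j)"
  define M where "M = (\<lambda>z. \<chi> i j. a i j - (if i = j then z else 0) :: complex^'n^'n)"
  \<comment> \<open>\<open>M z\<close> is \<open>z\<close> times \<open>G (1 / z)\<close>, so the
    behaviour of \<open>M\<close> at infinity is that of \<open>G\<close> at 0.\<close>
  define G where "G = (\<lambda>w. \<chi> i j. w * a i j - (if i = j then 1 else 0) :: complex^'n^'n)"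
  have hol: "(\<lambda>z. det (M z)) holomorphic_on UNIV"
  proof -
    have "(\<lambda>z. M z $ i $ j) holomorphic_on UNIV" for i j
      unfolding M_def by (cases "i = j") (auto intro!: holomorphic_intros)
    then show ?thesis unfolding det_def by (intro holomorphic_intros)
  qed
  have scale: "det (M z) = z ^ CARD('n) * det (G (1 / z))" if "z \<noteq> 0" for z
  proof -
    have "M z = (\<chi> i. z *s (\<chi> j. (1/z) * a i j - (if i = j then 1 else 0)))"
      using that by (simp add: M_def vec_eq_iff algebra_simps)
    also have "det \<dots> = prod (\<lambda>_. z) (UNIV :: 'n set) * det (\<chi> i. (\<chi> j. (1/z) * a i j - (if i = j then 1 else 0)))"
      by (rule det_rows_mul)
    finally show ?thesis by (simp add: G_def)
  qed
  have lim: "((\<lambda>z. det (G (1 / z))) \<longlongrightarrow> det (G 0)) at_infinity"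
  proof -
    have "continuous_on UNIV (\<lambda>w. det (G w))" unfolding det_def G_def by (auto intro!: continuous_intros)
    then have "isCont (\<lambda>w. det (G w)) 0" by (simp add: continuous_on_eq_continuous_at)
    moreover have eq: "(\<lambda>z::complex. 1 / z) = inverse" by (simp add: fun_eq_iff inverse_eq_divide)
    have "((\<lambda>z::complex. 1 / z) \<longlongrightarrow> 0) at_infinity"
      unfolding eq by (rule tendsto_inverse_0)
    ultimately show ?thesis by (rule isCont_tendsto_compose)
  qed
  have G0: "norm (det (G 0)) = 1"
  proof -
    have "G 0 = (\<chi> i. (-1) *s ((mat 1 :: complex^'n^'n) $ i))"
      by (auto simp: G_def vec_eq_iff mat_def)
    then have "det (G 0) = prod (\<lambda>_. -1) (UNIV :: 'n set) * det (\<chi> i. (mat 1 :: complex^'n^'n) $ i)"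
      by (simp only: det_rows_mul)
    then show ?thesis by (simp add: norm_power)
  qed
  have "\<exists>z. det (M z) = 0"
  proof (rule ccontr)
    assume "\<nexists>z. det (M z) = 0"
    obtain z where "det (M z) = 0"
    proof (rule Liouville_weak_inverse[OF hol])
      fix B :: real
      have "((\<lambda>z. norm (det (G (1 / z)))) \<longlongrightarrow> norm (det (G 0))) at_infinity" by (intro tendsto_intros lim)
      then have "\<forall>\<^sub>F z in at_infinity. norm (det (G (1 / z))) > 1/2"
        by (rule order_tendstoD(1)) (simp add: G0)
      moreover have "\<forall>\<^sub>F z::complex in at_infinity. norm z \<ge> max 1 (2 * \<bar>B\<bar>)"
        unfolding eventually_at_infinity by blast
      ultimately show "\<forall>\<^sub>F z in at_infinity. B \<le> norm (det (M z))"
      proof eventually_elim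
        case (elim z)
        then have z: "norm z \<ge> 1" "norm z \<ge> 2 * \<bar>B\<bar>" "z \<noteq> 0" by auto
        have "norm z ^ 1 \<le> norm z ^ CARD('n)" using z by (intro power_increasing) (auto simp: Suc_leI)
        then have "2 * \<bar>B\<bar> \<le> norm z ^ CARD('n)" using z by simp
        then have "2 * \<bar>B\<bar> * (1/2) \<le> norm z ^ CARD('n) * norm (det (G (1 / z)))"
          using elim by (intro mult_mono) auto
        then show ?case by (simp add: scale[OF z(3)] norm_mult norm_power)
      qed
    qed auto
    with \<open>\<nexists>z. det (M z) = 0\<close> show False by blast
  qed
  then obtain z where "det (M z) = 0" by blast
  then have "\<not> invertible (M z)" using invertible_det_nz by blast
  then have "\<not> (\<exists>B. B ** M z = mat 1)" using invertible_left_inverse by blast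
  then obtain v where v: "M z *v v = 0" "v \<noteq> 0" using matrix_left_invertible_ker[of "M z"] by blast
  have "M z *v v = matrix A *v v - z *s v"
    by (auto simp: M_def a_def matrix_vector_mult_def vec_eq_iff left_diff_distrib sum_subtractf if_distrib[of "\<lambda>x. x * _"] cong: if_cong)
  then have "A v = z *s v" using v(1) matrix_works[OF A, of v] by simp
  then show ?thesis using that v(2) by blast
qed

text \<open>Differentiability at 0 improves to strict differentiability: on a small ball
  \<open>Z - B\<close> is small compared with the radius, and Cauchy's estimate turns this into a
  small Lipschitz constant.\<close>

lemma hol_vf_strict_derivative:
  fixes Z :: "complex^'n \<Rightarrow> complex^'n"
  assumes Z: "hol_vf (ball 0 r) Z" "r > 0" "Z 0 = 0" and B: "(Z has_derivative B) (at 0)" "\<And>c w. B (c *s w) = c *s B w"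
    and e: "e > 0"
  obtains \<rho> where "\<rho> > 0" "\<rho> < r" "\<And>x y. x \<in> cball 0 \<rho> \<Longrightarrow> y \<in> cball 0 \<rho> \<Longrightarrow> norm (Z x - Z y - B (x - y)) \<le> e * norm (x - y)"
proof -
  have lin: "bounded_linear B" by (rule has_derivative_bounded_linear[OF B(1)])
  define W where "W = (\<lambda>x. Z x - B x)"
  have W: "hol_vf (ball 0 r) W"
    unfolding hol_vf_def hol_fun_def
  proof (intro allI conjI ballI)
    fix i z assume z: "z \<in> ball (0::complex^'n) r"
    obtain L where L: "(Z has_derivative L) (at z)" "\<And>c v. L (c *s v) = c *s L v"
      using hol_vf_has_derivative[OF Z(1) z] by blast
    have "(W has_derivative (\<lambda>v. L v - B v)) (at z)"
      unfolding W_def by (intro has_derivative_diff L bounded_linear_imp_has_derivative lin)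
    from has_derivative_vec_nth[OF this]
    show "\<exists>L. ((\<lambda>z. W z $ i) has_derivative L) (at z) \<and> (\<forall>c v. L (c *s v) = c * L v)"
      by (intro exI[of _ "\<lambda>v. (L v - B v) $ i"]) (auto simp: L B algebra_simps)
  qed auto
  \<comment> \<open>\<open>hol_vf_lipschitz\<close> multiplies the bound
    \<open>e' * (2 * \<rho>)\<close> by \<open>CARD('n) / \<rho>\<close>, which gives
    \<open>e\<close>.\<close>
  define e' where "e' = e / (2 * real CARD('n))"
  have e': "e' > 0" using e by (simp add: e'_def)
  obtain d where d: "d > 0" "\<And>y. norm (y - 0) < d \<Longrightarrow> norm (Z y - Z 0 - B (y - 0)) \<le> e' * norm (y - 0)"
    using B(1) e' unfolding has_derivative_at_alt by blast
  define \<rho> where "\<rho> = min (d/4) (r/4)"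
  have \<rho>: "\<rho> > 0" "2 * \<rho> < d" "2 * \<rho> < r" using d Z by (auto simp: \<rho>_def)
  show ?thesis
  proof (rule that[of \<rho>])
    fix x y :: "complex^'n" assume xy: "x \<in> cball 0 \<rho>" "y \<in> cball 0 \<rho>"
    have "norm (W x - W y) \<le> real CARD('n) * (e' * (2 * \<rho>)) / \<rho> * norm (x - y)"
    proof (rule hol_vf_lipschitz[OF W _ \<rho>(1) _ xy])
      show "cball (0::complex^'n) (2 * \<rho>) \<subseteq> ball 0 r" using \<rho> by auto
      fix w :: "complex^'n" assume w: "w \<in> cball 0 (2 * \<rho>)"
      then have "norm (W w) \<le> e' * norm w" using d(2)[of w] \<rho> Z(3) by (simp add: W_def)
      also have "\<dots> \<le> e' * (2 * \<rho>)" using w e' by (intro mult_left_mono) auto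
      finally show "norm (W w) \<le> e' * (2 * \<rho>)" .
    qed
    also have "real CARD('n) * (e' * (2 * \<rho>)) / \<rho> = e" using \<rho> by (simp add: e'_def)
    also have "W x - W y = Z x - Z y - B (x - y)"
      using bounded_linear.linear[OF lin] by (simp add: W_def linear_diff)
    finally show "norm (Z x - Z y - B (x - y)) \<le> e * norm (x - y)" .
  qed (use \<rho> in auto)
qed

section \<open>Formal solution of the separatrix equation\<close>

text \<open>Removability of the singularity of f / z^k produces the next Taylor coefficient, here in
  the form of a limit.\<close>

lemma holomorphic_next_coefficient:
  assumes f: "f holomorphic_on ball 0 d" "d > 0" and lim: "((\<lambda>z. f z / z ^ k) \<longlongrightarrow> 0) (at (0::complex))"
  shows "\<exists>c. ((\<lambda>z. f z / z ^ Suc k) \<longlongrightarrow> c) (at 0)"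
proof -
  define q where "q = (\<lambda>z. if z = 0 then 0 else f z / z ^ k)"
  have "q holomorphic_on ball 0 d"
  proof (rule no_isolated_singularity'[of "{0}"])
    show "q holomorphic_on ball 0 d - {0}"
    proof (rule holomorphic_transform[of "\<lambda>z. f z / z ^ k"])
      show "(\<lambda>z. f z / z ^ k) holomorphic_on ball 0 d - {0}"
        by (intro holomorphic_intros holomorphic_on_subset[OF f(1)]) auto
    qed (auto simp: q_def)
    show "(q \<longlongrightarrow> q z) (at z within ball 0 d)" if "z \<in> {0}" for z
    proof -
      have "(q \<longlongrightarrow> 0) (at 0)"
        by (rule Lim_transform_eventually[OF lim]) (auto simp: q_def eventually_at_filter)
      then have "(q \<longlongrightarrow> 0) (at 0 within ball 0 d)" by (rule tendsto_mono[OF at_le[OF subset_UNIV]])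
      moreover have "q 0 = 0" by (simp add: q_def)
      ultimately show ?thesis using that by simp
    qed
  qed auto
  then have "q field_differentiable (at 0)"
    using f(2) by (auto intro: holomorphic_on_imp_differentiable_at)
  then obtain c where "(q has_field_derivative c) (at 0)" by (auto simp: field_differentiable_def)
  then have "((\<lambda>z. (q z - q 0) / (z - 0)) \<longlongrightarrow> c) (at 0)" by (simp add: has_field_derivative_iff)
  then have "((\<lambda>z. f z / z ^ Suc k) \<longlongrightarrow> c) (at 0)"
    by (rule Lim_transform_eventually) (auto simp: q_def eventually_at_filter divide_simps)
  then show ?thesis by blast
qed

lemma tendsto_vec_iff:
  fixes f :: "'a \<Rightarrow> complex^'n"
  shows "(f \<longlongrightarrow> l) F \<longleftrightarrow> (\<forall>i. ((\<lambda>x. f x $ i) \<longlongrightarrow> l $ i) F)"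
  by (auto intro: tendsto_vec_nth vec_tendstoI)

text \<open>Solves z P' = Z(P) one coefficient at a time. If the error of \<open>P\<close> starts
  with c z^j, where j = k + 2, then adding b z^j to \<open>P\<close> changes the error by (j b - B
  b) z^j to leading order; nonresonance makes j - B invertible, so some \<open>b\<close> cancels
  c.\<close>

lemma formal_separatrix:
  fixes Z :: "complex^'n \<Rightarrow> complex^'n"
  assumes Z: "hol_vf (ball 0 r) Z" "r > 0" "Z 0 = 0" and B: "(Z has_derivative B) (at 0)" "\<And>c w. B (c *s w) = c *s B w"
    and v: "B v = v" and nonres: "\<And>j w. j \<ge> 2 \<Longrightarrow> w \<noteq> 0 \<Longrightarrow> B w \<noteq> of_nat j *s w"
  shows "\<exists>P P'. P 0 = 0 \<and> P' 0 = v \<and> (\<forall>z. has_vderiv P (P' z) z) \<and>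
    ((\<lambda>z. (1 / z ^ Suc k) *s (z *s P' z - Z (P z))) \<longlongrightarrow> 0) (at 0)"
proof (induction k)
  case 0
  show ?case
  proof (rule exI[of _ "\<lambda>z. z *s v"], rule exI[of _ "\<lambda>z. v"], intro conjI allI)
    show "has_vderiv (\<lambda>z. z *s v) v z" for z
      by (rule bounded_linear_imp_has_derivative[OF bounded_linear_cscale])
    show "((\<lambda>z. (1 / z ^ Suc 0) *s (z *s v - Z (z *s v))) \<longlongrightarrow> 0) (at 0)"
    proof (rule tendstoI)
      fix e :: real assume e: "e > 0"
      define e' where "e' = e / (2 * (norm v + 1))"
      have e': "e' > 0" using e norm_ge_zero[of v] by (simp add: e'_def add_nonneg_pos)
      obtain \<rho> where \<rho>: "\<rho> > 0" "\<And>x y. x \<in> cball 0 \<rho> \<Longrightarrow> y \<in> cball 0 \<rho> \<Longrightarrow> norm (Z x - Z y - B (x - y)) \<le> e' * norm (x - y)"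
        by (rule hol_vf_strict_derivative[OF Z B e']) (rule that; assumption)
      have "isCont (\<lambda>z. z *s v) 0"
        by (rule linear_continuous_at[OF bounded_linear_cscale])
      then have "\<forall>\<^sub>F z in at 0. dist (z *s v) (0 *s v) < \<rho>" using \<rho>(1) tendstoD unfolding isCont_def by blast
      moreover have "\<forall>\<^sub>F z in at 0. z \<noteq> (0::complex)" by (simp add: eventually_at_filter)
      ultimately show "\<forall>\<^sub>F z in at 0. dist ((1 / z ^ Suc 0) *s (z *s v - Z (z *s v))) 0 < e"
      proof eventually_elim
        case (elim z)
        have "norm (Z (z *s v) - Z 0 - B (z *s v - 0)) \<le> e' * norm (z *s v - 0)"
          by (rule \<rho>(2)) (use elim \<rho>(1) in auto)
        then have "norm (Z (z *s v) - z *s v) \<le> e' * (norm z * norm v)"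
          using Z(3) B(2) v by (simp add: norm_cscale)
        then have "norm (z *s v - Z (z *s v)) / norm z \<le> e' * norm v"
          using elim by (simp add: norm_minus_commute field_simps)
        also have "\<dots> < e"
        proof -
          have "e' * norm v \<le> e' * (norm v + 1)" using e' by (intro mult_left_mono) auto
          also have "\<dots> = e / 2" using norm_ge_zero[of v] by (simp add: e'_def field_simps add_nonneg_eq_0_iff)
          finally show ?thesis using e by simp
        qed
        finally have "norm ((1 / z) *s (z *s v - Z (z *s v))) < e"
          unfolding norm_cscale by (simp add: norm_divide)
        then show ?case by (simp only: dist_norm diff_zero power_Suc0_right)
      qed
    qed
  qed auto
next
  case (Suc k)
  then obtain P P' where P: "P 0 = 0" "P' 0 = v" "\<And>z. has_vderiv P (P' z) z"
    and lim: "((\<lambda>z. (1 / z ^ Suc k) *s (z *s P' z - Z (P z))) \<longlongrightarrow> 0) (at 0)" by blast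
  define E where "E = (\<lambda>z. z *s P' z - Z (P z))"
  have Pc: "isCont P 0" by (rule has_vderiv_imp_continuous[OF P(3)])
  then obtain d where d: "d > 0" "\<And>z. dist z 0 < d \<Longrightarrow> dist (P z) (P 0) < r"
    unfolding continuous_at_eps_delta using Z(2) by blast
  have P'hol: "(\<lambda>z. P' z $ i) holomorphic_on UNIV" for i
  proof -
    have der: "((\<lambda>z. P z $ i) has_field_derivative P' z $ i) (at z)" for z
      using P(3)[of z] unfolding has_vderiv_iff by blast
    then have "(\<lambda>z. P z $ i) holomorphic_on UNIV" by (auto simp: holomorphic_on_open)
    then have "deriv (\<lambda>z. P z $ i) holomorphic_on UNIV" by (intro holomorphic_deriv) auto
    moreover have "deriv (\<lambda>z. P z $ i) = (\<lambda>z. P' z $ i)" using DERIV_imp_deriv[OF der] by blast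
    ultimately show ?thesis by simp
  qed
  have "\<exists>c. ((\<lambda>z. E z $ i / z ^ Suc (Suc k)) \<longlongrightarrow> c) (at 0)" for i
  proof (rule holomorphic_next_coefficient)
    have "(\<lambda>z. Z (P z) $ i) holomorphic_on ball 0 d"
      by (rule hol_vf_curve[OF Z(1)]) (use P d(2) in \<open>auto simp: dist_commute\<close>)
    then show "(\<lambda>z. E z $ i) holomorphic_on ball 0 d"
      unfolding E_def by (auto intro!: holomorphic_intros holomorphic_on_subset[OF P'hol])
    show "((\<lambda>z. E z $ i / z ^ Suc k) \<longlongrightarrow> 0) (at 0)"
    proof -
      have eq: "((1 / z ^ Suc k) *s (z *s P' z - Z (P z))) $ i = E z $ i / z ^ Suc k" for z
        by (simp only: vector_smult_component times_divide_eq_left mult_1 E_def)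
      show ?thesis using tendsto_vec_nth[OF lim, of i] by (simp only: eq zero_index)
    qed
  qed (rule d(1))
  then obtain c where "\<And>i. ((\<lambda>z. E z $ i / z ^ Suc (Suc k)) \<longlongrightarrow> c i) (at 0)" by metis
  then have c: "((\<lambda>z. (1 / z ^ Suc (Suc k)) *s E z) \<longlongrightarrow> (\<chi> i. c i)) (at 0)"
    unfolding tendsto_vec_iff by simp
  have lin: "linear B" by (rule bounded_linear.linear[OF has_derivative_bounded_linear[OF B(1)]])
  \<comment> \<open>Injective by nonresonance, the factor being at least 2, and therefore onto in
    finite dimension.\<close>
  define T where "T = (\<lambda>b. of_nat (Suc (Suc k)) *s b - B b)"
  have "linear T" unfolding T_def
    by (intro linear_compose_sub lin bounded_linear.linear
         bounded_bilinear.bounded_linear_right[OF bounded_bilinear_cscale])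
  moreover have "inj T"
    unfolding linear_injective_0[OF \<open>linear T\<close>]
  proof (intro allI impI, rule ccontr)
    fix b assume "T b = 0" "b \<noteq> 0"
    then have "of_nat (Suc (Suc k)) *s b = B b" by (simp only: T_def right_minus_eq)
    then show False using nonres[of "Suc (Suc k)" b] \<open>b \<noteq> 0\<close> by (simp del: of_nat_Suc)
  qed
  ultimately have "surj T" by (rule linear_inj_imp_surj)
  then obtain b where b: "T b = - (\<chi> i. c i)" by (metis surjD)
  define Q where "Q = (\<lambda>z. P z + z ^ Suc (Suc k) *s b)"
  define Q' where "Q' = (\<lambda>z. P' z + (of_nat (Suc (Suc k)) * z ^ Suc k) *s b)"
  \<comment> \<open>Here strict differentiability enters: the values of \<open>Z\<close> are
    compared at two moving points whose difference is exactly z^(k+2) times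
    \<open>b\<close>.\<close>
  have BB: "((\<lambda>z. (1 / z ^ Suc (Suc k)) *s (Z (Q z) - Z (P z))) \<longlongrightarrow> B b) (at 0)"
  proof (rule tendstoI)
    fix e :: real assume e: "e > 0"
    define e' where "e' = e / (2 * (norm b + 1))"
    have e': "e' > 0" using e norm_ge_zero[of b] by (simp add: e'_def add_nonneg_pos)
    obtain \<rho> where \<rho>: "\<rho> > 0" "\<And>x y. x \<in> cball 0 \<rho> \<Longrightarrow> y \<in> cball 0 \<rho> \<Longrightarrow> norm (Z x - Z y - B (x - y)) \<le> e' * norm (x - y)"
      by (rule hol_vf_strict_derivative[OF Z B e']) (rule that; assumption)
    have "isCont Q 0" unfolding Q_def
      by (intro continuous_intros Pc bounded_bilinear.continuous[OF bounded_bilinear_cscale])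
    then have "\<forall>\<^sub>F z in at 0. dist (Q z) (Q 0) < \<rho>" using \<rho>(1) tendstoD unfolding isCont_def by blast
    moreover have "\<forall>\<^sub>F z in at 0. dist (P z) (P 0) < \<rho>" using Pc \<rho>(1) tendstoD unfolding isCont_def by blast
    moreover have "\<forall>\<^sub>F z in at 0. z \<noteq> (0::complex)" by (simp add: eventually_at_filter)
    ultimately show "\<forall>\<^sub>F z in at 0. dist ((1 / z ^ Suc (Suc k)) *s (Z (Q z) - Z (P z))) (B b) < e"
    proof eventually_elim
      case (elim z)
      define y where "y = z ^ Suc (Suc k)"
      have y: "y \<noteq> 0" using elim by (simp add: y_def)
      have "norm (Z (Q z) - Z (P z) - B (Q z - P z)) \<le> e' * norm (Q z - P z)"
        by (rule \<rho>(2)) (use elim P(1) in \<open>auto simp: Q_def\<close>)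
      then have "norm (Z (Q z) - Z (P z) - y *s B b) \<le> e' * (norm y * norm b)"
        by (simp add: Q_def B(2) norm_cscale y_def)
      then have "norm (Z (Q z) - Z (P z) - y *s B b) / norm y \<le> e' * norm b"
        using y by (simp add: field_simps)
      also have "\<dots> < e"
      proof -
        have "e' * norm b \<le> e' * (norm b + 1)" using e' by (intro mult_left_mono) auto
        also have "\<dots> = e / 2" using norm_ge_zero[of b] by (simp add: e'_def field_simps add_nonneg_eq_0_iff)
        finally show ?thesis using e by simp
      qed
      finally have "norm ((1 / y) *s (Z (Q z) - Z (P z) - y *s B b)) < e"
        unfolding norm_cscale by (simp add: norm_divide)
      moreover have "(1 / y) *s (Z (Q z) - Z (P z) - y *s B b) = (1 / y) *s (Z (Q z) - Z (P z)) - B b"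
        using y by (simp add: vec_eq_iff field_simps)
      ultimately show ?case unfolding y_def dist_norm by simp
    qed
  qed
  show ?case
  proof (rule exI[of _ Q], rule exI[of _ Q'], intro conjI allI)
    show "has_vderiv Q (Q' z) z" for z
    proof -
      have "((\<lambda>z. z ^ Suc (Suc k)) has_field_derivative (of_nat (Suc (Suc k)) * z ^ Suc k)) (at z)"
        by (rule DERIV_cong[OF DERIV_power[OF DERIV_ident]]) simp
      then have "((\<lambda>z. z ^ Suc (Suc k)) has_derivative (\<lambda>h. (of_nat (Suc (Suc k)) * z ^ Suc k) * h)) (at z)"
        by (simp only: has_field_derivative_def)
      from has_derivative_add[OF P(3)[of z] bounded_linear.has_derivative[OF bounded_linear_cscale[of b] this]]
      show ?thesis unfolding Q_def Q'_def
        by (rule has_derivative_eq_rhs) (simp add: fun_eq_iff vec_eq_iff algebra_simps)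
    qed
    have "((\<lambda>z. (1 / z ^ Suc (Suc k)) *s E z + of_nat (Suc (Suc k)) *s b - (1 / z ^ Suc (Suc k)) *s (Z (Q z) - Z (P z)))
        \<longlongrightarrow> (\<chi> i. c i) + of_nat (Suc (Suc k)) *s b - B b) (at 0)"
      by (intro tendsto_intros c BB)
    moreover have "(\<chi> i. c i) + of_nat (Suc (Suc k)) *s b - B b = 0" using b by (simp add: T_def algebra_simps)
    ultimately have "((\<lambda>z. (1 / z ^ Suc (Suc k)) *s E z + of_nat (Suc (Suc k)) *s b - (1 / z ^ Suc (Suc k)) *s (Z (Q z) - Z (P z)))
        \<longlongrightarrow> 0) (at 0)" by simp
    then show "((\<lambda>z. (1 / z ^ Suc (Suc k)) *s (z *s Q' z - Z (Q z))) \<longlongrightarrow> 0) (at 0)"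
    proof (rule Lim_transform_eventually)
      have "\<forall>\<^sub>F z in at 0. z \<noteq> (0::complex)" by (simp add: eventually_at_filter)
      then show "\<forall>\<^sub>F z in at 0. (1 / z ^ Suc (Suc k)) *s E z + of_nat (Suc (Suc k)) *s b - (1 / z ^ Suc (Suc k)) *s (Z (Q z) - Z (P z))
          = (1 / z ^ Suc (Suc k)) *s (z *s Q' z - Z (Q z))"
        by eventually_elim (simp add: vec_eq_iff E_def Q'_def field_simps)
    qed
  qed (use P in \<open>auto simp: Q_def Q'_def\<close>)
qed

section \<open>Convergence to a separatrix\<close>

text \<open>Integration along the segment from 0 to \<open>z\<close>. Besides raising the exponent
  it divides by \<open>Suc m\<close>, and this factor is what overcomes the Lipschitz constant in
  \<open>separatrix\<close>.\<close>

lemma vderiv_growth: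
  fixes \<gamma> :: "complex \<Rightarrow> complex^'n"
  assumes d: "\<And>z. z \<in> ball 0 \<rho> \<Longrightarrow> has_vderiv \<gamma> (w z) z" and 0: "\<gamma> 0 = 0"
    and w: "\<And>z. z \<in> ball 0 \<rho> \<Longrightarrow> z \<noteq> 0 \<Longrightarrow> norm (w z) \<le> C * norm z ^ m" and z: "z \<in> ball 0 \<rho>"
  shows "norm (\<gamma> z) \<le> C / real (Suc m) * norm z ^ Suc m"
proof (cases "z = 0")
  case True
  then show ?thesis using 0 by simp
next
  case False
  have inb: "of_real \<sigma> * z \<in> ball 0 \<rho>" if "\<sigma> \<in> {0..1}" for \<sigma>
  proof -
    have "norm (of_real \<sigma> * z) \<le> 1 * norm z" unfolding norm_mult using that by (intro mult_right_mono) auto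
    then show ?thesis using z by simp
  qed
  have vd: "((\<lambda>\<sigma>. \<gamma> (of_real \<sigma> * z)) has_vector_derivative (z *s w (of_real \<sigma> * z))) (at \<sigma>)" if "\<sigma> \<in> {0..1}" for \<sigma> :: real
  proof -
    have "((\<lambda>\<sigma>::real. complex_of_real \<sigma> * z) has_derivative (\<lambda>h. of_real h * z)) (at \<sigma>)"
      by (auto intro!: derivative_eq_intros)
    from diff_chain_at[OF this d[OF inb[OF that]]]
    show ?thesis unfolding has_vector_derivative_def o_def
      by (rule has_derivative_eq_rhs) (simp add: fun_eq_iff vec_eq_iff scaleR_conv_of_real[where 'a = complex])
  qed
  have "norm (\<gamma> (of_real 1 * z) - \<gamma> (of_real 0 * z)) \<le>
      C * norm z ^ Suc m / real (Suc m) * 1 ^ Suc m - C * norm z ^ Suc m / real (Suc m) * 0 ^ Suc m"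
  proof (rule differentiable_bound_general[where f = "\<lambda>\<sigma>. \<gamma> (of_real \<sigma> * z)" and \<phi> = "\<lambda>\<sigma>. C * norm z ^ Suc m / real (Suc m) * \<sigma> ^ Suc m"
        and f' = "\<lambda>\<sigma>. z *s w (of_real \<sigma> * z)" and \<phi>' = "\<lambda>\<sigma>. C * norm z ^ Suc m * \<sigma> ^ m"])
    show "continuous_on {0..1} (\<lambda>\<sigma>. \<gamma> (complex_of_real \<sigma> * z))"
      by (intro continuous_at_imp_continuous_on ballI has_vector_derivative_continuous[OF vd])
    fix \<sigma> :: real assume s: "0 < \<sigma>" "\<sigma> < 1"
    show "((\<lambda>\<sigma>. \<gamma> (of_real \<sigma> * z)) has_vector_derivative (z *s w (of_real \<sigma> * z))) (at \<sigma>)"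
      by (rule vd) (use s in auto)
    have "((\<lambda>\<sigma>. \<sigma> ^ Suc m) has_real_derivative (real (Suc m) * \<sigma> ^ m)) (at \<sigma>)"
      using DERIV_pow[of "Suc m" \<sigma>] by simp
    then have "((\<lambda>\<sigma>. C * norm z ^ Suc m / real (Suc m) * \<sigma> ^ Suc m) has_real_derivative (C * norm z ^ Suc m * \<sigma> ^ m)) (at \<sigma>)"
      by (rule DERIV_cong[OF DERIV_cmult]) (simp del: power_Suc of_nat_Suc)
    then show "((\<lambda>\<sigma>. C * norm z ^ Suc m / real (Suc m) * \<sigma> ^ Suc m) has_vector_derivative (C * norm z ^ Suc m * \<sigma> ^ m)) (at \<sigma>)"
      by (simp only: has_real_derivative_iff_has_vector_derivative)
    have "norm (z *s w (of_real \<sigma> * z)) \<le> norm z * (C * norm (of_real \<sigma> * z) ^ m)"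
      unfolding norm_cscale by (intro mult_left_mono w inb) (use s False in auto)
    also have "\<dots> = C * norm z ^ Suc m * \<sigma> ^ m" using s by (simp add: norm_mult power_mult_distrib)
    finally show "norm (z *s w (of_real \<sigma> * z)) \<le> C * norm z ^ Suc m * \<sigma> ^ m" .
  qed (auto intro!: continuous_intros)
  then show ?thesis using 0 by simp
qed

lemma holomorphic_vec_divide:
  fixes f :: "complex \<Rightarrow> complex^'n"
  assumes "\<And>i. (\<lambda>z. f z $ i) holomorphic_on ball 0 \<rho>" "f 0 = 0"
  obtains g where "\<And>i. (\<lambda>z. g z $ i) holomorphic_on ball 0 \<rho>" "\<And>z. z \<noteq> 0 \<Longrightarrow> g z = (1 / z) *s f z"
proof -
  define g where "g = (\<lambda>z. \<chi> i. if z = 0 then deriv (\<lambda>z. f z $ i) 0 else (f z $ i - f 0 $ i) / (z - 0))"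
  show ?thesis
  proof (rule that[of g])
    show "(\<lambda>z. g z $ i) holomorphic_on ball 0 \<rho>" for i
      using pole_lemma_open[OF assms(1)[of i] open_ball, of 0] by (simp add: g_def)
    show "g z = (1 / z) *s f z" if "z \<noteq> 0" for z
      using that assms(2) by (simp add: g_def vec_eq_iff)
  qed
qed

lemma has_vderiv_quadratic:
  fixes \<gamma> :: "complex \<Rightarrow> complex^'n"
  assumes P: "has_vderiv P v 0" and \<rho>: "\<rho> > 0" and d: "\<And>z. z \<in> ball 0 \<rho> \<Longrightarrow> norm (\<gamma> z - P z) \<le> C * norm z ^ 2"
  shows "has_vderiv \<gamma> v 0"
proof -
  have C: "0 \<le> C"
    using order_trans[OF norm_ge_zero d[of "of_real (\<rho>/2)"]] \<rho> by (auto simp: zero_le_mult_iff)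
  have "has_vderiv (\<lambda>z. \<gamma> z - P z) 0 0"
    unfolding has_derivative_at_alt
  proof (intro conjI allI impI)
    show "bounded_linear (\<lambda>h. h *s (0 :: complex^'n))" by (rule bounded_linear_cscale)
    fix e :: real assume e: "e > 0"
    have z0: "\<gamma> 0 - P 0 = 0" using d[of 0] \<rho> by simp
    show "\<exists>d>0. \<forall>y. norm (y - 0) < d \<longrightarrow> norm (\<gamma> y - P y - (\<gamma> 0 - P 0) - (y - 0) *s 0) \<le> e * norm (y - 0)"
    proof (intro exI[of _ "min \<rho> (e / (C + 1))"] conjI allI impI)
      show "min \<rho> (e / (C + 1)) > 0" using \<rho> e C by simp
      fix y :: complex assume y: "norm (y - 0) < min \<rho> (e / (C + 1))"
      then have "(C + 1) * norm y \<le> e" using C by (simp add: field_simps)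
      then have "C * norm y + norm y \<le> e" by (simp add: algebra_simps)
      then have "C * norm y \<le> e" using norm_ge_zero[of y] by linarith
      then have "C * norm y * norm y \<le> e * norm y" by (intro mult_right_mono) auto
      then show "norm (\<gamma> y - P y - (\<gamma> 0 - P 0) - (y - 0) *s 0) \<le> e * norm (y - 0)"
        using d[of y] y z0 by (simp add: power2_eq_square mult.assoc)
    qed
  qed
  from has_derivative_add[OF this P] show ?thesis by simp
qed

text \<open>Iteration of the map sending a curve \<gamma> to the primitive of Z(\<gamma>)/z. The
  equation is singular at 0, so a small radius would not give a contraction; instead the curves are
  required to agree with an approximate solution \<open>P\<close> to order m + 1, on which class the
  map contracts by \<Lambda>/(m + 1).\<close>

lemma separatrix:
  fixes Z :: "complex^'n \<Rightarrow> complex^'n"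
  assumes Z: "hol_vf (ball 0 r) Z" "r > 0" "Z 0 = 0" and B: "(Z has_derivative B) (at 0)" "\<And>c w. B (c *s w) = c *s B w"
    and v: "B v = v" and nonres: "\<And>j w. j \<ge> 2 \<Longrightarrow> w \<noteq> 0 \<Longrightarrow> B w \<noteq> of_nat j *s w"
  obtains \<rho> \<Gamma> where "\<rho> > 0" "\<Gamma> 0 = 0" "\<And>z. z \<in> ball 0 \<rho> \<Longrightarrow> \<Gamma> z \<in> ball 0 r" "has_vderiv \<Gamma> v 0"
    "\<And>z. z \<in> ball 0 \<rho> \<Longrightarrow> z \<noteq> 0 \<Longrightarrow> has_vderiv \<Gamma> ((1 / z) *s Z (\<Gamma> z)) z"
proof -
  have "{0} \<subseteq> ball (0::complex^'n) r" using Z by simp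
  then obtain \<rho>0 M0 \<Lambda> where b: "\<rho>0 > 0" "M0 > 0" "\<Lambda> > 0"
    "\<And>x. x \<in> {0::complex^'n} \<Longrightarrow> cball x \<rho>0 \<subseteq> ball 0 r"
    "\<And>x y. x \<in> {0} \<Longrightarrow> y \<in> cball x \<rho>0 \<Longrightarrow> norm (Z y) \<le> M0"
    "\<And>x y y'. x \<in> {0} \<Longrightarrow> y \<in> cball x \<rho>0 \<Longrightarrow> y' \<in> cball x \<rho>0 \<Longrightarrow> norm (Z y - Z y') \<le> \<Lambda> * norm (y - y')"
    by (rule hol_vf_local_bounds[OF Z(1) compact_sing _ open_ball order_refl]) (rule that; assumption)
  note Lip = b(6)[OF singletonI]
  \<comment> \<open>This gives \<Lambda>/(m + 1) \<le> 1/2 for the contraction and (\<Lambda> +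
    1)/(m + 1) \<le> 1 for staying in the class \<open>Q\<close>, the extra 1 being the error of
    \<open>P\<close>.\<close>
  obtain m where m: "real m \<ge> 2 * \<Lambda> + 1" using real_arch_simple by blast
  have m1: "m \<ge> 1" using m b(3) by (cases m) auto
  obtain P P' where P: "P 0 = 0" "P' 0 = v" "\<And>z. has_vderiv P (P' z) z"
    and lim: "((\<lambda>z. (1 / z ^ Suc m) *s (z *s P' z - Z (P z))) \<longlongrightarrow> 0) (at 0)"
    using formal_separatrix[OF Z B v nonres, of m] by blast
  obtain d1 where d1: "d1 > 0" "\<And>z. z \<noteq> 0 \<Longrightarrow> dist z 0 < d1 \<Longrightarrow> norm ((1 / z ^ Suc m) *s (z *s P' z - Z (P z))) < 1"
    using tendstoD[OF lim zero_less_one] unfolding eventually_at by auto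
  have "isCont P 0" by (rule has_vderiv_imp_continuous[OF P(3)])
  then obtain d2 where d2: "d2 > 0" "\<And>z. dist z 0 < d2 \<Longrightarrow> dist (P z) (P 0) < \<rho>0/2"
    unfolding continuous_at_eps_delta using b(1) half_gt_zero by blast
  define \<rho> where "\<rho> = min (min d1 d2) (min 1 (\<rho>0/2))"
  have \<rho>: "\<rho> > 0" "\<rho> \<le> d1" "\<rho> \<le> d2" "\<rho> \<le> 1" "\<rho> \<le> \<rho>0/2" using d1 d2 b by (auto simp: \<rho>_def)
  have E: "norm (z *s P' z - Z (P z)) \<le> norm z ^ Suc m" if "z \<in> ball 0 \<rho>" "z \<noteq> 0" for z
  proof -
    have "norm (1 / z ^ Suc m) * norm (z *s P' z - Z (P z)) < 1"
      unfolding norm_cscale[symmetric] by (rule d1(2)) (use that \<rho> in auto)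
    then have "norm (z *s P' z - Z (P z)) / norm z ^ Suc m < 1"
      by (simp only: norm_divide norm_power norm_one times_divide_eq_left mult_1)
    moreover have "norm z ^ Suc m > 0" using that(2) by simp
    ultimately show ?thesis by (simp add: pos_divide_less_eq del: power_Suc)
  qed
  have pw: "norm z ^ Suc m \<le> norm z" "norm z ^ Suc m \<le> norm z ^ 2" "norm z ^ m \<le> 1" if "z \<in> ball 0 \<rho>" for z
    using that \<rho> m1 power_decreasing[of 1 "Suc m" "norm z"] power_decreasing[of 2 "Suc m" "norm z"] by (auto intro!: power_le_one)
  have inb: "y \<in> cball 0 \<rho>0" if "z \<in> ball 0 \<rho>" "norm (y - P z) \<le> norm z ^ Suc m" for y z
  proof -
    have "norm y \<le> norm (y - P z) + norm (P z)" using norm_triangle_ineq[of "y - P z" "P z"] by simp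
    also have "\<dots> \<le> \<rho>0/2 + \<rho>0/2"
    proof (rule add_mono)
      show "norm (y - P z) \<le> \<rho>0/2" using that pw(1)[OF that(1)] \<rho> by auto
      show "norm (P z) \<le> \<rho>0/2" using d2(2)[of z] that \<rho> P(1) by simp
    qed
    finally show ?thesis by simp
  qed
  have in0r: "cball 0 \<rho>0 \<subseteq> ball (0::complex^'n) r" by (rule b(4)[OF singletonI])
  have Pin: "P z \<in> cball 0 \<rho>0" if "z \<in> ball 0 \<rho>" for z by (rule inb[OF that]) simp
  define Q where "Q = (\<lambda>n::nat. \<lambda>\<gamma>. \<gamma> 0 = 0 \<and> (\<forall>z\<in>ball 0 \<rho>. norm (\<gamma> z - P z) \<le> norm z ^ Suc m \<and> (\<exists>w. has_vderiv \<gamma> w z)))"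
  define T where "T = (\<lambda>n::nat. \<lambda>\<gamma> \<gamma>'. \<forall>z\<in>ball 0 \<rho>. z \<noteq> 0 \<longrightarrow> has_vderiv \<gamma>' ((1 / z) *s Z (\<gamma> z)) z)"
  have "\<exists>f. \<forall>n. Q n (f n) \<and> T n (f n) (f (Suc n))"
  proof (rule dependent_nat_choice)
    show "\<exists>\<gamma>. Q 0 \<gamma>" unfolding Q_def using P by (intro exI[of _ P]) auto
  next
    fix \<gamma> n assume Q: "Q n \<gamma>"
    have \<gamma>: "norm (\<gamma> z - P z) \<le> norm z ^ Suc m" "\<gamma> z \<in> cball 0 \<rho>0" "\<exists>w. has_vderiv \<gamma> w z" if "z \<in> ball 0 \<rho>" for z
      using Q that inb[OF that] by (auto simp: Q_def)
    have "(\<lambda>z. Z (\<gamma> z) $ i) holomorphic_on ball 0 \<rho>" for i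
      by (rule hol_vf_curve[OF Z(1)]) (use \<gamma> in0r in blast)+
    moreover have "Z (\<gamma> 0) = 0" using Q Z(3) by (simp add: Q_def)
    ultimately obtain g where g: "\<And>i. (\<lambda>z. g z $ i) holomorphic_on ball 0 \<rho>" "\<And>z. z \<noteq> 0 \<Longrightarrow> g z = (1 / z) *s Z (\<gamma> z)"
      using holomorphic_vec_divide[of "\<lambda>z. Z (\<gamma> z)" \<rho>] by blast
    obtain \<gamma>' where \<gamma>': "\<gamma>' 0 = 0" "\<And>z. z \<in> ball 0 \<rho> \<Longrightarrow> has_vderiv \<gamma>' (g z) z"
      using vderiv_primitive[of "ball 0 \<rho>" g 0 0] g(1) \<rho>(1) by auto
    have gr: "norm (\<gamma>' z - P z) \<le> (\<Lambda> + 1) / real (Suc m) * norm z ^ Suc m" if z: "z \<in> ball 0 \<rho>" for z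
    proof (rule vderiv_growth[of \<rho> "\<lambda>z. \<gamma>' z - P z" "\<lambda>z. g z - P' z"])
      show "has_vderiv (\<lambda>z. \<gamma>' z - P z) (g z - P' z) z" if "z \<in> ball 0 \<rho>" for z
        using has_derivative_diff[OF \<gamma>'(2)[OF that] P(3)[of z]] by simp
      fix z :: complex assume z: "z \<in> ball 0 \<rho>" "z \<noteq> 0"
      have "norm (Z (\<gamma> z) - Z (P z)) \<le> \<Lambda> * norm (\<gamma> z - P z)" by (rule Lip[OF \<gamma>(2)[OF z(1)] Pin[OF z(1)]])
      also have "\<dots> \<le> \<Lambda> * norm z ^ Suc m" using \<gamma>(1)[OF z(1)] b(3) by (intro mult_left_mono) auto
      finally have "norm ((Z (\<gamma> z) - Z (P z)) - (z *s P' z - Z (P z))) \<le> \<Lambda> * norm z ^ Suc m + norm z ^ Suc m"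
        using norm_triangle_ineq4[of "Z (\<gamma> z) - Z (P z)" "z *s P' z - Z (P z)"] E[OF z] by linarith
      then have "norm (Z (\<gamma> z) - z *s P' z) \<le> (\<Lambda> + 1) * norm z ^ m * norm z" by (simp add: algebra_simps)
      moreover have "g z - P' z = (1 / z) *s (Z (\<gamma> z) - z *s P' z)"
        using z(2) by (simp add: g(2) vec_eq_iff field_simps)
      ultimately show "norm (g z - P' z) \<le> (\<Lambda> + 1) * norm z ^ m"
        using z(2) by (simp only: norm_cscale) (simp add: norm_divide divide_simps)
    qed (use \<gamma>' P z in auto)
    have "(\<Lambda> + 1) / real (Suc m) \<le> 1" using m b(3) by simp
    then have le: "(\<Lambda> + 1) / real (Suc m) * norm z ^ Suc m \<le> 1 * norm z ^ Suc m" for z :: complex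
      by (rule mult_right_mono) simp
    have "norm (\<gamma>' z - P z) \<le> norm z ^ Suc m" if "z \<in> ball 0 \<rho>" for z
      using order_trans[OF gr[OF that] le] by simp
    then have "Q (Suc n) \<gamma>'" using \<gamma>' unfolding Q_def by blast
    moreover have "T n \<gamma> \<gamma>'" unfolding T_def
    proof (intro ballI impI)
      fix z :: complex assume z: "z \<in> ball 0 \<rho>" "z \<noteq> 0"
      show "has_vderiv \<gamma>' ((1 / z) *s Z (\<gamma> z)) z" using \<gamma>'(2)[OF z(1)] unfolding g(2)[OF z(2)] .
    qed
    ultimately show "\<exists>\<gamma>'. Q (Suc n) \<gamma>' \<and> T n \<gamma> \<gamma>'" by blast
  qed
  then obtain f where "\<forall>n. Q n (f n) \<and> T n (f n) (f (Suc n))" ..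
  then have QT: "Q n (f n)" "T n (f n) (f (Suc n))" for n by simp_all
  have f: "f n 0 = 0" "\<And>z. z \<in> ball 0 \<rho> \<Longrightarrow> norm (f n z - P z) \<le> norm z ^ Suc m"
     "\<And>z. z \<in> ball 0 \<rho> \<Longrightarrow> z \<noteq> 0 \<Longrightarrow> has_vderiv (f (Suc n)) ((1 / z) *s Z (f n z)) z"
     "\<And>z. z \<in> ball 0 \<rho> \<Longrightarrow> f n z \<in> cball 0 \<rho>0" for n
    using QT[of n] inb by (auto simp: Q_def T_def)
  \<comment> \<open>The right-hand side completed by its value at 0: the iterates are quadratically
    close to \<open>P\<close> and so have the velocity \<open>v\<close> there.\<close>
  define w where "w = (\<lambda>\<gamma> z. if z = 0 then v else (1 / z) *s Z (\<gamma> z))"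
  have fd: "has_vderiv (f (Suc n)) (w (f n) z) z" if z: "z \<in> ball 0 \<rho>" for n z
  proof (cases "z = 0")
    case True
    have "has_vderiv (f (Suc n)) v 0"
    proof (rule has_vderiv_quadratic[of P v \<rho> _ 1])
      show "has_vderiv P v 0" using P(3)[of 0] P(2) by simp
      show "norm (f (Suc n) z - P z) \<le> 1 * norm z ^ 2" if "z \<in> ball 0 \<rho>" for z
        using f(2)[OF that, of "Suc n"] pw(2)[OF that] by simp
    qed (rule \<rho>(1))
    then show ?thesis using True by (simp add: w_def)
  next
    case False
    then show ?thesis using f(3)[OF z False] by (simp add: w_def)
  qed
  \<comment> \<open>Division by \<open>z\<close> loses one power, which integration in
    \<open>vderiv_growth\<close> restores.\<close>
  have wd: "norm (w \<gamma> z - w \<gamma>' z) \<le> (\<Lambda> * a) * norm z ^ m"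
    if z: "z \<in> ball 0 \<rho>" and y: "\<gamma> z \<in> cball 0 \<rho>0" "\<gamma>' z \<in> cball 0 \<rho>0" and a: "a \<ge> 0" "norm (\<gamma> z - \<gamma>' z) \<le> a * norm z ^ Suc m" for \<gamma> \<gamma>' z a
  proof (cases "z = 0")
    case True
    then show ?thesis using a b(3) by (simp add: w_def)
  next
    case False
    have "norm (Z (\<gamma> z) - Z (\<gamma>' z)) \<le> \<Lambda> * norm (\<gamma> z - \<gamma>' z)" by (rule Lip[OF y])
    also have "\<dots> \<le> \<Lambda> * (a * norm z ^ Suc m)" using a(2) b(3) by (intro mult_left_mono) auto
    finally have "norm (Z (\<gamma> z) - Z (\<gamma>' z)) / norm z \<le> (\<Lambda> * a) * norm z ^ m"
      using False by (simp add: divide_simps mult_ac)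
    moreover have "w \<gamma> z - w \<gamma>' z = (1 / z) *s (Z (\<gamma> z) - Z (\<gamma>' z))"
      using False by (simp add: w_def vec_eq_iff diff_divide_distrib)
    ultimately show ?thesis by (simp only: norm_cscale) (simp add: norm_divide)
  qed
  have step: "norm (f (Suc n) z - f n z) \<le> 2 * (1/2)^n * norm z ^ Suc m" if "z \<in> ball 0 \<rho>" for n z
    using that
  proof (induction n arbitrary: z)
    case 0
    have "norm ((f (Suc 0) z - P z) - (f 0 z - P z)) \<le> norm z ^ Suc m + norm z ^ Suc m"
      using norm_triangle_ineq4[of "f (Suc 0) z - P z" "f 0 z - P z"] f(2)[OF 0, of 0] f(2)[OF 0, of "Suc 0"] by linarith
    then show ?case by simp
  next
    case (Suc n)
    have "norm (f (Suc (Suc n)) z - f (Suc n) z) \<le> (\<Lambda> * (2 * (1/2)^n)) / real (Suc m) * norm z ^ Suc m"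
    proof (rule vderiv_growth[of \<rho> "\<lambda>z. f (Suc (Suc n)) z - f (Suc n) z" "\<lambda>z. w (f (Suc n)) z - w (f n) z"])
      show "has_vderiv (\<lambda>z. f (Suc (Suc n)) z - f (Suc n) z) (w (f (Suc n)) z - w (f n) z) z" if "z \<in> ball 0 \<rho>" for z
        using has_derivative_diff[OF fd[OF that, of "Suc n"] fd[OF that, of n]] by simp
      show "norm (w (f (Suc n)) z - w (f n) z) \<le> (\<Lambda> * (2 * (1/2)^n)) * norm z ^ m" if "z \<in> ball 0 \<rho>" for z
        by (rule wd[of z "f (Suc n)" "f n" "2 * (1/2)^n", OF that f(4)[OF that] f(4)[OF that] _ Suc.IH[OF that]]) simp
    qed (use f(1) Suc.prems in auto)
    also have "\<dots> \<le> 2 * (1/2)^Suc n * norm z ^ Suc m"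
    proof (rule mult_right_mono)
      have "\<Lambda> / real (Suc m) \<le> 1/2" using m by (simp add: field_simps)
      then have "2 * (1/2)^n * (\<Lambda> / real (Suc m)) \<le> 2 * (1/2)^n * (1/2)" by (intro mult_left_mono) auto
      then show "\<Lambda> * (2 * (1/2)^n) / real (Suc m) \<le> 2 * (1/2)^Suc n" by (simp add: mult_ac)
    qed simp
    finally show ?case .
  qed
  have "\<forall>z\<in>ball 0 \<rho>. \<exists>l. \<forall>n. norm (f n z - l) \<le> 4 * (1/2)^n * norm z ^ Suc m"
  proof
    fix z :: complex assume z: "z \<in> ball 0 \<rho>"
    obtain l where l: "\<And>n. norm (f n z - l) \<le> (2 * norm z ^ Suc m) * (1/2)^n / (1 - 1/2)"
    proof (rule geometric_Cauchy_limit[of "\<lambda>n. f n z" "2 * norm z ^ Suc m" "1/2"])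
      show "norm (f (Suc n) z - f n z) \<le> 2 * norm z ^ Suc m * (1/2)^n" for n
        using step[OF z, of n] by (simp add: mult_ac)
    qed auto
    show "\<exists>l. \<forall>n. norm (f n z - l) \<le> 4 * (1/2)^n * norm z ^ Suc m"
      by (rule exI[of _ l]) (use l in \<open>simp add: mult_ac\<close>)
  qed
  from bchoice[OF this] obtain \<Gamma> where "\<forall>z\<in>ball 0 \<rho>. \<forall>n. norm (f n z - \<Gamma> z) \<le> 4 * (1/2)^n * norm z ^ Suc m" ..
  then have \<Gamma>: "norm (f n z - \<Gamma> z) \<le> 4 * (1/2)^n * norm z ^ Suc m" if "z \<in> ball 0 \<rho>" for n z using that by blast
  have small: "\<forall>\<^sub>F n in sequentially. 4 * (1/2)^n < e" if "e > (0::real)" for e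
  proof -
    have "(\<lambda>n. 4 * (1/2::real)^n) \<longlonglongrightarrow> 4 * 0" by (intro tendsto_intros LIMSEQ_power_zero) auto
    then have lim: "(\<lambda>n. 4 * (1/2::real)^n) \<longlonglongrightarrow> 0" by (simp only: mult_zero_right)
    show ?thesis by (rule order_tendstoD(2)[OF lim that])
  qed
  have \<Gamma>1: "norm (f n z - \<Gamma> z) \<le> 4 * (1/2)^n" if z: "z \<in> ball 0 \<rho>" for n z
  proof -
    have "norm z ^ Suc m \<le> 1" using z \<rho> by (intro power_le_one) auto
    then have "4 * (1/2)^n * norm z ^ Suc m \<le> 4 * (1/2)^n * 1" by (intro mult_left_mono) auto
    then show ?thesis using \<Gamma>[OF z, of n] by linarith
  qed
  have conv: "(\<lambda>n. f n z) \<longlonglongrightarrow> \<Gamma> z" if z: "z \<in> ball 0 \<rho>" for z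
  proof (rule tendstoI)
    fix e :: real assume "e > 0"
    show "\<forall>\<^sub>F n in sequentially. dist (f n z) (\<Gamma> z) < e"
      using small[OF \<open>e > 0\<close>] by eventually_elim (simp add: dist_norm le_less_trans[OF \<Gamma>1[OF z]])
  qed
  have \<Gamma>in: "\<Gamma> z \<in> cball 0 \<rho>0" if z: "z \<in> ball 0 \<rho>" for z
    by (rule closed_sequentially[OF closed_cball _ conv[OF z]]) (use f(4)[OF z] in blast)
  have "\<exists>g. \<forall>z\<in>ball 0 \<rho>. (\<lambda>n. f (Suc n) z) \<longlonglongrightarrow> g z \<and> (g has_derivative (\<lambda>h. h *s w \<Gamma> z)) (at z within ball 0 \<rho>)"
  proof (rule has_derivative_sequence[where f' = "\<lambda>n z h. h *s w (f n) z" and ?x0.0 = 0])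
    show "(f (Suc n) has_derivative (\<lambda>h. h *s w (f n) z)) (at z within ball 0 \<rho>)" if "z \<in> ball 0 \<rho>" for n z
      using fd[OF that] has_derivative_at_withinI by blast
    show "\<forall>\<^sub>F n in sequentially. \<forall>z\<in>ball 0 \<rho>. \<forall>h. norm (h *s w (f n) z - h *s w \<Gamma> z) \<le> e * norm h" if "e > 0" for e
    proof -
      have "e / \<Lambda> > 0" using that b(3) by simp
      from small[OF this] show ?thesis
      proof eventually_elim
        case (elim n)
        show ?case
        proof (intro ballI allI)
          fix z h :: complex assume z: "z \<in> ball 0 \<rho>"
          have "norm (w (f n) z - w \<Gamma> z) \<le> (\<Lambda> * (4 * (1/2)^n)) * norm z ^ m"
            by (rule wd[of z "f n" \<Gamma> "4 * (1/2)^n", OF z f(4)[OF z] \<Gamma>in[OF z] _ \<Gamma>[OF z]]) simp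
          also have "\<dots> \<le> (\<Lambda> * (e / \<Lambda>)) * 1"
            using elim b(3) pw(3)[OF z] \<open>e > 0\<close> by (intro mult_mono) auto
          finally have le: "norm (w (f n) z - w \<Gamma> z) \<le> e" using b(3) by simp
          have eq: "h *s w (f n) z - h *s w \<Gamma> z = h *s (w (f n) z - w \<Gamma> z)"
            by (simp add: vec_eq_iff algebra_simps)
          show "norm (h *s w (f n) z - h *s w \<Gamma> z) \<le> e * norm h"
            unfolding eq norm_cscale mult.commute[of e] by (rule mult_left_mono) (use le in auto)
        qed
      qed
    qed
    show "(\<lambda>n. f (Suc n) 0) \<longlonglongrightarrow> 0" by (simp add: f(1))
    show "(0::complex) \<in> ball 0 \<rho>" using \<rho> by simp
    show "convex (ball (0::complex) \<rho>)" by simp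
  qed
  then obtain g where "\<forall>z\<in>ball 0 \<rho>. (\<lambda>n. f (Suc n) z) \<longlonglongrightarrow> g z \<and> (g has_derivative (\<lambda>h. h *s w \<Gamma> z)) (at z within ball 0 \<rho>)" ..
  then have g: "(\<lambda>n. f (Suc n) z) \<longlonglongrightarrow> g z" "(g has_derivative (\<lambda>h. h *s w \<Gamma> z)) (at z within ball 0 \<rho>)"
    if "z \<in> ball 0 \<rho>" for z using that by simp_all
  have geq: "g z = \<Gamma> z" if "z \<in> ball 0 \<rho>" for z
    using g(1)[OF that] LIMSEQ_Suc[OF conv[OF that]] LIMSEQ_unique by blast
  have gd: "has_vderiv g (w \<Gamma> z) z" if "z \<in> ball 0 \<rho>" for z
    using g(2)[OF that] unfolding at_within_open[OF that open_ball] .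
  show ?thesis
  proof (rule that[of \<rho> g])
    show "g 0 = 0" using g(1)[of 0] \<rho> by (simp add: f(1) LIMSEQ_const_iff)
    show "g z \<in> ball 0 r" if "z \<in> ball 0 \<rho>" for z using \<Gamma>in[OF that] geq[OF that] in0r by auto
    show "has_vderiv g v 0" using gd[of 0] \<rho> by (simp add: w_def)
    show "has_vderiv g ((1 / z) *s Z (g z)) z" if "z \<in> ball 0 \<rho>" "z \<noteq> 0" for z
      using gd[OF that(1)] that(2) geq[OF that(1)] by (simp add: w_def)
  qed (rule \<rho>(1))
qed

section \<open>Images of separatrices\<close>

text \<open>In the parameter of the separatrix the field is the linear one, z' =
  \<open>\<alpha>\<close> z. The hypothesis on \<open>h\<close> is stated with norms because
  \<open>flow\<close> needs the orbit over a whole disc of complex times.\<close>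

lemma separatrix_flow:
  fixes X :: "complex^'n \<Rightarrow> complex^'n"
  assumes X: "hol_vf S X" and \<alpha>: "\<alpha> \<noteq> 0"
    and \<Gamma>S: "\<And>z. z \<in> ball 0 R \<Longrightarrow> \<Gamma> z \<in> S"
    and \<Gamma>d: "\<And>z. z \<in> ball 0 R - {0} \<Longrightarrow> has_vderiv \<Gamma> ((1 / (\<alpha> * z)) *s X (\<Gamma> z)) z"
    and z: "z \<noteq> 0" and h: "norm z * exp (norm \<alpha> * norm h) < R"
  shows "flow X S h (\<Gamma> z) = \<Gamma> (z * exp (\<alpha> * h))"
proof -
  \<comment> \<open>The time at which \<open>norm z * exp (norm \<alpha> * \<eta>)\<close> reaches
    \<open>R\<close>.\<close>
  define \<eta> where "\<eta> = ln (R / norm z) / norm \<alpha>"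
  have "0 < norm z * exp (norm \<alpha> * norm h)" using z by simp
  then have R: "R > 0" using h by linarith
  have lt: "norm t < \<eta> \<longleftrightarrow> norm z * exp (norm \<alpha> * norm t) < R" for t :: complex
  proof -
    have "norm t < \<eta> \<longleftrightarrow> norm \<alpha> * norm t < ln (R / norm z)"
      using \<alpha> by (simp add: \<eta>_def pos_less_divide_eq mult.commute)
    also have "\<dots> \<longleftrightarrow> exp (norm \<alpha> * norm t) < R / norm z"
      using R z by (metis divide_pos_pos exp_less_cancel_iff exp_ln zero_less_norm_iff)
    also have "\<dots> \<longleftrightarrow> norm z * exp (norm \<alpha> * norm t) < R" using z by (simp add: pos_less_divide_eq mult.commute)
    finally show ?thesis .
  qed
  have inb: "z * exp (\<alpha> * t) \<in> ball 0 R - {0}" if "norm t < \<eta>" for t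
  proof -
    have "Re (\<alpha> * t) \<le> norm (\<alpha> * t)" by (rule complex_Re_le_cmod)
    then have "exp (Re (\<alpha> * t)) \<le> exp (norm \<alpha> * norm t)" by (simp add: norm_mult)
    then have "norm (z * exp (\<alpha> * t)) \<le> norm z * exp (norm \<alpha> * norm t)"
      by (simp only: norm_mult norm_exp_eq_Re) (simp add: mult_left_mono)
    then show ?thesis using lt[of t] that z by simp
  qed
  have "integral_curve X S (ball 0 \<eta>) (\<lambda>t. \<Gamma> (z * exp (\<alpha> * t)))"
    unfolding integral_curve_def
  proof (intro conjI ballI)
    fix t :: complex assume "t \<in> ball 0 \<eta>"
    then have t: "norm t < \<eta>" by simp
    show "\<Gamma> (z * exp (\<alpha> * t)) \<in> S" using inb[OF t] \<Gamma>S by blast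
    have "((\<lambda>t. z * exp (\<alpha> * t)) has_field_derivative (\<alpha> * (z * exp (\<alpha> * t)))) (at t)"
      by (auto intro!: derivative_eq_intros)
    then have "((\<lambda>t. z * exp (\<alpha> * t)) has_derivative (\<lambda>h. (\<alpha> * (z * exp (\<alpha> * t))) * h)) (at t)"
      by (simp only: has_field_derivative_def)
    from diff_chain_at[OF this \<Gamma>d[OF inb[OF t]]]
    show "has_vderiv (\<lambda>t. \<Gamma> (z * exp (\<alpha> * t))) (X (\<Gamma> (z * exp (\<alpha> * t)))) t"
      unfolding o_def by (rule has_derivative_eq_rhs) (use \<alpha> z in \<open>simp add: fun_eq_iff vec_eq_iff\<close>)
  qed auto
  then show ?thesis using flow_eq[OF X, of \<eta> "\<lambda>t. \<Gamma> (z * exp (\<alpha> * t))" h "\<Gamma> z"] lt[of h] h by simp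
qed

text \<open>The chart at \<open>z0\<close> is the Y-time from the image of \<open>z0\<close> to that
  of \<open>z\<close>. The point at issue is a common \<epsilon>: over a closed annulus these times
  form a continuous family of injective functions on one disc, so their index is constant, and each
  annulus used contains the base point \<open>zb\<close>, where different families agree.\<close>

lemma charts_exist:
  fixes X Y :: "complex^'n \<Rightarrow> complex^'n"
  assumes X: "hol_vf S X" and Y: "hol_vf T Y" and U: "open U" "U \<subseteq> S" and V: "open V" "V \<subseteq> T"
    and hom: "homeomorphism U V \<phi> \<psi>"
    and leaf: "\<And>x. x \<in> U \<Longrightarrow> X x \<noteq> 0 \<Longrightarrow> \<phi> ` leaf X U x \<subseteq> leaf Y V (\<phi> x)"
    and \<alpha>: "\<alpha> \<noteq> 0" and R: "R > 0" and \<Gamma>U: "\<And>z. z \<in> ball 0 R \<Longrightarrow> \<Gamma> z \<in> U"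
    and \<Gamma>c: "continuous_on (ball 0 R) \<Gamma>"
    and \<Gamma>d: "\<And>z. z \<in> ball 0 R - {0} \<Longrightarrow> has_vderiv \<Gamma> ((1 / (\<alpha> * z)) *s X (\<Gamma> z)) z"
    and nz: "\<And>z. z \<in> ball 0 R - {0} \<Longrightarrow> X (\<Gamma> z) \<noteq> 0 \<and> Y (\<phi> (\<Gamma> z)) \<noteq> 0"
  obtains F \<epsilon> where "curve_charts R F \<epsilon>"
    "\<And>z0. z0 \<in> ball 0 R - {0} \<Longrightarrow> \<forall>\<^sub>F z in nhds z0. \<phi> (\<Gamma> z) = flow Y T (F z0 z) (\<phi> (\<Gamma> z0))"
proof -
  have phiV: "\<phi> x \<in> T" if "x \<in> U" for x using hom that V unfolding homeomorphism_def by blast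
  define zb where "zb = complex_of_real (R / 2)"
  have zb: "zb \<in> ball 0 R - {0}" "norm zb = R/2" using R by (auto simp: zb_def)
  \<comment> \<open>Below this bound Y-times from the image of the base point are unique, which
    links the families belonging to different annuli.\<close>
  obtain eb where eb: "eb > 0" "\<And>y. y \<in> {\<phi> (\<Gamma> zb)} \<Longrightarrow> inj_on (\<lambda>t. flow Y T t y) (ball 0 eb)"
  proof (rule flow_inj[OF Y compact_sing])
    show "{\<phi> (\<Gamma> zb)} \<subseteq> T" using phiV \<Gamma>U zb by blast
    show "Y x \<noteq> 0" if "x \<in> {\<phi> (\<Gamma> zb)}" for x using that nz zb by blast
  qed (rule that; assumption)
  define Ann where "Ann = (\<lambda>a b. {z::complex. a \<le> norm (z - 0) \<and> norm (z - 0) \<le> b})"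
  define good where "good = (\<lambda>a b \<delta> \<theta>. continuous_on (Ann a b \<times> cball 0 \<delta>) (\<lambda>(z, w). \<theta> z w) \<and> (\<forall>z\<in>Ann a b. \<theta> z 0 = 0 \<and> inj_on (\<theta> z) (cball 0 \<delta>) \<and>
      (\<forall>w\<in>cball 0 \<delta>. norm (\<theta> z w) < eb \<and> \<phi> (\<Gamma> (z + w)) = flow Y T (\<theta> z w) (\<phi> (\<Gamma> z)))))"
  \<comment> \<open>A displacement \<open>w\<close> of the parameter corresponds to the X-time h
    with z exp(\<alpha> h) = z + w, that is to \<open>L (w / z)\<close>; \<open>time_change\<close>
    converts it into a Y-time.\<close>
  have L1: "\<exists>\<delta>>0. \<exists>\<theta>. good a b \<delta> \<theta>"
    if ab: "0 < a" "a \<le> b" "b < R" for a b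
  proof -
    have AnnR: "Ann a b \<subseteq> ball 0 R - {0}" using ab by (auto simp: Ann_def)
    have "Ann a b = cball 0 b - ball 0 a" by (auto simp: Ann_def)
    then have comA: "compact (Ann a b)" by (simp add: compact_diff)
    define K where "K = \<Gamma> ` Ann a b"
    have \<Gamma>cA: "continuous_on (Ann a b) \<Gamma>" by (rule continuous_on_subset[OF \<Gamma>c]) (use AnnR in blast)
    have K: "compact K" "K \<subseteq> U"
      unfolding K_def using compact_continuous_image[OF \<Gamma>cA comA] AnnR \<Gamma>U by auto
    have nzK: "X x \<noteq> 0" "Y (\<phi> x) \<noteq> 0" if "x \<in> K" for x using that nz AnnR unfolding K_def by blast+
    obtain \<eta> \<tau> where \<eta>: "\<eta> > 0"
      and \<tau>: "\<And>x h. x \<in> K \<Longrightarrow> norm h \<le> \<eta> \<Longrightarrow>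
         flow X S h x \<in> U \<and> norm (\<tau> x h) < eb \<and> \<phi> (flow X S h x) = flow Y T (\<tau> x h) (\<phi> x)"
      and \<tau>i: "\<And>x. x \<in> K \<Longrightarrow> inj_on (\<tau> x) (cball 0 \<eta>)" and \<tau>0: "\<And>x. x \<in> K \<Longrightarrow> \<tau> x 0 = 0"
      and \<tau>c: "continuous_on (K \<times> cball 0 \<eta>) (\<lambda>(x, h). \<tau> x h)"
      by (rule time_change[OF X Y U V hom leaf K nzK eb(1)]) (assumption | rule that; assumption)+
    \<comment> \<open>The second bound keeps \<open>b * exp (norm \<alpha> * norm h)\<close> below
      \<open>R\<close>, so that every point of the annulus can be moved for time \<open>h\<close>
      inside the domain of \<open>\<Gamma>\<close>.\<close>
    define \<eta>2 where "\<eta>2 = min \<eta> (ln (R / b) / (2 * norm \<alpha>))"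
    have lnR: "ln (R / b) > 0" using ab by simp
    have \<eta>2: "\<eta>2 > 0" "\<eta>2 \<le> \<eta>" "\<eta>2 \<le> ln (R / b) / (2 * norm \<alpha>)" using \<eta> lnR \<alpha> by (auto simp: \<eta>2_def)
    have bR: "b * exp (norm \<alpha> * norm h) < R" if "norm h \<le> \<eta>2" for h :: complex
    proof -
      have "norm \<alpha> * norm h \<le> norm \<alpha> * (ln (R / b) / (2 * norm \<alpha>))"
        using that \<eta>2(3) by (intro mult_left_mono) auto
      also have "\<dots> = ln (R / b) / 2" using \<alpha> by simp
      also have "\<dots> < ln (R / b)" using lnR by simp
      finally have "exp (norm \<alpha> * norm h) < exp (ln (R / b))" by (simp only: exp_less_cancel_iff)
      also have "\<dots> = R / b" using ab by simp
      finally have "exp (norm \<alpha> * norm h) < R / b" .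
      then show ?thesis using ab by (simp add: field_simps)
    qed
    define L where "L = (\<lambda>u. Ln (1 + u) / \<alpha>)"
    have "isCont L 0" unfolding L_def using \<alpha> by (auto intro!: continuous_intros)
    then obtain d where d: "d > 0" "\<And>u. dist u 0 < d \<Longrightarrow> dist (L u) (L 0) < \<eta>2"
      unfolding continuous_at_eps_delta using \<eta>2(1) by blast
    define d' where "d' = min d 1 / 2"
    have d': "d' > 0" "d' < d" "d' < 1" using d by (auto simp: d'_def)
    have one: "1 + u \<notin> \<real>\<^sub>\<le>\<^sub>0" "1 + u \<noteq> 0" if "norm u \<le> d'" for u :: complex
    proof -
      have "Re (1 + u) > 0" using abs_Re_le_cmod[of u] that d' by simp
      then show "1 + u \<notin> \<real>\<^sub>\<le>\<^sub>0" by (auto simp: complex_nonpos_Reals_iff)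
      show "1 + u \<noteq> 0" using \<open>Re (1 + u) > 0\<close> by (metis less_irrefl zero_complex.simps(1))
    qed
    have Lb: "norm (L u) \<le> \<eta>2" if "norm u \<le> d'" for u
      using d(2)[of u] that d' by (simp add: L_def less_imp_le)
    have expL: "exp (\<alpha> * L u) = 1 + u" if "norm u \<le> d'" for u
      using one[OF that] \<alpha> by (simp add: L_def)
    \<comment> \<open>With \<open>a \<le> norm z\<close> on the annulus this yields
      \<open>norm (w / z) \<le> d'\<close> for all its points at once.\<close>
    define \<delta> where "\<delta> = a * d'"
    have \<delta>: "\<delta> > 0" using ab d' by (simp add: \<delta>_def)
    have wz: "norm (w / z) \<le> d'" "z \<noteq> 0" if "z \<in> Ann a b" "w \<in> cball 0 \<delta>" for w z
    proof -
      have "a \<le> norm z" using that by (simp add: Ann_def)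
      then show "z \<noteq> 0" using ab by auto
      have "norm w \<le> a * d'" using that by (simp add: \<delta>_def)
      also have "\<dots> \<le> norm z * d'" using \<open>a \<le> norm z\<close> d' by (intro mult_right_mono) auto
      finally show "norm (w / z) \<le> d'" using \<open>z \<noteq> 0\<close> by (simp add: norm_divide divide_le_eq mult.commute)
    qed
    define \<theta> where "\<theta> = (\<lambda>z w. \<tau> (\<Gamma> z) (L (w / z)))"
    show ?thesis
      unfolding good_def
    proof (intro exI[of _ \<delta>] exI[of _ \<theta>] conjI ballI \<delta>)
      have "continuous_on (Ann a b \<times> cball 0 \<delta>) (\<lambda>p. (\<lambda>(x, h). \<tau> x h) (\<Gamma> (fst p), L (snd p / fst p)))"
      proof (rule continuous_on_compose2[OF \<tau>c])
        have 1: "continuous_on (Ann a b \<times> cball 0 \<delta>) (\<lambda>p. \<Gamma> (fst p))"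
          by (rule continuous_on_compose2[OF \<Gamma>cA]) (auto intro!: continuous_intros)
        have 2: "continuous_on (Ann a b \<times> cball 0 \<delta>) (\<lambda>p. L (snd p / fst p))"
          unfolding L_def using wz one \<alpha> by (auto intro!: continuous_intros)
        show "continuous_on (Ann a b \<times> cball 0 \<delta>) (\<lambda>p. (\<Gamma> (fst p), L (snd p / fst p)))"
          by (rule continuous_on_Pair[OF 1 2])
        show "(\<lambda>p. (\<Gamma> (fst p), L (snd p / fst p))) ` (Ann a b \<times> cball 0 \<delta>) \<subseteq> K \<times> cball 0 \<eta>"
        proof
          fix q assume "q \<in> (\<lambda>p. (\<Gamma> (fst p), L (snd p / fst p))) ` (Ann a b \<times> cball 0 \<delta>)"
          then obtain z w where zw: "z \<in> Ann a b" "w \<in> cball 0 \<delta>" "q = (\<Gamma> z, L (w / z))" by auto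
          have "norm (L (w / z)) \<le> \<eta>" using Lb[OF wz(1)[OF zw(1,2)]] \<eta>2(2) by linarith
          then show "q \<in> K \<times> cball 0 \<eta>" using zw by (auto simp: K_def)
        qed
      qed
      then show "continuous_on (Ann a b \<times> cball 0 \<delta>) (\<lambda>(z, w). \<theta> z w)" by (simp add: \<theta>_def case_prod_beta)
      fix z assume z: "z \<in> Ann a b"
      then have zK: "\<Gamma> z \<in> K" by (simp add: K_def)
      show "\<theta> z 0 = 0" using \<tau>0[OF zK] by (simp add: \<theta>_def L_def)
      show "inj_on (\<theta> z) (cball 0 \<delta>)"
      proof (rule inj_onI)
        fix w w' assume w: "w \<in> cball 0 \<delta>" "w' \<in> cball 0 \<delta>" "\<theta> z w = \<theta> z w'"
        have "L (w / z) = L (w' / z)"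
          by (rule inj_onD[OF \<tau>i[OF zK]])
             (use w Lb[OF wz(1)[OF z w(1)]] Lb[OF wz(1)[OF z w(2)]] \<eta>2(2) in \<open>auto simp: \<theta>_def\<close>)
        then have "1 + w / z = 1 + w' / z" using expL[OF wz(1)[OF z w(1)]] expL[OF wz(1)[OF z w(2)]] by metis
        then have "w / z = w' / z" by (simp only: add_left_cancel)
        then show "w = w'" using divide_cancel_right[of w z w'] wz(2)[OF z w(1)] by blast
      qed
      fix w :: complex assume w: "w \<in> cball 0 \<delta>"
      note n = wz[OF z w]
      have hn: "norm (L (w / z)) \<le> \<eta>" using Lb[OF n(1)] \<eta>2(2) by linarith
      have "norm z * exp (norm \<alpha> * norm (L (w / z))) \<le> b * exp (norm \<alpha> * norm (L (w / z)))"
        using z by (intro mult_right_mono) (auto simp: Ann_def)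
      then have "norm z * exp (norm \<alpha> * norm (L (w / z))) < R"
        using bR[OF Lb[OF n(1)]] by (rule order_le_less_trans)
      then have "flow X S (L (w / z)) (\<Gamma> z) = \<Gamma> (z * exp (\<alpha> * L (w / z)))"
        by (intro separatrix_flow[OF X \<alpha> _ \<Gamma>d n(2)]) (use \<Gamma>U U(2) in blast)+
      also have "z * exp (\<alpha> * L (w / z)) = z + w" using expL[OF n(1)] n(2) by (simp add: algebra_simps)
      finally have fl: "flow X S (L (w / z)) (\<Gamma> z) = \<Gamma> (z + w)" .
      show "norm (\<theta> z w) < eb" "\<phi> (\<Gamma> (z + w)) = flow Y T (\<theta> z w) (\<phi> (\<Gamma> z))"
        using \<tau>[OF zK hn] by (auto simp: \<theta>_def fl)
    qed
  qed
  \<comment> \<open>The index is carried along a path in the annulus; injectivity together with the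
    value 0 at 0 keeps the loops away from 0.\<close>
  have const: "ind (\<theta> z) 0 \<delta> = ind (\<theta> z') 0 \<delta>"
    if c: "continuous_on (Ann a b \<times> cball 0 \<delta>) (\<lambda>(z, w). \<theta> z w)" and \<delta>: "\<delta> > 0"
      and z0: "\<And>z. z \<in> Ann a b \<Longrightarrow> \<theta> z 0 = 0 \<and> inj_on (\<theta> z) (cball 0 \<delta>)"
      and z: "z \<in> Ann a b" "z' \<in> Ann a b" for a b \<delta> \<theta> z z'
  proof -
    have "path_connected (Ann a b)" unfolding Ann_def by (rule path_connected_annulus) simp
    then obtain g where g: "path g" "path_image g \<subseteq> Ann a b" "pathstart g = z" "pathfinish g = z'"
      using z unfolding path_connected_def by blast
    have gA: "g s \<in> Ann a b" if "s \<in> {0..1}" for s using g(2) that by (auto simp: path_image_def)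
    have "ind (\<theta> (g 0)) 0 \<delta> = ind (\<theta> (g 1)) 0 \<delta>"
    proof (rule ind_homotopy[where H = "\<lambda>s. \<theta> (g s)", OF _ \<delta>])
      have "continuous_on ({0..1} \<times> sphere 0 \<delta>) (\<lambda>p. (\<lambda>(z, w). \<theta> z w) (g (fst p), snd p))"
        by (rule continuous_on_compose2[OF c])
           (use g(1) gA in \<open>auto simp: path_def intro!: continuous_intros continuous_on_compose2[OF g(1)[unfolded path_def]]\<close>)
      then show "continuous_on ({0..1} \<times> sphere 0 \<delta>) (\<lambda>(s, w). \<theta> (g s) w)" by (simp add: case_prod_beta)
      show "\<theta> (g s) w \<noteq> 0" if "s \<in> {0..1}" "w \<in> sphere 0 \<delta>" for s w
        using inj_onD[of "\<theta> (g s)" "cball 0 \<delta>" w 0] z0[OF gA[OF that(1)]] that(2) \<delta> by auto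
    qed
    then show ?thesis using g(3,4) by (simp add: pathstart_def pathfinish_def)
  qed
  have slice: "continuous_on (cball 0 \<delta>) (\<theta> z)"
    if "continuous_on (Ann a b \<times> cball 0 \<delta>) (\<lambda>(z, w). \<theta> z w)" "z \<in> Ann a b"
    for a b \<delta> and \<theta> :: "complex \<Rightarrow> complex \<Rightarrow> complex" and z
  proof -
    have "continuous_on (cball 0 \<delta>) (\<lambda>w. (\<lambda>(z, w). \<theta> z w) (z, w))"
      by (rule continuous_on_compose2[OF that(1)]) (use that(2) in \<open>auto intro!: continuous_intros\<close>)
    then show ?thesis by simp
  qed
  obtain \<delta>b \<theta>b where "\<delta>b > 0" and gb: "good (R/2) (R/2) \<delta>b \<theta>b"
    using L1[of "R/2" "R/2"] R by auto
  then have b: "\<delta>b > 0" "continuous_on (Ann (R/2) (R/2) \<times> cball 0 \<delta>b) (\<lambda>(z, w). \<theta>b z w)"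
    using gb unfolding good_def by simp_all
  have b2: "\<theta>b z 0 = 0 \<and> inj_on (\<theta>b z) (cball 0 \<delta>b) \<and>
      (\<forall>w\<in>cball 0 \<delta>b. norm (\<theta>b z w) < eb \<and> \<phi> (\<Gamma> (z + w)) = flow Y T (\<theta>b z w) (\<phi> (\<Gamma> z)))"
    if "z \<in> Ann (R/2) (R/2)" for z
    using gb that unfolding good_def by simp
  have zbA: "zb \<in> Ann (R/2) (R/2)" using zb by (simp add: Ann_def)
  note b0 = conjunct1[OF b2[OF zbA]] and bi = conjunct1[OF conjunct2[OF b2[OF zbA]]]
  have zero_ind: "f w \<noteq> 0" if "inj_on f (cball 0 \<delta>)" "f 0 = 0" "w \<in> cball 0 \<delta> - {0}" "\<delta> > 0"
    for f :: "complex \<Rightarrow> complex" and \<delta> w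
    using inj_onD[OF that(1), of w 0] that by auto
  obtain \<epsilon> where \<epsilon>: "lind (\<theta>b zb) 0 \<epsilon>" "\<epsilon> \<noteq> 0"
    using lind_inj[OF b(1) slice[OF b(2) zbA] bi b0] by blast
  have \<epsilon>b: "ind (\<theta>b zb) 0 \<delta>b = of_int \<epsilon>"
  proof -
    obtain k where "lind (\<theta>b zb) 0 k" "ind (\<theta>b zb) 0 \<delta>b = of_int k"
      by (rule lind_ex[OF b(1) continuous_on_subset[OF slice[OF b(2) zbA]], of 0])
         (use zero_ind[OF bi b0 _ b(1)] b(1) in auto)
    then show ?thesis using lind_unique[OF \<epsilon>(1)] by blast
  qed
  have "\<forall>z0\<in>ball 0 R - {0}. \<exists>F. F z0 = 0 \<and> lind F z0 \<epsilon> \<and> (\<exists>\<delta>>0. continuous_on (cball z0 \<delta>) F \<and> inj_on F (cball z0 \<delta>)) \<and>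
      (\<forall>\<^sub>F z in nhds z0. \<phi> (\<Gamma> z) = flow Y T (F z) (\<phi> (\<Gamma> z0)))"
  proof
    fix z0 :: complex assume z0: "z0 \<in> ball 0 R - {0}"
    \<comment> \<open>The smallest annulus containing both \<open>z0\<close> and the base point,
      whose modulus is R/2.\<close>
    define a where "a = min (norm z0) (R/2)"
    define b where "b = max (norm z0) (R/2)"
    have ab: "0 < a" "a \<le> b" "b < R" using z0 R by (auto simp: a_def b_def)
    have A: "z0 \<in> Ann a b" "zb \<in> Ann a b" using zb(2) by (auto simp: Ann_def a_def b_def)
    obtain \<delta> \<theta> where "\<delta> > 0" and g: "good a b \<delta> \<theta>" using L1[OF ab] by blast
    then have t: "\<delta> > 0" "continuous_on (Ann a b \<times> cball 0 \<delta>) (\<lambda>(z, w). \<theta> z w)"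
      unfolding good_def by simp_all
    have t2: "\<theta> z 0 = 0 \<and> inj_on (\<theta> z) (cball 0 \<delta>) \<and>
      (\<forall>w\<in>cball 0 \<delta>. norm (\<theta> z w) < eb \<and> \<phi> (\<Gamma> (z + w)) = flow Y T (\<theta> z w) (\<phi> (\<Gamma> z)))"
      if "z \<in> Ann a b" for z using g that unfolding good_def by simp
    note t0 = conjunct1[OF t2] and ti = conjunct1[OF conjunct2[OF t2]]
    define m where "m = min \<delta> \<delta>b"
    have m: "m > 0" "m \<le> \<delta>" "m \<le> \<delta>b" using t(1) \<open>\<delta>b > 0\<close> by (auto simp: m_def)
    have shrink: "ind f 0 m = ind f 0 d" if "continuous_on (cball 0 d) f" "inj_on f (cball 0 d)" "f 0 = 0" "m \<le> d" for f d
    proof (rule ind_annulus[OF continuous_on_subset[OF that(1)] m(1) that(4)])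
      show "f z \<noteq> 0" if z: "z \<in> cball 0 d - ball 0 m" for z
        by (rule zero_ind[of f d]) (use that z \<open>inj_on f (cball 0 d)\<close> \<open>f 0 = 0\<close> \<open>m \<le> d\<close> m(1) in auto)
    qed auto
    have "ind (\<theta> z0) 0 \<delta> = ind (\<theta> zb) 0 \<delta>" by (rule const[OF t(2,1) _ A]) (intro conjI t0 ti)
    also have "\<dots> = ind (\<theta> zb) 0 m" by (rule shrink[OF slice[OF t(2) A(2)] ti[OF A(2)] t0[OF A(2)] m(2), symmetric])
    \<comment> \<open>Both are Y-times between the same two points and shorter than
      \<open>eb\<close>, hence equal.\<close>
    also have "\<dots> = ind (\<theta>b zb) 0 m"
    proof (rule ind_cong[OF _ m(1)])
      fix w :: complex assume "w \<in> sphere 0 m"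
      then have w: "w \<in> cball 0 \<delta>" "w \<in> cball 0 \<delta>b" using m by auto
      note 1 = bspec[OF conjunct2[OF conjunct2[OF t2[OF A(2)]]] w(1)]
      note 2 = bspec[OF conjunct2[OF conjunct2[OF b2[OF zbA]]] w(2)]
      show "\<theta> zb w = \<theta>b zb w" by (rule inj_onD[OF eb(2)[OF singletonI]]) (use conjunct1[OF 1] conjunct1[OF 2] conjunct2[OF 1] conjunct2[OF 2] in auto)
    qed
    also have "\<dots> = ind (\<theta>b zb) 0 \<delta>b" by (rule shrink[OF slice[OF b(2) zbA] bi b0 m(3)])
    also have "\<dots> = of_int \<epsilon>" by (rule \<epsilon>b)
    finally have i: "ind (\<theta> z0) 0 \<delta> = of_int \<epsilon>" .
    define F where "F = (\<lambda>z. \<theta> z0 (z - z0))"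
    have cF: "continuous_on (cball z0 \<delta>) F" unfolding F_def
      by (rule continuous_on_compose2[OF slice[OF t(2) A(1)]])
         (auto intro!: continuous_intros simp: dist_norm norm_minus_commute)
    have iF: "inj_on F (cball z0 \<delta>)"
    proof (rule inj_onI)
      fix x y assume "x \<in> cball z0 \<delta>" "y \<in> cball z0 \<delta>" "F x = F y"
      then show "x = y" using inj_onD[OF ti[OF A(1)], of "x - z0" "y - z0"]
        by (auto simp: F_def dist_norm norm_minus_commute)
    qed
    have F0: "F z0 = 0" using t0[OF A(1)] by (simp add: F_def)
    have "lind F z0 \<epsilon>"
    proof (rule lindI[OF t(1)])
      show "continuous_on (cball z0 \<delta> - {z0}) F" by (rule continuous_on_subset[OF cF]) auto
      show "F z \<noteq> 0" if "z \<in> cball z0 \<delta> - {z0}" for z using inj_onD[OF iF, of z z0] F0 that t(1) by auto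
      have "ind F z0 \<delta> = ind (\<theta> z0) 0 \<delta>"
        unfolding ind_def F_def by (rule winding_number_cong) (simp add: circlepath)
      then show "ind F z0 \<delta> = of_int \<epsilon>" using i by simp
    qed
    moreover have "\<forall>\<^sub>F z in nhds z0. \<phi> (\<Gamma> z) = flow Y T (F z) (\<phi> (\<Gamma> z0))"
    proof -
      have "\<forall>\<^sub>F z in nhds z0. z \<in> ball z0 \<delta>" using t(1) by (intro eventually_nhds_in_open) auto
      then show ?thesis
      proof eventually_elim
        case (elim z)
        then have "z - z0 \<in> cball 0 \<delta>" by (simp add: dist_norm norm_minus_commute)
        then have "\<phi> (\<Gamma> (z0 + (z - z0))) = flow Y T (\<theta> z0 (z - z0)) (\<phi> (\<Gamma> z0))"
          using conjunct2[OF bspec[OF conjunct2[OF conjunct2[OF t2[OF A(1)]]]]] by blast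
        then show ?case by (simp add: F_def)
      qed
    qed
    ultimately show "\<exists>F. F z0 = 0 \<and> lind F z0 \<epsilon> \<and> (\<exists>\<delta>>0. continuous_on (cball z0 \<delta>) F \<and> inj_on F (cball z0 \<delta>)) \<and>
      (\<forall>\<^sub>F z in nhds z0. \<phi> (\<Gamma> z) = flow Y T (F z) (\<phi> (\<Gamma> z0)))"
      by (intro exI[of _ F] exI[of _ \<delta>] conjI F0 cF iF t(1))
  qed
  from bchoice[OF this] obtain F where F: "\<forall>z0\<in>ball 0 R - {0}. F z0 z0 = 0 \<and> lind (F z0) z0 \<epsilon> \<and>
      (\<exists>\<delta>>0. continuous_on (cball z0 \<delta>) (F z0) \<and> inj_on (F z0) (cball z0 \<delta>)) \<and>
      (\<forall>\<^sub>F z in nhds z0. \<phi> (\<Gamma> z) = flow Y T (F z0 z) (\<phi> (\<Gamma> z0)))" ..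
  have "curve_charts R F \<epsilon>"
  proof
    fix z0 :: complex assume "z0 \<in> ball 0 R - {0}"
    note Fz = bspec[OF F this]
    show "F z0 z0 = 0" using Fz by (elim conjE)
    show "lind (F z0) z0 \<epsilon>" using Fz by (elim conjE)
    show "\<exists>\<delta>>0. continuous_on (cball z0 \<delta>) (F z0) \<and> inj_on (F z0) (cball z0 \<delta>)" using Fz by (elim conjE)
  qed (use R \<epsilon>(2) in auto)
  then show ?thesis
  proof (rule that)
    show "\<forall>\<^sub>F z in nhds z0. \<phi> (\<Gamma> z) = flow Y T (F z0 z) (\<phi> (\<Gamma> z0))" if "z0 \<in> ball 0 R - {0}" for z0
      using bspec[OF F that] by (elim conjE)
  qed
qed

text \<open>The flow is holomorphic in time, so the coordinates of \<open>\<kappa>\<close> are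
  holomorphic in the charts and one of them can be uniformized by some \<open>s\<close>. Off the
  origin the Y-time as a function of w = s z is a local inverse of an injective holomorphic
  function, hence holomorphic, and so is the curve; the origin is a removable singularity by
  continuity.\<close>

lemma analytic_parametrization:
  fixes Y :: "complex^'n \<Rightarrow> complex^'n"
  assumes Y: "hol_vf T Y" and ch: "curve_charts R F \<epsilon>"
    and \<kappa>T: "\<And>z. z \<in> ball 0 R \<Longrightarrow> \<kappa> z \<in> T" and \<kappa>c: "continuous_on (ball 0 R) \<kappa>" and \<kappa>0: "\<kappa> 0 = 0"
    and \<kappa>nz: "\<And>z. z \<in> ball 0 R - {0} \<Longrightarrow> \<kappa> z \<noteq> 0"
    and fl: "\<And>z0. z0 \<in> ball 0 R - {0} \<Longrightarrow> \<forall>\<^sub>F z in nhds z0. \<kappa> z = flow Y T (F z0 z) (\<kappa> z0)"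
  obtains A \<mu> s \<sigma> r0 c where "open A" "0 \<in> A" "A \<subseteq> ball 0 R" "\<mu> > 0" "homeomorphism A (ball 0 \<mu>) s \<sigma>" "s 0 = 0"
    "r0 > 0" "\<And>r. 0 < r \<Longrightarrow> r \<le> r0 \<Longrightarrow> cball 0 r \<subseteq> A \<and> ind s 0 r = of_int \<epsilon>"
    "\<And>i. (\<lambda>w. \<kappa> (\<sigma> w) $ i) holomorphic_on ball 0 \<mu>"
    "\<And>w. w \<in> ball 0 \<mu> - {0} \<Longrightarrow> c w \<noteq> 0 \<and> has_vderiv (\<lambda>w. \<kappa> (\<sigma> w)) (c w *s Y (\<kappa> (\<sigma> w))) w"
proof -
  interpret curve_charts R F \<epsilon> by (rule ch)
  have W: "\<exists>\<eta>>0. integral_curve Y T (ball 0 \<eta>) (\<lambda>t. flow Y T t (\<kappa> z0))" if "z0 \<in> ball 0 R - {0}" for z0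
  proof -
    have "{\<kappa> z0} \<subseteq> T" using \<kappa>T that by blast
    then obtain \<eta> C :: real where "\<eta> > 0" "C > 0"
      "\<And>x. x \<in> {\<kappa> z0} \<Longrightarrow> integral_curve Y T (ball 0 \<eta>) (\<lambda>t. flow Y T t x)"
      by (rule local_flow[OF Y compact_sing _ hol_vf_open[OF Y] order_refl]) (rule that; assumption)
    then show ?thesis by blast
  qed
  have chol: "chol R F (\<lambda>z. \<kappa> z $ i)" for i
    unfolding chol_def
  proof
    fix z0 :: complex assume z0: "z0 \<in> ball 0 R - {0}"
    obtain \<eta> where \<eta>: "\<eta> > 0" "integral_curve Y T (ball 0 \<eta>) (\<lambda>t. flow Y T t (\<kappa> z0))" using W[OF z0] by blast
    have "((\<lambda>t. flow Y T t (\<kappa> z0) $ i) has_field_derivative Y (flow Y T t (\<kappa> z0)) $ i) (at t)" if "t \<in> ball 0 \<eta>" for t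
      using \<eta>(2) that unfolding integral_curve_def has_vderiv_iff by blast
    then have "(\<lambda>t. flow Y T t (\<kappa> z0) $ i) holomorphic_on ball 0 \<eta>"
      unfolding holomorphic_on_open[OF open_ball] by blast
    moreover have "\<forall>\<^sub>F z in nhds z0. \<kappa> z $ i = flow Y T (F z0 z) (\<kappa> z0) $ i"
      using fl[OF z0] by eventually_elim simp
    ultimately show "\<exists>\<eta>>0. \<exists>h. h holomorphic_on ball 0 \<eta> \<and> (\<forall>\<^sub>F z in nhds z0. \<kappa> z $ i = h (F z0 z))"
      using \<eta>(1) by blast
  qed
  \<comment> \<open>Any coordinate that is nonzero somewhere can be uniformized; all of them become
    holomorphic in the resulting parameter.\<close>
  define z1 where "z1 = complex_of_real (R / 2)"
  have z1: "z1 \<in> ball 0 R" "z1 \<noteq> 0" using R by (auto simp: z1_def)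
  then have "\<kappa> z1 \<noteq> 0" using \<kappa>nz by blast
  then obtain i where i: "\<kappa> z1 $ i \<noteq> 0" by (auto simp: vec_eq_iff)
  have \<kappa>i: "continuous_on (ball 0 R) (\<lambda>z. \<kappa> z $ i)" "\<kappa> 0 $ i = 0" using \<kappa>c \<kappa>0 by (auto intro!: continuous_intros)
  obtain A \<mu> s \<sigma> r0 where A: "open A" "0 \<in> A" "A \<subseteq> ball 0 R" "\<mu> > 0" and hom: "homeomorphism A (ball 0 \<mu>) s \<sigma>" and s0: "s 0 = 0"
    and sh: "\<And>z0. z0 \<in> A - {0} \<Longrightarrow> \<exists>\<eta>>0. \<exists>h. h holomorphic_on ball 0 \<eta> \<and> (\<forall>\<^sub>F z in nhds z0. s z = h (F z0 z))"
    and r0: "r0 > 0" "\<And>r. 0 < r \<Longrightarrow> r \<le> r0 \<Longrightarrow> cball 0 r \<subseteq> A \<and> ind s 0 r = of_int \<epsilon>"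
    by (rule uniformization[OF ch chol \<kappa>i z1(1) i]) (rule that; assumption)
  have \<sigma>: "\<And>w. w \<in> ball 0 \<mu> \<Longrightarrow> \<sigma> w \<in> A" "\<And>w. w \<in> ball 0 \<mu> \<Longrightarrow> s (\<sigma> w) = w" "\<And>z. z \<in> A \<Longrightarrow> \<sigma> (s z) = z"
    "continuous_on (ball 0 \<mu>) \<sigma>" "\<And>z. z \<in> A \<Longrightarrow> s z \<in> ball 0 \<mu>"
    using hom unfolding homeomorphism_def by blast+
  have \<sigma>0: "\<sigma> 0 = 0" using \<sigma>(3)[OF A(2)] s0 by simp
  have \<sigma>nz: "\<sigma> w \<noteq> 0" if "w \<in> ball 0 \<mu> - {0}" for w using \<sigma>(2)[of w] that s0 by auto
  have der: "\<exists>c. c \<noteq> 0 \<and> has_vderiv (\<lambda>w. \<kappa> (\<sigma> w)) (c *s Y (\<kappa> (\<sigma> w0))) w0" if w0: "w0 \<in> ball 0 \<mu> - {0}" for w0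
  proof -
    define z0 where "z0 = \<sigma> w0"
    have z0: "z0 \<in> A - {0}" "z0 \<in> ball 0 R - {0}" using \<sigma>(1)[of w0] \<sigma>nz[OF w0] w0 A(3) by (auto simp: z0_def)
    obtain \<eta>h h where h: "\<eta>h > 0" "h holomorphic_on ball 0 \<eta>h" "\<forall>\<^sub>F z in nhds z0. s z = h (F z0 z)" using sh[OF z0(1)] by blast
    obtain \<eta> where \<eta>: "\<eta> > 0" "integral_curve Y T (ball 0 \<eta>) (\<lambda>t. flow Y T t (\<kappa> z0))" using W[OF z0(2)] by blast
    obtain d0 where d0: "d0 > 0" "continuous_on (cball z0 d0) (F z0)" "inj_on (F z0) (cball z0 d0)" using Floc[OF z0(2)] by blast
    have Fc: "isCont (F z0) z0" using d0(1,2) continuous_on_cball_isCont by blast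
    have "((\<lambda>z. F z0 z) \<longlongrightarrow> F z0 z0) (nhds z0)" using Fc by (simp add: isCont_def tendsto_at_iff_tendsto_nhds)
    then have "\<forall>\<^sub>F z in nhds z0. F z0 z \<in> ball 0 (min \<eta> \<eta>h)"
      by (rule topological_tendstoD) (use F0[OF z0(2)] \<eta>(1) h(1) in auto)
    then have "\<forall>\<^sub>F z in nhds z0. s z = h (F z0 z) \<and> \<kappa> z = flow Y T (F z0 z) (\<kappa> z0) \<and> F z0 z \<in> ball 0 (min \<eta> \<eta>h) \<and> z \<in> A \<and> z \<in> ball z0 d0"
      using h(3) fl[OF z0(2)] A(1) z0(1) d0(1) by (intro eventually_conj eventually_nhds_in_open) auto
    then obtain d where d: "d > 0" "\<And>z. z \<in> ball z0 d \<Longrightarrow> s z = h (F z0 z) \<and> \<kappa> z = flow Y T (F z0 z) (\<kappa> z0) \<and> F z0 z \<in> ball 0 (min \<eta> \<eta>h) \<and> z \<in> A \<and> z \<in> ball z0 d0"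
      unfolding eventually_nhds_metric by (auto simp: dist_commute)
    have sub: "ball z0 d \<subseteq> cball z0 d0" using d(2) by force
    define Q where "Q = F z0 ` ball z0 d"
    have Q: "open Q" unfolding Q_def
      by (rule invariance_of_domain[OF continuous_on_subset[OF d0(2) sub] open_ball inj_on_subset[OF d0(3) sub]])
    have Q0: "0 \<in> Q" unfolding Q_def using F0[OF z0(2)] d(1) by (metis centre_in_ball imageI)
    have Qsub: "Q \<subseteq> ball 0 \<eta>h" "Q \<subseteq> ball 0 \<eta>" using d(2) by (auto simp: Q_def)
    \<comment> \<open>\<open>h\<close> after the chart is \<open>s\<close>, which is injective. An
      injective holomorphic function has nonzero derivative, and the inverse of that derivative
      becomes the factor \<open>c\<close>.\<close>
    have hinj: "inj_on h Q"
    proof (rule inj_onI)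
      fix x y assume "x \<in> Q" "y \<in> Q" "h x = h y"
      then obtain a b where ab: "a \<in> ball z0 d" "b \<in> ball z0 d" "x = F z0 a" "y = F z0 b"
        unfolding Q_def by blast
      have "s a = s b" using d(2)[OF ab(1)] d(2)[OF ab(2)] \<open>h x = h y\<close> ab(3,4) by simp
      moreover have "a \<in> A" using d(2)[OF ab(1)] by (elim conjE)
      moreover have "b \<in> A" using d(2)[OF ab(2)] by (elim conjE)
      ultimately have "a = b" using \<sigma>(3) by metis
      then show "x = y" using ab by simp
    qed
    have hh: "h holomorphic_on Q" using h(2) Qsub(1) holomorphic_on_subset by blast
    have dh: "deriv h 0 \<noteq> 0" by (rule holomorphic_injective_imp_regular[OF hh Q hinj Q0])
    have Dh: "(h has_field_derivative deriv h 0) (at 0)" by (rule holomorphic_derivI[OF hh Q Q0])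
    define t where "t = (\<lambda>w. F z0 (\<sigma> w))"
    have t0: "t w0 = 0" using F0[OF z0(2)] by (simp add: t_def z0_def)
    have \<sigma>c: "isCont \<sigma> w0" using \<sigma>(4) w0 by (simp add: continuous_on_eq_continuous_at)
    have tc: "isCont t w0" unfolding t_def
      by (rule isCont_o2[OF \<sigma>c, where g = "F z0"]) (unfold z0_def[symmetric], rule Fc)
    define O' where "O' = ball 0 \<mu> \<inter> \<sigma> -` ball z0 d"
    have "\<sigma> w0 \<in> ball z0 d" unfolding z0_def[symmetric] using d(1) by simp
    then have O': "open O'" "w0 \<in> O'" "\<And>w. w \<in> O' \<Longrightarrow> w \<in> ball 0 \<mu> \<and> \<sigma> w \<in> ball z0 d"
      unfolding O'_def using continuous_open_preimage[OF \<sigma>(4) open_ball open_ball] w0 by blast+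
    have Dt: "(t has_field_derivative inverse (deriv h 0)) (at w0)"
    proof (rule has_field_derivative_inverse_basic[of h "deriv h 0" t w0])
      show "(h has_field_derivative deriv h 0) (at (t w0))" using Dh t0 by simp
      show "h (t w) = w" if "w \<in> O'" for w
        using O'(3)[OF that] d(2)[of "\<sigma> w"] \<sigma>(2)[of w] by (simp add: t_def)
    qed (use dh tc O' in auto)
    have "has_vderiv (\<lambda>t. flow Y T t (\<kappa> z0)) (Y (flow Y T 0 (\<kappa> z0))) (t w0)"
      using \<eta> t0 unfolding integral_curve_def by simp
    moreover have "flow Y T 0 (\<kappa> z0) = \<kappa> z0" using flow_zero[OF Y] \<kappa>T z0(2) by blast
    ultimately have "has_vderiv (\<lambda>t. flow Y T t (\<kappa> z0)) (Y (\<kappa> z0)) (t w0)" by simp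
    from diff_chain_at[OF Dt[unfolded has_field_derivative_def] this]
    have "has_vderiv (\<lambda>w. flow Y T (t w) (\<kappa> z0)) (inverse (deriv h 0) *s Y (\<kappa> z0)) w0"
      unfolding o_def by (rule has_derivative_eq_rhs) (simp add: fun_eq_iff vec_eq_iff mult_ac)
    then have "has_vderiv (\<lambda>w. \<kappa> (\<sigma> w)) (inverse (deriv h 0) *s Y (\<kappa> z0)) w0"
      by (rule has_derivative_transform_within_open[OF _ O'(1,2)]) (use O'(3) d(2) in \<open>auto simp: t_def\<close>)
    then show ?thesis using dh by (intro exI[of _ "inverse (deriv h 0)"]) (simp add: z0_def)
  qed
  then have "\<forall>w\<in>ball 0 \<mu> - {0}. \<exists>c. c \<noteq> 0 \<and> has_vderiv (\<lambda>w. \<kappa> (\<sigma> w)) (c *s Y (\<kappa> (\<sigma> w))) w"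
    by (rule ballI)
  from bchoice[OF this] obtain c where c: "\<forall>w\<in>ball 0 \<mu> - {0}. c w \<noteq> 0 \<and> has_vderiv (\<lambda>w. \<kappa> (\<sigma> w)) (c w *s Y (\<kappa> (\<sigma> w))) w" ..
  have hol: "(\<lambda>w. \<kappa> (\<sigma> w) $ i) holomorphic_on ball 0 \<mu>" for i
  proof (rule no_isolated_singularity[of _ _ "{0}"])
    have "continuous_on (ball 0 \<mu>) (\<lambda>w. \<kappa> (\<sigma> w))"
      by (rule continuous_on_compose2[OF \<kappa>c \<sigma>(4)]) (use \<sigma>(1) A(3) in blast)
    then show "continuous_on (ball 0 \<mu>) (\<lambda>w. \<kappa> (\<sigma> w) $ i)" by (intro continuous_intros)
    have "((\<lambda>w. \<kappa> (\<sigma> w) $ i) has_field_derivative (c w *s Y (\<kappa> (\<sigma> w))) $ i) (at w)" if "w \<in> ball 0 \<mu> - {0}" for w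
      using c that unfolding has_vderiv_iff by blast
    then show "(\<lambda>w. \<kappa> (\<sigma> w) $ i) holomorphic_on ball 0 \<mu> - {0}"
      unfolding holomorphic_on_open[OF open_Diff[OF open_ball closed_singleton]] by blast
  qed auto
  show ?thesis by (rule that[OF A hom s0 r0 hol, of c]) (assumption | (rule bspec[OF c], assumption))+
qed

section \<open>Orders of vanishing along the curve\<close>

text \<open>\<open>m\<close> is the largest power of w that divides all coordinates of
  \<open>G\<close>; it exists because the order of one nonconstant coordinate bounds it, and
  maximality gives \<open>V 0 \<noteq> 0\<close>.\<close>

lemma holomorphic_curve_order:
  fixes G :: "complex \<Rightarrow> complex^'n"
  assumes hol: "\<And>i. (\<lambda>w. G w $ i) holomorphic_on ball 0 \<mu>" and \<mu>: "\<mu> > 0" and G0: "G 0 = 0"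
    and w1: "w1 \<in> ball 0 \<mu>" "G w1 \<noteq> 0"
  obtains m V where "m > 0" "\<And>i. (\<lambda>w. V w $ i) holomorphic_on ball 0 \<mu>" "\<And>w. w \<in> ball 0 \<mu> \<Longrightarrow> G w = w ^ m *s V w" "V 0 \<noteq> 0"
proof -
  obtain i where i: "G w1 $ i \<noteq> 0" using w1(2) by (auto simp: vec_eq_iff)
  have "\<not> (\<lambda>w. G w $ i) constant_on ball 0 \<mu>"
  proof
    assume "(\<lambda>w. G w $ i) constant_on ball 0 \<mu>"
    then obtain k where k: "\<And>w. w \<in> ball 0 \<mu> \<Longrightarrow> G w $ i = k" unfolding constant_on_def by blast
    show False using k[OF w1(1)] k[of 0] G0 \<mu> i by simp
  qed
  then obtain g r n where g: "0 < n" "0 < r" "ball (0::complex) r \<subseteq> ball 0 \<mu>" "g holomorphic_on ball 0 r"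
     "\<And>w. w \<in> ball 0 r \<Longrightarrow> G w $ i = (w - 0) ^ n * g w" "\<And>w. w \<in> ball 0 r \<Longrightarrow> g w \<noteq> 0"
  proof (rule_tac holomorphic_factor_zero_nonconstant[OF hol[of i] open_ball connected_ball])
    show "0 \<in> ball 0 \<mu>" using \<mu> by simp
    show "G 0 $ i = 0" using G0 by simp
  qed (assumption | rule that; assumption)+
  define D where "D = (\<lambda>m. \<exists>V. (\<forall>i. (\<lambda>w. V w $ i) holomorphic_on ball 0 \<mu>) \<and> (\<forall>w\<in>ball 0 \<mu>. G w = w ^ m *s V w))"
  have bd: "m \<le> n" if Dm: "D m" for m
  proof (rule ccontr)
    assume "\<not> m \<le> n"
    then obtain q where q: "m = n + Suc q" using less_imp_Suc_add not_le by (metis add_Suc_right)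
    obtain V where V: "\<And>i. (\<lambda>w. V w $ i) holomorphic_on ball 0 \<mu>" "\<And>w. w \<in> ball 0 \<mu> \<Longrightarrow> G w = w ^ m *s V w"
      using Dm unfolding D_def by blast
    have eq: "g w = w ^ Suc q * V w $ i" if "w \<in> ball 0 r - {0}" for w
    proof -
      have "w ^ n * g w = w ^ m * V w $ i" using g(5)[of w] V(2)[of w] that g(3) by auto
      then show ?thesis using that by (simp add: q power_add)
    qed
    have c1: "isCont g 0" using holomorphic_on_imp_continuous_on[OF g(4)] g(2) by (simp add: continuous_on_eq_continuous_at)
    have "isCont (\<lambda>w. V w $ i) 0"
      using holomorphic_on_imp_continuous_on[OF V(1)[of i]] \<mu> by (simp add: continuous_on_eq_continuous_at)
    then have c2: "isCont (\<lambda>w. w ^ Suc q * V w $ i) 0" by (intro isCont_mult isCont_power continuous_ident)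
    have "\<forall>\<^sub>F w in at 0. w ^ Suc q * V w $ i = g w"
      using eventually_at_ball'[OF g(2), of 0 UNIV] by eventually_elim (use eq in auto)
    then have "(g \<longlongrightarrow> 0) (at 0)"
      using c2 Lim_transform_eventually[of _ 0 "at 0" g] by (simp add: isCont_def)
    then have "g 0 = 0" using c1 tendsto_unique[OF at_neq_bot] unfolding isCont_def by blast
    then show False using g(6)[of 0] g(2) by simp
  qed
  have "D 0" unfolding D_def using hol by (intro exI[of _ G]) auto
  obtain m where m: "D m" "\<And>k. D k \<Longrightarrow> k \<le> m"
    by (rule that[of "Greatest D"]) (use GreatestI_nat[of D 0 n] Greatest_le_nat[of D _ n] \<open>D 0\<close> bd in auto)
  obtain V where V: "\<And>i. (\<lambda>w. V w $ i) holomorphic_on ball 0 \<mu>" "\<And>w. w \<in> ball 0 \<mu> \<Longrightarrow> G w = w ^ m *s V w"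
    using m(1) unfolding D_def by blast
  have V0: "V 0 \<noteq> 0"
  proof
    assume V00: "V 0 = 0"
    obtain h where h: "\<And>i. (\<lambda>z. h z $ i) holomorphic_on ball 0 \<mu>" "\<And>z. z \<noteq> 0 \<Longrightarrow> h z = (1 / z) *s V z"
      by (rule holomorphic_vec_divide[of V, OF V(1) V00]) (rule that; assumption)
    have "V w = w *s h w" for w by (cases "w = 0") (use V00 h(2)[of w] in \<open>auto simp: vec_eq_iff\<close>)
    then have "G w = w ^ Suc m *s h w" if "w \<in> ball 0 \<mu>" for w using V(2)[OF that] by (simp add: vec_eq_iff mult_ac)
    then have "D (Suc m)" unfolding D_def using h(1) by blast
    then show False using m(2) by fastforce
  qed
  have "m > 0"
  proof (rule ccontr)
    assume "\<not> m > 0"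
    then have "V 0 = 0" using V(2)[of 0] \<mu> G0 by simp
    then show False using V0 by simp
  qed
  then show ?thesis using that V V0 by blast
qed

text \<open>If \<open>Y\<close> vanished along the curve to the order \<open>m\<close> of the curve itself, then the leading coefficient
  vector of the curve would be an eigenvector of \<open>A\<close> with a nonzero eigenvalue.\<close>

lemma invariant_curve_orders:
  fixes Y :: "complex^'n \<Rightarrow> complex^'n"
  assumes Y: "hol_vf (ball 0 r) Y" "r > 0" "Y 0 = 0" and A: "(Y has_derivative A) (at 0)" "\<And>c w. A (c *s w) = c *s A w"
    and spec: "\<And>c v. v \<noteq> 0 \<Longrightarrow> A v = c *s v \<Longrightarrow> c = 0"
    and hol: "\<And>i. (\<lambda>w. G w $ i) holomorphic_on ball 0 \<mu>" and \<mu>: "\<mu> > 0" and G0: "G 0 = 0"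
    and Gnz: "\<And>w. w \<in> ball 0 \<mu> - {0} \<Longrightarrow> G w \<noteq> 0" and Gr: "\<And>w. w \<in> ball 0 \<mu> \<Longrightarrow> G w \<in> ball 0 r"
    and c: "\<And>w. w \<in> ball 0 \<mu> - {0} \<Longrightarrow> c w \<noteq> 0 \<and> has_vderiv G (c w *s Y (G w)) w"
  obtains i m k p q \<mu>1 where "m > 0" "k \<noteq> m" "\<mu>1 > 0" "\<mu>1 \<le> \<mu>"
    "p holomorphic_on ball 0 \<mu>1" "q holomorphic_on ball 0 \<mu>1" "\<And>w. w \<in> ball 0 \<mu>1 \<Longrightarrow> p w \<noteq> 0 \<and> q w \<noteq> 0"
    "\<And>w. w \<in> ball 0 \<mu>1 \<Longrightarrow> deriv (\<lambda>w. G w $ i) w = w ^ (m - 1) * p w"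
    "\<And>w. w \<in> ball 0 \<mu>1 \<Longrightarrow> Y (G w) $ i = w ^ k * q w"
proof -
  define w1 where "w1 = complex_of_real (\<mu> / 2)"
  have w1: "w1 \<in> ball 0 \<mu>" "w1 \<noteq> 0" using \<mu> by (auto simp: w1_def)
  have "G w1 \<noteq> 0" using Gnz w1 by blast
  obtain m V where m: "m > 0" and V: "\<And>i. (\<lambda>w. V w $ i) holomorphic_on ball 0 \<mu>" "\<And>w. w \<in> ball 0 \<mu> \<Longrightarrow> G w = w ^ m *s V w" "V 0 \<noteq> 0"
    by (rule holomorphic_curve_order[of G \<mu>, OF hol \<mu> G0 w1(1) \<open>G w1 \<noteq> 0\<close>]) (rule that; assumption)
  \<comment> \<open>The derivative of \<open>G\<close> is w^(m-1) times \<open>U\<close>, with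
    leading vector m V(0).\<close>
  define U where "U = (\<lambda>i w. of_nat m * V w $ i + w * deriv (\<lambda>w. V w $ i) w)"
  have Uhol: "U i holomorphic_on ball 0 \<mu>" for i
    unfolding U_def by (intro holomorphic_intros V(1) holomorphic_deriv) auto
  have dG: "((\<lambda>w. G w $ i) has_field_derivative w ^ (m - 1) * U i w) (at w)" if w: "w \<in> ball 0 \<mu>" for i w
  proof -
    obtain m' where m': "m = Suc m'" using m by (cases m) auto
    have dV: "((\<lambda>w. V w $ i) has_field_derivative deriv (\<lambda>w. V w $ i) w) (at w)"
      by (rule holomorphic_derivI[OF V(1) open_ball w])
    have "((\<lambda>w. w ^ m * V w $ i) has_field_derivative w ^ (m - 1) * U i w) (at w)"
      by (rule DERIV_cong[OF DERIV_mult[OF DERIV_power[OF DERIV_ident] dV]]) (simp add: U_def m' algebra_simps)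
    then show ?thesis
      by (rule has_field_derivative_transform_within_open[OF _ open_ball w]) (simp add: V(2))
  qed
  have prp: "w ^ (m - 1) * U j w = c w * Y (G w) $ j" if w: "w \<in> ball 0 \<mu> - {0}" for j w
  proof -
    have "((\<lambda>w. G w $ j) has_field_derivative (c w *s Y (G w)) $ j) (at w)"
      using c[OF w] unfolding has_vderiv_iff by blast
    then show ?thesis using DERIV_unique dG[of w j] w by fastforce
  qed
  define v where "v = V 0"
  have lin: "bounded_linear A" by (rule has_derivative_bounded_linear[OF A(1)])
  have isV: "isCont (\<lambda>w. V w $ j) 0" for j
    using holomorphic_on_imp_continuous_on[OF V(1)[of j]] \<mu> by (simp add: continuous_on_eq_continuous_at)
  have limV: "(V \<longlongrightarrow> v) (at 0)" unfolding tendsto_vec_iff v_def using isV by (simp add: isCont_def)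
  \<comment> \<open>By homogeneity \<open>A (G w)\<close> is w^m times \<open>A (V w)\<close>, and
    \<open>Y - A\<close> is small compared with \<open>G w\<close>, which has the size of
    w^m.\<close>
  have limY: "((\<lambda>w. (1 / w ^ m) *s Y (G w)) \<longlongrightarrow> A v) (at 0)"
  proof -
    have lA: "((\<lambda>w. A (V w)) \<longlongrightarrow> A v) (at 0)" by (rule bounded_linear.tendsto[OF lin limV])
    have "((\<lambda>w. (1 / w ^ m) *s Y (G w) - A (V w)) \<longlongrightarrow> 0) (at 0)"
    proof (rule tendstoI)
      fix e :: real assume e: "e > 0"
      define e' where "e' = e / (norm v + 1)"
      have e': "e' > 0" using e norm_ge_zero[of v] by (simp add: e'_def add_nonneg_pos)
      obtain \<rho> where \<rho>: "\<rho> > 0" "\<rho> < r" "\<And>x y. x \<in> cball 0 \<rho> \<Longrightarrow> y \<in> cball 0 \<rho> \<Longrightarrow> norm (Y x - Y y - A (x - y)) \<le> e' * norm (x - y)"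
        by (rule hol_vf_strict_derivative[OF Y A e']) (rule that; assumption)
      have isG: "isCont (\<lambda>w. G w $ j) 0" for j
        using holomorphic_on_imp_continuous_on[OF hol[of j]] \<mu> by (simp add: continuous_on_eq_continuous_at)
      have "(G \<longlongrightarrow> 0) (at 0)" unfolding tendsto_vec_iff using isG G0 by (simp add: isCont_def)
      then have "\<forall>\<^sub>F w in at 0. dist (G w) 0 < \<rho>" by (rule tendstoD[OF _ \<rho>(1)])
      moreover have "\<forall>\<^sub>F w in at 0. norm (V w) < norm v + 1"
        by (rule order_tendstoD(2)[OF tendsto_norm[OF limV]]) simp
      moreover have "\<forall>\<^sub>F w in at 0. w \<in> ball 0 \<mu> - {0}"
        using eventually_at_ball'[OF \<mu>, of 0 UNIV] by eventually_elim auto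
      ultimately show "\<forall>\<^sub>F w in at 0. dist ((1 / w ^ m) *s Y (G w) - A (V w)) 0 < e"
      proof eventually_elim
        case (elim w)
        define y where "y = w ^ m"
        have y: "y \<noteq> 0" using elim by (simp add: y_def)
        have Gw: "G w = y *s V w" using V(2)[of w] elim by (simp add: y_def)
        have "norm (Y (G w) - Y 0 - A (G w - 0)) \<le> e' * norm (G w - 0)"
          by (rule \<rho>(3)) (use elim \<rho>(1) in auto)
        then have "norm (Y (G w) - y *s A (V w)) \<le> norm y * (e' * norm (V w))"
          using Y(3) by (simp add: Gw A(2) norm_cscale mult_ac)
        then have "norm (Y (G w) - y *s A (V w)) / norm y \<le> e' * norm (V w)"
          using y by (simp add: divide_le_eq mult.commute)
        also have "\<dots> < e' * (norm v + 1)" using elim e' by (intro mult_strict_left_mono) auto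
        also have "\<dots> = e" using norm_ge_zero[of v] by (simp add: e'_def add_nonneg_eq_0_iff)
        finally have "norm ((1 / y) *s (Y (G w) - y *s A (V w))) < e" unfolding norm_cscale by (simp add: norm_divide)
        moreover have "(1 / y) *s (Y (G w) - y *s A (V w)) = (1 / y) *s Y (G w) - A (V w)"
          using y by (simp add: vec_eq_iff field_simps)
        ultimately show ?case unfolding y_def dist_norm by simp
      qed
    qed
    from tendsto_add[OF this lA] show ?thesis by simp
  qed
  have limU: "(U j \<longlongrightarrow> of_nat m * v $ j) (at 0)" for j
  proof -
    have "isCont (U j) 0" using holomorphic_on_imp_continuous_on[OF Uhol[of j]] \<mu> by (simp add: continuous_on_eq_continuous_at)
    then show ?thesis by (simp add: isCont_def U_def v_def)
  qed
  \<comment> \<open>The velocity of \<open>G\<close> is a multiple of \<open>Y\<close> along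
    \<open>G\<close>, so the 2 by 2 minors of the two vectors vanish; after division by powers of w
    the limit shows \<open>v\<close> and \<open>A v\<close> to be parallel.\<close>
  have par: "v $ i * A v $ j = v $ j * A v $ i" for i j
  proof -
    define f where "f = (\<lambda>i j w. U i w * ((1 / w ^ m) *s Y (G w)) $ j)"
    have l: "(f i j \<longlongrightarrow> (of_nat m * v $ i) * A v $ j) (at 0)" for i j
      unfolding f_def by (intro tendsto_mult limU tendsto_vec_nth limY)
    have "\<forall>\<^sub>F w in at 0. f i j w = f j i w"
      using eventually_at_ball'[OF \<mu>, of 0 UNIV]
    proof eventually_elim
      case (elim w)
      then have w: "w \<in> ball 0 \<mu> - {0}" by simp
      have "w ^ (m - 1) * U i w * (c w * Y (G w) $ j) = w ^ (m - 1) * U j w * (c w * Y (G w) $ i)"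
        using prp[OF w, of i] prp[OF w, of j] by (metis mult.commute)
      then have "U i w * Y (G w) $ j = U j w * Y (G w) $ i" using c[OF w] w by simp
      then show ?case by (simp add: f_def field_simps)
    qed
    then have "(f j i \<longlongrightarrow> (of_nat m * v $ i) * A v $ j) (at 0)" by (rule Lim_transform_eventually[OF l])
    then have "(of_nat m * v $ i) * A v $ j = (of_nat m * v $ j) * A v $ i"
      using l tendsto_unique[OF at_neq_bot] by blast
    then show ?thesis using m by simp
  qed
  \<comment> \<open>In this coordinate \<open>G\<close> has order exactly \<open>m\<close>, whereas
    the coefficient of w^m in \<open>Y (G w)\<close> is the \<open>i\<close>-th entry of
    \<open>A v\<close>, shown here to be 0.\<close>
  obtain i where i: "v $ i \<noteq> 0" using V(3) by (auto simp: v_def vec_eq_iff)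
  have "A v = (A v $ i / v $ i) *s v" using i par[of i] by (simp add: vec_eq_iff field_simps)
  then have "A v $ i / v $ i = 0" using spec[of v] V(3) unfolding v_def by blast
  then have Avi: "A v $ i = 0" using i by simp
  have "\<forall>\<^sub>F w in nhds 0. U i w \<noteq> 0"
  proof -
    have "isCont (U i) 0" using holomorphic_on_imp_continuous_on[OF Uhol[of i]] \<mu> by (simp add: continuous_on_eq_continuous_at)
    then have "(U i \<longlongrightarrow> U i 0) (nhds 0)" by (simp add: isCont_def tendsto_at_iff_tendsto_nhds)
    moreover have "U i 0 \<noteq> 0" using i m by (simp add: U_def v_def)
    ultimately show ?thesis by (rule tendsto_imp_eventually_ne)
  qed
  then obtain d where d: "d > 0" "\<And>w. dist w 0 < d \<Longrightarrow> U i w \<noteq> 0" unfolding eventually_nhds_metric by blast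
  define f where "f = (\<lambda>w. Y (G w) $ i)"
  have fhol: "f holomorphic_on ball 0 \<mu>" unfolding f_def
  proof (rule hol_vf_curve[OF Y(1) open_ball])
    show "\<exists>w'. has_vderiv G w' w" if "w \<in> ball 0 \<mu>" for w
      unfolding has_vderiv_iff using dG[OF that] by (intro exI[of _ "\<chi> i. w ^ (m - 1) * U i w"]) simp
  qed (rule Gr)
  have f0: "f 0 = 0" using G0 Y(3) by (simp add: f_def)
  \<comment> \<open>The \<open>i\<close>-th coordinate of \<open>Y\<close> along \<open>G\<close> is
    proportional to that of the velocity, which has no zeros near 0 except possibly 0 itself; so it
    has a finite order k.\<close>
  have fnz: "f w \<noteq> 0" if "w \<in> ball 0 \<mu> - {0}" "norm w < d" for w
    using prp[OF that(1), of i] d(2)[of w] that by (auto simp: f_def)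
  have nc: "\<not> f constant_on ball 0 \<mu>"
  proof
    assume "f constant_on ball 0 \<mu>"
    then obtain k where k: "\<And>w. w \<in> ball 0 \<mu> \<Longrightarrow> f w = k" unfolding constant_on_def by blast
    define w2 where "w2 = complex_of_real (min \<mu> d / 2)"
    have w2: "w2 \<in> ball 0 \<mu> - {0}" "norm w2 < d" using \<mu> d(1) by (auto simp: w2_def)
    have "0 \<in> ball 0 \<mu>" "w2 \<in> ball 0 \<mu>" using \<mu> w2 by auto
    then have "f w2 = 0" using k f0 by metis
    then show False using fnz[OF w2] by simp
  qed
  obtain q \<mu>q k where q: "0 < k" "0 < \<mu>q" "ball (0::complex) \<mu>q \<subseteq> ball 0 \<mu>" "q holomorphic_on ball 0 \<mu>q"
     "\<And>w. w \<in> ball 0 \<mu>q \<Longrightarrow> f w = (w - 0) ^ k * q w" "\<And>w. w \<in> ball 0 \<mu>q \<Longrightarrow> q w \<noteq> 0"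
  proof (rule holomorphic_factor_zero_nonconstant[OF fhol open_ball connected_ball _ f0 nc])
    show "0 \<in> ball 0 \<mu>" using \<mu> by simp
  qed (rule that; assumption)
  have "k \<noteq> m"
  proof
    assume km: "k = m"
    have "((\<lambda>w. ((1 / w ^ m) *s Y (G w)) $ i) \<longlongrightarrow> 0) (at 0)" using tendsto_vec_nth[OF limY, of i] Avi by simp
    moreover have "\<forall>\<^sub>F w in at 0. ((1 / w ^ m) *s Y (G w)) $ i = q w"
      using eventually_at_ball'[OF q(2), of 0 UNIV]
      by eventually_elim (use q(5) in \<open>auto simp: f_def km\<close>)
    ultimately have "(q \<longlongrightarrow> 0) (at 0)" by (rule Lim_transform_eventually)
    moreover have "isCont q 0" using holomorphic_on_imp_continuous_on[OF q(4)] q(2) by (simp add: continuous_on_eq_continuous_at)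
    ultimately have "q 0 = 0" using tendsto_unique[OF at_neq_bot] unfolding isCont_def by blast
    then show False using q(6)[of 0] q(2) by simp
  qed
  define \<mu>1 where "\<mu>1 = min \<mu> (min d \<mu>q)"
  have \<mu>1: "\<mu>1 > 0" "\<mu>1 \<le> \<mu>" "\<mu>1 \<le> d" "\<mu>1 \<le> \<mu>q" using \<mu> d q(2) by (auto simp: \<mu>1_def)
  show ?thesis
  proof (rule that[OF m \<open>k \<noteq> m\<close> \<mu>1(1,2), of "U i" q i])
    show "U i holomorphic_on ball 0 \<mu>1" by (rule holomorphic_on_subset[OF Uhol]) (use \<mu>1 in auto)
    show "q holomorphic_on ball 0 \<mu>1" by (rule holomorphic_on_subset[OF q(4)]) (use \<mu>1 in auto)
    fix w :: complex assume w: "w \<in> ball 0 \<mu>1"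
    then have w': "w \<in> ball 0 \<mu>" "w \<in> ball 0 \<mu>q" "norm w < d" using \<mu>1 by auto
    show "U i w \<noteq> 0 \<and> q w \<noteq> 0" using d(2)[of w] q(6)[OF w'(2)] w' by simp
    show "deriv (\<lambda>w. G w $ i) w = w ^ (m - 1) * U i w" by (rule DERIV_imp_deriv[OF dG[OF w'(1)]])
    show "Y (G w) $ i = w ^ k * q w" using q(5)[OF w'(2)] by (simp add: f_def)
  qed
qed

section \<open>Comparison of indices\<close>

text \<open>Composed with the radial clamp \<open>cl\<close>, the time for a fixed nonzero
  \<open>h\<close> becomes a function without zeros on all of C^n minus the origin. Its real
  dimension is at least 4, so this space is simply connected and carries a logarithm, which
  restricts to the curve.\<close>

lemma time_change_index:
  fixes X Y :: "complex^'n \<Rightarrow> complex^'n"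
  assumes n: "CARD('n) \<ge> 2"
    and X: "hol_vf S X" and Y: "hol_vf T Y" and U: "open U" "U \<subseteq> S" and V: "open V" "V \<subseteq> T"
    and hom: "homeomorphism U V \<phi> \<psi>"
    and leaf: "\<And>x. x \<in> U \<Longrightarrow> X x \<noteq> 0 \<Longrightarrow> \<phi> ` leaf X U x \<subseteq> leaf Y V (\<phi> x)"
    and nz: "\<And>x. x \<in> U - {0} \<Longrightarrow> X x \<noteq> 0 \<and> Y (\<phi> x) \<noteq> 0"
    and r: "0 < r1" "r1 \<le> r2" "cball 0 r2 \<subseteq> U"
    and \<Gamma>: "continuous_on (sphere 0 \<rho>) \<Gamma>" "\<And>z. z \<in> sphere 0 \<rho> \<Longrightarrow> r1 \<le> norm (\<Gamma> z) \<and> norm (\<Gamma> z) \<le> r2"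
    and \<rho>: "\<rho> > 0" and \<eta>': "\<eta>' > 0"
  obtains \<eta> where "\<eta> > 0"
    "\<And>h. norm h \<le> \<eta> \<Longrightarrow> h \<noteq> 0 \<Longrightarrow> \<exists>t. continuous_on (sphere 0 \<rho>) t \<and> ind t 0 \<rho> = 0 \<and>
       (\<forall>z\<in>sphere 0 \<rho>. t z \<noteq> 0 \<and> norm (t z) < \<eta>' \<and> \<phi> (flow X S h (\<Gamma> z)) = flow Y T (t z) (\<phi> (\<Gamma> z)))"
proof -
  define K where "K = cball (0::complex^'n) r2 - ball 0 r1"
  have K: "compact K" "K \<subseteq> U" "K \<subseteq> U - {0}" using r by (auto simp: K_def compact_diff)
  have nzK: "X x \<noteq> 0" "Y (\<phi> x) \<noteq> 0" if "x \<in> K" for x using nz K(3) that by blast+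
  obtain \<eta> \<tau> where \<eta>: "\<eta> > 0"
    and \<tau>: "\<And>x h. x \<in> K \<Longrightarrow> norm h \<le> \<eta> \<Longrightarrow>
       flow X S h x \<in> U \<and> norm (\<tau> x h) < \<eta>' \<and> \<phi> (flow X S h x) = flow Y T (\<tau> x h) (\<phi> x)"
    and \<tau>i: "\<And>x. x \<in> K \<Longrightarrow> inj_on (\<tau> x) (cball 0 \<eta>)" and \<tau>0: "\<And>x. x \<in> K \<Longrightarrow> \<tau> x 0 = 0"
    and \<tau>c: "continuous_on (K \<times> cball 0 \<eta>) (\<lambda>(x, h). \<tau> x h)"
    by (rule time_change[OF X Y U V hom leaf K(1,2) nzK \<eta>']) (assumption | rule that; assumption)+
  \<comment> \<open>Radial retraction onto the closed shell between the radii \<open>r1\<close> and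
    \<open>r2\<close>, the set on which \<open>\<tau>\<close> is available.\<close>
  define cl where "cl = (\<lambda>x :: complex^'n. (max r1 (min r2 (norm x)) / norm x) *\<^sub>R x)"
  have clK: "cl x \<in> K" if "x \<noteq> 0" for x using that r by (auto simp: cl_def K_def)
  have clc: "continuous_on (- {0}) cl" unfolding cl_def by (intro continuous_intros) auto
  have clid: "cl x = x" if "r1 \<le> norm x" "norm x \<le> r2" for x
  proof -
    have "norm x > 0" using that r by linarith
    then show ?thesis using that by (simp add: cl_def)
  qed
  have dim: "3 \<le> DIM(complex^'n)" using n by simp
  show ?thesis
  proof (rule that[OF \<eta>])
    fix h :: complex assume h: "norm h \<le> \<eta>" "h \<noteq> 0"
    have nzt: "\<tau> x h \<noteq> 0" if "x \<in> K" for x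
      using inj_onD[OF \<tau>i[OF that], of h 0] \<tau>0[OF that] h \<eta> by auto
    have "continuous_on (- {0}) (\<lambda>x. (\<lambda>(x, h). \<tau> x h) (cl x, h))"
      by (rule continuous_on_compose2[OF \<tau>c]) (use clK clc h in \<open>auto intro!: continuous_intros\<close>)
    then have c: "continuous_on (- {0}) (\<lambda>x. \<tau> (cl x) h)" by simp
    have "open (- {0 :: complex^'n})" by auto
    then have "locally path_connected (- {0 :: complex^'n})" by (rule open_imp_locally_path_connected)
    then obtain L where L: "continuous_on (- {0}) L" "\<And>x. x \<in> - {0} \<Longrightarrow> \<tau> (cl x) h = exp (L x)"
      using continuous_logarithm_on_simply_connected[OF c simply_connected_punctured_universe[OF dim]] nzt clK
      by (metis Compl_iff singletonI)
    define t where "t = (\<lambda>z. \<tau> (\<Gamma> z) h)"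
    have \<Gamma>K: "\<Gamma> z \<in> K" "\<Gamma> z \<in> - {0}" "cl (\<Gamma> z) = \<Gamma> z" if "z \<in> sphere 0 \<rho>" for z
      using \<Gamma>(2)[OF that] clid r by (auto simp: K_def)
    have tL: "t z = exp (L (\<Gamma> z))" if "z \<in> sphere 0 \<rho>" for z
      using L(2)[OF \<Gamma>K(2)[OF that]] \<Gamma>K(3)[OF that] by (simp add: t_def)
    have Lc: "continuous_on (sphere 0 \<rho>) (\<lambda>z. L (\<Gamma> z))"
      by (rule continuous_on_compose2[OF L(1) \<Gamma>(1)]) (rule image_subsetI, rule \<Gamma>K(2))
    have tc: "continuous_on (sphere 0 \<rho>) t"
      by (rule continuous_on_eq[OF continuous_on_exp[OF Lc]]) (rule tL[symmetric])
    have t0: "ind t 0 \<rho> = 0" by (rule ind_exp[OF Lc \<rho> tL])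
    have tz: "t z \<noteq> 0 \<and> norm (t z) < \<eta>' \<and> \<phi> (flow X S h (\<Gamma> z)) = flow Y T (t z) (\<phi> (\<Gamma> z))"
      if "z \<in> sphere 0 \<rho>" for z
      unfolding t_def by (rule conjI[OF nzt[OF \<Gamma>K(1)[OF that]] conjunct2[OF \<tau>[OF \<Gamma>K(1)[OF that] h(1)]]])
    show "\<exists>t. continuous_on (sphere 0 \<rho>) t \<and> ind t 0 \<rho> = 0 \<and>
       (\<forall>z\<in>sphere 0 \<rho>. t z \<noteq> 0 \<and> norm (t z) < \<eta>' \<and> \<phi> (flow X S h (\<Gamma> z)) = flow Y T (t z) (\<phi> (\<Gamma> z)))"
      by (rule exI[of _ t], rule conjI[OF tc conjI[OF t0 ballI[OF tz]]])
  qed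
qed

text \<open>To first order the displacement is \<open>t z *s Y (\<kappa> z)\<close>, with an error
  quadratic in the time. So its index is the sum of those of \<open>t\<close> and of the coordinate
  of \<open>Y\<close>, and \<open>t\<close> does not wind.\<close>

lemma index_displacement_flow:
  fixes Y :: "complex^'n \<Rightarrow> complex^'n"
  assumes Y: "hol_vf T Y" and r: "r > 0"
    and \<kappa>: "continuous_on (sphere 0 r) \<kappa>" "\<And>z. z \<in> sphere 0 r \<Longrightarrow> \<kappa> z \<in> T"
    and nz: "\<And>z. z \<in> sphere 0 r \<Longrightarrow> Y (\<kappa> z) $ i \<noteq> 0"
  obtains \<eta> where "\<eta> > 0"
    "\<And>t f. continuous_on (sphere 0 r) t \<Longrightarrow> continuous_on (sphere 0 r) f \<Longrightarrow> ind t 0 r = 0 \<Longrightarrow>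
       (\<forall>z\<in>sphere 0 r. t z \<noteq> 0 \<and> norm (t z) < \<eta> \<and> f z = flow Y T (t z) (\<kappa> z)) \<Longrightarrow>
       ind (\<lambda>z. f z $ i - \<kappa> z $ i) 0 r = ind (\<lambda>z. Y (\<kappa> z) $ i) 0 r"
proof -
  define K where "K = \<kappa> ` sphere 0 r"
  have K: "compact K" "K \<subseteq> T" unfolding K_def using compact_continuous_image[OF \<kappa>(1)] \<kappa>(2) by auto
  obtain \<eta> C :: real where \<eta>: "\<eta> > 0" "C > 0"
    and f0: "\<And>x. x \<in> K \<Longrightarrow> flow Y T 0 x = x"
    and aff: "\<And>x t t' \<delta>. x \<in> K \<Longrightarrow> norm t \<le> \<delta> \<Longrightarrow> norm t' \<le> \<delta> \<Longrightarrow> \<delta> < \<eta> \<Longrightarrow>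
       norm (flow Y T t x - flow Y T t' x - (t - t') *s Y x) \<le> C * \<delta> * norm (t - t')"
    by (rule local_flow[OF Y K hol_vf_open[OF Y] order_refl]) (rule that; assumption)
  have Yc: "continuous_on (sphere 0 r) (\<lambda>z. Y (\<kappa> z) $ i)"
    by (intro continuous_intros continuous_on_compose2[OF hol_vf_continuous_on[OF Y] \<kappa>(1)]) (use \<kappa>(2) in blast)
  obtain b where b: "b > 0" "\<And>z. z \<in> sphere 0 r \<Longrightarrow> b \<le> norm (Y (\<kappa> z) $ i)"
    by (rule compact_norm_lower_bound[OF compact_sphere Yc nz]) (assumption | rule that; assumption)+
  \<comment> \<open>For times below \<open>b / C\<close> the quadratic error stays under
    \<open>b * norm (t z)\<close>, a lower bound for the main term.\<close>
  show ?thesis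
  proof (rule that[of "min \<eta> (b / C)"])
    show "min \<eta> (b / C) > 0" using \<eta> b by simp
    fix t :: "complex \<Rightarrow> complex" and f :: "complex \<Rightarrow> complex^'n"
    assume tc: "continuous_on (sphere 0 r) t" and fc: "continuous_on (sphere 0 r) f" and t0: "ind t 0 r = 0"
      and t: "\<forall>z\<in>sphere 0 r. t z \<noteq> 0 \<and> norm (t z) < min \<eta> (b / C) \<and> f z = flow Y T (t z) (\<kappa> z)"
    have "ind (\<lambda>z. f z $ i - \<kappa> z $ i) 0 r = ind (\<lambda>z. t z * Y (\<kappa> z) $ i) 0 r"
    proof (rule ind_close[OF _ _ r])
      show "continuous_on (sphere 0 r) (\<lambda>z. f z $ i - \<kappa> z $ i)" by (intro continuous_intros fc \<kappa>(1))
      show "continuous_on (sphere 0 r) (\<lambda>z. t z * Y (\<kappa> z) $ i)" by (intro continuous_on_mult tc Yc)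
      fix z :: complex assume z: "z \<in> sphere 0 r"
      have zK: "\<kappa> z \<in> K" using z by (simp add: K_def)
      have tz: "t z \<noteq> 0" "norm (t z) < \<eta>" "norm (t z) < b / C" "f z = flow Y T (t z) (\<kappa> z)" using bspec[OF t z] by auto
      have "norm (f z $ i - \<kappa> z $ i - t z * Y (\<kappa> z) $ i) = norm ((f z - \<kappa> z - t z *s Y (\<kappa> z)) $ i)" by simp
      also have "\<dots> \<le> norm (f z - \<kappa> z - t z *s Y (\<kappa> z))" by (rule Finite_Cartesian_Product.norm_nth_le)
      also have "\<dots> \<le> C * norm (t z) * norm (t z)"
        using aff[OF zK order_refl _ tz(2), of 0] tz(4) f0[OF zK] by simp
      also have "\<dots> < b * norm (t z)"
        using tz(1,3) \<eta>(2) by (simp add: pos_less_divide_eq mult.commute)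
      also have "\<dots> \<le> norm (t z * Y (\<kappa> z) $ i)"
        using mult_right_mono[OF b(2)[OF z], of "norm (t z)"] by (simp add: norm_mult mult.commute)
      finally show "norm (f z $ i - \<kappa> z $ i - t z * Y (\<kappa> z) $ i) < norm (t z * Y (\<kappa> z) $ i)" .
    qed
    also have "\<dots> = ind t 0 r + ind (\<lambda>z. Y (\<kappa> z) $ i) 0 r"
      by (rule ind_mult[OF tc _ Yc nz r]) (use t in auto)
    finally show "ind (\<lambda>z. f z $ i - \<kappa> z $ i) 0 r = ind (\<lambda>z. Y (\<kappa> z) $ i) 0 r" using t0 by simp
  qed
qed

text \<open>Shrinking the factor \<open>a\<close> to 0 is a homotopy without zeros, since
  \<open>s\<close> is injective on the closed disc and the scaled point lies strictly inside; it
  ends at the negative of \<open>s\<close>.\<close>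

lemma ind_inj_displacement:
  assumes c: "continuous_on (cball 0 r) s" and inj: "inj_on s (cball 0 r)" and s0: "s 0 = 0" and r: "r > 0"
    and a: "0 < a" "a < (1::real)"
  shows "ind (\<lambda>z. s (of_real a * z) - s z) 0 r = ind s 0 r"
proof -
  define H where "H = (\<lambda>(t::real) z. s (of_real ((1 - t) * a) * z) - s z)"
  have le: "norm (of_real ((1 - t) * a) * z) < r" if "t \<in> {0..1}" "z \<in> sphere 0 r" for t and z :: complex
  proof -
    have "(1 - t) * a \<le> 1 * a" using that a by (intro mult_right_mono) auto
    then have "(1 - t) * a < 1" using a by linarith
    then have "(1 - t) * a * r < 1 * r" using r by (rule mult_strict_right_mono)
    moreover have "norm (of_real ((1 - t) * a) * z) = \<bar>(1 - t) * a\<bar> * norm z" by (simp only: norm_mult norm_of_real)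
    ultimately show ?thesis using that a by (simp add: abs_mult)
  qed
  have "continuous_on ({0..1} \<times> sphere 0 r) (\<lambda>p. s (of_real ((1 - fst p) * a) * snd p) - s (snd p))"
    by (intro continuous_on_diff continuous_on_compose2[OF c] continuous_intros) (use le in \<open>auto simp: less_imp_le\<close>)
  then have "ind (H 0) 0 r = ind (H 1) 0 r"
  proof (intro ind_homotopy[OF _ r])
    show "H t z \<noteq> 0" if "t \<in> {0..1}" "z \<in> sphere 0 r" for t z
    proof
      assume "H t z = 0"
      then have eq: "of_real ((1 - t) * a) * z = z"
        using inj_onD[OF inj, of "of_real ((1 - t) * a) * z" z] le[OF that] that by (simp add: H_def)
      show False using le[OF that] that(2) unfolding eq by simp
    qed
  qed (simp add: H_def case_prod_beta)
  moreover have "H 0 = (\<lambda>z. s (of_real a * z) - s z)" "H 1 = (\<lambda>z. (- 1) * s z)"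
    by (auto simp: H_def s0)
  moreover have "ind (\<lambda>z. (- 1) * s z) 0 r = ind (\<lambda>_. - 1) 0 r + ind s 0 r"
  proof (rule ind_mult[OF _ _ _ _ r])
    show "continuous_on (sphere 0 r) s" by (rule continuous_on_subset[OF c]) auto
    show "s z \<noteq> 0" if "z \<in> sphere 0 r" for z using inj_onD[OF inj, of z 0] s0 that r by auto
  qed auto
  ultimately show ?thesis using ind_const[OF _ r, of "- 1" 0] by simp
qed

text \<open>For a factor close to 1 the displacement of \<open>g\<close> is that of \<open>s\<close>
  times \<open>deriv g (s z)\<close>, up to a relatively smaller error because the derivative has no
  zeros on the curve. The displacement of \<open>s\<close> contributes the index of
  \<open>s\<close>.\<close>

lemma index_displacement_holomorphic:
  assumes c: "continuous_on (cball 0 r) s" and inj: "inj_on s (cball 0 r)" and s0: "s 0 = 0" and r: "r > 0"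
    and g: "g holomorphic_on ball 0 \<mu>" and s\<mu>: "\<And>z. z \<in> cball 0 r \<Longrightarrow> s z \<in> ball 0 \<mu>"
    and nz: "\<And>w. w \<in> ball 0 \<mu> - {0} \<Longrightarrow> deriv g w \<noteq> 0"
  obtains x0 where "x0 > 0"
    "\<And>x. 0 < x \<Longrightarrow> x < x0 \<Longrightarrow> ind (\<lambda>z. g (s (of_real (exp (- x)) * z)) - g (s z)) 0 r = ind s 0 r + ind (\<lambda>z. deriv g (s z)) 0 r"
proof -
  have "compact (s ` cball 0 r)" by (rule compact_continuous_image[OF c compact_cball])
  \<comment> \<open>The image of the disc is compact, so it lies in a closed disc of radius
    \<open>\<nu> < \<mu>\<close>, on which the derivative of \<open>g\<close> is uniformly
    continuous and which contains all segments between image points.\<close>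
  then obtain w0 where w0: "w0 \<in> s ` cball 0 r" "\<And>w. w \<in> s ` cball 0 r \<Longrightarrow> norm w \<le> norm w0"
    using continuous_attains_sup[of "s ` cball 0 r" norm] r continuous_on_norm_id by fastforce
  define \<nu> where "\<nu> = norm w0"
  have \<nu>: "\<nu> < \<mu>" "\<And>z. z \<in> cball 0 r \<Longrightarrow> s z \<in> cball 0 \<nu>" using w0 s\<mu> by (auto simp: \<nu>_def)
  have D: "deriv g holomorphic_on ball 0 \<mu>" by (rule holomorphic_deriv[OF g open_ball])
  have Dc: "continuous_on (ball 0 \<mu>) (deriv g)" by (rule holomorphic_on_imp_continuous_on[OF D])
  have snz: "s z \<noteq> 0" if "z \<in> sphere 0 r" for z using inj_onD[OF inj, of z 0] s0 that r by auto
  have cs: "continuous_on (sphere 0 r) s" by (rule continuous_on_subset[OF c]) auto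
  have cD: "continuous_on (sphere 0 r) (\<lambda>z. deriv g (s z))"
    by (rule continuous_on_compose2[OF Dc cs]) (use s\<mu> in auto)
  have nzD: "deriv g (s z) \<noteq> 0" if "z \<in> sphere 0 r" for z using nz[of "s z"] snz[OF that] s\<mu>[of z] that by auto
  obtain b where b: "b > 0" "\<And>z. z \<in> sphere 0 r \<Longrightarrow> b \<le> norm (deriv g (s z))"
    by (rule compact_norm_lower_bound[OF compact_sphere cD nzD]) (assumption | rule that; assumption)+
  have "uniformly_continuous_on (cball 0 \<nu>) (deriv g)"
    by (rule compact_uniformly_continuous[OF continuous_on_subset[OF Dc] compact_cball]) (use \<nu> in auto)
  then obtain d where d: "d > 0" "\<And>u w. u \<in> cball 0 \<nu> \<Longrightarrow> w \<in> cball 0 \<nu> \<Longrightarrow> dist u w < d \<Longrightarrow> dist (deriv g u) (deriv g w) < b / 2"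
    using b(1) unfolding uniformly_continuous_on_def by (metis half_gt_zero dist_commute)
  have "uniformly_continuous_on (cball 0 r) s" by (rule compact_uniformly_continuous[OF c compact_cball])
  then obtain e where e: "e > 0" "\<And>u w. u \<in> cball 0 r \<Longrightarrow> w \<in> cball 0 r \<Longrightarrow> dist u w < e \<Longrightarrow> dist (s u) (s w) < d"
    using d(1) unfolding uniformly_continuous_on_def by (metis dist_commute)
  show ?thesis
  proof (rule that[of "e / r"])
    show "e / r > 0" using e r by simp
    fix x assume x: "0 < x" "x < e / r"
    define a where "a = exp (- x)"
    \<comment> \<open>1 - exp(-x) \<le> x, so the scaled point is less than \<open>e\<close> away
      from \<open>z\<close>.\<close>
    have a: "0 < a" "a < 1" "1 - a < e / r" using x exp_ge_add_one_self[of "- x"] by (auto simp: a_def)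
    have az: "of_real a * z \<in> cball 0 r" "dist (of_real a * z) z < e" if "z \<in> sphere 0 r" for z :: complex
    proof -
      show "of_real a * z \<in> cball 0 r" using that a r mult_right_mono[of a 1 r] by (simp add: norm_mult)
      have "norm (of_real (a - 1) * z) = (1 - a) * r" unfolding norm_mult norm_of_real using that a by simp
      then have "dist (of_real a * z) z = (1 - a) * r" by (simp add: dist_norm algebra_simps)
      also have "\<dots> < e" using a(3) r by (simp add: pos_less_divide_eq)
      finally show "dist (of_real a * z) z < e" .
    qed
    have csa: "continuous_on (sphere 0 r) (\<lambda>z. s (of_real a * z))"
      by (rule continuous_on_compose2[OF c]) (use az in \<open>auto intro!: continuous_intros\<close>)
    have cg: "continuous_on (ball 0 \<mu>) g" by (rule holomorphic_on_imp_continuous_on[OF g])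
    have ne: "s (of_real a * z) \<noteq> s z" if "z \<in> sphere 0 r" for z
    proof
      assume "s (of_real a * z) = s z"
      then have "of_real a * z = z" using inj_onD[OF inj _ az(1)[OF that], of z] that by auto
      then show False using a that r by auto
    qed
    have "ind (\<lambda>z. g (s (of_real a * z)) - g (s z)) 0 r = ind (\<lambda>z. (s (of_real a * z) - s z) * deriv g (s z)) 0 r"
    proof (rule ind_close[OF _ _ r])
      show "continuous_on (sphere 0 r) (\<lambda>z. g (s (of_real a * z)) - g (s z))"
        by (intro continuous_on_diff continuous_on_compose2[OF cg csa] continuous_on_compose2[OF cg cs])
           (use s\<mu> az(1) in auto)
      show "continuous_on (sphere 0 r) (\<lambda>z. (s (of_real a * z) - s z) * deriv g (s z))"
        by (intro continuous_on_mult continuous_on_diff csa cs cD)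
      fix z :: complex assume z: "z \<in> sphere 0 r"
      define w where "w = s z"
      define w' where "w' = s (of_real a * z)"
      have wn: "w \<in> cball 0 \<nu>" "w' \<in> cball 0 \<nu>" using \<nu>(2) az(1)[OF z] z by (auto simp: w_def w'_def)
      have ww: "dist w' w < d" unfolding w_def w'_def by (rule e(2)[OF az(1)[OF z] _ az(2)[OF z]]) (use z in auto)
      have seg: "u \<in> cball 0 \<nu>" "dist u w < d" if "u \<in> closed_segment w w'" for u
      proof -
        show "u \<in> cball 0 \<nu>" using closed_segment_subset[OF wn convex_cball] that by blast
        have "dist u w \<le> dist w' w" using dist_in_closed_segment[OF that] by (simp add: dist_commute)
        then show "dist u w < d" using ww by linarith
      qed
      have "norm ((g w' - deriv g w * w') - (g w - deriv g w * w)) \<le> b / 2 * norm (w' - w)"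
      proof (rule field_differentiable_bound[OF convex_closed_segment[of w w'], where f' = "\<lambda>u. deriv g u - deriv g w"])
        fix u assume u: "u \<in> closed_segment w w'"
        then have "u \<in> ball 0 \<mu>" using seg(1) \<nu>(1) by force
        then have "(g has_field_derivative deriv g u) (at u within closed_segment w w')"
          using holomorphic_derivI[OF g open_ball] has_field_derivative_at_within by blast
        then show "((\<lambda>u. g u - deriv g w * u) has_field_derivative deriv g u - deriv g w) (at u within closed_segment w w')"
          by (auto intro!: derivative_eq_intros)
        show "norm (deriv g u - deriv g w) \<le> b / 2"
          using d(2)[OF seg(1)[OF u] wn(1) seg(2)[OF u]] by (simp add: dist_norm less_imp_le)
      qed auto
      also have "\<dots> < b * norm (w' - w)" using b(1) ne[OF z] by (simp add: w_def w'_def)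
      also have "\<dots> \<le> norm (deriv g w) * norm (w' - w)" using b(2)[OF z] by (intro mult_right_mono) (auto simp: w_def)
      also have "(g w' - deriv g w * w') - (g w - deriv g w * w) = (g w' - g w) - (w' - w) * deriv g w" by (simp add: algebra_simps)
      finally show "norm (g (s (of_real a * z)) - g (s z) - (s (of_real a * z) - s z) * deriv g (s z))
          < norm ((s (of_real a * z) - s z) * deriv g (s z))"
        unfolding w_def w'_def by (simp add: norm_mult mult.commute)
    qed
    also have "\<dots> = ind (\<lambda>z. s (of_real a * z) - s z) 0 r + ind (\<lambda>z. deriv g (s z)) 0 r"
      by (rule ind_mult[OF _ _ cD nzD r]) (use ne csa cs in \<open>auto intro!: continuous_intros\<close>)
    also have "ind (\<lambda>z. s (of_real a * z) - s z) 0 r = ind s 0 r"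
      by (rule ind_inj_displacement[OF c inj s0 r a(1,2)])
    finally show "ind (\<lambda>z. g (s (of_real (exp (- x)) * z)) - g (s z)) 0 r = ind s 0 r + ind (\<lambda>z. deriv g (s z)) 0 r"
      unfolding a_def .
  qed
qed

lemma ind_power_times_unit:
  assumes c: "continuous_on (cball 0 r) s" and inj: "inj_on s (cball 0 r)" and s0: "s 0 = 0" and r: "r > 0"
    and s\<mu>: "\<And>z. z \<in> cball 0 r \<Longrightarrow> s z \<in> ball 0 \<mu>" and q: "continuous_on (ball 0 \<mu>) q" "\<And>w. w \<in> ball 0 \<mu> \<Longrightarrow> q w \<noteq> 0"
  shows "ind (\<lambda>z. s z ^ k * q (s z)) 0 r = of_nat k * ind s 0 r"
proof -
  have cs: "continuous_on (sphere 0 r) s" by (rule continuous_on_subset[OF c]) auto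
  have snz: "s z \<noteq> 0" if "z \<in> sphere 0 r" for z using inj_onD[OF inj, of z 0] s0 that r by auto
  have qs: "continuous_on (cball 0 r) (\<lambda>z. q (s z))" by (rule continuous_on_compose2[OF q(1) c]) (use s\<mu> in auto)
  have "ind (\<lambda>z. s z ^ k * q (s z)) 0 r = ind (\<lambda>z. s z ^ k) 0 r + ind (\<lambda>z. q (s z)) 0 r"
    by (rule ind_mult[OF _ _ continuous_on_subset[OF qs] _ r]) (use cs snz q(2) s\<mu> in \<open>auto intro!: continuous_intros\<close>)
  also have "ind (\<lambda>z. q (s z)) 0 r = 0" by (rule ind_nonzero_cball[OF qs r]) (use q(2) s\<mu> in auto)
  also have "ind (\<lambda>z. s z ^ k) 0 r = of_nat k * ind s 0 r" by (rule ind_power[OF cs snz r])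
  finally show ?thesis by simp
qed

section \<open>Dimension and spectrum\<close>

text \<open>In dimension one the only component of \<open>X\<close> would itself be a common divisor
  vanishing at 0. The gcd condition is thus the origin of n \<ge> 2, and through it of the simply
  connected complement of the origin.\<close>

lemma vf_germ_dim:
  fixes X :: "complex^'n \<Rightarrow> complex^'n"
  assumes "vf_germ X r"
  shows "CARD('n) \<ge> 2"
proof (rule ccontr)
  assume "\<not> CARD('n) \<ge> 2"
  then have "CARD('n) = 1" using zero_less_card_finite[where 'a='n] by linarith
  then obtain i0 :: 'n where "UNIV = {i0}" by (rule card_1_singletonE)
  then have i0: "i = i0" for i by auto
  have X: "r > 0" "hol_vf (ball 0 r) X" "X 0 = 0" using assms unfolding vf_germ_def by auto
  have 1: "hol_fun (ball 0 r) (\<lambda>z. X z $ i0)" using X(2) unfolding hol_vf_def by blast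
  have "\<exists>L. ((\<lambda>_. 1) has_derivative L) (at z) \<and> (\<forall>c v. L (c *s v) = c * L v)" for z :: "complex^'n"
    by (intro exI[of _ "\<lambda>_. 0"]) auto
  then have 2: "hol_fun (ball 0 r) (\<lambda>_ :: complex^'n. 1)" unfolding hol_fun_def by auto
  have 3: "X z $ i = X z $ i0 * 1" for i z using i0[of i] by simp
  have "\<exists>h g \<epsilon>. \<epsilon> > 0 \<and> hol_fun (ball 0 \<epsilon>) h \<and> h 0 = 0 \<and> (\<forall>i. hol_fun (ball 0 \<epsilon>) (g i)) \<and>
          (\<forall>i. \<forall>z\<in>ball 0 \<epsilon>. X z $ i = h z * g i z)"
    by (rule exI[of _ "\<lambda>z. X z $ i0"], rule exI[of _ "\<lambda>_ _. 1"], rule exI[of _ r])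
       (intro conjI allI ballI X(1) 1 2 3, simp add: X(3))
  then show False using assms unfolding vf_germ_def by blast
qed

text \<open>An eigenvalue of modulus above half the supremum of all moduli suffices: its multiples
  by j \<ge> 2 exceed the supremum. The operator norm makes the supremum finite, the given nonzero
  eigenvalue makes it positive.\<close>

lemma nonresonant_eigenvalue:
  fixes A :: "complex^'n \<Rightarrow> complex^'n"
  assumes lin: "bounded_linear A" and ev: "v0 \<noteq> 0" "A v0 = c0 *s v0" "c0 \<noteq> 0"
  obtains \<alpha> v where "\<alpha> \<noteq> 0" "v \<noteq> 0" "A v = \<alpha> *s v" "\<And>j (w :: complex^'n). j \<ge> 2 \<Longrightarrow> w \<noteq> 0 \<Longrightarrow> A w \<noteq> (of_nat j * \<alpha>) *s w"
proof -
  define E where "E = {norm c | c. \<exists>v. v \<noteq> 0 \<and> A v = c *s v}"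
  have "norm c \<le> onorm A" if "v \<noteq> 0" "A v = c *s v" for c v
    using onorm[OF lin, of v] that by (simp add: norm_cscale)
  then have bdd: "bdd_above E" unfolding E_def by (intro bdd_aboveI[of _ "onorm A"]) auto
  have inE: "norm c \<in> E" if "v \<noteq> 0" "A v = c *s v" for c v using that unfolding E_def by blast
  have pos: "Sup E > 0" using cSup_upper[OF inE[OF ev(1,2)] bdd] ev(3) by (auto intro: less_le_trans[of 0 "norm c0"])
  then have "Sup E / 2 < Sup E" by simp
  then obtain x where x: "x \<in> E" "Sup E / 2 < x" using less_cSupE[of "Sup E / 2" E] inE[OF ev(1,2)] by blast
  then obtain \<alpha> v where \<alpha>: "v \<noteq> 0" "A v = \<alpha> *s v" "x = norm \<alpha>" unfolding E_def by blast
  show ?thesis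
  proof (rule that[of \<alpha> v])
    show "\<alpha> \<noteq> 0" using \<alpha>(3) x(2) pos by auto
    fix j :: nat and w :: "complex^'n" assume j: "2 \<le> j" "w \<noteq> 0"
    show "A w \<noteq> (of_nat j * \<alpha>) *s w"
    proof
      assume "A w = (of_nat j * \<alpha>) *s w"
      then have "norm (of_nat j * \<alpha>) \<le> Sup E" using cSup_upper[OF inE bdd] j(2) by blast
      moreover have "2 * norm \<alpha> \<le> real j * norm \<alpha>" using j(1) by (intro mult_right_mono) auto
      ultimately show False using x(2) \<alpha>(3) by (simp add: norm_mult)
    qed
  qed (use \<alpha> in auto)
qed

lemma hol_vf_cscale: "hol_vf S X \<Longrightarrow> hol_vf S (\<lambda>z. c *s X z)"
  unfolding hol_vf_def hol_fun_def
proof (intro allI conjI ballI)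
  fix i z assume X: "\<forall>i. open S \<and> (\<forall>z\<in>S. \<exists>L. ((\<lambda>z. X z $ i) has_derivative L) (at z) \<and> (\<forall>c v. L (c *s v) = c * L v))"
    and z: "z \<in> S"
  then obtain L where L: "((\<lambda>z. X z $ i) has_derivative L) (at z)" "\<forall>c v. L (c *s v) = c * L v" by blast
  show "\<exists>L. ((\<lambda>z. (c *s X z) $ i) has_derivative L) (at z) \<and> (\<forall>c v. L (c *s v) = c * L v)"
    by (rule exI[of _ "\<lambda>v. c * L v"]) (use L in \<open>auto intro!: has_derivative_mult_right\<close>)
qed auto

lemma Spect_eq:
  assumes "(X has_derivative A) (at 0)"
  shows "Spect X = {c. \<exists>v. v \<noteq> 0 \<and> A v = c *s v}"
  using frechet_derivative_at[OF assms] unfolding Spect_def by simp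

section \<open>The two computations of one index\<close>

theorem theoremC:
  fixes X Y :: "complex^'n \<Rightarrow> complex^'n" and r s :: real
  assumes "vf_germ X r" and "vf_germ Y s"
    and "top_equiv X (ball 0 r) Y (ball 0 s)"
    and "Spect X \<noteq> {0}"
  shows "Spect Y \<noteq> {0}"
proof
  assume SY: "Spect Y = {0}"
  have n: "CARD('n) \<ge> 2" by (rule vf_germ_dim[OF assms(1)])
  have X: "r > 0" "hol_vf (ball 0 r) X" "X 0 = 0" "\<And>z. z \<in> ball 0 r \<Longrightarrow> z \<noteq> 0 \<Longrightarrow> X z \<noteq> 0"
    using assms(1) unfolding vf_germ_def by auto
  have Y: "s > 0" "hol_vf (ball 0 s) Y" "Y 0 = 0" "\<And>z. z \<in> ball 0 s \<Longrightarrow> z \<noteq> 0 \<Longrightarrow> Y z \<noteq> 0"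
    using assms(2) unfolding vf_germ_def by auto
  obtain LX where LX: "(X has_derivative LX) (at 0)" "\<And>c v. LX (c *s v) = c *s LX v"
    by (rule hol_vf_has_derivative[OF X(2)]) (use X(1) in auto)
  obtain LY where LY: "(Y has_derivative LY) (at 0)" "\<And>c v. LY (c *s v) = c *s LY v"
    by (rule hol_vf_has_derivative[OF Y(2)]) (use Y(1) in auto)
  have linX: "bounded_linear LX" by (rule has_derivative_bounded_linear[OF LX(1)])
  have "Vector_Spaces.linear (*s) (*s) LX"
    by unfold_locales (auto simp: LX(2) bounded_linear.linear[OF linX, THEN linear_add] vec_eq_iff algebra_simps)
  \<comment> \<open>\<open>Spect X \<noteq> {0}\<close> alone would be compatible with an empty
    spectrum; since there is an eigenvalue, there is a nonzero one.\<close>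
  then obtain c1 v1 where cv1: "v1 \<noteq> 0" "LX v1 = c1 *s v1" by (rule complex_linear_eigenvalue)
  then have "c1 \<in> Spect X" unfolding Spect_eq[OF LX(1)] by blast
  then obtain c0 where "c0 \<in> Spect X" "c0 \<noteq> 0" using assms(4) by blast
  then obtain v0 where cv0: "v0 \<noteq> 0" "LX v0 = c0 *s v0" "c0 \<noteq> 0" unfolding Spect_eq[OF LX(1)] by blast
  obtain \<alpha> v where \<alpha>: "\<alpha> \<noteq> 0" and v: "v \<noteq> 0" "LX v = \<alpha> *s v"
    and nonres: "\<And>j w. j \<ge> 2 \<Longrightarrow> w \<noteq> 0 \<Longrightarrow> LX w \<noteq> (of_nat j * \<alpha>) *s w"
    by (rule nonresonant_eigenvalue[OF linX cv0]) (rule that; assumption)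
  \<comment> \<open>Division by \<open>\<alpha>\<close> normalizes the eigenvalue to 1 as in
    \<open>separatrix\<close>; it does not change the leaves, and \<open>\<alpha>\<close> reappears
    in the equation for \<open>\<Gamma>\<close>.\<close>
  define B where "B = (\<lambda>w. (1 / \<alpha>) *s LX w)"
  have B1: "((\<lambda>z. (1 / \<alpha>) *s X z) has_derivative B) (at 0)"
    unfolding B_def by (rule bounded_linear.has_derivative[OF bounded_bilinear.bounded_linear_right[OF bounded_bilinear_cscale] LX(1)])
  have B2: "B (c *s w) = c *s B w" for c w by (simp add: B_def LX(2) mult.commute)
  have B3: "B v = v" using \<alpha> by (simp add: B_def v(2))
  have B4: "B w \<noteq> of_nat j *s w" if "j \<ge> 2" "w \<noteq> 0" for j w
  proof
    assume "B w = of_nat j *s w"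
    then have "\<alpha> *s B w = (of_nat j * \<alpha>) *s w" by (simp add: mult.commute)
    moreover have "\<alpha> *s B w = LX w" using \<alpha> by (simp add: B_def)
    ultimately show False using nonres[OF that] by simp
  qed
  have Z0: "(1 / \<alpha>) *s X 0 = 0" by (simp add: X(3))
  obtain \<rho> \<Gamma> where \<rho>: "\<rho> > 0" and \<Gamma>0: "\<Gamma> 0 = 0" and "\<And>z. z \<in> ball 0 \<rho> \<Longrightarrow> \<Gamma> z \<in> ball 0 r"
    and \<Gamma>d0: "has_vderiv \<Gamma> v 0"
    and \<Gamma>d': "\<And>z. z \<in> ball 0 \<rho> \<Longrightarrow> z \<noteq> 0 \<Longrightarrow> has_vderiv \<Gamma> ((1 / z) *s ((1 / \<alpha>) *s X (\<Gamma> z))) z"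
    by (rule separatrix[OF hol_vf_cscale[OF X(2)] X(1) Z0 B1 B2 B3 B4]) (assumption | rule that; assumption)+
  have \<Gamma>d: "has_vderiv \<Gamma> ((1 / (\<alpha> * z)) *s X (\<Gamma> z)) z" if "z \<in> ball 0 \<rho> - {0}" for z
    using \<Gamma>d'[of z] that by (simp add: mult.commute)
  have "isCont \<Gamma> z" if "z \<in> ball 0 \<rho>" for z
    using has_derivative_continuous[OF \<Gamma>d0] has_derivative_continuous[OF \<Gamma>d[of z]] that by (cases "z = 0") auto
  then have \<Gamma>c: "continuous_on (ball 0 \<rho>) \<Gamma>" by (rule continuous_at_imp_continuous_on[OF ballI])

  obtain U V \<phi> \<psi> where "open U \<and> open V \<and> 0 \<in> U \<and> 0 \<in> V \<and> U \<subseteq> ball 0 r \<and> V \<subseteq> ball 0 s \<and>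
        homeomorphism U V \<phi> \<psi> \<and> \<phi> 0 = 0 \<and> (\<forall>x\<in>U. X x \<noteq> 0 \<longrightarrow> \<phi> ` leaf X U x = leaf Y V (\<phi> x))"
    using assms(3) unfolding top_equiv_def by (elim exE)
  then have U: "open U" "U \<subseteq> ball 0 r" and V: "open V" "V \<subseteq> ball 0 s" and UV0: "0 \<in> U" "0 \<in> V"
    and hom: "homeomorphism U V \<phi> \<psi>" and \<phi>0: "\<phi> 0 = 0"
    and leaf: "\<And>x. x \<in> U \<Longrightarrow> X x \<noteq> 0 \<Longrightarrow> \<phi> ` leaf X U x \<subseteq> leaf Y V (\<phi> x)" by auto
  have \<phi>: "continuous_on U \<phi>" "\<And>x. x \<in> U \<Longrightarrow> \<phi> x \<in> V" "\<And>x. x \<in> U \<Longrightarrow> \<psi> (\<phi> x) = x"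
    using hom unfolding homeomorphism_def by blast+
  have \<phi>nz: "\<phi> x \<noteq> 0" if "x \<in> U - {0}" for x using \<phi>(3)[of x] \<phi>(3)[OF UV0(1)] \<phi>0 that by auto
  have nzXY: "X x \<noteq> 0 \<and> Y (\<phi> x) \<noteq> 0" if "x \<in> U - {0}" for x
    using X(4)[of x] Y(4)[OF _ \<phi>nz[OF that]] \<phi>(2)[of x] U V that by blast

  \<comment> \<open>The separatrix has the nonzero velocity \<open>v\<close> at 0, so it does not
    return to the origin nearby.\<close>
  have "\<forall>\<^sub>F z in at 0. \<Gamma> z \<noteq> 0"
  proof -
    obtain i where i: "v $ i \<noteq> 0" using v(1) by (auto simp: vec_eq_iff)
    have "((\<lambda>z. \<Gamma> z $ i) has_field_derivative v $ i) (at 0)" using \<Gamma>d0 unfolding has_vderiv_iff by blast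
    then have "((\<lambda>z. (\<Gamma> z $ i - \<Gamma> 0 $ i) / (z - 0)) \<longlongrightarrow> v $ i) (at 0)" by (simp only: has_field_derivative_iff)
    from tendsto_imp_eventually_ne[OF this i] show ?thesis by eventually_elim (auto simp: \<Gamma>0)
  qed
  moreover have "\<forall>\<^sub>F z in at 0. \<Gamma> z \<in> U"
    by (rule topological_tendstoD[OF _ U(1)]) (use has_derivative_continuous[OF \<Gamma>d0] UV0 \<Gamma>0 in \<open>auto simp: isCont_def\<close>)
  ultimately have "\<forall>\<^sub>F z in at 0. \<Gamma> z \<noteq> 0 \<and> \<Gamma> z \<in> U" by (rule eventually_conj)
  then obtain d where d: "d > 0" "\<And>z. z \<noteq> 0 \<Longrightarrow> dist z 0 < d \<Longrightarrow> \<Gamma> z \<noteq> 0 \<and> \<Gamma> z \<in> U"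
    unfolding eventually_at by auto
  define R where "R = min d \<rho>"
  have R: "R > 0" "R \<le> d" "ball 0 R \<subseteq> ball (0::complex) \<rho>" using d \<rho> by (auto simp: R_def)
  have \<Gamma>U: "\<Gamma> z \<in> U" if "z \<in> ball 0 R" for z using d(2)[of z] that R(2) \<Gamma>0 UV0 by (cases "z = 0") auto
  have \<Gamma>nz: "\<Gamma> z \<in> U - {0}" if "z \<in> ball 0 R - {0}" for z using d(2)[of z] that R(2) by auto
  have \<Gamma>dR: "has_vderiv \<Gamma> ((1 / (\<alpha> * z)) *s X (\<Gamma> z)) z" if "z \<in> ball 0 R - {0}" for z using \<Gamma>d R(3) that by blast
  have \<Gamma>cR: "continuous_on (ball 0 R) \<Gamma>" by (rule continuous_on_subset[OF \<Gamma>c R(3)])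
  define \<kappa> where "\<kappa> = (\<lambda>z. \<phi> (\<Gamma> z))"
  have \<kappa>c: "continuous_on (ball 0 R) \<kappa>"
    unfolding \<kappa>_def by (rule continuous_on_compose2[OF \<phi>(1) \<Gamma>cR]) (use \<Gamma>U in blast)
  have \<kappa>T: "\<kappa> z \<in> ball 0 s" if "z \<in> ball 0 R" for z using \<phi>(2)[OF \<Gamma>U[OF that]] V(2) unfolding \<kappa>_def by blast
  have \<kappa>0: "\<kappa> 0 = 0" by (simp add: \<kappa>_def \<Gamma>0 \<phi>0)
  have \<kappa>nz: "\<kappa> z \<noteq> 0" if "z \<in> ball 0 R - {0}" for z unfolding \<kappa>_def by (rule \<phi>nz[OF \<Gamma>nz[OF that]])
  obtain F \<epsilon> where ch: "curve_charts R F \<epsilon>"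
    and fl: "\<And>z0. z0 \<in> ball 0 R - {0} \<Longrightarrow> \<forall>\<^sub>F z in nhds z0. \<phi> (\<Gamma> z) = flow Y (ball 0 s) (F z0 z) (\<phi> (\<Gamma> z0))"
    by (rule charts_exist[OF X(2) Y(2) U V hom leaf \<alpha> R(1) \<Gamma>U \<Gamma>cR \<Gamma>dR nzXY[OF \<Gamma>nz]])
       (assumption | rule that; assumption)+
  have fl\<kappa>: "\<forall>\<^sub>F z in nhds z0. \<kappa> z = flow Y (ball 0 s) (F z0 z) (\<kappa> z0)" if "z0 \<in> ball 0 R - {0}" for z0
    unfolding \<kappa>_def by (rule fl[OF that])
  obtain A \<mu> u \<sigma> r0 c where A: "open A" "0 \<in> A" "A \<subseteq> ball 0 R" "\<mu> > 0" and homA: "homeomorphism A (ball 0 \<mu>) u \<sigma>"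
    and u0: "u 0 = 0" and r0: "r0 > 0" "\<And>r. 0 < r \<Longrightarrow> r \<le> r0 \<Longrightarrow> cball 0 r \<subseteq> A \<and> ind u 0 r = of_int \<epsilon>"
    and Ghol: "\<And>i. (\<lambda>w. \<kappa> (\<sigma> w) $ i) holomorphic_on ball 0 \<mu>"
    and Gc: "\<And>w. w \<in> ball 0 \<mu> - {0} \<Longrightarrow> c w \<noteq> 0 \<and> has_vderiv (\<lambda>w. \<kappa> (\<sigma> w)) (c w *s Y (\<kappa> (\<sigma> w))) w"
    by (rule analytic_parametrization[OF Y(2) ch \<kappa>T \<kappa>c \<kappa>0 \<kappa>nz fl\<kappa>])
       (assumption | rule that; assumption)+
  have u: "continuous_on A u" "\<And>z. z \<in> A \<Longrightarrow> \<sigma> (u z) = z" "\<And>w. w \<in> ball 0 \<mu> \<Longrightarrow> \<sigma> w \<in> A" "\<And>w. w \<in> ball 0 \<mu> \<Longrightarrow> u (\<sigma> w) = w"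
    using homA unfolding homeomorphism_def by blast+
  have \<sigma>0: "\<sigma> 0 = 0" using u(2)[OF A(2)] u0 by simp
  have \<sigma>R: "\<sigma> w \<in> ball 0 R" if "w \<in> ball 0 \<mu>" for w using u(3)[OF that] A(3) by blast
  have \<sigma>nz: "\<sigma> w \<in> ball 0 R - {0}" if "w \<in> ball 0 \<mu> - {0}" for w
    using u(4)[of w] \<sigma>R[of w] that u0 by auto
  have spec: "c = 0" if "v \<noteq> 0" "LY v = c *s v" for c v
    using SY that unfolding Spect_eq[OF LY(1)] by blast
  define G where "G = (\<lambda>w. \<kappa> (\<sigma> w))"
  have GholG: "(\<lambda>w. G w $ i) holomorphic_on ball 0 \<mu>" for i unfolding G_def by (rule Ghol)
  have GcG: "c w \<noteq> 0 \<and> has_vderiv G (c w *s Y (G w)) w" if "w \<in> ball 0 \<mu> - {0}" for w unfolding G_def by (rule Gc[OF that])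
  have G0: "G 0 = 0" by (simp add: G_def \<sigma>0 \<kappa>0)
  have Gnz: "G w \<noteq> 0" if "w \<in> ball 0 \<mu> - {0}" for w unfolding G_def by (rule \<kappa>nz[OF \<sigma>nz[OF that]])
  have Gs: "G w \<in> ball 0 s" if "w \<in> ball 0 \<mu>" for w unfolding G_def by (rule \<kappa>T[OF \<sigma>R[OF that]])
  obtain i m k p q \<mu>1 where m: "m > 0" "k \<noteq> m" and \<mu>1: "\<mu>1 > 0" "\<mu>1 \<le> \<mu>"
    and pq: "p holomorphic_on ball 0 \<mu>1" "q holomorphic_on ball 0 \<mu>1" "\<And>w. w \<in> ball 0 \<mu>1 \<Longrightarrow> p w \<noteq> 0 \<and> q w \<noteq> 0"
    and dG: "\<And>w. w \<in> ball 0 \<mu>1 \<Longrightarrow> deriv (\<lambda>w. G w $ i) w = w ^ (m - 1) * p w"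
    and YG: "\<And>w. w \<in> ball 0 \<mu>1 \<Longrightarrow> Y (G w) $ i = w ^ k * q w"
    by (rule invariant_curve_orders[OF Y(2,1,3) LY spec GholG A(4) G0 Gnz Gs GcG])
       (assumption | rule that; assumption)+

  obtain r2 where r2: "r2 > 0" "cball 0 r2 \<subseteq> U" using U(1) UV0(1) open_contains_cball by blast
  have "\<forall>\<^sub>F z in nhds 0. norm (\<Gamma> z) < r2 \<and> norm (u z) < \<mu>1"
  proof (rule eventually_conj)
    have "(\<Gamma> \<longlongrightarrow> \<Gamma> 0) (nhds 0)"
      using has_derivative_continuous[OF \<Gamma>d0] by (simp add: isCont_def tendsto_at_iff_tendsto_nhds)
    from tendstoD[OF this r2(1)] show "\<forall>\<^sub>F z in nhds 0. norm (\<Gamma> z) < r2" by (simp add: \<Gamma>0)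
    have "isCont u 0" using u(1) A(1,2) by (simp add: continuous_on_eq_continuous_at)
    then have "(u \<longlongrightarrow> u 0) (nhds 0)" by (simp add: isCont_def tendsto_at_iff_tendsto_nhds)
    from tendstoD[OF this \<mu>1(1)] show "\<forall>\<^sub>F z in nhds 0. norm (u z) < \<mu>1" by (simp add: u0)
  qed
  then obtain d' where d': "d' > 0" "\<And>z. dist z 0 < d' \<Longrightarrow> norm (\<Gamma> z) < r2 \<and> norm (u z) < \<mu>1"
    unfolding eventually_nhds_metric by blast
  \<comment> \<open>On this disc \<open>u\<close> stays where \<open>p\<close> and \<open>q\<close>
    have no zeros and \<open>\<Gamma>\<close> stays in a ball inside \<open>U\<close>, while the
    circle has index \<epsilon> under \<open>u\<close>.\<close>
  define \<delta> where "\<delta> = min r0 (min d' R) / 2"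
  have \<delta>: "\<delta> > 0" "\<delta> \<le> r0" "\<delta> < d'" "\<delta> < R" using r0(1) d'(1) R(1) by (auto simp: \<delta>_def)
  have \<delta>A: "cball 0 \<delta> \<subseteq> A" and iu: "ind u 0 \<delta> = of_int \<epsilon>" using r0(2)[OF \<delta>(1,2)] by auto
  have uc: "continuous_on (cball 0 \<delta>) u" by (rule continuous_on_subset[OF u(1) \<delta>A])
  have ui: "inj_on u (cball 0 \<delta>)" by (rule inj_on_inverseI[of _ \<sigma>]) (use u(2) \<delta>A in blast)
  have u\<mu>: "u z \<in> ball 0 \<mu>1" "norm (\<Gamma> z) \<le> r2" if "z \<in> cball 0 \<delta>" for z using d'(2)[of z] that \<delta>(3) by auto
  have unz: "u z \<noteq> 0" if "z \<in> sphere 0 \<delta>" for z using inj_onD[OF ui, of z 0] u0 that \<delta>(1) by auto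
  have G\<kappa>: "G (u z) = \<kappa> z" if "z \<in> cball 0 \<delta>" for z using u(2)[of z] that \<delta>A by (auto simp: G_def)
  have sub: "sphere 0 \<delta> \<subseteq> ball (0::complex) R" "cball 0 \<delta> \<subseteq> ball (0::complex) R" using \<delta>(4) by auto
  have \<kappa>s: "continuous_on (sphere 0 \<delta>) \<kappa>" "\<And>z. z \<in> sphere 0 \<delta> \<Longrightarrow> \<kappa> z \<in> ball 0 s"
    using continuous_on_subset[OF \<kappa>c sub(1)] \<kappa>T sub(1) by auto
  have Y\<kappa>: "Y (\<kappa> z) $ i = u z ^ k * q (u z)" if "z \<in> sphere 0 \<delta>" for z
    using YG[OF u\<mu>(1)[of z]] G\<kappa>[of z] that by simp
  have Y\<kappa>nz: "Y (\<kappa> z) $ i \<noteq> 0" if "z \<in> sphere 0 \<delta>" for z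
    using Y\<kappa>[OF that] unz[OF that] pq(3)[OF u\<mu>(1)[of z]] that by simp
  \<comment> \<open>Order of the choices: \<open>\<eta>1\<close> bounds the Y-times for which the
    first-order expansion is valid, \<open>\<eta>2\<close> the X-times whose Y-times stay below
    \<open>\<eta>1\<close>, and \<open>x\<close> comes last.\<close>
  obtain \<eta>1 where \<eta>1: "\<eta>1 > 0"
    and disp: "\<And>t f. continuous_on (sphere 0 \<delta>) t \<Longrightarrow> continuous_on (sphere 0 \<delta>) f \<Longrightarrow> ind t 0 \<delta> = 0 \<Longrightarrow>
       (\<forall>z\<in>sphere 0 \<delta>. t z \<noteq> 0 \<and> norm (t z) < \<eta>1 \<and> f z = flow Y (ball 0 s) (t z) (\<kappa> z)) \<Longrightarrow>
       ind (\<lambda>z. f z $ i - \<kappa> z $ i) 0 \<delta> = ind (\<lambda>z. Y (\<kappa> z) $ i) 0 \<delta>"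
    by (rule index_displacement_flow[OF Y(2) \<delta>(1) \<kappa>s Y\<kappa>nz]) (assumption | rule that; assumption)+
  have \<Gamma>s: "continuous_on (sphere 0 \<delta>) \<Gamma>" by (rule continuous_on_subset[OF \<Gamma>cR sub(1)])
  have \<Gamma>snz: "\<Gamma> z \<noteq> 0" if "z \<in> sphere 0 \<delta>" for z using \<Gamma>nz[of z] that \<delta>(1,4) by auto
  \<comment> \<open>The image of the circle is compact and avoids the origin, so it lies in a shell,
    as \<open>time_change_index\<close> requires.\<close>
  obtain r1 where r1: "r1 > 0" "\<And>z. z \<in> sphere 0 \<delta> \<Longrightarrow> r1 \<le> norm (\<Gamma> z)"
    by (rule compact_norm_lower_bound[OF compact_sphere \<Gamma>s \<Gamma>snz]) (assumption | rule that; assumption)+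
  have r12: "r1 \<le> r2" using r1(2)[of "of_real \<delta>"] u\<mu>(2)[of "of_real \<delta>"] \<delta>(1) by simp
  have \<Gamma>r: "r1 \<le> norm (\<Gamma> z) \<and> norm (\<Gamma> z) \<le> r2" if "z \<in> sphere 0 \<delta>" for z using r1(2)[OF that] u\<mu>(2)[of z] that by simp
  obtain \<eta>2 where \<eta>2: "\<eta>2 > 0"
    and tc: "\<And>h. norm h \<le> \<eta>2 \<Longrightarrow> h \<noteq> 0 \<Longrightarrow> \<exists>t. continuous_on (sphere 0 \<delta>) t \<and> ind t 0 \<delta> = 0 \<and>
       (\<forall>z\<in>sphere 0 \<delta>. t z \<noteq> 0 \<and> norm (t z) < \<eta>1 \<and> \<phi> (flow X (ball 0 r) h (\<Gamma> z)) = flow Y (ball 0 s) (t z) (\<phi> (\<Gamma> z)))"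
    by (rule time_change_index[OF n X(2) Y(2) U V hom leaf nzXY r1(1) r12 r2(2) \<Gamma>s \<Gamma>r \<delta>(1) \<eta>1])
       (assumption | rule that; assumption)+
  define g where "g = (\<lambda>w. G w $ i)"
  have ghol: "g holomorphic_on ball 0 \<mu>1"
    unfolding g_def G_def by (rule holomorphic_on_subset[OF Ghol]) (use \<mu>1(2) in auto)
  have gnz: "deriv g w \<noteq> 0" if "w \<in> ball 0 \<mu>1 - {0}" for w using dG[of w] pq(3)[of w] that by (simp add: g_def)
  obtain x0 where x0: "x0 > 0"
    and hd: "\<And>x. 0 < x \<Longrightarrow> x < x0 \<Longrightarrow>
      ind (\<lambda>z. g (u (of_real (exp (- x)) * z)) - g (u z)) 0 \<delta> = ind u 0 \<delta> + ind (\<lambda>z. deriv g (u z)) 0 \<delta>"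
    by (rule index_displacement_holomorphic[OF uc ui u0 \<delta>(1) ghol u\<mu>(1) gnz]) (assumption | rule that; assumption)+
  \<comment> \<open>The same \<open>x\<close> has to serve both computations: \<open>x0\<close>
    belongs to the holomorphic one, \<open>norm \<alpha> * \<eta>2\<close> bounds the X-time, and
    \<open>ln (R / \<delta>)\<close> meets the norm condition of
    \<open>separatrix_flow\<close>.\<close>
  define x where "x = min x0 (min (norm \<alpha> * \<eta>2) (ln (R / \<delta>))) / 2"
  have "ln (R / \<delta>) > 0" using \<delta>(1,4) by simp
  then have x: "0 < x" "x < x0" "x \<le> norm \<alpha> * \<eta>2" "x < ln (R / \<delta>)" using x0 \<alpha> \<eta>2 by (auto simp: x_def min_def)
  \<comment> \<open>\<open>\<alpha> * h\<close> is the real number -x, so time \<open>h\<close>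
    scales the parameter by \<open>exp (- x)\<close> at every point of the circle: a constant X-time
    gives a contraction of the disc.\<close>
  define h where "h = - of_real x / \<alpha>"
  have h: "norm h \<le> \<eta>2" "h \<noteq> 0" "norm \<alpha> * norm h = x" "\<alpha> * h = of_real (- x)"
    using x(1,3) \<alpha> by (auto simp: h_def norm_divide divide_le_eq mult.commute)
  obtain t where t: "continuous_on (sphere 0 \<delta>) t" "ind t 0 \<delta> = 0"
    "\<forall>z\<in>sphere 0 \<delta>. t z \<noteq> 0 \<and> norm (t z) < \<eta>1 \<and> \<phi> (flow X (ball 0 r) h (\<Gamma> z)) = flow Y (ball 0 s) (t z) (\<phi> (\<Gamma> z))"
    using tc[OF h(1,2)] by (elim exE conjE)
  define f where "f = (\<lambda>z. \<kappa> (of_real (exp (- x)) * z))"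
  have in\<delta>: "of_real (exp (- x)) * z \<in> cball 0 \<delta>" if "z \<in> sphere 0 \<delta>" for z :: complex
    using that x(1) \<delta>(1) mult_right_mono[of "exp (- x)" 1 \<delta>] by (simp add: norm_mult)
  have fc: "continuous_on (sphere 0 \<delta>) f"
    unfolding f_def by (rule continuous_on_compose2[OF \<kappa>c]) (use in\<delta> sub(2) in \<open>auto intro!: continuous_intros\<close>)
  have flX: "flow X (ball 0 r) h (\<Gamma> z) = \<Gamma> (of_real (exp (- x)) * z)" if "z \<in> sphere 0 \<delta>" for z
  proof -
    have "exp x < exp (ln (R / \<delta>))" using x(4) by (simp only: exp_less_cancel_iff)
    then have "exp x < R / \<delta>" using \<delta>(1) R(1) by simp
    then have "norm z * exp (norm \<alpha> * norm h) < R" using that \<delta>(1) by (simp add: h(3) pos_less_divide_eq mult.commute)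
    moreover have "z \<noteq> 0" using that \<delta>(1) by auto
    ultimately have "flow X (ball 0 r) h (\<Gamma> z) = \<Gamma> (z * exp (\<alpha> * h))"
      by (intro separatrix_flow[OF X(2) \<alpha> _ \<Gamma>dR]) (use \<Gamma>U U(2) in blast)+
    then show ?thesis by (simp only: h(4) exp_of_real mult.commute)
  qed
  \<comment> \<open>First evaluation: \<open>f\<close> arises from \<open>\<kappa>\<close> by
    flowing along \<open>Y\<close> for the times \<open>t\<close> of index 0, so the displacement
    winds like the coordinate of \<open>Y\<close>, whose order is \<open>k\<close>.\<close>
  have "ind (\<lambda>z. f z $ i - \<kappa> z $ i) 0 \<delta> = ind (\<lambda>z. Y (\<kappa> z) $ i) 0 \<delta>"
  proof (rule disp[OF t(1) fc t(2) ballI])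
    fix z :: complex assume z: "z \<in> sphere 0 \<delta>"
    show "t z \<noteq> 0 \<and> norm (t z) < \<eta>1 \<and> f z = flow Y (ball 0 s) (t z) (\<kappa> z)"
      using bspec[OF t(3) z] unfolding flX[OF z] f_def \<kappa>_def .
  qed
  also have "\<dots> = ind (\<lambda>z. u z ^ k * q (u z)) 0 \<delta>" by (rule ind_cong[OF Y\<kappa> \<delta>(1)])
  also have "\<dots> = of_nat k * ind u 0 \<delta>"
    by (rule ind_power_times_unit[OF uc ui u0 \<delta>(1) u\<mu>(1) holomorphic_on_imp_continuous_on[OF pq(2)]]) (use pq(3) in auto)
  finally have 1: "ind (\<lambda>z. f z $ i - \<kappa> z $ i) 0 \<delta> = of_nat k * ind u 0 \<delta>" .
  \<comment> \<open>Second evaluation, through the analytic parameter: 1 from the displacement of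
    \<open>u\<close> and m - 1 from the zero of the derivative.\<close>
  have "ind (\<lambda>z. f z $ i - \<kappa> z $ i) 0 \<delta> = ind (\<lambda>z. g (u (of_real (exp (- x)) * z)) - g (u z)) 0 \<delta>"
    by (rule ind_cong[OF _ \<delta>(1)]) (use G\<kappa> in\<delta> in \<open>auto simp: f_def g_def\<close>)
  also have "\<dots> = ind u 0 \<delta> + ind (\<lambda>z. deriv g (u z)) 0 \<delta>" by (rule hd[OF x(1,2)])
  also have "ind (\<lambda>z. deriv g (u z)) 0 \<delta> = ind (\<lambda>z. u z ^ (m - 1) * p (u z)) 0 \<delta>"
    by (rule ind_cong[OF _ \<delta>(1)]) (use dG u\<mu>(1) in \<open>auto simp: g_def\<close>)
  also have "\<dots> = of_nat (m - 1) * ind u 0 \<delta>"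
    by (rule ind_power_times_unit[OF uc ui u0 \<delta>(1) u\<mu>(1) holomorphic_on_imp_continuous_on[OF pq(1)]]) (use pq(3) in auto)
  also have "ind u 0 \<delta> + of_nat (m - 1) * ind u 0 \<delta> = of_nat m * ind u 0 \<delta>"
    using m(1) by (cases m) (auto simp: algebra_simps)
  finally have "of_nat k * ind u 0 \<delta> = of_nat m * ind u 0 \<delta>" using 1 by simp
  moreover have "ind u 0 \<delta> \<noteq> 0" using iu curve_charts.eps[OF ch] by simp
  ultimately show False using m(2) by simp
qed

end
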